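(* Each square matrix $A\in\mathbb{R}^{n\times n}$ is real-congruent to a direct sum, uniquely determined up to permutation of summands, of canonical matrices of the following four types (with $k\ge 1$ an arbitrary integer in each summand): Type (i): $J_k(0)$. Type (ii): $\Gamma_k\otimes N$, where either $N=\pm1$ (a $1\times 1$ matrix) or $N=C(a,b)$ with $a,b\in\mathbb{R}$, $a^2+b^2=1$ and $b>0$. Type (iii): $H_{2k}(a)$, with $a\in\mathbb{R}$, $0<|a|<1$. Type (iv): $\widehat H_{4k}(a,b)$, with $a,b\in\mathbb{R}$, $a^2+b^2<1$ and $b>0$. In the matrices of Type (ii), $\Gamma_k\otimes N$ can be replaced by $N\otimes\Gamma_k$. In the matrices of Type (iii), the condition $0<|a|<1$ can be replaced by $|a|>1$; in other words, each $a$ is determined up to replacement by $1/a$. In the matrices of Type (iv), the condition $a^2+b^2<1$ can be replaced by $a^2+b^2>1$; in other words, each pair $(a,b)$ is determined up to replacement by $\left(a/(a^2+b^2),\,b/(a^2+b^2)\right)$.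
   Context: Two matrices $A,B\in\mathbb{R}^{n\times n}$ are real-congruent if there is an invertible $S\in\mathbb{R}^{n\times n}$ with $SAS^\top=B$. The direct sum is $A\oplus B=\begin{bmatrix} A & 0 \\ 0 & B \end{bmatrix}$, and $\otimes$ is the Kronecker product. For integers $k\ge1$: $J_k(\mu)$ is the $k\times k$ upper triangular Jordan block with $\mu$ on the diagonal and $1$ on the superdiagonal ($J_1(\mu)=\mu$). $\Gamma_k$ is the $k\times k$ matrix whose only nonzero entries are $(\Gamma_k)_{r,\,k+1-r}=(-1)^{k-r}$ for $1\le r\le k$ and $(\Gamma_k)_{r,\,k+2-r}=(-1)^{k-r}$ for $2\le r\le k$. So $\Gamma_1=1$, $\Gamma_2=\begin{bmatrix} 0 & -1 \\ 1 & 1 \end{bmatrix}$, $\Gamma_3=\begin{bmatrix} 0 & 0 & 1 \\ 0 & -1 & -1 \\ 1 & 1 & 0 \end{bmatrix}$. $H_{2k}(\mu)=\begin{bmatrix} 0 & I_k \\ J_k(\mu) & 0 \end{bmatrix}$ (size $2k\times2k$). $C(a,b)=\begin{bmatrix} a & b \\ -b & a \end{bmatrix}$, and $C_{2k}(a,b)$ is the $2k\times 2k$ block upper bidiagonal matrix with $k$ diagonal $2\times2$ blocks equal to $C(a,b)$, blocks $I_2$ on the block superdiagonal and zeros elsewhere. $\widehat H_{4k}(a,b)=\begin{bmatrix} 0 & I_{2k} \\ C_{2k}(a,b) & 0 \end{bmatrix}$ (size $4k\times4k$). *)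

theory Defs
  imports Jordan_Normal_Form.Jordan_Normal_Form "HOL-Library.Multiset"
begin

definition real_congruent :: "nat \<Rightarrow> real mat \<Rightarrow> real mat \<Rightarrow> bool" where
  "real_congruent n A B \<longleftrightarrow>
     A \<in> carrier_mat n n \<and> B \<in> carrier_mat n n \<and>
     (\<exists>S \<in> carrier_mat n n. invertible_mat S \<and> S * A * transpose_mat S = B)"

definition kronecker :: "real mat \<Rightarrow> real mat \<Rightarrow> real mat" (infixl "\<otimes>\<^sub>K" 70) where
  "A \<otimes>\<^sub>K B = mat (dim_row A * dim_row B) (dim_col A * dim_col B)
     (\<lambda>(i, j). A $$ (i div dim_row B, j div dim_col B) * B $$ (i mod dim_row B, j mod dim_col B))"

text \<open>
  Rows and columns are indexed from 0 here. With \<open>r = i + 1\<close> and \<open>c = j + 1\<close>, the nonzero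
  positions \<open>r + c = k + 1\<close> and \<open>r + c = k + 2\<close> are \<open>i + j + 1 = k\<close> and \<open>i + j = k\<close>;
  the sign is \<open>(-1)^(k - r)\<close> in both cases.
\<close>

definition Gamma_mat :: "nat \<Rightarrow> real mat" where
  "Gamma_mat k = mat k k
     (\<lambda>(i, j). if i + j + 1 = k \<or> i + j = k then (- 1) ^ (k - Suc i) else 0)"

definition H_mat :: "nat \<Rightarrow> real \<Rightarrow> real mat" where
  "H_mat k a = four_block_mat (0\<^sub>m k k) (1\<^sub>m k) (jordan_block k a) (0\<^sub>m k k)"

definition C_mat :: "real \<Rightarrow> real \<Rightarrow> real mat" where
  "C_mat a b = mat_of_rows_list 2 [[a, b], [- b, a]]"

text \<open>The parameter \<open>k\<close> of \<open>H_mat\<close>, \<open>C_block_mat\<close> and \<open>H_hat_mat\<close> is the mathematical \<open>k\<close>, not the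
  size: the sizes are \<open>2k\<close>, \<open>2k\<close> and \<open>4k\<close>.\<close>

definition C_block_mat :: "nat \<Rightarrow> real \<Rightarrow> real \<Rightarrow> real mat" where
  "C_block_mat k a b = mat (2 * k) (2 * k)
     (\<lambda>(i, j). if i div 2 = j div 2 then C_mat a b $$ (i mod 2, j mod 2)
               else if Suc (i div 2) = j div 2 then 1\<^sub>m 2 $$ (i mod 2, j mod 2)
               else 0)"

definition H_hat_mat :: "nat \<Rightarrow> real \<Rightarrow> real \<Rightarrow> real mat" where
  "H_hat_mat k a b =
     four_block_mat (0\<^sub>m (2 * k) (2 * k)) (1\<^sub>m (2 * k)) (C_block_mat k a b) (0\<^sub>m (2 * k) (2 * k))"

definition type_i :: "real mat set" where
  "type_i = {jordan_block k 0 | k. k \<ge> 1}"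

definition N_mats :: "real mat set" where
  "N_mats = {1\<^sub>m 1, - 1\<^sub>m 1} \<union> {C_mat a b | a b. a\<^sup>2 + b\<^sup>2 = 1 \<and> b > 0}"

definition type_ii :: "real mat set" where
  "type_ii = {Gamma_mat k \<otimes>\<^sub>K N | k N. k \<ge> 1 \<and> N \<in> N_mats}"

definition type_iii :: "real mat set" where
  "type_iii = {H_mat k a | k a. k \<ge> 1 \<and> 0 < \<bar>a\<bar> \<and> \<bar>a\<bar> < 1}"

definition type_iv :: "real mat set" where
  "type_iv = {H_hat_mat k a b | k a b. k \<ge> 1 \<and> a\<^sup>2 + b\<^sup>2 < 1 \<and> b > 0}"

text \<open>The primed families are the permitted substitutes for types (ii), (iii) and (iv).\<close>

definition type_ii' :: "real mat set" where
  "type_ii' = {N \<otimes>\<^sub>K Gamma_mat k | k N. k \<ge> 1 \<and> N \<in> N_mats}"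

definition type_iii' :: "real mat set" where
  "type_iii' = {H_mat k a | k a. k \<ge> 1 \<and> \<bar>a\<bar> > 1}"

definition type_iv' :: "real mat set" where
  "type_iv' = {H_hat_mat k a b | k a b. k \<ge> 1 \<and> a\<^sup>2 + b\<^sup>2 > 1 \<and> b > 0}"

text \<open>\<open>replacement B B'\<close>: the summand \<open>B'\<close> is \<open>B\<close> itself or arises from it by one of the
  permitted replacements.\<close>

inductive replacement :: "real mat \<Rightarrow> real mat \<Rightarrow> bool" where
  same: "replacement B B"
| swap_ii: "k \<ge> 1 \<Longrightarrow> N \<in> N_mats \<Longrightarrow> replacement (Gamma_mat k \<otimes>\<^sub>K N) (N \<otimes>\<^sub>K Gamma_mat k)"
| swap_ii': "k \<ge> 1 \<Longrightarrow> N \<in> N_mats \<Longrightarrow> replacement (N \<otimes>\<^sub>K Gamma_mat k) (Gamma_mat k \<otimes>\<^sub>K N)"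
| inverse_iii: "k \<ge> 1 \<Longrightarrow> a \<noteq> 0 \<Longrightarrow> replacement (H_mat k a) (H_mat k (1 / a))"
| inverse_iv: "k \<ge> 1 \<Longrightarrow> b > 0 \<Longrightarrow>
    replacement (H_hat_mat k a b) (H_hat_mat k (a / (a\<^sup>2 + b\<^sup>2)) (b / (a\<^sup>2 + b\<^sup>2)))"

end

theory Submission
  imports Defs "HOL-Library.Function_Algebras"
begin

text \<open>
  Existence: complexify the real space, keeping the conjugation, and regard \<open>A\<close> as a bilinear form
  \<open>B\<close>. Splitting off the left kernel again and again extracts the blocks \<open>J\<^sub>k(0)\<close> and leaves a
  nondegenerate form. There the asymmetry, the operator \<open>\<tau>\<close> with \<open>B x y = B y (\<tau> x)\<close>, decomposes
  the space into generalized eigenspaces, paired as \<open>\<mu>\<close> with \<open>1 / \<mu>\<close>. A Jordan chain of maximal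
  length together with its dual chain spans an orthogonal summand of type (iii) or (iv) or, in the
  case \<open>\<mu>\<^sup>2 = 1\<close> or \<open>\<bar>\<mu>\<bar> = 1\<close>, possibly of type (ii).

  Uniqueness: the vectors \<open>X\<^sub>0\<close> that start a Jordan chain of length \<open>k\<close> of the pencil
  \<open>A - \<lambda> A\<^sup>T\<close> carry a nonnegative form (for \<open>\<bar>\<lambda>\<bar> < 1\<close>) or a Hermitian form (for
  \<open>\<bar>\<lambda>\<bar> = 1\<close>) whose number of positive squares is a congruence invariant, is additive over direct
  sums, and can be read off from each canonical block. These numbers determine all multiplicities.
\<close>

section \<open>The action of the canonical blocks on vectors\<close>

text \<open>For unimodular \<open>\<kappa>\<close> everything rests on
  \<open>B x (cj y) = G \<kappa> x y - G \<kappa> (M x) y\<close>. Since \<open>M\<close> is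
  skew-adjoint, the values of \<open>G\<close> along a chain of powers of \<open>M\<close> depend,
  up to sign, only on the sum of the exponents; once the lower ones are removed, the two terms fill
  exactly the two antidiagonals of \<open>Gamma_mat\<close>. A chain of
  \<open>\<tau> - \<kappa>\<close> lacks this symmetry, its adjoint involving the inverse of
  \<open>\<tau>\<close>. The obstacle is reality. A real generator exists only if the top form is
  symmetric on real vectors; otherwise real and imaginary parts of a complex generator are used
  together, which produces the cells C(a,b) and requires its bilinear (not only its hermitian)
  values to vanish. The invariants are never defined as dimensions or signatures. A count is
  certified from below by witness chains and from above by linear conditions; both bounds are
  additive, and elimination compares them. The replacements in types (iii) and (iv) need no explicit
  congruence: the replaced block has some canonical form by existence, and the counts leave one
  candidate.\<close>

definition ap :: "real mat \<Rightarrow> (nat \<Rightarrow> complex) \<Rightarrow> nat \<Rightarrow> complex" where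
  "ap A x i = (\<Sum>j<dim_col A. of_real (A $$ (i, j)) * x j)"

definition apT :: "real mat \<Rightarrow> (nat \<Rightarrow> complex) \<Rightarrow> nat \<Rightarrow> complex" where
  "apT A x j = (\<Sum>i<dim_row A. of_real (A $$ (i, j)) * x i)"

text \<open>Injectivity of the transpose is the useful side: a linear relation among vectors, paired
  with the same vectors, is annihilated by the transpose of their Gram matrix. Coordinates beyond
  the dimension are ignored.\<close>

definition nonsing :: "real mat \<Rightarrow> bool" where
  "nonsing A \<longleftrightarrow> (\<forall>x. (\<forall>j<dim_col A. apT A x j = 0) \<longrightarrow> (\<forall>i<dim_row A. x i = 0))"

lemma sum_pairs: "(\<Sum>i<2*k. f i) = (\<Sum>j<k. f (2*j) + f (Suc (2*j)) :: 'a::comm_monoid_add)"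
  by (induction k) (auto simp: ac_simps)

lemma sum_delta_mult:
  "(\<Sum>j<n. (if j = a then c else 0) * x j) = (if (a::nat) < n then c * x a else (0::complex))"
  by (simp add: if_distrib[of "\<lambda>t. t * _"] sum.delta cong: if_cong)

lemma all_less_double: "(\<forall>i<2*k. Q i) \<longleftrightarrow> (\<forall>j<k. Q (2*j) \<and> Q (Suc (2*j)))" (is "?l = ?r")
proof
  assume ?r
  show ?l
  proof (intro allI impI)
    fix i assume i: "i < 2 * k"
    have "i = 2 * (i div 2) \<or> i = Suc (2 * (i div 2))" by presburger
    moreover have "i div 2 < k" using i by auto
    ultimately show "Q i" using \<open>?r\<close> by metis
  qed
qed auto

subsection \<open>Jordan blocks and type (iii)\<close>

lemma jordan_sum:
  assumes "i < k"
  shows "(\<Sum>j<k. of_real (jordan_block k a $$ (i, j)) * x j) = of_real a * x i + (if Suc i < k then x (Suc i) else (0::complex))"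
proof -
  have "(\<Sum>j<k. of_real (jordan_block k a $$ (i, j)) * x j) =
    (\<Sum>j<k. (if j = i then of_real a else 0) * x j) + (\<Sum>j<k. (if j = Suc i then 1 else 0) * x j)"
    unfolding sum.distrib[symmetric] using assms by (intro sum.cong) (auto simp: jordan_block_def)
  thus ?thesis using assms unfolding sum_delta_mult by simp
qed

lemma jordan_sumT:
  assumes "j < k"
  shows "(\<Sum>i<k. of_real (jordan_block k a $$ (i, j)) * x i) = of_real a * x j + (if 0 < j then x (j - 1) else (0::complex))"
proof -
  have "(\<Sum>i<k. of_real (jordan_block k a $$ (i, j)) * x i) =
    (\<Sum>i<k. (if i = j then of_real a else 0) * x i) + (\<Sum>i<k. (if i = j - 1 then (if 0 < j then 1 else 0) else 0) * x i)"
    unfolding sum.distrib[symmetric] using assms by (intro sum.cong) (auto simp: jordan_block_def)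
  thus ?thesis using assms unfolding sum_delta_mult by auto
qed

lemma ap_jordan: "i < k \<Longrightarrow> ap (jordan_block k a) x i = of_real a * x i + (if Suc i < k then x (Suc i) else 0)"
  unfolding ap_def using jordan_sum[of i k a x] by simp

lemma apT_jordan: "j < k \<Longrightarrow> apT (jordan_block k a) x j = of_real a * x j + (if 0 < j then x (j - 1) else 0)"
  unfolding apT_def using jordan_sumT[of j k a x] by simp

lemma sum_split: "(\<Sum>i<k+l. f i) = (\<Sum>i<k. f i) + (\<Sum>i<(l::nat). f (k + i) :: 'a::comm_monoid_add)"
  by (induction l) (auto simp: ac_simps)

lemma one_entry: "i < k \<Longrightarrow> j < k \<Longrightarrow> complex_of_real ((1\<^sub>m k) $$ (i, j)) * z = (if j = i then 1 else 0) * z"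
  "i < k \<Longrightarrow> j < k \<Longrightarrow> complex_of_real ((1\<^sub>m k) $$ (i, j)) * z = (if i = j then 1 else 0) * z"
  by auto

lemma sum_one: "i < k \<Longrightarrow> (\<Sum>j<k. of_real ((1\<^sub>m k) $$ (i, j)) * x j) = (x i :: complex)"
  using sum_delta_mult[of i 1 x k] by (simp add: one_entry(1) del: index_one_mat cong: sum.cong_simp)

lemma sum_oneT: "j < k \<Longrightarrow> (\<Sum>i<k. of_real ((1\<^sub>m k) $$ (i, j)) * x i) = (x j :: complex)"
  using sum_delta_mult[of j 1 x k] by (simp add: one_entry(2) del: index_one_mat cong: sum.cong_simp)

definition antiblock :: "nat \<Rightarrow> real mat \<Rightarrow> real mat" where
  "antiblock k M = four_block_mat (0\<^sub>m k k) (1\<^sub>m k) M (0\<^sub>m k k)"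

lemma antiblock_carrier: "M \<in> carrier_mat k k \<Longrightarrow> antiblock k M \<in> carrier_mat (k + k) (k + k)"
  unfolding antiblock_def by simp

lemma antiblock_index:
  assumes "M \<in> carrier_mat k k" "i < k" "j < k"
  shows "antiblock k M $$ (i, j) = 0" "antiblock k M $$ (i, k + j) = 1\<^sub>m k $$ (i, j)"
    "antiblock k M $$ (k + i, j) = M $$ (i, j)" "antiblock k M $$ (k + i, k + j) = 0"
  using assms unfolding antiblock_def by auto

lemma ap_antiblock:
  assumes "M \<in> carrier_mat k k" "i < k"
  shows "ap (antiblock k M) x i = x (k + i)" "ap (antiblock k M) x (k + i) = ap M x i"
proof -
  have c: "dim_col (antiblock k M) = k + k" "dim_col M = k" using antiblock_carrier[OF assms(1)] assms by auto
  show "ap (antiblock k M) x i = x (k + i)"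
    unfolding ap_def c sum_split using antiblock_index[OF assms] sum_one[OF assms(2), of "\<lambda>i. x (k + i)"]
    by (simp cong: sum.cong_simp)
  show "ap (antiblock k M) x (k + i) = ap M x i"
    unfolding ap_def c sum_split using antiblock_index[OF assms] by (simp cong: sum.cong_simp)
qed

lemma apT_antiblock:
  assumes "M \<in> carrier_mat k k" "j < k"
  shows "apT (antiblock k M) x j = apT M (\<lambda>i. x (k + i)) j" "apT (antiblock k M) x (k + j) = x j"
proof -
  have c: "dim_row (antiblock k M) = k + k" "dim_row M = k" using antiblock_carrier[OF assms(1)] assms by auto
  show "apT (antiblock k M) x j = apT M (\<lambda>i. x (k + i)) j"
    unfolding apT_def c sum_split using antiblock_index[OF assms(1) _ assms(2)]
    by (simp cong: sum.cong_simp)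
  show "apT (antiblock k M) x (k + j) = x j"
    unfolding apT_def c sum_split using antiblock_index[OF assms(1) _ assms(2)] sum_oneT[OF assms(2), of x]
    by (simp cong: sum.cong_simp)
qed

lemma nonsing_antiblock: assumes M: "M \<in> carrier_mat k k" and n: "nonsing M" shows "nonsing (antiblock k M)"
  unfolding nonsing_def
proof (intro allI impI)
  fix x i assume h: "\<forall>j<dim_col (antiblock k M). apT (antiblock k M) x j = 0" "i < dim_row (antiblock k M)"
  have d: "dim_col (antiblock k M) = k + k" "dim_row (antiblock k M) = k + k"
    using antiblock_carrier[OF M] by auto
  have "x j = 0" if "j < k" for j using h(1) apT_antiblock(2)[OF M that, of x] that d by auto
  moreover have "\<forall>j<dim_col M. apT M (\<lambda>i. x (k + i)) j = 0"
    using h(1) apT_antiblock(1)[OF M, of _ x] M d by auto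
  hence "\<forall>i<dim_row M. x (k + i) = 0" using n unfolding nonsing_def by blast
  hence "x (k + j) = 0" if "j < k" for j using that M by simp
  ultimately show "x i = 0" using h(2) d by (metis add_diff_inverse_nat nat_add_left_cancel_less)
qed

lemma H_mat_anti: "H_mat k a = antiblock k (jordan_block k a)" unfolding H_mat_def antiblock_def ..

lemma C_block_carrier: "C_block_mat k a b \<in> carrier_mat (2*k) (2*k)" unfolding C_block_mat_def by simp

lemma H_hat_anti: "H_hat_mat k a b = antiblock (2*k) (C_block_mat k a b)" unfolding H_hat_mat_def antiblock_def ..

lemma C_mat_index: "C_mat a b $$ (0, 0) = a" "C_mat a b $$ (0, Suc 0) = b"
  "C_mat a b $$ (Suc 0, 0) = - b" "C_mat a b $$ (Suc 0, Suc 0) = a"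
  "dim_row (C_mat a b) = 2" "dim_col (C_mat a b) = 2"
  unfolding C_mat_def by (auto simp: mat_of_rows_list_def)

lemma C_block_index:
  assumes "i < k" "j < k"
  shows "C_block_mat k a b $$ (2*i, 2*j) = jordan_block k a $$ (i, j)"
    "C_block_mat k a b $$ (2*i, Suc (2*j)) = (if i = j then b else 0)"
    "C_block_mat k a b $$ (Suc (2*i), 2*j) = (if i = j then - b else 0)"
    "C_block_mat k a b $$ (Suc (2*i), Suc (2*j)) = jordan_block k a $$ (i, j)"
  using assms C_mat_index[of a b] by (auto simp: C_block_mat_def jordan_block_def)

text \<open>For \<open>e = \<i>\<close> and \<open>e = - \<i>\<close> the row (1, e) is a left
  eigenvector of C(a,b) with eigenvalue a - e b. The combination therefore turns the real block into
  an ordinary Jordan block in half as many unknowns; leaving \<open>e\<close> arbitrary treats both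
  conjugates at once.\<close>

lemma ap_C_block:
  assumes "i < k" and e: "e * e = (-1::complex)"
  shows "ap (C_block_mat k a b) x (2*i) + e * ap (C_block_mat k a b) x (Suc (2*i)) =
     (of_real a - e * of_real b) * (x (2*i) + e * x (Suc (2*i))) +
      (if Suc i < k then x (2*Suc i) + e * x (Suc (2*Suc i)) else 0)"
proof -
  let ?y = "\<lambda>j. x (2*j) + e * x (Suc (2*j))"
  have d: "dim_col (C_block_mat k a b) = 2*k" using C_block_carrier by blast
  have ee: "e * (e * z) = - z" for z using e by (metis mult.assoc mult_minus1)
  have *: "ap (C_block_mat k a b) x (2*i) + e * ap (C_block_mat k a b) x (Suc (2*i)) =
    (\<Sum>j<k. of_real (jordan_block k a $$ (i, j)) * ?y j) + (\<Sum>j<k. (if j = i then of_real b else 0) * (x (Suc (2*j)) - e * x (2*j)))"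
    unfolding ap_def d sum_pairs sum_distrib_left sum.distrib[symmetric]
    apply (rule sum.cong[OF refl])
    apply (simp only: lessThan_iff C_block_index assms(1))
    apply (auto simp: algebra_simps ee)
    done
  have "of_real b * (x (Suc (2*i)) - e * x (2*i)) = - (e * of_real b) * ?y i + (1 + e * e) * of_real b * x (Suc (2*i))"
    by (simp add: algebra_simps)
  hence "of_real b * (x (Suc (2*i)) - e * x (2*i)) = - (e * of_real b) * ?y i" using e by simp
  thus ?thesis unfolding * sum_delta_mult jordan_sum[OF assms(1)] using assms(1) by (simp add: algebra_simps)
qed

text \<open>Transposing C(a,b) changes the sign of b, hence the conjugate factor a + e b.\<close>

lemma apT_C_block:
  assumes "j < k" and e: "e * e = (-1::complex)"
  shows "apT (C_block_mat k a b) x (2*j) + e * apT (C_block_mat k a b) x (Suc (2*j)) =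
     (of_real a + e * of_real b) * (x (2*j) + e * x (Suc (2*j))) +
      (if 0 < j then x (2*(j-1)) + e * x (Suc (2*(j-1))) else 0)"
proof -
  let ?y = "\<lambda>j. x (2*j) + e * x (Suc (2*j))"
  have d: "dim_row (C_block_mat k a b) = 2*k" using C_block_carrier by blast
  have ee: "e * (e * z) = - z" for z using e by (metis mult.assoc mult_minus1)
  have *: "apT (C_block_mat k a b) x (2*j) + e * apT (C_block_mat k a b) x (Suc (2*j)) =
    (\<Sum>i<k. of_real (jordan_block k a $$ (i, j)) * ?y i) + (\<Sum>i<k. (if i = j then of_real b else 0) * (e * x (2*i) - x (Suc (2*i))))"
    unfolding apT_def d sum_pairs sum_distrib_left sum.distrib[symmetric]
    apply (rule sum.cong[OF refl])
    apply (simp only: lessThan_iff C_block_index assms(1))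
    apply (auto simp: algebra_simps ee)
    done
  have "of_real b * (e * x (2*j) - x (Suc (2*j))) = (e * of_real b) * ?y j - (1 + e * e) * of_real b * x (Suc (2*j))"
    by (simp add: algebra_simps)
  hence "of_real b * (e * x (2*j) - x (Suc (2*j))) = (e * of_real b) * ?y j" using e by simp
  thus ?thesis unfolding * sum_delta_mult jordan_sumT[OF assms(1)] using assms(1) by (simp add: algebra_simps)
qed

lemma pair_zero: "(x::complex) + \<i> * y = 0 \<Longrightarrow> x - \<i> * y = 0 \<Longrightarrow> x = 0 \<and> y = 0"
  by (simp add: complex_eq_iff)

lemma pairs_zero:
  assumes "\<And>e. e * e = (-1::complex) \<Longrightarrow> x + e * y = 0" shows "x = 0 \<and> y = 0"
  using pair_zero[of x y] assms[of \<i>] assms[of "-\<i>"] by simp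

lemma up_zero: fixes j :: nat assumes "c \<noteq> 0" "\<And>j. j < k \<Longrightarrow> c * y j + (if 0 < j then y (j - 1) else 0) = (0::complex)"
  shows "j < k \<Longrightarrow> y j = 0"
proof (induction j)
  case 0 thus ?case using assms(2)[of 0] assms(1) by simp
next
  case (Suc j) thus ?case using assms(2)[of "Suc j"] assms(1) by simp
qed

lemma down_zero: fixes j :: nat assumes "c \<noteq> 0" "\<And>j. j < k \<Longrightarrow> c * y j + (if Suc j < k then y (Suc j) else 0) = (0::complex)"
  shows "j < k \<Longrightarrow> y j = 0"
proof (induction "k - j" arbitrary: j rule: less_induct)
  case less
  show ?case
  proof (cases "Suc j < k")
    case True
    have "y (Suc j) = 0" by (rule less.hyps) (use True in auto)
    thus ?thesis using assms(2)[of j] assms(1) less.prems True by simp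
  next
    case False thus ?thesis using assms(2)[of j] assms(1) less.prems by simp
  qed
qed

lemma nonsing_jordan: assumes "a \<noteq> 0" shows "nonsing (jordan_block k a)"
  unfolding nonsing_def
proof (intro allI impI)
  fix x i assume h: "\<forall>j<dim_col (jordan_block k a). apT (jordan_block k a) x j = 0" "i < dim_row (jordan_block k a)"
  show "x i = 0"
    by (rule up_zero[of "of_real a" k x]) (use h assms in \<open>auto simp: apT_jordan[symmetric]\<close>)
qed

lemma e_square: "e * e = (-1::complex) \<Longrightarrow> e = \<i> \<or> e = - \<i>"
  by (metis add.inverse_inverse i_squared minus_mult_minus square_eq_iff power2_i power2_eq_square)

lemma nonsing_C_block: assumes "b \<noteq> 0" shows "nonsing (C_block_mat k a b)"
  unfolding nonsing_def
proof (intro allI impI)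
  let ?C = "C_block_mat k a b"
  have d: "dim_col ?C = 2*k" "dim_row ?C = 2*k" using C_block_carrier by blast+
  fix x i assume h: "\<forall>j<dim_col ?C. apT ?C x j = 0" "i < dim_row ?C"
  have e: "x (2*j) + e * x (Suc (2*j)) = 0" if "e * e = -1" "j < k" for e j
  proof (rule up_zero[of "of_real a + e * of_real b" k "\<lambda>j. x (2*j) + e * x (Suc (2*j))"])
    show "of_real a + e * of_real b \<noteq> 0" using e_square[OF that(1)] assms by (auto simp: complex_eq_iff)
    fix j assume j: "j < k"
    have "apT ?C x (2*j) = 0" "apT ?C x (Suc (2*j)) = 0" using h(1) j d by auto
    thus "(of_real a + e * of_real b) * (x (2*j) + e * x (Suc (2*j))) +
      (if 0 < j then x (2*(j-1)) + e * x (Suc (2*(j-1))) else 0) = 0"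
      using apT_C_block[OF j that(1), of a b x] by simp
  qed (rule that(2))
  have "\<forall>i<2*k. x i = 0" unfolding all_less_double using pairs_zero e by blast
  thus "x i = 0" using h(2) d by simp
qed

subsection \<open>Type (ii)\<close>

lemma Gamma_carrier: "Gamma_mat k \<in> carrier_mat k k" unfolding Gamma_mat_def by simp

lemma Gamma_sum:
  assumes "i < k"
  shows "(\<Sum>j<k. of_real (Gamma_mat k $$ (i, j)) * y j) =
    (-1) ^ (k - Suc i) * (y (k - Suc i) + (if 0 < i then y (k - i) else (0::complex)))"
proof -
  have "(\<Sum>j<k. of_real (Gamma_mat k $$ (i, j)) * y j) =
    (\<Sum>j<k. (if j = k - Suc i then (-1) ^ (k - Suc i) else 0) * y j) + (\<Sum>j<k. (if j = k - i then (-1) ^ (k - Suc i) else 0) * y j)"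
    unfolding sum.distrib[symmetric] using assms by (intro sum.cong) (auto simp: Gamma_mat_def)
  thus ?thesis using assms unfolding sum_delta_mult by (auto simp: algebra_simps)
qed

text \<open>The two nonzero entries of a row have equal signs, those of a column opposite ones. This
  difference between the matrix and its transpose is what the chain equations \<open>gch\<close>
  exploit.\<close>

lemma Gamma_sumT:
  assumes "j < k"
  shows "(\<Sum>i<k. of_real (Gamma_mat k $$ (i, j)) * y i) =
    (-1) ^ j * (y (k - Suc j) - (if 0 < j then y (k - j) else (0::complex)))"
proof -
  have p: "(-1::complex) ^ (k - Suc (k - Suc j)) = (-1)^j" using assms by (simp add: Suc_diff_Suc)
  have q: "(-1::complex) ^ (k - Suc (k - j)) = - ((-1)^j)" if "0 < j"
  proof -
    have "k - Suc (k - j) = j - 1" using assms that by simp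
    thus ?thesis using that by (cases j) auto
  qed
  have "(\<Sum>i<k. of_real (Gamma_mat k $$ (i, j)) * y i) =
    (\<Sum>i<k. (if i = k - Suc j then (-1) ^ (k - Suc (k - Suc j)) else 0) * y i) + (\<Sum>i<k. (if i = k - j then (-1) ^ (k - Suc (k - j)) else 0) * y i)"
    unfolding sum.distrib[symmetric] using assms by (intro sum.cong) (auto simp: Gamma_mat_def)
  thus ?thesis using assms p q unfolding sum_delta_mult by (auto simp: algebra_simps)
qed

lemma kron_bound: assumes "(i::nat) < m" "s < d" shows "i * d + s < m * d"
proof -
  have "i * d + s < Suc i * d" using assms(2) by simp
  also have "\<dots> \<le> m * d" using assms(1) by (intro mult_le_mono1) simp
  finally show ?thesis .
qed

lemma kron_index:
  assumes "i < dim_row A" "j < dim_col A" "s < dim_row N" "t < dim_col N"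
  shows "(A \<otimes>\<^sub>K N) $$ (i * dim_row N + s, j * dim_col N + t) = A $$ (i, j) * N $$ (s, t)"
proof -
  have "i * dim_row N + s < dim_row A * dim_row N" "j * dim_col N + t < dim_col A * dim_col N"
    using assms(1,3) assms(2,4) by (auto intro: kron_bound)
  thus ?thesis using assms unfolding kronecker_def by simp
qed

lemma kron_dim: "dim_row (A \<otimes>\<^sub>K N) = dim_row A * dim_row N" "dim_col (A \<otimes>\<^sub>K N) = dim_col A * dim_col N"
  unfolding kronecker_def by auto

lemma kron_C_index:
  assumes "i < k" "j < k"
  shows "(Gamma_mat k \<otimes>\<^sub>K C_mat a b) $$ (2*i, 2*j) = Gamma_mat k $$ (i, j) * a"
   "(Gamma_mat k \<otimes>\<^sub>K C_mat a b) $$ (2*i, Suc (2*j)) = Gamma_mat k $$ (i, j) * b"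
   "(Gamma_mat k \<otimes>\<^sub>K C_mat a b) $$ (Suc (2*i), 2*j) = - Gamma_mat k $$ (i, j) * b"
   "(Gamma_mat k \<otimes>\<^sub>K C_mat a b) $$ (Suc (2*i), Suc (2*j)) = Gamma_mat k $$ (i, j) * a"
  using kron_index[of i "Gamma_mat k" j 0 "C_mat a b" 0] kron_index[of i "Gamma_mat k" j 0 "C_mat a b" 1]
    kron_index[of i "Gamma_mat k" j 1 "C_mat a b" 0] kron_index[of i "Gamma_mat k" j 1 "C_mat a b" 1]
    assms Gamma_carrier[of k] by (auto simp: C_mat_index mult.commute)

text \<open>A free scalar \<open>s\<close> treats N = 1 and N = -1 together; \<open>Gsgn_pm\<close>
  specializes it.\<close>

definition Gsgn :: "real \<Rightarrow> nat \<Rightarrow> real mat" where "Gsgn s k = Gamma_mat k \<otimes>\<^sub>K (s \<cdot>\<^sub>m 1\<^sub>m 1)"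

lemma Gsgn_dim: "dim_row (Gsgn s k) = k" "dim_col (Gsgn s k) = k"
  unfolding Gsgn_def kron_dim using Gamma_carrier[of k] by auto

lemma Gsgn_index: assumes "i < k" "j < k" shows "Gsgn s k $$ (i, j) = s * Gamma_mat k $$ (i, j)"
  using kron_index[of i "Gamma_mat k" j 0 "s \<cdot>\<^sub>m 1\<^sub>m 1" 0] assms Gamma_carrier[of k] unfolding Gsgn_def by auto

lemma ap_Gsgn: assumes "i < k"
  shows "ap (Gsgn s k) x i = of_real s * (-1) ^ (k - Suc i) * (x (k - Suc i) + (if 0 < i then x (k - i) else 0))"
proof -
  have "ap (Gsgn s k) x i = (\<Sum>j<k. of_real s * (of_real (Gamma_mat k $$ (i, j)) * x j))"
    unfolding ap_def Gsgn_dim using assms by (intro sum.cong) (auto simp: Gsgn_index)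
  thus ?thesis unfolding sum_distrib_left[symmetric] Gamma_sum[OF assms] by simp
qed

lemma apT_Gsgn: assumes "j < k"
  shows "apT (Gsgn s k) x j = of_real s * (-1) ^ j * (x (k - Suc j) - (if 0 < j then x (k - j) else 0))"
proof -
  have "apT (Gsgn s k) x j = (\<Sum>i<k. of_real s * (of_real (Gamma_mat k $$ (i, j)) * x i))"
    unfolding apT_def Gsgn_dim using assms by (intro sum.cong) (auto simp: Gsgn_index)
  thus ?thesis unfolding sum_distrib_left[symmetric] Gamma_sumT[OF assms] by simp
qed

lemma kron_C_dim: "dim_row (Gamma_mat k \<otimes>\<^sub>K C_mat a b) = 2 * k" "dim_col (Gamma_mat k \<otimes>\<^sub>K C_mat a b) = 2 * k"
  unfolding kron_dim using Gamma_carrier[of k] by (auto simp: C_mat_index)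

lemma ap_GC:
  fixes x a b k e defines "y \<equiv> \<lambda>j. x (2*j) + e * x (Suc (2*j))"
  assumes "i < k" and e: "e * e = (-1::complex)"
  shows "ap (Gamma_mat k \<otimes>\<^sub>K C_mat a b) x (2*i) + e * ap (Gamma_mat k \<otimes>\<^sub>K C_mat a b) x (Suc (2*i)) =
     (of_real a - e * of_real b) * (-1) ^ (k - Suc i) * (y (k - Suc i) + (if 0 < i then y (k - i) else 0))"
proof -
  have ee: "e * (e * z) = - z" for z using e by (metis mult.assoc mult_minus1)
  have *: "ap (Gamma_mat k \<otimes>\<^sub>K C_mat a b) x (2*i) + e * ap (Gamma_mat k \<otimes>\<^sub>K C_mat a b) x (Suc (2*i)) =
    (\<Sum>j<k. (of_real a - e * of_real b) * (of_real (Gamma_mat k $$ (i, j)) * y j))"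
    unfolding ap_def kron_C_dim sum_pairs sum_distrib_left sum.distrib[symmetric] y_def
    apply (rule sum.cong[OF refl])
    apply (simp only: lessThan_iff kron_C_index assms(2))
    apply (simp add: algebra_simps ee)
    done
  show ?thesis unfolding * sum_distrib_left[symmetric] Gamma_sum[OF assms(2)] by simp
qed

lemma apT_GC:
  fixes x a b k e defines "y \<equiv> \<lambda>j. x (2*j) + e * x (Suc (2*j))"
  assumes "j < k" and e: "e * e = (-1::complex)"
  shows "apT (Gamma_mat k \<otimes>\<^sub>K C_mat a b) x (2*j) + e * apT (Gamma_mat k \<otimes>\<^sub>K C_mat a b) x (Suc (2*j)) =
     (of_real a + e * of_real b) * (-1) ^ j * (y (k - Suc j) - (if 0 < j then y (k - j) else 0))"
proof -
  have ee: "e * (e * z) = - z" for z using e by (metis mult.assoc mult_minus1)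
  have *: "apT (Gamma_mat k \<otimes>\<^sub>K C_mat a b) x (2*j) + e * apT (Gamma_mat k \<otimes>\<^sub>K C_mat a b) x (Suc (2*j)) =
    (\<Sum>i<k. (of_real a + e * of_real b) * (of_real (Gamma_mat k $$ (i, j)) * y i))"
    unfolding apT_def kron_C_dim sum_pairs sum_distrib_left sum.distrib[symmetric] y_def
    apply (rule sum.cong[OF refl])
    apply (simp only: lessThan_iff kron_C_index assms(2))
    apply (simp add: algebra_simps ee)
    done
  show ?thesis unfolding * sum_distrib_left[symmetric] Gamma_sumT[OF assms(2)] by simp
qed

lemma gamma_zero:
  assumes "c \<noteq> 0" "\<And>j. j < k \<Longrightarrow> c * (-1) ^ j * (y (k - Suc j) - (if 0 < j then y (k - j) else 0)) = (0::complex)" "i < k"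
  shows "y i = 0"
proof -
  have "y (k - Suc j) = 0" if "j < k" for j using that
  proof (induction j)
    case 0 thus ?case using assms(2)[of 0] assms(1) by simp
  next
    case (Suc j) thus ?case using assms(2)[of "Suc j"] assms(1) by simp
  qed
  from this[of "k - Suc i"] show ?thesis using assms(3) by (simp add: Suc_diff_Suc)
qed

lemma nonsing_Gsgn: assumes "s \<noteq> 0" shows "nonsing (Gsgn s k)"
  unfolding nonsing_def Gsgn_dim
proof (intro allI impI)
  fix x i assume h: "\<forall>j<k. apT (Gsgn s k) x j = 0" "i < k"
  show "x i = 0"
    by (rule gamma_zero[of "of_real s" k x i]) (use h assms in \<open>auto simp: apT_Gsgn\<close>)
qed

lemma nonsing_GC: assumes "b \<noteq> 0" shows "nonsing (Gamma_mat k \<otimes>\<^sub>K C_mat a b)"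
  unfolding nonsing_def kron_C_dim
proof (intro allI impI)
  let ?C = "Gamma_mat k \<otimes>\<^sub>K C_mat a b"
  fix x i assume h: "\<forall>j<2*k. apT ?C x j = 0" "i < 2*k"
  have e: "x (2*j) + e * x (Suc (2*j)) = 0" if "e * e = -1" "j < k" for e j
  proof (rule gamma_zero[of "of_real a + e * of_real b" k "\<lambda>j. x (2*j) + e * x (Suc (2*j))"])
    show "of_real a + e * of_real b \<noteq> 0" using e_square[OF that(1)] assms by (auto simp: complex_eq_iff)
    fix j assume j: "j < k"
    have "apT ?C x (2*j) = 0" "apT ?C x (Suc (2*j)) = 0" using h(1) j by auto
    thus "(of_real a + e * of_real b) * (-1) ^ j * (x (2*(k - Suc j)) + e * x (Suc (2*(k - Suc j))) -
      (if 0 < j then x (2*(k - j)) + e * x (Suc (2*(k - j))) else 0)) = 0"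
      using apT_GC[OF j that(1), of a b x] by simp
  qed (rule that(2))
  have "\<forall>i<2*k. x i = 0" unfolding all_less_double using pairs_zero e by blast
  thus "x i = 0" using h(2) by simp
qed

section \<open>Complex spaces with conjugation and a bilinear form\<close>

text \<open>\<open>B\<close> is bilinear, and \<open>B_cj\<close> expresses that its matrix is real.
  Sesquilinear forms arise only by writing \<open>B x (cj y)\<close>.\<close>

locale cform = Vector_Spaces.vector_space sc
  for sc :: "complex \<Rightarrow> 'v::ab_group_add \<Rightarrow> 'v" (infixr "*s" 75) +
  fixes cj :: "'v \<Rightarrow> 'v" and B :: "'v \<Rightarrow> 'v \<Rightarrow> complex"
  assumes cj_add: "cj (x + y) = cj x + cj y"
    and cj_sc: "cj (c *s x) = cnj c *s cj x"
    and cj_cj [simp]: "cj (cj x) = x"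
    and B_addl: "B (x + y) z = B x z + B y z"
    and B_addr: "B z (x + y) = B z x + B z y"
    and B_scl: "B (c *s x) y = c * B x y"
    and B_scr: "B x (c *s y) = c * B x y"
    and B_cj: "B (cj x) (cj y) = cnj (B x y)"
begin

lemma B_zero [simp]: "B 0 x = 0" "B x 0 = 0"
  using B_scl[of 0 0 x] B_scr[of x 0 0] by simp_all

lemma B_minus: "B (- x) y = - B x y" "B x (- y) = - B x y"
  using B_scl[of "-1" x y] B_scr[of x "-1" y] by simp_all

lemma B_diff: "B (x - y) z = B x z - B y z" "B z (x - y) = B z x - B z y"
  using B_addl[of x "-y" z] B_addr[of z x "-y"] by (simp_all add: B_minus)

lemma B_suml: "B (sum f I) y = (\<Sum>i\<in>I. B (f i) y)"
  by (induction I rule: infinite_finite_induct) (auto simp: B_addl)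

lemma B_sumr: "B y (sum f I) = (\<Sum>i\<in>I. B y (f i))"
  by (induction I rule: infinite_finite_induct) (auto simp: B_addr)

lemmas B_simps = B_addl B_addr B_scl B_scr B_minus B_diff

lemma cj_zero [simp]: "cj 0 = 0"
  using cj_sc[of 0 0] by simp

lemma cj_minus: "cj (- x) = - cj x"
  using cj_sc[of "-1" x] by simp

lemma cj_diff: "cj (x - y) = cj x - cj y"
  using cj_add[of x "-y"] by (simp add: cj_minus)

lemma cj_sum: "cj (sum f I) = (\<Sum>i\<in>I. cj (f i))"
  by (induction I rule: infinite_finite_induct) (auto simp: cj_add)

lemmas cj_simps = cj_add cj_sc cj_minus cj_diff

lemma B_cj1: "B (cj x) y = cnj (B x (cj y))"
  using B_cj[of x "cj y"] by simp

definition re :: "'v \<Rightarrow> 'v" where "re x = (1/2) *s (x + cj x)"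
definition im :: "'v \<Rightarrow> 'v" where "im x = (- \<i>/2) *s (x - cj x)"

lemma cj_re [simp]: "cj (re x) = re x"
  by (simp add: re_def cj_simps add.commute)

lemma cj_im [simp]: "cj (im x) = im x"
  by (simp add: im_def cj_simps scale_right_diff_distrib)

lemma re_im: "x = re x + \<i> *s im x"
proof -
  have "\<i> *s im x = (1/2) *s (x - cj x)"
    by (simp add: im_def)
  hence "re x + \<i> *s im x = (1/2) *s x + (1/2) *s x"
    by (simp add: re_def scale_right_diff_distrib scale_right_distrib)
  also have "\<dots> = (1/2 + 1/2) *s x" by (simp only: scale_left_distrib)
  finally show ?thesis by simp
qed

lemma re_real: "cj x = x \<Longrightarrow> re x = x"
proof -
  assume "cj x = x"
  hence "re x = (1/2) *s x + (1/2) *s x" by (simp add: re_def scale_right_distrib)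
  also have "\<dots> = (1/2 + 1/2) *s x" by (simp only: scale_left_distrib)
  finally show ?thesis by simp
qed

section \<open>Finite-dimensional subspaces, conjugation-stable subspaces, maps linear on a
  subspace\<close>

definition fds :: "'v set \<Rightarrow> bool" where
  "fds V \<longleftrightarrow> subspace V \<and> (\<exists>T. finite T \<and> V \<subseteq> span T)"

definition csub :: "'v set \<Rightarrow> bool" where
  "csub V \<longleftrightarrow> fds V \<and> (\<forall>x\<in>V. cj x \<in> V)"

text \<open>The type of vectors is fixed while the space shrinks with every split, so operators are
  total functions controlled on the current subspace only.\<close>

definition lin :: "'v set \<Rightarrow> ('v \<Rightarrow> 'v) \<Rightarrow> bool" where
  "lin V f \<longleftrightarrow> (\<forall>x\<in>V. f x \<in> V) \<and> (\<forall>x\<in>V. \<forall>y\<in>V. f (x + y) = f x + f y) \<and>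
     (\<forall>c. \<forall>x\<in>V. f (c *s x) = c *s f x)"

definition linf :: "'v set \<Rightarrow> ('v \<Rightarrow> complex) \<Rightarrow> bool" where
  "linf V f \<longleftrightarrow> (\<forall>x\<in>V. \<forall>y\<in>V. f (x + y) = f x + f y) \<and> (\<forall>c. \<forall>x\<in>V. f (c *s x) = c * f x)"

lemma fds_subspace: "fds V \<Longrightarrow> subspace V" by (simp add: fds_def)
lemma csub_fds: "csub V \<Longrightarrow> fds V" by (simp add: csub_def)
lemma csub_subspace: "csub V \<Longrightarrow> subspace V" by (simp add: csub_def fds_def)
lemma csub_cj: "csub V \<Longrightarrow> x \<in> V \<Longrightarrow> cj x \<in> V" by (simp add: csub_def)

lemma fds_sub: "fds V \<Longrightarrow> subspace W \<Longrightarrow> W \<subseteq> V \<Longrightarrow> fds W"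
  unfolding fds_def by blast

lemma csub_sub: "csub V \<Longrightarrow> subspace W \<Longrightarrow> W \<subseteq> V \<Longrightarrow> (\<And>x. x \<in> W \<Longrightarrow> cj x \<in> W) \<Longrightarrow> csub W"
  unfolding csub_def using fds_sub by blast

lemma csub_re: "csub V \<Longrightarrow> x \<in> V \<Longrightarrow> re x \<in> V"
  unfolding re_def using csub_subspace csub_cj subspace_add subspace_scale by blast

lemma csub_im: "csub V \<Longrightarrow> x \<in> V \<Longrightarrow> im x \<in> V"
  unfolding im_def using csub_subspace csub_cj subspace_diff subspace_scale by blast

lemma linfD: assumes "linf V f" "x \<in> V" "y \<in> V"
  shows "f (x + y) = f x + f y" "f (c *s x) = c * f x"
  using assms by (auto simp: linf_def)

lemma linf_diff: assumes "linf V f" "subspace V" "x \<in> V" "y \<in> V"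
  shows "f (x - y) = f x - f y"
proof -
  have "(-1) *s y \<in> V" using assms subspace_scale by blast
  hence "f (x + (-1) *s y) = f x + (-1) * f y"
    using linfD[OF assms(1,3), of "(-1) *s y"] linfD(2)[OF assms(1,4,4), of "-1"] by simp
  thus ?thesis by simp
qed

lemma linf_zero: "linf V f \<Longrightarrow> subspace V \<Longrightarrow> f 0 = 0"
  using linf_diff[of V f 0 0] subspace_0 by simp

lemma linf_sum: assumes "linf V f" "subspace V" "\<And>i. i \<in> I \<Longrightarrow> g i \<in> V"
  shows "f (\<Sum>i\<in>I. c i *s g i) = (\<Sum>i\<in>I. c i * f (g i))"
  using assms(3)
proof (induction I rule: infinite_finite_induct)
  case (insert a I)
  have 1: "c a *s g a \<in> V" using insert assms(2) subspace_scale by blast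
  have 2: "(\<Sum>i\<in>I. c i *s g i) \<in> V" using insert assms(2) by (intro subspace_sum subspace_scale) auto
  show ?case using insert linfD(1)[OF assms(1) 1 2] linfD(2)[OF assms(1), of "g a" "g a" "c a"] by simp
qed (auto simp: linf_zero[OF assms(1,2)])

lemma linD: assumes "lin V f" "x \<in> V"
  shows "f x \<in> V" "y \<in> V \<Longrightarrow> f (x + y) = f x + f y" "f (c *s x) = c *s f x"
  using assms by (auto simp: lin_def)

lemma lin_diff: assumes "lin V f" "subspace V" "x \<in> V" "y \<in> V"
  shows "f (x - y) = f x - f y"
proof -
  have "(-1) *s y \<in> V" using assms subspace_scale by blast
  hence "f (x + (-1) *s y) = f x + (-1) *s f y"
    using linD(2)[OF assms(1,3), of "(-1) *s y"] linD(3)[OF assms(1,4), of "-1"] by simp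
  thus ?thesis by simp
qed

lemma lin_zero: "lin V f \<Longrightarrow> subspace V \<Longrightarrow> f 0 = 0"
  using lin_diff[of V f 0 0] subspace_0 by simp

lemma lin_sum: assumes "lin V f" "subspace V" "\<And>i. i \<in> I \<Longrightarrow> g i \<in> V"
  shows "f (\<Sum>i\<in>I. c i *s g i) = (\<Sum>i\<in>I. c i *s f (g i))"
  using assms(3)
proof (induction I rule: infinite_finite_induct)
  case (insert a I)
  have 1: "c a *s g a \<in> V" using insert assms(2) subspace_scale by blast
  have 2: "(\<Sum>i\<in>I. c i *s g i) \<in> V" using insert assms(2) by (intro subspace_sum subspace_scale) auto
  show ?case using insert linD(2)[OF assms(1) 1 2] linD(3)[OF assms(1), of "g a" "c a"] by simp
qed (auto simp: lin_zero[OF assms(1,2)])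

lemma lin_funpow: assumes "lin V f" shows "lin V (f ^^ m)"
proof (induction m)
  case 0 show ?case by (simp add: lin_def)
next
  case (Suc m)
  thus ?case using assms unfolding lin_def by simp
qed

lemma lin_subset: "lin V f \<Longrightarrow> W \<subseteq> V \<Longrightarrow> (\<And>x. x \<in> W \<Longrightarrow> f x \<in> W) \<Longrightarrow> lin W f"
  unfolding lin_def by blast

lemma funpow_comm: "(f ^^ m) (f x) = f ((f ^^ m) x)"
  by (induction m) auto

lemma funpow_le_zero: assumes "lin V f" "subspace V" "(f ^^ m) x = 0" "m \<le> n"
  shows "(f ^^ n) x = 0"
proof -
  have z: "(f ^^ j) 0 = 0" for j using lin_zero[OF lin_funpow[OF assms(1)] assms(2)] .
  have "(f ^^ n) x = (f ^^ (n - m)) ((f ^^ m) x)"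
    using assms(4) by (metis comp_apply funpow_add le_add_diff_inverse2)
  thus ?thesis using assms(3) z by simp
qed

subsection \<open>Dual families\<close>

text \<open>Biorthogonalization by induction. If the last functional agreed everywhere with its
  expansion in the earlier ones, the family would be dependent; a vector where the two differ, made
  orthogonal to the earlier functionals, becomes the last dual vector, and the others are corrected
  by it.\<close>

lemma dual_family:
  fixes n :: nat
  assumes V: "subspace V" and \<phi>: "\<And>i. i < n \<Longrightarrow> linf V (\<phi> i)"
    and ind: "\<And>c. (\<And>v. v \<in> V \<Longrightarrow> (\<Sum>i<n. c i * \<phi> i v) = 0) \<Longrightarrow> \<forall>i<n. c i = 0"
  shows "\<exists>s. \<forall>j<n. s j \<in> V \<and> (\<forall>i<n. \<phi> i (s j) = (if i = j then 1 else 0))"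
  using \<phi> ind
proof (induction n)
  case 0 show ?case by simp
next
  case (Suc n)
  have ind: "\<forall>i<n. c i = 0" if h: "\<And>v. v \<in> V \<Longrightarrow> (\<Sum>i<n. c i * \<phi> i v) = 0" for c
  proof -
    have "(\<Sum>i<Suc n. (c(n := 0)) i * \<phi> i v) = 0" if "v \<in> V" for v
    proof -
      have "(\<Sum>i<n. (c(n := 0)) i * \<phi> i v) = (\<Sum>i<n. c i * \<phi> i v)" by (rule sum.cong) auto
      thus ?thesis using h[OF that] by simp
    qed
    hence z: "\<forall>i<Suc n. (c(n := 0)) i = 0" by (rule Suc.prems(2))
    show ?thesis
    proof (intro allI impI)
      fix i assume "i < n"
      thus "c i = 0" using z[rule_format, of i] by simp
    qed
  qed
  have "\<exists>s. \<forall>j<n. s j \<in> V \<and> (\<forall>i<n. \<phi> i (s j) = (if i = j then 1 else 0))"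
    by (rule Suc.IH) (use Suc.prems(1) ind in auto)
  then obtain s where s: "\<And>j. j < n \<Longrightarrow> s j \<in> V"
    "\<And>i j. j < n \<Longrightarrow> i < n \<Longrightarrow> \<phi> i (s j) = (if i = j then 1 else 0)" by blast
  have "\<exists>v\<in>V. \<phi> n v - (\<Sum>j<n. \<phi> n (s j) * \<phi> j v) \<noteq> 0"
  proof (rule ccontr)
    assume "\<not> ?thesis"
    hence h: "\<phi> n v = (\<Sum>j<n. \<phi> n (s j) * \<phi> j v)" if "v \<in> V" for v using that by auto
    have "\<forall>i<Suc n. (\<lambda>i. if i = n then 1 else - \<phi> n (s i)) i = 0"
      by (rule Suc.prems(2)) (simp add: h sum_negf)
    thus False by (metis lessI zero_neq_one)
  qed
  then obtain v where v: "v \<in> V" "\<phi> n v - (\<Sum>j<n. \<phi> n (s j) * \<phi> j v) \<noteq> 0" by blast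
  define w where "w = v - (\<Sum>j<n. \<phi> j v *s s j)"
  have sumV: "(\<Sum>j<n. \<phi> j v *s s j) \<in> V" using s(1) V by (intro subspace_sum subspace_scale) auto
  have wV: "w \<in> V" unfolding w_def using v sumV V subspace_diff by blast
  have \<phi>w: "\<phi> i w = \<phi> i v - (\<Sum>j<n. \<phi> j v * \<phi> i (s j))" if "i < Suc n" for i
    unfolding w_def using linf_diff[OF Suc.prems(1)[OF that] V v(1) sumV]
      linf_sum[OF Suc.prems(1)[OF that] V, of "{..<n}" s "\<lambda>j. \<phi> j v"] s(1) by simp
  have \<phi>w0: "\<phi> i w = 0" if "i < n" for i
    using \<phi>w[of i] that s(2)[of _ i]
    by (simp add: if_distrib[of "(*) _"] sum.delta' cong: sum.cong_simp if_cong)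
  have \<phi>wn: "\<phi> n w \<noteq> 0" using \<phi>w[of n] v(2) by (simp add: mult.commute)
  define t where "t = (1 / \<phi> n w) *s w"
  have tV: "t \<in> V" unfolding t_def using wV V subspace_scale by blast
  have \<phi>t: "\<phi> i t = (if i = n then 1 else 0)" if "i < Suc n" for i
    using linfD(2)[OF Suc.prems(1)[OF that] wV wV] \<phi>w0[of i] \<phi>wn that by (auto simp: t_def)
  define s' where "s' = (\<lambda>j. if j = n then t else s j - \<phi> n (s j) *s t)"
  have "s' j \<in> V" if "j < Suc n" for j
    using that s(1)[of j] tV V by (auto simp: s'_def intro!: subspace_diff subspace_scale)
  moreover have "\<phi> i (s' j) = (if i = j then 1 else 0)" if "i < Suc n" "j < Suc n" for i j
  proof (cases "j = n")
    case True thus ?thesis using \<phi>t that by (simp add: s'_def)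
  next
    case False
    hence j: "j < n" using that by simp
    have "\<phi> i (s' j) = \<phi> i (s j) - \<phi> n (s j) * \<phi> i t"
      using False linf_diff[OF Suc.prems(1)[OF that(1)] V s(1)[OF j], of "\<phi> n (s j) *s t"]
        linfD(2)[OF Suc.prems(1)[OF that(1)] tV tV] tV V subspace_scale
      by (auto simp: s'_def)
    thus ?thesis using s(2)[OF j, of i] \<phi>t[OF that(1)] that(1) j by auto
  qed
  ultimately show ?case by blast
qed

text \<open>The prescribed values 0 and 1 are real, so taking real parts preserves them when the
  functionals commute with conjugation.\<close>

lemma dual_family_real:
  fixes n :: nat
  assumes V: "csub V" and \<phi>: "\<And>i. i < n \<Longrightarrow> linf V (\<phi> i)"
    and real: "\<And>i v. i < n \<Longrightarrow> v \<in> V \<Longrightarrow> \<phi> i (cj v) = cnj (\<phi> i v)"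
    and ind: "\<And>c. (\<And>v. v \<in> V \<Longrightarrow> (\<Sum>i<n. c i * \<phi> i v) = 0) \<Longrightarrow> \<forall>i<n. c i = 0"
  shows "\<exists>s. \<forall>j<n. s j \<in> V \<and> cj (s j) = s j \<and> (\<forall>i<n. \<phi> i (s j) = (if i = j then 1 else 0))"
proof -
  obtain s where s: "\<And>j. j < n \<Longrightarrow> s j \<in> V"
    "\<And>i j. j < n \<Longrightarrow> i < n \<Longrightarrow> \<phi> i (s j) = (if i = j then 1 else 0)"
    using dual_family[where V=V and n=n and \<phi>=\<phi>, OF csub_subspace[OF V] \<phi> ind] by blast
  have "\<phi> i (re (s j)) = (if i = j then 1 else 0)" if "i < n" "j < n" for i j
  proof -
    have c: "cj (s j) \<in> V" using s(1) that V csub_cj by blast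
    have m: "s j + cj (s j) \<in> V" using s(1) that c csub_subspace[OF V] subspace_add by blast
    have "\<phi> i (re (s j)) = (1/2) * (\<phi> i (s j) + cnj (\<phi> i (s j)))"
      unfolding re_def using linfD[OF \<phi>[OF that(1)] m m] linfD(1)[OF \<phi>[OF that(1)] s(1) c] that
       real[OF that(1) s(1)[OF that(2)]] by simp
    thus ?thesis using s(2)[OF that(2,1)] by auto
  qed
  hence "\<forall>j<n. re (s j) \<in> V \<and> cj (re (s j)) = re (s j) \<and> (\<forall>i<n. \<phi> i (re (s j)) = (if i = j then 1 else 0))"
    using s(1) csub_re[OF V] cj_re by blast
  thus ?thesis by (rule exI[of _ "\<lambda>j. re (s j)"])
qed

subsection \<open>Lists of vectors\<close>

text \<open>Lists rather than sets, because Gram matrices depend on the order of a basis. A repeated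
  vector makes a list dependent.\<close>

definition lc :: "'v list \<Rightarrow> (nat \<Rightarrow> complex) \<Rightarrow> 'v" where
  "lc es c = (\<Sum>i<length es. c i *s es ! i)"

definition indl :: "'v list \<Rightarrow> bool" where
  "indl es \<longleftrightarrow> (\<forall>c. lc es c = 0 \<longrightarrow> (\<forall>i<length es. c i = 0))"

lemma lc_in: assumes "subspace V" "set es \<subseteq> V" shows "lc es c \<in> V"
  unfolding lc_def using assms by (intro subspace_sum subspace_scale) auto

lemma lc_append: "lc (xs @ ys) c = lc xs c + lc ys (\<lambda>i. c (i + length xs))"
proof -
  have "lc (xs @ ys) c = (\<Sum>i<length xs. c i *s (xs @ ys) ! i) + (\<Sum>i=length xs..<length xs + length ys. c i *s (xs @ ys) ! i)"
    unfolding lc_def length_append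
    by (metis (no_types, lifting) atLeast0LessThan le_add1 sum.atLeastLessThan_concat zero_le)
  also have "(\<Sum>i=length xs..<length xs + length ys. c i *s (xs @ ys) ! i) = lc ys (\<lambda>i. c (i + length xs))"
    unfolding lc_def using sum.shift_bounds_nat_ivl[of "\<lambda>i. c i *s (xs @ ys) ! i" 0 "length xs" "length ys"]
    by (simp add: nth_append add.commute atLeast0LessThan)
  also have "(\<Sum>i<length xs. c i *s (xs @ ys) ! i) = lc xs c"
    unfolding lc_def by (rule sum.cong) (auto simp: nth_append)
  finally show ?thesis .
qed

lemma lc_append2: "\<exists>e. lc (xs @ ys) e = lc xs c + lc ys d"
proof -
  have "lc (xs @ ys) (\<lambda>i. if i < length xs then c i else d (i - length xs)) = lc xs c + lc ys d"
    unfolding lc_append by (simp add: lc_def)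
  thus ?thesis by blast
qed

lemma span_list: "span (set es) = range (lc es)"
proof
  have "set es \<subseteq> range (lc es)"
  proof
    fix x assume "x \<in> set es"
    then obtain j where j: "j < length es" "x = es ! j" by (metis in_set_conv_nth)
    have "lc es (\<lambda>i. if i = j then 1 else 0) = x"
      unfolding lc_def using j by (simp add: if_distrib[of "\<lambda>c. c *s _"] sum.delta cong: if_cong)
    thus "x \<in> range (lc es)" by blast
  qed
  moreover have "subspace (range (lc es))"
  proof (rule subspaceI)
    show "0 \<in> range (lc es)" by (intro image_eqI[of _ _ "\<lambda>_. 0"]) (auto simp: lc_def)
    fix x y assume "x \<in> range (lc es)" "y \<in> range (lc es)"
    then obtain c d where "x = lc es c" "y = lc es d" by blast
    thus "x + y \<in> range (lc es)"
      by (intro image_eqI[of _ _ "\<lambda>i. c i + d i"]) (auto simp: lc_def scale_left_distrib sum.distrib)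
  next
    fix a x assume "x \<in> range (lc es)"
    then obtain c where "x = lc es c" by blast
    thus "a *s x \<in> range (lc es)"
      by (intro image_eqI[of _ _ "\<lambda>i. a * c i"]) (auto simp: lc_def scale_sum_right)
  qed
  ultimately show "span (set es) \<subseteq> range (lc es)" by (rule span_minimal)
  show "range (lc es) \<subseteq> span (set es)"
    using lc_in[OF subspace_span span_superset] by blast
qed

lemma span_listE: assumes "x \<in> V" "V = span (set es)" obtains c where "x = lc es c"
  using assms unfolding span_list by blast

lemma lc_span: "lc es c \<in> span (set es)"
  unfolding span_list by blast

lemma indl_distinct: assumes "indl es" shows "distinct es"
proof (rule ccontr)
  assume "\<not> distinct es"
  then obtain i j where ij: "i < length es" "j < length es" "i \<noteq> j" "es ! i = es ! j"
    by (auto simp: distinct_conv_nth)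
  have "lc es (\<lambda>l. if l = i then 1 else if l = j then -1 else 0) =
     (\<Sum>l<length es. (if l = i then es ! i else 0)) - (\<Sum>l<length es. (if l = j then es ! j else 0))"
    unfolding lc_def sum_subtractf[symmetric] using ij(3) by (intro sum.cong) auto
  also have "\<dots> = 0" using ij by (simp add: sum.delta)
  finally have "(\<lambda>l. if l = i then 1 else if l = j then -1 else (0::complex)) i = 0"
    using assms ij unfolding indl_def by blast
  thus False by simp
qed

lemma indl_independent: assumes "indl es" shows "independent (set es)"
proof (rule independent_if_scalars_zero)
  show "finite (set es)" by simp
  fix f x assume s: "(\<Sum>x\<in>set es. f x *s x) = 0" "x \<in> set es"
  obtain j where j: "j < length es" "x = es ! j" using s(2) by (metis in_set_conv_nth)
  have "lc es (\<lambda>i. f (es ! i)) = (\<Sum>x\<in>set es. f x *s x)"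
    unfolding lc_def using indl_distinct[OF assms]
    by (intro sum.reindex_bij_betw[OF bij_betw_nth]) auto
  hence "lc es (\<lambda>i. f (es ! i)) = 0" using s(1) by simp
  hence "\<forall>i<length es. f (es ! i) = 0" using assms unfolding indl_def by blast
  thus "f x = 0" using j by simp
qed

lemma indl_length: assumes "indl es" "set es \<subseteq> span T" "finite T" shows "length es \<le> card T"
  using independent_span_bound[OF assms(3) indl_independent[OF assms(1)] assms(2)]
    distinct_card[OF indl_distinct[OF assms(1)]] by simp

definition rbasis :: "'v set \<Rightarrow> 'v list \<Rightarrow> bool" where
  "rbasis V es \<longleftrightarrow> (\<forall>e\<in>set es. cj e = e) \<and> indl es \<and> span (set es) = V"

lemma indl_append_single: assumes "indl es" "v \<notin> span (set es)" shows "indl (es @ [v])"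
  unfolding indl_def
proof (intro allI impI)
  fix c i assume h: "lc (es @ [v]) c = 0" "i < length (es @ [v])"
  have e: "lc es c + c (length es) *s v = 0"
    using h(1) unfolding lc_append by (simp add: lc_def)
  have cl: "c (length es) = 0"
  proof (rule ccontr)
    assume n: "c (length es) \<noteq> 0"
    have "c (length es) *s v = - lc es c" using e by (simp add: eq_neg_iff_add_eq_0 add.commute)
    moreover have "- lc es c \<in> span (set es)" using span_list by (intro span_neg) auto
    ultimately have "c (length es) *s v \<in> span (set es)" by simp
    hence "(1 / c (length es)) *s (c (length es) *s v) \<in> span (set es)" by (rule span_scale)
    thus False using assms(2) n by simp
  qed
  hence "lc es c = 0" using e by simp
  thus "c i = 0" using assms(1) h(2) cl unfolding indl_def by (cases "i < length es") (auto simp: less_Suc_eq)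
qed

text \<open>Greedy extension, ended by the bound \<open>card T\<close> on the length of independent
  lists. The new vectors come from \<open>S\<close> itself; taking for \<open>S\<close> the real
  vectors of a space gives real bases.\<close>

lemma extend_list:
  assumes "indl es" "finite T" "set es \<subseteq> span T" "S \<subseteq> span T"
  shows "\<exists>fs. set fs \<subseteq> S \<and> indl (es @ fs) \<and> S \<subseteq> span (set (es @ fs))"
  using assms(1,3)
proof (induction "card T - length es" arbitrary: es rule: less_induct)
  case less
  show ?case
  proof (cases "S \<subseteq> span (set es)")
    case True
    thus ?thesis using less.prems by (intro exI[of _ "[]"]) auto
  next
    case False
    then obtain v where v: "v \<in> S" "v \<notin> span (set es)" by blast
    have i: "indl (es @ [v])" using indl_append_single less.prems v by blast
    have s: "set (es @ [v]) \<subseteq> span T" using less.prems v assms(4) by auto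
    have "length (es @ [v]) \<le> card T" using indl_length[OF i s assms(2)] .
    hence "card T - length (es @ [v]) < card T - length es" by simp
    from less.hyps[OF this i s] obtain fs where fs: "set fs \<subseteq> S" "indl ((es @ [v]) @ fs)"
      "S \<subseteq> span (set ((es @ [v]) @ fs))" by metis
    have "(es @ [v]) @ fs = es @ v # fs" by simp
    hence "set (v # fs) \<subseteq> S \<and> indl (es @ v # fs) \<and> S \<subseteq> span (set (es @ v # fs))"
      using fs v(1) by (metis insert_subset list.simps(15))
    thus ?thesis by blast
  qed
qed

lemma span_real: assumes "csub V" shows "V \<subseteq> span {x \<in> V. cj x = x}"
proof
  fix x assume x: "x \<in> V"
  have "re x \<in> {x \<in> V. cj x = x}" "im x \<in> {x \<in> V. cj x = x}"
    using csub_re[OF assms x] csub_im[OF assms x] cj_re cj_im by blast+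
  hence "re x + \<i> *s im x \<in> span {x \<in> V. cj x = x}" by (intro span_add span_scale span_base)
  thus "x \<in> span {x \<in> V. cj x = x}" using arg_cong[OF re_im[of x], of "\<lambda>y. y \<in> span {x \<in> V. cj x = x}"] by blast
qed

lemma indl_Nil [simp]: "indl []" by (simp add: indl_def)

lemma extend_rbasis:
  assumes V: "csub V" and es: "indl es" "set es \<subseteq> V" "\<forall>e\<in>set es. cj e = e"
  shows "\<exists>fs. rbasis V (es @ fs)"
proof -
  obtain T where T: "finite T" "V \<subseteq> span T" using V unfolding csub_def fds_def by blast
  have "set es \<subseteq> span T" "{x \<in> V. cj x = x} \<subseteq> span T" using T(2) es(2) by auto
  hence "\<exists>fs. set fs \<subseteq> {x \<in> V. cj x = x} \<and> indl (es @ fs) \<and> {x \<in> V. cj x = x} \<subseteq> span (set (es @ fs))"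
    by (rule extend_list[OF es(1) T(1)])
  then obtain fs where fs: "set fs \<subseteq> {x \<in> V. cj x = x}" "indl (es @ fs)" "{x \<in> V. cj x = x} \<subseteq> span (set (es @ fs))"
    by blast
  have sub: "set (es @ fs) \<subseteq> V" using fs(1) es(2) by auto
  have 1: "span (set (es @ fs)) \<subseteq> V" by (rule span_minimal[OF sub csub_subspace[OF V]])
  have 2: "V \<subseteq> span (set (es @ fs))"
    by (rule order.trans[OF span_real[OF V] span_minimal[OF fs(3) subspace_span]])
  have "\<forall>e\<in>set (es @ fs). cj e = e" using fs(1) es(3) by auto
  hence "rbasis V (es @ fs)" unfolding rbasis_def using fs(2) 1 2 by blast
  thus ?thesis by blast
qed

lemma rbasis_exists: assumes "csub V" shows "\<exists>es. rbasis V es"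
proof -
  have "set [] \<subseteq> V" "\<forall>e\<in>set []. cj e = e" by auto
  from extend_rbasis[OF assms indl_Nil this] show ?thesis unfolding append_Nil .
qed

lemma rbasisD: assumes "rbasis V es"
  shows "indl es" "span (set es) = V" "\<And>e. e \<in> set es \<Longrightarrow> cj e = e" "set es \<subseteq> V" "V = range (lc es)" "csub V"
proof -
  show a: "indl es" "span (set es) = V" and r: "\<And>e. e \<in> set es \<Longrightarrow> cj e = e"
    using assms unfolding rbasis_def by blast+
  show "set es \<subseteq> V" using a(2) span_superset by blast
  show l: "V = range (lc es)" using a(2) span_list by blast
  have "cj (lc es c) = lc es (\<lambda>i. cnj (c i))" for c
    unfolding lc_def cj_sum by (rule sum.cong) (simp_all add: cj_sc r)
  hence "\<forall>x\<in>V. cj x \<in> V" unfolding l by blast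
  moreover have "subspace V" using a(2) subspace_span by blast
  moreover have "finite (set es) \<and> V \<subseteq> span (set es)" using a(2) by blast
  ultimately show "csub V" unfolding csub_def fds_def by blast
qed

lemma rbasis_dim: assumes "rbasis V es" shows "length es = dim V"
proof -
  have "card (set es) = dim V"
    using rbasisD(2,4)[OF assms] indl_independent[OF rbasisD(1)[OF assms]]
    by (intro basis_card_eq_dim) auto
  thus ?thesis using distinct_card[OF indl_distinct[OF rbasisD(1)[OF assms]]] by simp
qed

lemma indl_length_span:
  assumes "indl es" "set es \<subseteq> V" "rbasis V bs" "length es = length bs" shows "span (set es) = V"
proof
  show "span (set es) \<subseteq> V" using assms(2) rbasisD[OF assms(3)] csub_subspace by (intro span_minimal) auto
  show "V \<subseteq> span (set es)"
  proof (rule ccontr)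
    assume "\<not> ?thesis"
    then obtain v where v: "v \<in> V" "v \<notin> span (set es)" by blast
    have "length (es @ [v]) \<le> card (set bs)"
      using indl_length[OF indl_append_single[OF assms(1) v(2)]] assms(2) v(1) rbasisD(2)[OF assms(3)] by auto
    also have "\<dots> \<le> length bs" by (rule card_length)
    finally show False using assms(4) by simp
  qed
qed

lemma indl_appendI:
  assumes "indl es" "indl fs" "span (set es) \<inter> span (set fs) \<subseteq> {0}"
  shows "indl (es @ fs)"
  unfolding indl_def
proof (intro allI impI)
  fix c i assume h: "lc (es @ fs) c = 0" "i < length (es @ fs)"
  let ?d = "\<lambda>i. c (i + length es)"
  have e: "lc es c = - lc fs ?d" using h(1) unfolding lc_append by (simp add: eq_neg_iff_add_eq_0)
  have "lc es c \<in> span (set es)" using span_list by blast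
  moreover have "- lc fs ?d \<in> span (set fs)" using span_list span_neg by blast
  ultimately have z: "lc es c = 0" "lc fs ?d = 0" using assms(3) e by auto
  show "c i = 0"
  proof (cases "i < length es")
    case True thus ?thesis using z(1) assms(1) unfolding indl_def by blast
  next
    case False
    have "i - length es < length fs" using False h(2) by simp
    hence "?d (i - length es) = 0" using z(2) assms(2) unfolding indl_def by blast
    thus ?thesis using False by simp
  qed
qed

lemma indl_appendD: assumes "indl (es @ fs)"
  shows "indl es" "indl fs" "span (set es) \<inter> span (set fs) \<subseteq> {0}"
proof -
  have main: "(\<forall>i<length es. c i = 0) \<and> (\<forall>i<length fs. d i = 0)" if "lc es c + lc fs d = 0" for c d
  proof -
    define e where "e = (\<lambda>i. if i < length es then c i else d (i - length es))"
    have "lc (es @ fs) e = lc es c + lc fs d" unfolding lc_append by (simp add: lc_def e_def)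
    hence "lc (es @ fs) e = 0" using that by simp
    hence "\<forall>i<length (es @ fs). e i = 0" using assms unfolding indl_def by blast
    hence e0: "e i = 0" if "i < length es + length fs" for i using that by simp
    have "c i = 0" if "i < length es" for i using e0[of i] that by (simp add: e_def)
    moreover have "d i = 0" if "i < length fs" for i using e0[of "i + length es"] that by (simp add: e_def)
    ultimately show ?thesis by blast
  qed
  have z: "lc es (\<lambda>_. 0) = 0" for es by (simp add: lc_def)
  show "indl es" unfolding indl_def using main[of _ "\<lambda>_. 0"] z by auto
  show "indl fs" unfolding indl_def using main[of "\<lambda>_. 0"] z by auto
  show "span (set es) \<inter> span (set fs) \<subseteq> {0}"
  proof
    fix x assume "x \<in> span (set es) \<inter> span (set fs)"
    then obtain c d where x: "x = lc es c" "x = lc fs d" unfolding span_list by blast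
    have "lc fs (\<lambda>i. - d i) = - x" using x by (simp add: lc_def sum_negf)
    hence "lc es c + lc fs (\<lambda>i. - d i) = 0" using x by simp
    hence "\<forall>i<length es. c i = 0" using main by blast
    thus "x \<in> {0}" using x by (simp add: lc_def)
  qed
qed

end

section \<open>Nilpotent operators and the asymmetry\<close>

context cform
begin

text \<open>Recursion instead of a geometric series: if \<open>z'\<close> solves the equation for
  \<open>N y\<close>, then z = (y - z') / \<alpha> satisfies \<open>N z = z'\<close>. The solution
  keeps the exponent \<open>m\<close>, which \<open>M_nil\<close> relies on.\<close>

lemma nilp_surj:
  assumes "lin V N" "subspace V" "\<alpha> \<noteq> 0" "y \<in> V" "(N ^^ m) y = 0"
  shows "\<exists>z\<in>V. \<alpha> *s z + N z = y \<and> (N ^^ m) z = 0"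
  using assms(4,5)
proof (induction m arbitrary: y)
  case 0
  thus ?case using lin_zero[OF assms(1,2)] by (intro bexI[of _ 0]) auto
next
  case (Suc m)
  have Ny: "N y \<in> V" using linD(1)[OF assms(1)] Suc by blast
  have "(N ^^ m) (N y) = 0" using Suc.prems by (simp add: funpow_comm)
  from Suc.IH[OF Ny this] obtain z' where z': "z' \<in> V" "\<alpha> *s z' + N z' = N y" "(N ^^ m) z' = 0" by blast
  define z where "z = (1/\<alpha>) *s (y - z')"
  have yz: "y - z' \<in> V" using Suc.prems z' assms(2) subspace_diff by blast
  have zV: "z \<in> V" unfolding z_def using yz assms(2) subspace_scale by blast
  have "N z = (1/\<alpha>) *s (N y - N z')" unfolding z_def
    using linD(3)[OF assms(1) yz] lin_diff[OF assms(1,2) Suc.prems(1) z'(1)] by simp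
  also have "N y - N z' = \<alpha> *s z'" using z'(2) by (simp add: algebra_simps)
  finally have Nz: "N z = z'" using assms(3) by simp
  have "\<alpha> *s z = y - z'" unfolding z_def using assms(3) by simp
  hence "\<alpha> *s z + N z = y" using Nz by simp
  moreover have "(N ^^ Suc m) z = 0" using z'(3) Nz by (simp add: funpow_Suc_right del: funpow.simps)
  ultimately show ?case using zV by blast
qed

lemma nilp_inj:
  assumes "lin V N" "subspace V" "\<alpha> \<noteq> 0" "z \<in> V" "(N ^^ m) z = 0" "\<alpha> *s z + N z = 0"
  shows "z = 0"
  using assms(4,5,6)
proof (induction m arbitrary: z)
  case (Suc m)
  have Nz: "N z \<in> V" using linD(1)[OF assms(1)] Suc by blast
  have az: "\<alpha> *s z \<in> V" using Suc assms(2) subspace_scale by blast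
  have "N (\<alpha> *s z + N z) = \<alpha> *s N z + N (N z)"
    using linD(2)[OF assms(1) az Nz] linD(3)[OF assms(1) Suc.prems(1)] by simp
  hence "\<alpha> *s N z + N (N z) = 0" using Suc.prems lin_zero[OF assms(1,2)] by simp
  moreover have "(N ^^ m) (N z) = 0" using Suc.prems by (simp add: funpow_comm)
  ultimately have "N z = 0" using Suc.IH[OF Nz] by blast
  thus ?case using Suc.prems assms(3) by simp
qed simp

lemma list_basis: assumes "fds V"
  shows "\<exists>es. indl es \<and> set es \<subseteq> V \<and> V = span (set es)"
proof -
  obtain T where T: "finite T" "V \<subseteq> span T" using assms unfolding fds_def by blast
  have "\<exists>fs. set fs \<subseteq> V \<and> indl ([] @ fs) \<and> V \<subseteq> span (set ([] @ fs))"
    by (rule extend_list[OF indl_Nil T(1) _ T(2)]) simp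
  then obtain fs where fs: "set fs \<subseteq> V" "indl fs" "V \<subseteq> span (set fs)" by auto
  have "span (set fs) \<subseteq> V" by (rule span_minimal[OF fs(1) fds_subspace[OF assms]])
  thus ?thesis using fs by blast
qed

lemma lin_lc: assumes "lin V f" "subspace V" "set es \<subseteq> V"
  shows "f (lc es c) = lc (map f es) c"
proof -
  have "es ! i \<in> V" if "i \<in> {..<length es}" for i using that assms(3) by auto
  from lin_sum[where I="{..<length es}" and g="(!) es" and c=c, OF assms(1,2) this]
  show ?thesis unfolding lc_def by simp
qed

lemma inj_surj:
  assumes "fds W" "lin W f" "\<And>x. x \<in> W \<Longrightarrow> f x = 0 \<Longrightarrow> x = 0" "y \<in> W"
  shows "\<exists>x\<in>W. f x = y"
proof -
  obtain es where es: "indl es" "set es \<subseteq> W" "W = span (set es)" using list_basis[OF assms(1)] by blast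
  note sW = fds_subspace[OF assms(1)]
  have i: "indl (map f es)" unfolding indl_def
  proof (intro allI impI)
    fix c i assume h: "lc (map f es) c = 0" "i < length (map f es)"
    have "f (lc es c) = 0" using lin_lc[OF assms(2) sW es(2)] h by simp
    hence "lc es c = 0" using assms(3) lc_in[OF sW es(2)] by blast
    thus "c i = 0" using es(1) h(2) unfolding indl_def by simp
  qed
  have "y \<in> span (set (map f es))"
  proof (rule ccontr)
    assume n: "\<not> ?thesis"
    have "set (map f es @ [y]) \<subseteq> span (set es)" using linD(1)[OF assms(2)] es assms(4) by auto
    from indl_length[OF indl_append_single[OF i n] this]
    have "length es + 1 \<le> card (set es)" by simp
    thus False using card_length[of es] by simp
  qed
  then obtain c where "y = lc (map f es) c" unfolding span_list by blast
  hence "y = f (lc es c)" using lin_lc[OF assms(2) sW es(2)] by simp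
  thus ?thesis using lc_in[OF sW es(2)] by blast
qed

text \<open>The hypothesis says that \<open>T\<close> is injective on its image, hence surjective
  there, so \<open>T v = T (T w)\<close> for some \<open>w\<close>: every vector is a kernel vector
  plus an image vector.\<close>

lemma fitting:
  assumes V: "fds V" and T: "lin V T" and ker: "\<And>x. x \<in> V \<Longrightarrow> T (T x) = 0 \<Longrightarrow> T x = 0" and v: "v \<in> V"
  shows "\<exists>w\<in>V. T (v - T w) = 0"
proof -
  note sV = fds_subspace[OF V]
  have sub: "subspace (T ` V)"
  proof (rule subspaceI)
    show "0 \<in> T ` V" using lin_zero[OF T sV] subspace_0[OF sV] by (metis image_eqI)
    fix x y assume "x \<in> T ` V" "y \<in> T ` V"
    then obtain a b where ab: "x = T a" "y = T b" "a \<in> V" "b \<in> V" by blast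
    show "x + y \<in> T ` V" using ab linD(2)[OF T ab(3,4)] subspace_add[OF sV ab(3,4)] by (metis image_eqI)
  next
    fix c x assume "x \<in> T ` V"
    then obtain a where ab: "x = T a" "a \<in> V" by blast
    show "c *s x \<in> T ` V" using ab linD(3)[OF T ab(2)] subspace_scale[OF sV ab(2)] by (metis image_eqI)
  qed
  have TV: "T ` V \<subseteq> V" using linD(1)[OF T] by blast
  have f: "fds (T ` V)" by (rule fds_sub[OF V sub TV])
  have l: "lin (T ` V) T" by (rule lin_subset[OF T TV]) (use TV in blast)
  have "\<exists>x\<in>T ` V. T x = T v"
    by (rule inj_surj[OF f l]) (use ker v in auto)
  then obtain w where w: "w \<in> V" "T (T w) = T v" by blast
  have "T (v - T w) = T v - T (T w)" using lin_diff[OF T sV v] w linD(1)[OF T] by blast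
  thus ?thesis using w by auto
qed

lemma subspace_gker: assumes "lin V N" "subspace V" shows "subspace {x \<in> V. \<exists>m. (N ^^ m) x = 0}"
proof (rule subspaceI)
  show "0 \<in> {x \<in> V. \<exists>m. (N ^^ m) x = 0}" using subspace_0[OF assms(2)] by (auto intro: exI[of _ 0])
  fix x y assume "x \<in> {x \<in> V. \<exists>m. (N ^^ m) x = 0}" "y \<in> {x \<in> V. \<exists>m. (N ^^ m) x = 0}"
  then obtain a b where ab: "x \<in> V" "y \<in> V" "(N ^^ a) x = 0" "(N ^^ b) y = 0" by blast
  have "(N ^^ (a+b)) x = 0" "(N ^^ (a+b)) y = 0"
    using funpow_le_zero[OF assms ab(3)] funpow_le_zero[OF assms ab(4)] by auto
  hence "(N ^^ (a+b)) (x + y) = 0" using linD(2)[OF lin_funpow[OF assms(1)] ab(1,2)] by simp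
  thus "x + y \<in> {x \<in> V. \<exists>m. (N ^^ m) x = 0}" using ab subspace_add[OF assms(2)] by blast
next
  fix c x assume "x \<in> {x \<in> V. \<exists>m. (N ^^ m) x = 0}"
  then obtain a where ab: "x \<in> V" "(N ^^ a) x = 0" by blast
  have "(N ^^ a) (c *s x) = 0" using linD(3)[OF lin_funpow[OF assms(1)] ab(1)] ab(2) by simp
  thus "c *s x \<in> {x \<in> V. \<exists>m. (N ^^ m) x = 0}" using ab subspace_scale[OF assms(2)] by blast
qed

text \<open>The generalized kernel is finite-dimensional; the sum of exponents that work for the
  vectors of a basis works for all of it.\<close>

lemma stable_exponent:
  assumes V: "fds V" and N: "lin V N"
  shows "\<exists>K. \<forall>x\<in>V. \<forall>m. (N ^^ m) x = 0 \<longrightarrow> (N ^^ K) x = 0"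
proof -
  note sV = fds_subspace[OF V]
  define W where "W = {x \<in> V. \<exists>m. (N ^^ m) x = 0}"
  have sW: "subspace W" unfolding W_def by (rule subspace_gker[OF N sV])
  have WV: "W \<subseteq> V" unfolding W_def by blast
  obtain es where es: "indl es" "set es \<subseteq> W" "W = span (set es)"
    using list_basis[OF fds_sub[OF V sW WV]] by blast
  have "\<forall>e\<in>set es. \<exists>m. (N ^^ m) e = 0" using es(2) unfolding W_def by blast
  hence "\<exists>m. \<forall>e\<in>set es. (N ^^ m e) e = 0" by (rule bchoice)
  then obtain m where m: "\<And>e. e \<in> set es \<Longrightarrow> (N ^^ m e) e = 0" by blast
  define K where "K = (\<Sum>e\<in>set es. m e)"
  have Ke: "(N ^^ K) e = 0" if "e \<in> set es" for e
  proof (rule funpow_le_zero[OF N sV m[OF that]])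
    show "m e \<le> K" unfolding K_def using member_le_sum[of e "set es" m] that by simp
  qed
  have "(N ^^ K) x = 0" if xW: "x \<in> W" for x
  proof -
    obtain c where x: "x = lc es c" by (rule span_listE[OF xW es(3)])
    have "(N ^^ K) (lc es c) = lc (map (N ^^ K) es) c"
      by (rule lin_lc[OF lin_funpow[OF N] sV]) (use es WV in blast)
    also have "\<dots> = 0" unfolding lc_def using Ke by (intro sum.neutral) auto
    finally show ?thesis using x by simp
  qed
  hence "\<forall>x\<in>V. \<forall>m. (N ^^ m) x = 0 \<longrightarrow> (N ^^ K) x = 0" unfolding W_def by blast
  thus ?thesis by blast
qed

text \<open>Among the nonzero polynomials p with p(\<tau>) v = 0 take one of least degree. It has a
  root \<kappa>, and the cofactor of the linear factor, applied to \<open>v\<close>, is nonzero by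
  minimality and is an eigenvector.\<close>

lemma eigen_exists:
  assumes V: "fds V" and \<tau>: "lin V \<tau>" and v: "v \<in> V" "v \<noteq> 0"
  shows "\<exists>\<kappa>. \<exists>x\<in>V. x \<noteq> 0 \<and> \<tau> x = \<kappa> *s x"
proof -
  note sV = fds_subspace[OF V]
  obtain T where T: "finite T" "V \<subseteq> span T" using V unfolding fds_def by blast
  define pw where "pw = (\<lambda>i. (\<tau> ^^ i) v)"
  have pV: "pw i \<in> V" for i unfolding pw_def using linD(1)[OF lin_funpow[OF \<tau>] v(1)] .
  \<comment> \<open>p(\<tau>) v with the sum cut off at \<open>n\<close>; every cut-off above the
    degree gives the same vector, which allows polynomials of different degrees to be
    compared.\<close>
  define pv where "pv = (\<lambda>(p :: complex poly) n. \<Sum>i<n. coeff p i *s pw i)"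
  have pvV: "pv p n \<in> V" for p n unfolding pv_def using pV by (intro subspace_sum[OF sV] subspace_scale[OF sV])
  have pvn: "pv p n = pv p (Suc (degree p))" if "n > degree p" for p n
    unfolding pv_def using that by (intro sum.mono_neutral_right) (auto simp: coeff_eq_0)
  have "\<exists>p n. p \<noteq> 0 \<and> n > degree p \<and> pv p n = 0"
  proof -
    have "\<not> indl (map pw [0..<Suc (card T)])"
    proof
      assume "indl (map pw [0..<Suc (card T)])"
      from indl_length[OF this _ T(1)] pV T(2) show False by auto
    qed
    then obtain c i where c: "lc (map pw [0..<Suc (card T)]) c = 0" "i < Suc (card T)" "c i \<noteq> 0"
      unfolding indl_def by auto
    define p where "p = Poly (map c [0..<Suc (card T)])"
    have cp: "coeff p j = (if j < Suc (card T) then c j else 0)" for j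
      unfolding p_def by (simp add: nth_default_def del: upt_Suc)
    have "coeff p i \<noteq> 0" using cp c by simp
    moreover have "degree p < Suc (card T)" using cp by (intro le_imp_less_Suc degree_le) auto
    moreover have "pv p (Suc (card T)) = lc (map pw [0..<Suc (card T)]) c"
      unfolding pv_def lc_def by (rule sum.cong) (auto simp: cp simp del: upt_Suc)
    ultimately show ?thesis using c(1) by (metis coeff_0)
  qed
  hence "\<exists>p. p \<noteq> 0 \<and> pv p (Suc (degree p)) = 0" using pvn by metis
  then obtain p where p: "p \<noteq> 0" "pv p (Suc (degree p)) = 0"
    and pmin: "\<And>q. q \<noteq> 0 \<Longrightarrow> pv q (Suc (degree q)) = 0 \<Longrightarrow> degree p \<le> degree q"
    using exists_least_iff[of "\<lambda>d. \<exists>p. p \<noteq> 0 \<and> pv p (Suc (degree p)) = 0 \<and> degree p = d"]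
    by (metis not_le_imp_less)
  have "degree p \<noteq> 0"
  proof
    assume d: "degree p = 0"
    hence "coeff p 0 \<noteq> 0" using p(1) by (metis leading_coeff_0_iff)
    thus False using p(2) v(2) d by (simp add: pv_def pw_def)
  qed
  hence "\<exists>z. poly p z = 0" by (simp add: fundamental_theorem_of_algebra constant_degree)
  then obtain \<kappa> q where q: "p = [:- \<kappa>, 1:] * q" by (metis dvdE poly_eq_0_iff_dvd)
  have q0: "q \<noteq> 0" using p(1) q by auto
  have dq: "degree p = Suc (degree q)" unfolding q using q0 by (subst degree_mult_eq) auto
  define x where "x = pv q (Suc (degree q))"
  have xV: "x \<in> V" unfolding x_def by (rule pvV)
  have "x \<noteq> 0" using pmin[OF q0] dq unfolding x_def by auto
  moreover have "\<tau> x - \<kappa> *s x = pv p (Suc (degree p))"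
  proof -
    have x2: "x = pv q (Suc (Suc (degree q)))" unfolding x_def using pvn[of q "Suc (Suc (degree q))"] by simp
    have "\<tau> x = (\<Sum>i<Suc (degree q). coeff q i *s pw (Suc i))"
      unfolding x_def pv_def using lin_sum[OF \<tau> sV, of "{..<Suc (degree q)}" pw] pV
      by (simp add: pw_def)
    also have "\<dots> = (\<Sum>i<Suc (Suc (degree q)). (if i = 0 then 0 else coeff q (i - 1)) *s pw i)"
      by (subst (2) sum.lessThan_Suc_shift) simp
    finally have "\<tau> x - \<kappa> *s x = (\<Sum>i<Suc (Suc (degree q)). ((if i = 0 then 0 else coeff q (i - 1)) - \<kappa> * coeff q i) *s pw i)"
      unfolding x2 pv_def by (simp only: scale_sum_right sum_subtractf[symmetric] scale_left_diff_distrib scale_scale)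
    also have "\<dots> = pv p (Suc (degree p))"
      unfolding pv_def dq by (rule sum.cong) (auto simp: q coeff_pCons split: nat.splits)
    finally show ?thesis .
  qed
  ultimately show ?thesis using xV p(2) by auto
qed

end

section \<open>Nondegenerate forms and representation of functionals\<close>

locale nondeg = cform sc cj B
  for sc :: "complex \<Rightarrow> 'v::ab_group_add \<Rightarrow> 'v" (infixr "*s" 75)
    and cj :: "'v \<Rightarrow> 'v" and B :: "'v \<Rightarrow> 'v \<Rightarrow> complex" +
  fixes V :: "'v set"
  assumes csV: "csub V"
    and nondeg_left: "\<And>x. x \<in> V \<Longrightarrow> (\<And>y. y \<in> V \<Longrightarrow> B x y = 0) \<Longrightarrow> x = 0"
begin

lemmas fV = csub_fds[OF csV]
lemmas sV = csub_subspace[OF csV]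

lemma linf_B: "linf V (B x)" "linf V (\<lambda>x. B x y)"
  unfolding linf_def by (auto simp: B_simps)

lemma dual_basis:
  assumes "indl es" "set es \<subseteq> V"
  shows "\<exists>s. \<forall>j<length es. s j \<in> V \<and> (\<forall>i<length es. B (es ! i) (s j) = (if i = j then 1 else 0))"
proof (rule dual_family[OF sV linf_B(1)])
  fix c assume h: "\<And>v. v \<in> V \<Longrightarrow> (\<Sum>i<length es. c i * B (es ! i) v) = 0"
  have "B (lc es c) v = 0" if "v \<in> V" for v using h[OF that] by (simp add: lc_def B_suml B_scl)
  hence "lc es c = 0" using nondeg_left lc_in[OF sV assms(2)] by blast
  thus "\<forall>i<length es. c i = 0" using assms(1) unfolding indl_def by blast
qed

lemma riesz_right: assumes "linf V \<phi>" shows "\<exists>z\<in>V. \<forall>x\<in>V. \<phi> x = B x z"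
proof -
  obtain es where es: "indl es" "set es \<subseteq> V" "V = span (set es)" using list_basis[OF fV] by blast
  from dual_basis[OF es(1,2)] obtain s where s: "\<And>j. j < length es \<Longrightarrow> s j \<in> V"
    "\<And>i j. j < length es \<Longrightarrow> i < length es \<Longrightarrow> B (es ! i) (s j) = (if i = j then 1 else 0)" by blast
  define z where "z = (\<Sum>j<length es. \<phi> (es ! j) *s s j)"
  have zV: "z \<in> V" unfolding z_def using s(1) by (intro subspace_sum[OF sV] subspace_scale[OF sV]) auto
  have e: "B (es ! i) z = \<phi> (es ! i)" if "i < length es" for i
    unfolding z_def B_sumr using s(2) that
    by (simp add: B_scr if_distrib[of "(*) _"] sum.delta' cong: sum.cong_simp if_cong)
  have "\<phi> x = B x z" if xV: "x \<in> V" for x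
  proof -
    obtain c where x: "x = lc es c" by (rule span_listE[OF xV es(3)])
    have "\<phi> x = (\<Sum>i<length es. c i * \<phi> (es ! i))" unfolding x lc_def
      by (rule linf_sum[OF assms sV]) (use es in auto)
    also have "\<dots> = B x z" unfolding x lc_def B_suml B_scl using e by simp
    finally show ?thesis .
  qed
  thus ?thesis using zV by blast
qed

text \<open>The locale assumes nondegeneracy on the left only. Right vectors dual to a basis are
  independent and equally many, hence again a basis; in it, a vector of the right kernel has all
  coordinates 0.\<close>

lemma nondeg_right: assumes "y \<in> V" "\<And>x. x \<in> V \<Longrightarrow> B x y = 0" shows "y = 0"
proof -
  obtain es where es: "rbasis V es" using rbasis_exists[OF csV] by blast
  note d = rbasisD[OF es]
  from dual_basis[OF d(1,4)] obtain s where s: "\<And>j. j < length es \<Longrightarrow> s j \<in> V"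
    "\<And>i j. j < length es \<Longrightarrow> i < length es \<Longrightarrow> B (es ! i) (s j) = (if i = j then 1 else 0)" by blast
  let ?ss = "map s [0..<length es]"
  have Bl: "B (es ! i) (lc ?ss c) = c i" if "i < length es" for i c
    unfolding lc_def B_sumr using s(2) that
    by (simp add: B_scr if_distrib[of "(*) _"] sum.delta' cong: sum.cong_simp if_cong)
  have "indl ?ss" unfolding indl_def
  proof (intro allI impI)
    fix c i assume "lc ?ss c = 0" "i < length ?ss"
    thus "c i = 0" using Bl[of i c] by simp
  qed
  moreover have "set ?ss \<subseteq> V" using s(1) by auto
  ultimately have "span (set ?ss) = V" using indl_length_span[OF _ _ es, of ?ss] by simp
  then obtain c where y: "y = lc ?ss c" using span_listE[OF assms(1)] by metis
  have "c i = 0" if "i < length es" for i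
  proof -
    have "es ! i \<in> V" using d(4) that by auto
    thus ?thesis using Bl[OF that, of c] assms(2)[of "es ! i"] y by simp
  qed
  thus ?thesis unfolding y lc_def by (intro sum.neutral) auto
qed

text \<open>Lets each statement about one argument of the form be reused for the other.\<close>

lemma flip_nondeg: "nondeg (*s) cj (\<lambda>x y. B y x) V"
proof unfold_locales
  fix x assume "x \<in> V" "\<And>y. y \<in> V \<Longrightarrow> B y x = 0"
  thus "x = 0" by (rule nondeg_right)
qed (rule cj_add cj_sc cj_cj B_addl B_addr B_scl B_scr B_cj csV)+

lemma riesz_left: assumes "linf V \<phi>" shows "\<exists>z\<in>V. \<forall>x\<in>V. \<phi> x = B z x"
  using nondeg.riesz_right[OF flip_nondeg assms] .

lemma rho_exists:
  "\<exists>\<rho>. lin V \<rho> \<and> (\<forall>x\<in>V. \<forall>y\<in>V. B x y = B y (\<rho> x)) \<and> (\<forall>x\<in>V. \<rho> (cj x) = cj (\<rho> x))"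
proof -
  have "\<forall>x. \<exists>z\<in>V. \<forall>y\<in>V. B x y = B y z" using riesz_right[OF linf_B(1)] by blast
  then obtain \<rho> where \<rho>: "\<And>x. \<rho> x \<in> V" "\<And>x y. y \<in> V \<Longrightarrow> B x y = B y (\<rho> x)" by metis
  have eq: "u = w" if "u \<in> V" "w \<in> V" "\<And>y. y \<in> V \<Longrightarrow> B y u = B y w" for u w
  proof -
    have "u - w \<in> V" using that subspace_diff[OF sV] by blast
    hence "u - w = 0" using that(3) by (intro nondeg_right) (simp_all add: B_diff)
    thus ?thesis by simp
  qed
  have "\<rho> (x + y) = \<rho> x + \<rho> y" for x y
  proof (rule eq)
    show "B z (\<rho> (x + y)) = B z (\<rho> x + \<rho> y)" if "z \<in> V" for z
      using \<rho>(2)[OF that, of "x + y"] \<rho>(2)[OF that, of x] \<rho>(2)[OF that, of y] by (simp add: B_addl B_addr)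
  qed (intro \<rho>(1) subspace_add[OF sV])+
  moreover have "\<rho> (c *s x) = c *s \<rho> x" for c x
  proof (rule eq)
    show "B z (\<rho> (c *s x)) = B z (c *s \<rho> x)" if "z \<in> V" for z
      using \<rho>(2)[OF that, of "c *s x"] \<rho>(2)[OF that, of x] by (simp add: B_scl B_scr)
  qed (intro \<rho>(1) subspace_scale[OF sV])+
  moreover have "\<rho> (cj x) = cj (\<rho> x)" for x
  proof (rule eq)
    fix y assume y: "y \<in> V"
    have "B y (cj (\<rho> x)) = cnj (B (cj y) (\<rho> x))" using B_cj1[of "cj y" "cj (\<rho> x)"] by simp
    also have "\<dots> = cnj (B x (cj y))" using \<rho>(2)[OF csub_cj[OF csV y]] by simp
    also have "\<dots> = B (cj x) y" by (simp add: B_cj1)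
    finally show "B y (\<rho> (cj x)) = B y (cj (\<rho> x))" using \<rho>(2)[OF y] by simp
  qed (auto simp: \<rho>(1) csub_cj[OF csV])
  ultimately show ?thesis using \<rho> unfolding lin_def by blast
qed

lemma tau_exists:
  "\<exists>\<tau>. lin V \<tau> \<and> (\<forall>x\<in>V. \<forall>y\<in>V. B y x = B (\<tau> x) y) \<and> (\<forall>x\<in>V. \<tau> (cj x) = cj (\<tau> x))"
  using nondeg.rho_exists[OF flip_nondeg] .

end

text \<open>From \<open>B (\<tau> x) y = B y x = B x (\<rho> y)\<close>, \<open>\<rho>\<close> is
  the adjoint of \<open>\<tau>\<close>; by nondegeneracy it is also its inverse. This double role
  pairs \<kappa> with 1/\<kappa>. Eigenvalues always refer to \<open>\<tau>\<close>, which acts in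
  the first argument; the relation \<open>B x y = B y (\<rho> x)\<close> is that of the
  inverse.\<close>

locale asym = nondeg sc cj B V
  for sc :: "complex \<Rightarrow> 'v::ab_group_add \<Rightarrow> 'v" (infixr "*s" 75)
    and cj :: "'v \<Rightarrow> 'v" and B :: "'v \<Rightarrow> 'v \<Rightarrow> complex" and V :: "'v set" +
  fixes \<tau> \<rho> :: "'v \<Rightarrow> 'v"
  assumes \<tau>: "lin V \<tau>" "\<And>x y. x \<in> V \<Longrightarrow> y \<in> V \<Longrightarrow> B y x = B (\<tau> x) y" "\<And>x. x \<in> V \<Longrightarrow> \<tau> (cj x) = cj (\<tau> x)"
    and \<rho>: "lin V \<rho>" "\<And>x y. x \<in> V \<Longrightarrow> y \<in> V \<Longrightarrow> B x y = B y (\<rho> x)" "\<And>x. x \<in> V \<Longrightarrow> \<rho> (cj x) = cj (\<rho> x)"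

lemma (in nondeg) asym_exists: "\<exists>\<tau> \<rho>. asym (*s) cj B V \<tau> \<rho>"
proof -
  obtain \<tau> where t: "lin V \<tau>" "\<forall>x\<in>V. \<forall>y\<in>V. B y x = B (\<tau> x) y" "\<forall>x\<in>V. \<tau> (cj x) = cj (\<tau> x)"
    using tau_exists by blast
  obtain \<rho> where r: "lin V \<rho>" "\<forall>x\<in>V. \<forall>y\<in>V. B x y = B y (\<rho> x)" "\<forall>x\<in>V. \<rho> (cj x) = cj (\<rho> x)"
    using rho_exists by blast
  have "asym (*s) cj B V \<tau> \<rho>" by unfold_locales (use t r in blast)+
  thus ?thesis by blast
qed

context asym
begin

lemma tauV: "x \<in> V \<Longrightarrow> \<tau> x \<in> V" using linD(1)[OF \<tau>(1)] .
lemma rhoV: "x \<in> V \<Longrightarrow> \<rho> x \<in> V" using linD(1)[OF \<rho>(1)] .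

lemma eq_left: assumes "u \<in> V" "w \<in> V" "\<And>y. y \<in> V \<Longrightarrow> B u y = B w y" shows "u = w"
proof -
  have "u - w \<in> V" using assms subspace_diff[OF sV] by blast
  hence "u - w = 0" using assms(3) by (intro nondeg_left) (simp_all add: B_diff)
  thus ?thesis by simp
qed

lemma eq_right: assumes "u \<in> V" "w \<in> V" "\<And>y. y \<in> V \<Longrightarrow> B y u = B y w" shows "u = w"
proof -
  have "u - w \<in> V" using assms subspace_diff[OF sV] by blast
  hence "u - w = 0" using assms(3) by (intro nondeg_right) (simp_all add: B_diff)
  thus ?thesis by simp
qed

lemma tau_rho: assumes "x \<in> V" shows "\<tau> (\<rho> x) = x"
proof (rule eq_left)
  show "B (\<tau> (\<rho> x)) y = B x y" if "y \<in> V" for y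
    using \<tau>(2)[OF rhoV[OF assms] that] \<rho>(2)[OF assms that] by simp
qed (simp_all add: tauV rhoV assms)

lemma rho_tau: assumes "x \<in> V" shows "\<rho> (\<tau> x) = x"
proof (rule eq_right)
  show "B y (\<rho> (\<tau> x)) = B y x" if "y \<in> V" for y
    using \<rho>(2)[OF tauV[OF assms] that] \<tau>(2)[OF assms that] by simp
qed (simp_all add: tauV rhoV assms)

lemma B_tau: "x \<in> V \<Longrightarrow> y \<in> V \<Longrightarrow> B (\<tau> x) (\<tau> y) = B x y"
  using \<tau>(2)[of x "\<tau> y"] \<tau>(2)[of y x] tauV by simp

text \<open>\<open>E\<close> belongs to \<open>\<tau>\<close> and \<open>F\<close> to the adjoint
  \<open>\<rho>\<close>. Although \<open>FE\<close> puts \<open>F \<kappa>\<close> inside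
  \<open>E (1 / \<kappa>)\<close>, \<open>F\<close> is kept because powers of \<open>N\<close> move
  across the form as the same powers of \<open>P\<close>.\<close>

definition N :: "complex \<Rightarrow> 'v \<Rightarrow> 'v" where "N \<kappa> x = \<tau> x - \<kappa> *s x"
definition P :: "complex \<Rightarrow> 'v \<Rightarrow> 'v" where "P \<kappa> x = \<rho> x - \<kappa> *s x"
definition E :: "complex \<Rightarrow> 'v set" where "E \<kappa> = {x \<in> V. \<exists>m. (N \<kappa> ^^ m) x = 0}"
definition F :: "complex \<Rightarrow> 'v set" where "F \<kappa> = {x \<in> V. \<exists>m. (P \<kappa> ^^ m) x = 0}"

lemma lin_shift: assumes "lin V f" shows "lin V (\<lambda>x. f x - \<kappa> *s x)"
  using assms unfolding lin_def
  by (auto simp: subspace_diff[OF sV] subspace_scale[OF sV] algebra_simps scale_right_diff_distrib scale_right_distrib)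

lemma linN: "lin V (N \<kappa>)" unfolding N_def by (rule lin_shift[OF \<tau>(1)])
lemma linP: "lin V (P \<kappa>)" unfolding P_def by (rule lin_shift[OF \<rho>(1)])

lemma NV: "x \<in> V \<Longrightarrow> (N \<kappa> ^^ m) x \<in> V" using linD(1)[OF lin_funpow[OF linN]] .
lemma PV: "x \<in> V \<Longrightarrow> (P \<kappa> ^^ m) x \<in> V" using linD(1)[OF lin_funpow[OF linP]] .

lemma subE: "subspace (E \<kappa>)" unfolding E_def by (rule subspace_gker[OF linN sV])
lemma subF: "subspace (F \<kappa>)" unfolding F_def by (rule subspace_gker[OF linP sV])
lemma EV: "E \<kappa> \<subseteq> V" unfolding E_def by blast
lemma FV: "F \<kappa> \<subseteq> V" unfolding F_def by blast
lemma fdsE: "fds (E \<kappa>)" by (rule fds_sub[OF fV subE EV])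
lemma fdsF: "fds (F \<kappa>)" by (rule fds_sub[OF fV subF FV])

lemma NE: assumes "x \<in> E \<kappa>" shows "N \<kappa> x \<in> E \<kappa>"
proof -
  obtain m where m: "(N \<kappa> ^^ m) x = 0" "x \<in> V" using assms unfolding E_def by blast
  have "(N \<kappa> ^^ Suc m) x = 0" by (rule funpow_le_zero[OF linN sV m(1)]) simp
  hence "(N \<kappa> ^^ m) (N \<kappa> x) = 0" by (simp add: funpow_comm)
  thus ?thesis using linD(1)[OF linN m(2)] unfolding E_def by blast
qed

lemma PF: assumes "x \<in> F \<kappa>" shows "P \<kappa> x \<in> F \<kappa>"
proof -
  obtain m where m: "(P \<kappa> ^^ m) x = 0" "x \<in> V" using assms unfolding F_def by blast
  have "(P \<kappa> ^^ Suc m) x = 0" by (rule funpow_le_zero[OF linP sV m(1)]) simp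
  hence "(P \<kappa> ^^ m) (P \<kappa> x) = 0" by (simp add: funpow_comm)
  thus ?thesis using linD(1)[OF linP m(2)] unfolding F_def by blast
qed

lemma linNE: "lin (E \<kappa>) (N \<kappa>)" by (rule lin_subset[OF linN EV NE])
lemma linPF: "lin (F \<kappa>) (P \<kappa>)" by (rule lin_subset[OF linP FV PF])

lemma tau_N: "\<tau> x = N \<kappa> x + \<kappa> *s x" unfolding N_def by simp
lemma rho_P: "\<rho> x = P \<kappa> x + \<kappa> *s x" unfolding P_def by simp

lemma adj: "x \<in> V \<Longrightarrow> y \<in> V \<Longrightarrow> B (N \<kappa> x) y = B x (P \<kappa> y)"
  unfolding N_def P_def using \<tau>(2)[of x y] \<rho>(2)[of y x] by (simp add: B_simps)

lemma adj_pow: "x \<in> V \<Longrightarrow> y \<in> V \<Longrightarrow> B ((N \<kappa> ^^ m) x) y = B x ((P \<kappa> ^^ m) y)"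
proof (induction m arbitrary: y)
  case (Suc m)
  have "B ((N \<kappa> ^^ Suc m) x) y = B ((N \<kappa> ^^ m) x) (P \<kappa> y)" using adj NV Suc by simp
  also have "\<dots> = B x ((P \<kappa> ^^ m) (P \<kappa> y))" using Suc PV[of y 1 \<kappa>] by simp
  finally show ?case by (simp add: funpow_comm)
qed simp

text \<open>Fitting's decomposition for the adjoint writes \<open>V\<close> as
  \<open>F \<kappa>\<close> plus the image of a high power of \<open>P\<close>. That power, moved to
  the other side, kills \<open>x\<close>, so orthogonality to \<open>F \<kappa>\<close> is already
  orthogonality to \<open>V\<close>. In the exponent \<open>K + m\<close>, \<open>K\<close>
  stabilizes the kernels and \<open>m\<close> annihilates \<open>x\<close>.\<close>

lemma pair_EF: assumes x: "x \<in> E \<kappa>" and h: "\<And>y. y \<in> F \<kappa> \<Longrightarrow> B x y = 0" shows "x = 0"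
proof -
  obtain K where K: "\<And>y m. y \<in> V \<Longrightarrow> (P \<kappa> ^^ m) y = 0 \<Longrightarrow> (P \<kappa> ^^ K) y = 0"
    using stable_exponent[OF fV linP] by blast
  obtain m where m: "(N \<kappa> ^^ m) x = 0" and xV: "x \<in> V" using x unfolding E_def by blast
  let ?T = "P \<kappa> ^^ (K + m)"
  have "B x v = 0" if v: "v \<in> V" for v
  proof -
    have "\<exists>w\<in>V. ?T (v - ?T w) = 0"
    proof (rule fitting[OF fV lin_funpow[OF linP] _ v])
      fix z assume z: "z \<in> V" "?T (?T z) = 0"
      have "(P \<kappa> ^^ ((K+m)+(K+m))) z = 0" using z(2) by (simp only: funpow_add o_apply)
      from K[OF z(1) this] show "?T z = 0" by (rule funpow_le_zero[OF linP sV]) simp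
    qed
    then obtain w where w: "w \<in> V" "?T (v - ?T w) = 0" by blast
    have "v - ?T w \<in> F \<kappa>" unfolding F_def using w v PV subspace_diff[OF sV] by blast
    hence "B x (v - ?T w) = 0" by (rule h)
    moreover have "(N \<kappa> ^^ (K + m)) x = 0" by (rule funpow_le_zero[OF linN sV m]) simp
    hence "B x (?T w) = 0" using adj_pow[OF xV w(1), of "K + m" \<kappa>] by simp
    ultimately show ?thesis by (simp add: B_diff)
  qed
  thus ?thesis using nondeg_left xV by blast
qed

lemma pair_FE: assumes y: "y \<in> F \<kappa>" and h: "\<And>x. x \<in> E \<kappa> \<Longrightarrow> B x y = 0" shows "y = 0"
proof -
  obtain K where K: "\<And>y m. y \<in> V \<Longrightarrow> (N \<kappa> ^^ m) y = 0 \<Longrightarrow> (N \<kappa> ^^ K) y = 0"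
    using stable_exponent[OF fV linN] by blast
  obtain m where m: "(P \<kappa> ^^ m) y = 0" and yV: "y \<in> V" using y unfolding F_def by blast
  let ?T = "N \<kappa> ^^ (K + m)"
  have "B v y = 0" if v: "v \<in> V" for v
  proof -
    have "\<exists>w\<in>V. ?T (v - ?T w) = 0"
    proof (rule fitting[OF fV lin_funpow[OF linN] _ v])
      fix z assume z: "z \<in> V" "?T (?T z) = 0"
      have "(N \<kappa> ^^ ((K+m)+(K+m))) z = 0" using z(2) by (simp only: funpow_add o_apply)
      from K[OF z(1) this] show "?T z = 0" by (rule funpow_le_zero[OF linN sV]) simp
    qed
    then obtain w where w: "w \<in> V" "?T (v - ?T w) = 0" by blast
    have "v - ?T w \<in> E \<kappa>" unfolding E_def using w v NV subspace_diff[OF sV] by blast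
    hence "B (v - ?T w) y = 0" by (rule h)
    moreover have "(P \<kappa> ^^ (K + m)) y = 0" by (rule funpow_le_zero[OF linP sV m]) simp
    hence "B (?T w) y = 0" using adj_pow[OF w(1) yV, of "K + m" \<kappa>] by simp
    ultimately show ?thesis by (simp add: B_diff)
  qed
  thus ?thesis using nondeg_right yV by blast
qed

text \<open>\<open>B\<close> is invariant under \<open>\<tau>\<close>. By induction all terms
  containing a nilpotent part vanish, and what is left reads
  \<open>B x y = \<kappa> * \<mu> * B x y\<close>.\<close>

lemma orth_aux:
  assumes "\<kappa> * \<mu> \<noteq> 1" "x \<in> V" "y \<in> V" "(N \<kappa> ^^ a) x = 0" "(N \<mu> ^^ b) y = 0"
  shows "B x y = 0"
  using assms(2-5)
proof (induction "a + b" arbitrary: a b x y rule: less_induct)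
  case less
  show ?case
  proof (cases "a = 0 \<or> b = 0")
    case True thus ?thesis using less.prems by auto
  next
    case False
    then obtain a' b' where ab: "a = Suc a'" "b = Suc b'" by (metis not0_implies_Suc)
    have Nx: "(N \<kappa> ^^ a') (N \<kappa> x) = 0" "N \<kappa> x \<in> V" and Ny: "(N \<mu> ^^ b') (N \<mu> y) = 0" "N \<mu> y \<in> V"
      using less.prems ab linD(1)[OF linN] by (auto simp: funpow_comm)
    have "B (N \<kappa> x) y = 0" by (rule less.hyps[of a' b]) (use ab Nx less.prems in auto)
    moreover have "B x (N \<mu> y) = 0" by (rule less.hyps[of a b']) (use ab Ny less.prems in auto)
    moreover have "B (N \<kappa> x) (N \<mu> y) = 0" by (rule less.hyps[of a' b']) (use ab Nx Ny in auto)
    ultimately have "B (\<tau> x) (\<tau> y) = \<kappa> * \<mu> * B x y"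
      unfolding tau_N[of x \<kappa>] tau_N[of y \<mu>] by (simp add: B_simps)
    hence "B x y = \<kappa> * \<mu> * B x y" using B_tau less.prems by simp
    thus ?thesis using assms(1) by (metis mult_cancel_right mult_1)
  qed
qed

lemma orth: "\<kappa> * \<mu> \<noteq> 1 \<Longrightarrow> x \<in> E \<kappa> \<Longrightarrow> y \<in> E \<mu> \<Longrightarrow> B x y = 0"
  using orth_aux unfolding E_def by blast

text \<open>On \<open>V\<close>, \<open>N (1 / \<kappa>)\<close> equals - 1/\<kappa> times
  \<open>\<tau>\<close> after \<open>P \<kappa>\<close>, and \<open>\<tau>\<close> commutes with
  \<open>P \<kappa>\<close>; so nilpotency of the one gives nilpotency of the other.\<close>

lemma FE: assumes "\<kappa> \<noteq> 0" shows "F \<kappa> \<subseteq> E (1 / \<kappa>)"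
proof
  fix y assume "y \<in> F \<kappa>"
  then obtain m where yV: "y \<in> V" and m: "(P \<kappa> ^^ m) y = 0" unfolding F_def by blast
  have step: "N (1 / \<kappa>) z = (- 1 / \<kappa>) *s \<tau> (P \<kappa> z)" if "z \<in> V" for z
  proof -
    have "\<tau> (P \<kappa> z) = z - \<kappa> *s \<tau> z"
      unfolding P_def using lin_diff[OF \<tau>(1) sV rhoV[OF that] subspace_scale[OF sV that, of \<kappa>]]
        linD(3)[OF \<tau>(1) that] tau_rho[OF that] by simp
    thus ?thesis using assms by (simp add: N_def scale_right_diff_distrib)
  qed
  have comm: "P \<kappa> (\<tau> z) = \<tau> (P \<kappa> z)" if "z \<in> V" for z
    unfolding P_def using lin_diff[OF \<tau>(1) sV rhoV[OF that] subspace_scale[OF sV that, of \<kappa>]]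
        linD(3)[OF \<tau>(1) that] tau_rho[OF that] rho_tau[OF that] by simp
  have "(N (1 / \<kappa>) ^^ m) y = 0" using yV m
  proof (induction m arbitrary: y)
    case (Suc m)
    have PyV: "P \<kappa> y \<in> V" using linD(1)[OF linP Suc.prems(1)] .
    have NyV: "N (1 / \<kappa>) y \<in> V" using linD(1)[OF linN Suc.prems(1)] .
    have "(P \<kappa> ^^ m) (\<tau> z) = \<tau> ((P \<kappa> ^^ m) z)" if "z \<in> V" for z using that
      by (induction m) (auto simp: comm PV)
    hence "(P \<kappa> ^^ m) (\<tau> (P \<kappa> y)) = \<tau> ((P \<kappa> ^^ Suc m) y)" using PyV by (simp add: funpow_comm)
    also have "\<dots> = 0" using Suc.prems(2) lin_zero[OF \<tau>(1) sV] by simp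
    finally have "(P \<kappa> ^^ m) (\<tau> (P \<kappa> y)) = 0" .
    hence "(P \<kappa> ^^ m) (N (1 / \<kappa>) y) = 0"
      unfolding step[OF Suc.prems(1)] by (simp only: linD(3)[OF lin_funpow[OF linP] tauV[OF PyV]] scale_zero_right)
    from Suc.IH[OF NyV this] show ?case by (simp add: funpow_comm)
  qed simp
  thus "y \<in> E (1 / \<kappa>)" unfolding E_def using yV by blast
qed

lemma N_cj: "x \<in> V \<Longrightarrow> N (cnj \<kappa>) (cj x) = cj (N \<kappa> x)"
  unfolding N_def using \<tau>(3) by (simp add: cj_simps)

lemma N_cj_pow: "x \<in> V \<Longrightarrow> (N (cnj \<kappa>) ^^ m) (cj x) = cj ((N \<kappa> ^^ m) x)"
  by (induction m) (auto simp: N_cj NV)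

lemma P_cj: "x \<in> V \<Longrightarrow> P (cnj \<kappa>) (cj x) = cj (P \<kappa> x)"
  unfolding P_def using \<rho>(3) by (simp add: cj_simps)

lemma P_cj_pow: "x \<in> V \<Longrightarrow> (P (cnj \<kappa>) ^^ m) (cj x) = cj ((P \<kappa> ^^ m) x)"
  by (induction m) (auto simp: P_cj PV)

lemma E_cj: "x \<in> E \<kappa> \<Longrightarrow> cj x \<in> E (cnj \<kappa>)"
proof -
  assume "x \<in> E \<kappa>"
  then obtain m where "x \<in> V" "(N \<kappa> ^^ m) x = 0" unfolding E_def by blast
  hence "cj x \<in> V" "(N (cnj \<kappa>) ^^ m) (cj x) = 0" using N_cj_pow csub_cj[OF csV] by auto
  thus ?thesis unfolding E_def by blast
qed

lemma F_cj: "x \<in> F \<kappa> \<Longrightarrow> cj x \<in> F (cnj \<kappa>)"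
proof -
  assume "x \<in> F \<kappa>"
  then obtain m where "x \<in> V" "(P \<kappa> ^^ m) x = 0" unfolding F_def by blast
  hence "cj x \<in> V" "(P (cnj \<kappa>) ^^ m) (cj x) = 0" using P_cj_pow csub_cj[OF csV] by auto
  thus ?thesis unfolding F_def by blast
qed

lemma E_nonzero_lambda: assumes "x \<in> E \<kappa>" "x \<noteq> 0" shows "\<kappa> \<noteq> 0"
proof
  assume l: "\<kappa> = 0"
  obtain m where m: "(N \<kappa> ^^ m) x = 0" "x \<in> V" using assms unfolding E_def by blast
  have "x = 0" using m
  proof (induction m)
    case (Suc m)
    have "\<tau> ((N \<kappa> ^^ m) x) = N \<kappa> ((N \<kappa> ^^ m) x)" using tau_N[of "(N \<kappa> ^^ m) x" \<kappa>] l by simp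
    hence z: "\<tau> ((N \<kappa> ^^ m) x) = 0" using Suc.prems by simp
    have "(N \<kappa> ^^ m) x = \<rho> (\<tau> ((N \<kappa> ^^ m) x))" using rho_tau[OF NV[OF Suc.prems(2)]] by simp
    hence "(N \<kappa> ^^ m) x = 0" using z lin_zero[OF \<rho>(1) sV] by simp
    thus ?case using Suc by blast
  qed simp
  thus False using assms by blast
qed

end

section \<open>Summands of type (iii) and (iv)\<close>

context cform
begin

section \<open>Real Gram matrices and orthogonal splitting\<close>

definition rgram :: "'v list \<Rightarrow> real mat \<Rightarrow> bool" where
  "rgram es M \<longleftrightarrow> dim_row M = length es \<and> dim_col M = length es \<and>
     (\<forall>i<length es. \<forall>j<length es. B (es ! i) (es ! j) = of_real (M $$ (i, j)))"

lemma rgram_append: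
  assumes "rgram us M" "rgram ws D"
    and "\<And>u w. u \<in> set us \<Longrightarrow> w \<in> set ws \<Longrightarrow> B u w = 0 \<and> B w u = 0"
  shows "rgram (us @ ws) (four_block_mat M (0\<^sub>m (dim_row M) (dim_col D)) (0\<^sub>m (dim_row D) (dim_col M)) D)"
  using assms unfolding rgram_def by (auto simp: nth_append)

lemma rgram_antiblock:
  assumes M: "M \<in> carrier_mat k k" and l: "length xs = k" "length ys = k"
    and "\<And>i j. i < k \<Longrightarrow> j < k \<Longrightarrow> B (xs ! i) (xs ! j) = 0"
    and "\<And>i j. i < k \<Longrightarrow> j < k \<Longrightarrow> B (ys ! i) (ys ! j) = 0"
    and "\<And>i j. i < k \<Longrightarrow> j < k \<Longrightarrow> B (xs ! i) (ys ! j) = (if i = j then 1 else 0)"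
    and "\<And>i j. i < k \<Longrightarrow> j < k \<Longrightarrow> B (ys ! i) (xs ! j) = of_real (M $$ (i, j))"
  shows "rgram (xs @ ys) (antiblock k M)"
  unfolding rgram_def
proof (intro conjI allI impI)
  have c: "antiblock k M \<in> carrier_mat (k + k) (k + k)" by (rule antiblock_carrier[OF M])
  show "dim_row (antiblock k M) = length (xs @ ys)" "dim_col (antiblock k M) = length (xs @ ys)"
    using c l by auto
  fix i j assume ij: "i < length (xs @ ys)" "j < length (xs @ ys)"
  show "B ((xs @ ys) ! i) ((xs @ ys) ! j) = of_real (antiblock k M $$ (i, j))"
    using assms ij unfolding antiblock_def by (auto simp: nth_append)
qed

lemma span_real_csub: assumes "\<And>e. e \<in> set es \<Longrightarrow> cj e = e" shows "csub (span (set es))"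
proof -
  have c: "cj (lc es c) = lc es (\<lambda>i. cnj (c i))" for c
    unfolding lc_def cj_sum by (rule sum.cong) (simp_all add: cj_sc assms)
  have "cj x \<in> span (set es)" if xs: "x \<in> span (set es)" for x
  proof -
    obtain d where d: "x = lc es d" by (rule span_listE[OF xs refl])
    show ?thesis unfolding d c by (rule lc_span)
  qed
  moreover have "finite (set es) \<and> span (set es) \<subseteq> span (set es)" by simp
  ultimately show ?thesis unfolding csub_def fds_def using subspace_span by blast
qed

lemma lc_nth: "j < length es \<Longrightarrow> lc es (\<lambda>i. if i = j then 1 else 0) = es ! j"
  unfolding lc_def by (simp add: if_distrib[of "\<lambda>c. c *s _"] sum.delta cong: if_cong)

lemma rgram_lc: assumes "rgram us M" "j < length us"
  shows "B (lc us c) (us ! j) = apT M c j"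
  using assms unfolding rgram_def lc_def B_suml apT_def
  by (simp add: B_scl mult.commute cong: sum.cong_simp)

lemma rgram_nonsing_indl: assumes "rgram us M" "nonsing M"
    "\<And>j. j < length us \<Longrightarrow> B (lc us c) (us ! j) = 0"
  shows "\<forall>i<length us. c i = 0"
proof -
  have "\<forall>j<dim_col M. apT M c j = 0" using assms(3) rgram_lc[OF assms(1)] assms(1) unfolding rgram_def by simp
  hence "\<forall>i<dim_row M. c i = 0" using assms(2) unfolding nonsing_def by blast
  thus ?thesis using assms(1) unfolding rgram_def by simp
qed

lemma B_span_zero: assumes "\<And>u. u \<in> set us \<Longrightarrow> B u w = 0" "x \<in> span (set us)" shows "B x w = 0"
proof -
  obtain c where x: "x = lc us c" by (rule span_listE[OF assms(2) refl])
  show ?thesis unfolding x lc_def B_suml using assms(1) by (intro sum.neutral) (auto simp: B_scl)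
qed

end

context asym
begin

text \<open>Stability under \<open>\<tau>\<close> makes the two orthogonal complements coincide,
  since \<open>B w u = B (\<tau> u) w\<close>. The nonsingular Gram matrix provides a projection
  onto the span, so the complement is a true complement and inherits nondegeneracy.\<close>

lemma split_off:
  assumes us: "set us \<subseteq> V" "\<And>u. u \<in> set us \<Longrightarrow> cj u = u" and g: "rgram us M" and ns: "nonsing M"
    and st: "\<And>u. u \<in> set us \<Longrightarrow> \<tau> u \<in> span (set us)"
  shows "\<exists>W. nondeg (*s) cj B W \<and> (\<forall>u\<in>set us. \<forall>w\<in>W. B u w = 0 \<and> B w u = 0) \<and>
     (\<forall>ws. rbasis W ws \<longrightarrow> rbasis V (us @ ws))"
proof -
  define W where "W = {w \<in> V. \<forall>u\<in>set us. B u w = 0}"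
  have WV: "W \<subseteq> V" unfolding W_def by blast
  have sW: "subspace W" unfolding W_def
    by (rule subspaceI) (auto simp: B_simps subspace_0[OF sV] subspace_add[OF sV] subspace_scale[OF sV])
  have csW: "csub W"
  proof (rule csub_sub[OF csV sW WV])
    fix x assume x: "x \<in> W"
    have "B u (cj x) = 0" if "u \<in> set us" for u
      using B_cj[of u x] us(2)[OF that] x that unfolding W_def by simp
    thus "cj x \<in> W" using x csub_cj[OF csV] unfolding W_def by blast
  qed
  have spV: "span (set us) \<subseteq> V" by (rule span_minimal[OF us(1) sV])
  have W0: "B x w = 0" if "x \<in> span (set us)" "w \<in> W" for x w
    by (rule B_span_zero[OF _ that(1)]) (use that(2) in \<open>auto simp: W_def\<close>)
  have orthW: "B u w = 0 \<and> B w u = 0" if "u \<in> set us" "w \<in> W" for u w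
  proof -
    have "B w u = B (\<tau> u) w" by (rule \<tau>(2)) (use that us WV in auto)
    thus ?thesis using W0[OF st[OF that(1)] that(2)] W0[OF span_base[OF that(1)] that(2)] by simp
  qed
  have ind: "indl us" unfolding indl_def
  proof (rule allI, rule impI)
    fix c assume "lc us c = 0"
    thus "\<forall>i<length us. c i = 0" by (intro rgram_nonsing_indl[OF g ns]) simp
  qed
  have int0: "x = 0" if x: "x \<in> span (set us)" "x \<in> W" for x
  proof -
    obtain c where c: "x = lc us c" by (rule span_listE[OF x(1) refl])
    have "\<forall>i<length us. c i = 0"
      by (rule rgram_nonsing_indl[OF g ns]) (use orthW[OF _ x(2)] c in auto)
    thus ?thesis unfolding c lc_def by simp
  qed
  have "\<exists>s. \<forall>j<length us. s j \<in> span (set us) \<and> (\<forall>i<length us. B (us ! i) (s j) = (if i = j then 1 else 0))"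
  proof (rule dual_family[OF subspace_span])
    show "linf (span (set us)) (B (us ! i))" for i unfolding linf_def by (auto simp: B_simps)
    fix c assume h: "\<And>v. v \<in> span (set us) \<Longrightarrow> (\<Sum>i<length us. c i * B (us ! i) v) = 0"
    show "\<forall>i<length us. c i = 0"
    proof (rule rgram_nonsing_indl[OF g ns])
      fix j assume "j < length us"
      hence "(\<Sum>i<length us. c i * B (us ! i) (us ! j)) = 0" by (intro h span_base) simp
      thus "B (lc us c) (us ! j) = 0" unfolding lc_def B_suml B_scl .
    qed
  qed
  then obtain s where s: "\<And>j. j < length us \<Longrightarrow> s j \<in> span (set us)"
    "\<And>i j. j < length us \<Longrightarrow> i < length us \<Longrightarrow> B (us ! i) (s j) = (if i = j then 1 else 0)" by blast
  \<comment> \<open>Projection onto the span along \<open>W\<close>, written with the vectors dual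
    to \<open>us\<close>.\<close>
  define p where "p = (\<lambda>v. \<Sum>i<length us. B (us ! i) v *s s i)"
  have p1: "p v \<in> span (set us)" for v unfolding p_def using s(1) by (intro span_sum span_scale) auto
  have p2: "v - p v \<in> W" if v: "v \<in> V" for v
  proof -
    have "B (us ! j) (v - p v) = 0" if "j < length us" for j
      unfolding p_def B_diff B_sumr B_scr using s(2) that
      by (simp add: if_distrib[of "(*) _"] sum.delta' cong: sum.cong_simp if_cong)
    hence "B u (v - p v) = 0" if "u \<in> set us" for u using that by (metis in_set_conv_nth)
    moreover have "v - p v \<in> V" using v p1 spV subspace_diff[OF sV] by blast
    ultimately show ?thesis unfolding W_def by blast
  qed
  have nd: "nondeg (*s) cj B W"
  proof unfold_locales
    fix x assume x: "x \<in> W" "\<And>y. y \<in> W \<Longrightarrow> B x y = 0"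
    have "B x v = 0" if v: "v \<in> V" for v
    proof -
      obtain c where c: "p v = lc us c" by (rule span_listE[OF p1 refl])
      have "B x (p v) = 0" unfolding c lc_def B_sumr B_scr using orthW[OF _ x(1)] by simp
      moreover have "B x (v - p v) = 0" by (rule x(2)[OF p2[OF v]])
      ultimately show ?thesis by (simp add: B_diff)
    qed
    thus "x = 0" using nondeg_left x(1) WV by blast
  qed (rule csW)
  have "rbasis V (us @ ws)" if ws: "rbasis W ws" for ws
    unfolding rbasis_def
  proof (intro conjI)
    note d = rbasisD[OF ws]
    show "\<forall>e\<in>set (us @ ws). cj e = e" using us(2) d(3) by auto
    show "indl (us @ ws)" by (rule indl_appendI[OF ind d(1)]) (use int0 d(2) in auto)
    show "span (set (us @ ws)) = V"
    proof
      show "span (set (us @ ws)) \<subseteq> V" by (rule span_minimal[OF _ sV]) (use us d(4) WV in auto)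
      show "V \<subseteq> span (set (us @ ws))"
      proof
        fix v assume v: "v \<in> V"
        have "p v \<in> span (set (us @ ws))" by (rule set_mp[OF span_mono p1]) simp
        moreover have "v - p v \<in> span (set (us @ ws))"
          by (rule set_mp[OF span_mono[of "set ws"]]) (use p2[OF v] d(2) in auto)
        ultimately have "p v + (v - p v) \<in> span (set (us @ ws))" by (rule span_add)
        thus "v \<in> span (set (us @ ws))" by simp
      qed
    qed
  qed
  thus ?thesis using nd orthW by (intro exI[of _ W]) blast
qed

subsection \<open>Hyperbolic summands\<close>

lemma nil_index:
  assumes "lin S f" "subspace S" "\<forall>x\<in>S. (f ^^ K) x = 0" "x0 \<in> S" "x0 \<noteq> 0"
  shows "\<exists>n. (\<forall>x\<in>S. (f ^^ Suc n) x = 0) \<and> (\<exists>x\<in>S. (f ^^ n) x \<noteq> 0)"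
proof -
  define k where "k = (LEAST k. \<forall>x\<in>S. (f ^^ k) x = 0)"
  have k: "\<forall>x\<in>S. (f ^^ k) x = 0" unfolding k_def by (rule LeastI[of _ K]) (rule assms(3))
  have "k \<noteq> 0"
  proof
    assume "k = 0"
    hence "x0 = 0" using k assms(4) by simp
    thus False using assms(5) by simp
  qed
  then obtain n where n: "k = Suc n" by (metis not0_implies_Suc)
  have "\<not> (\<forall>x\<in>S. (f ^^ n) x = 0)" using not_less_Least[of n "\<lambda>k. \<forall>x\<in>S. (f ^^ k) x = 0"] n k_def by auto
  thus ?thesis using k n by blast
qed

lemma E_K: "\<exists>K. \<forall>x\<in>E \<kappa>. (N \<kappa> ^^ K) x = 0"
proof -
  obtain K where "\<forall>x\<in>V. \<forall>m. (N \<kappa> ^^ m) x = 0 \<longrightarrow> (N \<kappa> ^^ K) x = 0" using stable_exponent[OF fV linN] by blast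
  hence "\<forall>x\<in>E \<kappa>. (N \<kappa> ^^ K) x = 0" unfolding E_def by auto
  thus ?thesis by blast
qed

lemma NEp: "x \<in> E \<kappa> \<Longrightarrow> (N \<kappa> ^^ m) x \<in> E \<kappa>" using linD(1)[OF lin_funpow[OF linNE]] .
lemma PFp: "x \<in> F \<kappa> \<Longrightarrow> (P \<kappa> ^^ m) x \<in> F \<kappa>" using linD(1)[OF lin_funpow[OF linPF]] .

lemma csub_E: assumes "cnj \<kappa> = \<kappa>" shows "csub (E \<kappa>)"
proof (rule csub_sub[OF csV subE EV])
  fix x assume "x \<in> E \<kappa>" thus "cj x \<in> E \<kappa>" using E_cj[of x \<kappa>] assms by simp
qed

lemma csub_F: assumes "cnj \<kappa> = \<kappa>" shows "csub (F \<kappa>)"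
proof (rule csub_sub[OF csV subF FV])
  fix x assume "x \<in> F \<kappa>" thus "cj x \<in> F \<kappa>" using F_cj[of x \<kappa>] assms by simp
qed

lemma real_witness_lin:
  assumes "csub S" "linf S \<phi>" "x \<in> S" "\<phi> x \<noteq> 0"
  shows "\<exists>y\<in>S. cj y = y \<and> \<phi> y \<noteq> 0"
proof -
  have rS: "re x \<in> S" "im x \<in> S" using csub_re[OF assms(1,3)] csub_im[OF assms(1,3)] .
  have iS: "\<i> *s im x \<in> S" by (rule subspace_scale[OF csub_subspace[OF assms(1)] rS(2)])
  have "\<phi> x = \<phi> (re x + \<i> *s im x)" by (simp flip: re_im)
  also have "\<dots> = \<phi> (re x) + \<i> * \<phi> (im x)"
    using linfD(1)[OF assms(2) rS(1) iS] linfD(2)[OF assms(2) rS(2) rS(2)] by simp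
  finally have "\<phi> (re x) \<noteq> 0 \<or> \<phi> (im x) \<noteq> 0" using assms(4) by auto
  thus ?thesis using rS cj_re cj_im by blast
qed

text \<open>Choose \<open>n\<close> maximal such that \<open>N \<kappa> ^^ n\<close> is nonzero on
  \<open>E \<kappa>\<close> and let \<open>pair_EF\<close> supply a partner for a nonzero top
  vector. By duality the same \<open>n\<close> bounds the exponent of \<open>P\<close>. The partner
  is then corrected until the two chains are dual; for real \<kappa> all choices can be made
  real.\<close>

lemma hyper_chain:
  assumes x0: "x0 \<in> E \<kappa>" "x0 \<noteq> 0"
  shows "\<exists>n x y. x \<in> E \<kappa> \<and> y \<in> F \<kappa> \<and> (N \<kappa> ^^ Suc n) x = 0 \<and> (P \<kappa> ^^ Suc n) y = 0 \<and>
     (\<forall>m. B ((N \<kappa> ^^ m) x) y = (if m = n then 1 else 0)) \<and> (cnj \<kappa> = \<kappa> \<longrightarrow> cj x = x \<and> cj y = y)"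
proof -
  obtain K where "\<forall>x\<in>E \<kappa>. (N \<kappa> ^^ K) x = 0" using E_K by blast
  from nil_index[OF linNE subE this x0] obtain n where
    n0: "\<forall>x\<in>E \<kappa>. (N \<kappa> ^^ Suc n) x = 0" and ex: "\<exists>x\<in>E \<kappa>. (N \<kappa> ^^ n) x \<noteq> 0" by (elim exE conjE)
  note n = bspec[OF n0]
  from ex obtain x1 where x1: "x1 \<in> E \<kappa>" "(N \<kappa> ^^ n) x1 \<noteq> 0" by (elim bexE)
  obtain y1 where y1: "y1 \<in> F \<kappa>" "B ((N \<kappa> ^^ n) x1) y1 \<noteq> 0"
  proof -
    have "\<exists>y\<in>F \<kappa>. B ((N \<kappa> ^^ n) x1) y \<noteq> 0"
    proof (rule ccontr)
      assume "\<not> ?thesis"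
      hence "B ((N \<kappa> ^^ n) x1) y = 0" if "y \<in> F \<kappa>" for y using that by blast
      hence "(N \<kappa> ^^ n) x1 = 0" by (rule pair_EF[OF NEp[OF x1(1)]])
      thus False using x1(2) by simp
    qed
    thus ?thesis using that by blast
  qed
  have Nz: "(N \<kappa> ^^ m) x = 0" if "x \<in> E \<kappa>" "m > n" for x m
    by (rule funpow_le_zero[OF linN sV n[OF that(1)]]) (use that in auto)
  have Pz: "(P \<kappa> ^^ Suc n) y = 0" if "y \<in> F \<kappa>" for y
  proof (rule pair_FE[OF PFp[OF that]])
    fix x assume x: "x \<in> E \<kappa>"
    have "B ((N \<kappa> ^^ Suc n) x) y = B x ((P \<kappa> ^^ Suc n) y)"
      by (rule adj_pow[OF set_mp[OF EV x] set_mp[OF FV that]])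
    thus "B x ((P \<kappa> ^^ Suc n) y) = 0" unfolding n[OF x] B_zero by (rule sym)
  qed
  have "\<exists>x y. x \<in> E \<kappa> \<and> y \<in> F \<kappa> \<and> B ((N \<kappa> ^^ n) x) y \<noteq> 0 \<and> (cnj \<kappa> = \<kappa> \<longrightarrow> cj x = x \<and> cj y = y)"
  proof (cases "cnj \<kappa> = \<kappa>")
    case True
    have l1: "linf (E \<kappa>) (\<lambda>x. B ((N \<kappa> ^^ n) x) y1)"
      unfolding linf_def using linD(2,3)[OF lin_funpow[OF linNE]] by (auto simp: B_simps)
    obtain x where x: "x \<in> E \<kappa>" "cj x = x" "B ((N \<kappa> ^^ n) x) y1 \<noteq> 0"
      using real_witness_lin[OF csub_E[OF True] l1 x1(1) y1(2)] by blast
    have l2: "linf (F \<kappa>) (B ((N \<kappa> ^^ n) x))" unfolding linf_def by (auto simp: B_simps)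
    obtain y where "y \<in> F \<kappa>" "cj y = y" "B ((N \<kappa> ^^ n) x) y \<noteq> 0"
      using real_witness_lin[OF csub_F[OF True] l2 y1(1) x(3)] by blast
    thus ?thesis using x by blast
  next
    case False thus ?thesis using x1 y1 by blast
  qed
  then obtain x y2 where x: "x \<in> E \<kappa>" "cnj \<kappa> = \<kappa> \<Longrightarrow> cj x = x"
    and y2: "y2 \<in> F \<kappa>" "B ((N \<kappa> ^^ n) x) y2 \<noteq> 0" "cnj \<kappa> = \<kappa> \<Longrightarrow> cj y2 = y2" by blast
  have xV: "x \<in> V" using x EV by blast
  have Breal: "cnj (B ((N \<kappa> ^^ m) x) y) = B ((N \<kappa> ^^ m) x) y" if "cnj \<kappa> = \<kappa>" "cj y = y" for m y
    using B_cj[of "(N \<kappa> ^^ m) x" y] N_cj_pow[OF xV, of m \<kappa>] x(2) that by simp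
  \<comment> \<open>Works downwards from \<open>n\<close>: after \<open>d\<close> rounds the values
    at the \<open>d\<close> exponents just below \<open>n\<close> are 0.\<close>
  have step: "\<exists>y. y \<in> F \<kappa> \<and> B ((N \<kappa> ^^ n) x) y = 1 \<and> (\<forall>m. n - d \<le> m \<and> m < n \<longrightarrow> B ((N \<kappa> ^^ m) x) y = 0) \<and>
     (cnj \<kappa> = \<kappa> \<longrightarrow> cj y = y)" if "d \<le> n" for d
    using that
  proof (induction d)
    case 0
    define y where "y = (1 / B ((N \<kappa> ^^ n) x) y2) *s y2"
    have "y \<in> F \<kappa>" unfolding y_def by (rule subspace_scale[OF subF y2(1)])
    moreover have "B ((N \<kappa> ^^ n) x) y = 1" unfolding y_def using y2(2) by (simp add: B_scr)
    moreover have "cnj \<kappa> = \<kappa> \<longrightarrow> cj y = y" unfolding y_def using Breal[of y2 n] y2(3) by (simp add: cj_sc)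
    ultimately show ?case by (intro exI[of _ y]) auto
  next
    case (Suc d)
    then obtain y where y: "y \<in> F \<kappa>" "B ((N \<kappa> ^^ n) x) y = 1"
      "\<And>m. n - d \<le> m \<Longrightarrow> m < n \<Longrightarrow> B ((N \<kappa> ^^ m) x) y = 0" "cnj \<kappa> = \<kappa> \<Longrightarrow> cj y = y" by auto
    define m0 where "m0 = n - Suc d"
    have m0: "m0 < n" "n - d = Suc m0" using Suc.prems unfolding m0_def by auto
    define t where "t = B ((N \<kappa> ^^ m0) x) y"
    \<comment> \<open>The added power of \<open>P\<close> raises the exponent \<open>m0\<close> to
      \<open>n\<close>, where the value is 1, so exactly \<open>t\<close> is subtracted; exponents
      above \<open>m0\<close> are raised beyond \<open>n\<close>, where the chain is 0.\<close>
    define y' where "y' = y - t *s (P \<kappa> ^^ (n - m0)) y"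
    have yV: "y \<in> V" using y(1) FV by blast
    have a1: "y' \<in> F \<kappa>" unfolding y'_def
      by (rule subspace_diff[OF subF y(1) subspace_scale[OF subF PFp[OF y(1)]]])
    have g: "B ((N \<kappa> ^^ m) x) y' = B ((N \<kappa> ^^ m) x) y - t * B ((N \<kappa> ^^ (m + (n - m0))) x) y" for m
    proof -
      have "B ((N \<kappa> ^^ m) x) ((P \<kappa> ^^ (n - m0)) y) = B ((N \<kappa> ^^ (n - m0)) ((N \<kappa> ^^ m) x)) y"
        using adj_pow[OF NV[OF xV] yV] by simp
      also have "(N \<kappa> ^^ (n - m0)) ((N \<kappa> ^^ m) x) = (N \<kappa> ^^ (m + (n - m0))) x"
        by (metis add.commute comp_apply funpow_add)
      finally show ?thesis unfolding y'_def by (simp add: B_simps)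
    qed
    have a2: "B ((N \<kappa> ^^ n) x) y' = 1" using g[of n] y(2) Nz[OF x(1), of "n + (n - m0)"] m0 by simp
    have a3: "B ((N \<kappa> ^^ m) x) y' = 0" if m: "n - Suc d \<le> m" "m < n" for m
    proof (cases "m = m0")
      case True
      thus ?thesis using g[of m0] y(2) m0 by (simp add: t_def)
    next
      case False
      hence "m0 < m" using m unfolding m0_def by auto
      hence "n < m + (n - m0)" using m0 by simp
      thus ?thesis using g[of m] y(3)[of m] m \<open>m0 < m\<close> m0 Nz[OF x(1)] by simp
    qed
    have a4: "cj y' = y'" if r: "cnj \<kappa> = \<kappa>"
    proof -
      have "cj ((P \<kappa> ^^ (n - m0)) y) = (P \<kappa> ^^ (n - m0)) y"
        using P_cj_pow[OF yV, of "n - m0" \<kappa>] r y(4)[OF r] by simp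
      moreover have "cnj t = t" unfolding t_def using Breal[OF r y(4)[OF r]] .
      ultimately show ?thesis unfolding y'_def using y(4)[OF r] by (simp add: cj_simps)
    qed
    show ?case by (rule exI[of _ y']) (intro conjI allI impI a1 a2 a3 a4; simp)
  qed
  from step[of n] obtain y where y: "y \<in> F \<kappa>" "B ((N \<kappa> ^^ n) x) y = 1"
    "\<And>m. m < n \<Longrightarrow> B ((N \<kappa> ^^ m) x) y = 0" "cnj \<kappa> = \<kappa> \<Longrightarrow> cj y = y" by auto
  have "B ((N \<kappa> ^^ m) x) y = (if m = n then 1 else 0)" for m
    using y(2,3) Nz[OF x(1), of m] by (cases m n rule: linorder_cases) auto
  hence "\<forall>m. B ((N \<kappa> ^^ m) x) y = (if m = n then 1 else 0)" by blast
  moreover have "cnj \<kappa> = \<kappa> \<longrightarrow> cj x = x \<and> cj y = y" using x(2) y(4) by blast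
  ultimately show ?thesis using x(1) y(1) n[OF x(1)] Pz[OF y(1)] by (intro exI[of _ n] exI[of _ x] exI[of _ y] conjI)
qed

end

section \<open>Real lists made from complex families\<close>

lemma pairs2:
  fixes Q :: "nat \<Rightarrow> nat \<Rightarrow> bool"
  assumes h: "\<And>i j. i < k \<Longrightarrow> j < k \<Longrightarrow> Q (2*i) (2*j) \<and> Q (2*i) (Suc (2*j)) \<and> Q (Suc (2*i)) (2*j) \<and> Q (Suc (2*i)) (Suc (2*j))"
    and "i < 2 * k" "j < 2 * k"
  shows "Q i j"
proof -
  have d: "i div 2 < k" "j div 2 < k" using assms(2,3) by auto
  have "i = 2 * (i div 2) \<or> i = Suc (2 * (i div 2))" "j = 2 * (j div 2) \<or> j = Suc (2 * (j div 2))" by presburger+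
  thus ?thesis using h[OF d] by metis
qed

context cform
begin

text \<open>The factors \<open>p\<close> and \<open>q\<close> are left free so that the
  normalizations 1/2 and -1/2 and the signs coming from \<open>B_reim\<close> can be
  compensated.\<close>

definition rlist :: "complex \<Rightarrow> complex \<Rightarrow> 'v list \<Rightarrow> 'v list" where
  "rlist p q zs = map (\<lambda>i. if even i then p *s re (zs ! (i div 2)) else q *s im (zs ! (i div 2))) [0..<2 * length zs]"

lemma rlist_length [simp]: "length (rlist p q zs) = 2 * length zs" unfolding rlist_def by simp

lemma rlist_nth: assumes "i < length zs"
  shows "rlist p q zs ! (2 * i) = p *s re (zs ! i)" "rlist p q zs ! (Suc (2 * i)) = q *s im (zs ! i)"
  using assms unfolding rlist_def by auto

lemma rlist_mem: assumes "u \<in> set (rlist p q zs)"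
  obtains z where "z \<in> set zs" "u = p *s re z" | z where "z \<in> set zs" "u = q *s im z"
proof -
  obtain i where i: "i < 2 * length zs" "u = rlist p q zs ! i" using assms by (auto simp: in_set_conv_nth)
  have d: "i div 2 < length zs" using i by auto
  show ?thesis using i d that(1)[of "zs ! (i div 2)"] that(2)[of "zs ! (i div 2)"]
    unfolding rlist_def by (auto split: if_splits)
qed

lemma rlist_sub: assumes "csub V" "set zs \<subseteq> V" shows "set (rlist p q zs) \<subseteq> V"
proof
  fix u assume "u \<in> set (rlist p q zs)"
  thus "u \<in> V"
  proof (cases rule: rlist_mem)
    case (1 z) thus ?thesis using subspace_scale[OF csub_subspace[OF assms(1)] csub_re[OF assms(1)]] assms(2) by auto
  next
    case (2 z) thus ?thesis using subspace_scale[OF csub_subspace[OF assms(1)] csub_im[OF assms(1)]] assms(2) by auto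
  qed
qed

lemma rlist_real: assumes "cnj p = p" "cnj q = q" "u \<in> set (rlist p q zs)" shows "cj u = u"
  using assms(3) by (cases rule: rlist_mem) (auto simp: cj_sc assms(1,2))

lemma rlist_span: assumes "p \<noteq> 0" "q \<noteq> 0" "z \<in> set zs" shows "z \<in> span (set (rlist p q zs))"
proof -
  obtain i where i: "i < length zs" "z = zs ! i" using assms(3) by (auto simp: in_set_conv_nth)
  have "rlist p q zs ! (2 * i) \<in> set (rlist p q zs)" "rlist p q zs ! Suc (2 * i) \<in> set (rlist p q zs)"
    using i by (auto intro!: nth_mem)
  hence m: "p *s re z \<in> span (set (rlist p q zs))" "q *s im z \<in> span (set (rlist p q zs))"
    using rlist_nth[OF i(1)] i(2) span_base by metis+
  have "(1/p) *s (p *s re z) + (\<i>/q) *s (q *s im z) \<in> span (set (rlist p q zs))"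
    by (intro span_add span_scale m)
  moreover have "(1/p) *s (p *s re z) + (\<i>/q) *s (q *s im z) = z"
    using assms by (simp flip: re_im)
  ultimately show ?thesis by simp
qed

text \<open>All four products are governed by \<open>B z w\<close> and \<open>B z (cj w)\<close>.
  For dual chains with non-real \<kappa> off the unit circle the second vanishes, for an isotropic
  chain with unimodular \<kappa> the first.\<close>

lemma B_reim:
  shows "B (re z) (re w) = of_real ((Re (B z w) + Re (B z (cj w))) / 2)"
   "B (re z) (im w) = of_real ((Im (B z w) - Im (B z (cj w))) / 2)"
   "B (im z) (re w) = of_real ((Im (B z w) + Im (B z (cj w))) / 2)"
   "B (im z) (im w) = of_real ((Re (B z (cj w)) - Re (B z w)) / 2)"
  unfolding re_def im_def B_simps B_cj B_cj1[of z w]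
  by (simp_all add: complex_eq_iff field_simps)

end

context asym
begin

text \<open>Exactly the input of \<open>split_off\<close>, together with nonemptiness, which makes
  the dimension drop.\<close>

definition summand :: "'v list \<Rightarrow> real mat \<Rightarrow> bool" where
  "summand us M \<longleftrightarrow> us \<noteq> [] \<and> set us \<subseteq> V \<and> (\<forall>u\<in>set us. cj u = u \<and> \<tau> u \<in> span (set us)) \<and> rgram us M \<and> nonsing M"

text \<open>\<open>\<tau>\<close> inverts \<open>\<rho>\<close>, which is \<kappa> plus the
  nilpotent \<open>P \<kappa>\<close>; solving the equation inside \<open>S\<close> keeps the image
  of \<open>\<tau>\<close> in \<open>S\<close>.\<close>

lemma tau_stable_P:
  assumes "subspace S" "S \<subseteq> V" "\<And>s. s \<in> S \<Longrightarrow> P \<kappa> s \<in> S" "\<kappa> \<noteq> 0" "s \<in> S" "(P \<kappa> ^^ m) s = 0"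
  shows "\<tau> s \<in> S"
proof -
  obtain z where z: "z \<in> S" "\<kappa> *s z + P \<kappa> z = s"
    using nilp_surj[OF lin_subset[OF linP assms(2,3)] assms(1,4,5,6)] by blast
  have "\<rho> z = s" using z(2) rho_P[of z \<kappa>] by (simp add: add.commute)
  moreover have "z \<in> V" using z assms(2) by (rule_tac set_mp)
  ultimately have "\<tau> s = z" using tau_rho[of z] by simp
  thus ?thesis using z by simp
qed

lemma lin_span_stable:
  assumes "lin V f" "set es \<subseteq> V" "\<And>e. e \<in> set es \<Longrightarrow> f e \<in> S" "subspace S" "s \<in> span (set es)"
  shows "f s \<in> S"
proof -
  obtain c where c: "s = lc es c" by (rule span_listE[OF assms(5) refl])
  have "set (map f es) \<subseteq> S" using assms(3) by auto
  thus ?thesis unfolding c lin_lc[OF assms(1) sV assms(2)] by (rule lc_in[OF assms(4)])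
qed

context
  fixes \<kappa> n x y
  assumes xE: "x \<in> E \<kappa>" and yF: "y \<in> F \<kappa>" and x0: "(N \<kappa> ^^ Suc n) x = 0" and y0: "(P \<kappa> ^^ Suc n) y = 0"
    and xy: "\<And>m. B ((N \<kappa> ^^ m) x) y = (if m = n then 1 else 0)" and k0: "\<kappa> \<noteq> 0"
begin

text \<open>Listed from the eigenvector upwards, whereas \<open>ys\<close> starts at its generator.
  With these orders the products of \<open>xs\<close> with \<open>ys\<close> form the identity and
  those of \<open>ys\<close> with \<open>xs\<close> an upper triangular Jordan block.\<close>

definition "xs = map (\<lambda>i. (N \<kappa> ^^ (n - i)) x) [0..<Suc n]"
definition "ys = map (\<lambda>i. (P \<kappa> ^^ i) y) [0..<Suc n]"

lemma len_xy: "length xs = Suc n" "length ys = Suc n" unfolding xs_def ys_def by auto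

lemma xs_nth: "i < Suc n \<Longrightarrow> xs ! i = (N \<kappa> ^^ (n - i)) x" unfolding xs_def by (simp del: upt_Suc)
lemma ys_nth: "i < Suc n \<Longrightarrow> ys ! i = (P \<kappa> ^^ i) y" unfolding ys_def by (simp del: upt_Suc)

lemma xs_E: "set xs \<subseteq> E \<kappa>" unfolding xs_def using NEp[OF xE] by (auto simp del: upt_Suc)
lemma ys_F: "set ys \<subseteq> F \<kappa>" unfolding ys_def using PFp[OF yF] by (auto simp del: upt_Suc)
lemma xs_V: "set xs \<subseteq> V" using xs_E EV by (rule order.trans)
lemma ys_V: "set ys \<subseteq> V" using ys_F FV by (rule order.trans)

lemma Bxy: assumes "i < Suc n" "j < Suc n" shows "B (xs ! i) (ys ! j) = (if i = j then 1 else 0)"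
proof -
  have xV: "x \<in> V" and yV: "y \<in> V" using xE yF EV FV by (auto dest: set_mp)
  have "B (xs ! i) (ys ! j) = B ((N \<kappa> ^^ j) ((N \<kappa> ^^ (n - i)) x)) y"
    unfolding xs_nth[OF assms(1)] ys_nth[OF assms(2)] using adj_pow[OF NV[OF xV] yV] by simp
  also have "(N \<kappa> ^^ j) ((N \<kappa> ^^ (n - i)) x) = (N \<kappa> ^^ (j + (n - i))) x" by (simp add: funpow_add)
  also have "B \<dots> y = (if i = j then 1 else 0)" unfolding xy using assms by auto
  finally show ?thesis .
qed

lemma tau_xs: assumes "i < Suc n" shows "\<tau> (xs ! i) = \<kappa> *s xs ! i + (if 0 < i then xs ! (i - 1) else 0)"
proof (cases i)
  case 0
  have "N \<kappa> (xs ! i) = 0" using x0 xs_nth[of 0] 0 by simp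
  thus ?thesis using tau_N[of "xs ! i" \<kappa>] 0 by simp
next
  case (Suc m)
  have "N \<kappa> (xs ! i) = (N \<kappa> ^^ Suc (n - i)) x" unfolding xs_nth[OF assms] by simp
  also have "Suc (n - i) = n - (i - 1)" using Suc assms by simp
  also have "(N \<kappa> ^^ (n - (i - 1))) x = xs ! (i - 1)" using xs_nth[of "i - 1"] assms by simp
  finally show ?thesis using tau_N[of "xs ! i" \<kappa>] Suc by (simp add: add.commute)
qed

lemma Byx: assumes "i < Suc n" "j < Suc n"
  shows "B (ys ! i) (xs ! j) = (if i = j then \<kappa> else if Suc i = j then 1 else 0)"
proof -
  have m: "xs ! j \<in> V" "ys ! i \<in> V" using xs_V ys_V assms len_xy by (auto intro: set_mp nth_mem)
  have "B (ys ! i) (xs ! j) = B (\<tau> (xs ! j)) (ys ! i)" by (rule \<tau>(2)[OF m])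
  also have "\<dots> = \<kappa> * B (xs ! j) (ys ! i) + (if 0 < j then B (xs ! (j - 1)) (ys ! i) else 0)"
    unfolding tau_xs[OF assms(2)] by (simp add: B_simps)
  finally show ?thesis using Bxy[OF assms(2,1)] Bxy[of "j - 1" i] assms by auto
qed

lemma tau_span_xs: assumes "z \<in> set xs" shows "\<tau> z \<in> span (set xs)"
proof -
  obtain i where i: "i < Suc n" "z = xs ! i" using assms len_xy by (auto simp: in_set_conv_nth)
  have "xs ! i \<in> span (set xs)" "xs ! (i - 1) \<in> span (set xs)" using i len_xy by (auto intro!: span_base nth_mem)
  thus ?thesis unfolding i(2) tau_xs[OF i(1)] by (auto intro!: span_add span_scale span_zero)
qed

lemma tau_span_ys: assumes "z \<in> set ys" shows "\<tau> z \<in> span (set ys)"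
proof -
  have Py: "P \<kappa> e \<in> span (set ys)" if ey: "e \<in> set ys" for e
  proof -
    obtain i where i: "i < Suc n" "e = ys ! i" using ey len_xy by (auto simp: in_set_conv_nth)
    have e: "P \<kappa> e = (P \<kappa> ^^ Suc i) y" unfolding i(2) ys_nth[OF i(1)] by simp
    show ?thesis
    proof (cases "Suc i < Suc n")
      case True
      thus ?thesis unfolding e ys_nth[OF True, symmetric] using len_xy by (intro span_base nth_mem) simp
    next
      case False
      hence "Suc i = Suc n" using i by simp
      hence "P \<kappa> e = 0" unfolding e using y0 by simp
      thus ?thesis by (simp add: span_zero)
    qed
  qed
  show ?thesis
  proof (rule tau_stable_P[OF subspace_span span_minimal[OF ys_V sV] _ k0 span_base[OF assms]])
    show "P \<kappa> s \<in> span (set ys)" if "s \<in> span (set ys)" for s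
      by (rule lin_span_stable[OF linP ys_V Py subspace_span that])
    obtain i where i: "i < Suc n" "z = ys ! i" using assms len_xy by (auto simp: in_set_conv_nth)
    have "(P \<kappa> ^^ Suc n) z = (P \<kappa> ^^ (Suc n + i)) y" unfolding i(2) ys_nth[OF i(1)] by (simp only: funpow_add o_apply)
    also have "\<dots> = 0" by (rule funpow_le_zero[OF linP sV y0]) simp
    finally show "(P \<kappa> ^^ Suc n) z = 0" .
  qed
qed

lemma hyper_real:
  assumes k: "\<kappa> = of_real a" "a * a \<noteq> 1" and r: "cj x = x" "cj y = y"
  shows "summand (xs @ ys) (H_mat (Suc n) a)"
  unfolding summand_def H_mat_anti
proof (intro conjI ballI)
  have ck: "cnj \<kappa> = \<kappa>" using k by simp
  have xV: "x \<in> V" and yV: "y \<in> V" using xE yF EV FV by (auto dest: set_mp)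
  show "xs @ ys \<noteq> []" using len_xy by auto
  show "set (xs @ ys) \<subseteq> V" using xs_V ys_V by simp
  show "cj u = u" if "u \<in> set (xs @ ys)" for u
    using that N_cj_pow[OF xV, of _ \<kappa>] P_cj_pow[OF yV, of _ \<kappa>] r ck unfolding xs_def ys_def by auto
  show "\<tau> u \<in> span (set (xs @ ys))" if "u \<in> set (xs @ ys)" for u
  proof -
    have s: "span (set xs) \<subseteq> span (set (xs @ ys))" "span (set ys) \<subseteq> span (set (xs @ ys))"
      by (rule span_mono, simp)+
    consider "u \<in> set xs" | "u \<in> set ys" using \<open>u \<in> set (xs @ ys)\<close> by auto
    thus ?thesis by cases (rule set_mp[OF s(1) tau_span_xs] set_mp[OF s(2) tau_span_ys], assumption)+
  qed
  \<comment> \<open>With \<kappa> squared different from 1, \<open>orth\<close> makes both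
    \<open>E \<kappa>\<close> and \<open>E (1 / \<kappa>)\<close>, hence both chains,
    isotropic.\<close>
  have kk: "\<kappa> * \<kappa> \<noteq> 1" unfolding k by (metis k(2) of_real_1 of_real_eq_iff of_real_mult)
  have kk2: "(1/\<kappa>) * (1/\<kappa>) \<noteq> 1" using kk k0 by (simp add: field_simps)
  show "rgram (xs @ ys) (antiblock (Suc n) (jordan_block (Suc n) a))"
  proof (rule rgram_antiblock)
    fix i j assume ij: "i < Suc n" "j < Suc n"
    have m: "xs ! i \<in> E \<kappa>" "xs ! j \<in> E \<kappa>" "ys ! i \<in> F \<kappa>" "ys ! j \<in> F \<kappa>"
      using xs_E ys_F ij len_xy by (auto intro: set_mp nth_mem)
    show "B (xs ! i) (xs ! j) = 0" by (rule orth[OF kk m(1,2)])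
    show "B (ys ! i) (ys ! j) = 0" by (rule orth[OF kk2]) (use m(3,4) FE[OF k0] in auto)
    show "B (xs ! i) (ys ! j) = (if i = j then 1 else 0)" by (rule Bxy[OF ij])
    show "B (ys ! i) (xs ! j) = of_real (jordan_block (Suc n) a $$ (i, j))"
    proof -
      have "(if i = j then \<kappa> else if Suc i = j then 1 else 0) = of_real (jordan_block (Suc n) a $$ (i, j))"
        using ij unfolding k(1) by (auto simp: jordan_block_def)
      thus ?thesis unfolding Byx[OF ij] .
    qed
  qed (auto simp: len_xy)
  have "a \<noteq> 0" using k k0 by auto
  thus "nonsing (antiblock (Suc n) (jordan_block (Suc n) a))"
    by (intro nonsing_antiblock[OF _ nonsing_jordan]) auto
qed

text \<open>As \<kappa> is neither real nor unimodular, \<open>orth\<close> kills every product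
  among the chains and their conjugates except those between a chain and its own dual. The factors 2
  and -2 undo the 1/2 and the sign that \<open>B_reim\<close> attaches to products of real and of
  imaginary parts.\<close>

lemma hyper_complex:
  assumes k: "Im \<kappa> \<noteq> 0" "cmod \<kappa> \<noteq> 1"
  shows "summand (rlist 1 1 xs @ rlist 2 (-2) ys) (H_hat_mat (Suc n) (Re \<kappa>) (Im \<kappa>))"
  unfolding summand_def H_hat_anti
proof (intro conjI ballI)
  let ?rx = "rlist 1 1 xs" and ?ry = "rlist 2 (-2) ys"
  show "?rx @ ?ry \<noteq> []" using rlist_length[of 1 1 xs] len_xy by (metis Nil_is_append_conv length_0_conv mult_is_0 nat.distinct(1) numeral_2_eq_2)
  show sub: "set (?rx @ ?ry) \<subseteq> V" using rlist_sub[OF csV xs_V] rlist_sub[OF csV ys_V] by simp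
  show re: "cj u = u" if "u \<in> set (?rx @ ?ry)" for u
    using that rlist_real[of 1 1 u xs] rlist_real[of 2 "-2" u ys] by auto
  let ?U = "span (set (?rx @ ?ry))"
  have cU: "csub ?U" by (rule span_real_csub[OF re])
  have s: "span (set ?rx) \<subseteq> ?U" "span (set ?ry) \<subseteq> ?U" by (rule span_mono, simp)+
  have zU: "set xs \<subseteq> ?U" "set ys \<subseteq> ?U" using rlist_span[of 1 1 _ xs] rlist_span[of 2 "-2" _ ys] s by auto
  have tz: "\<tau> z \<in> ?U" if "z \<in> set xs \<union> set ys" for z
  proof -
    have "span (set xs) \<subseteq> ?U" "span (set ys) \<subseteq> ?U" using zU span_minimal[OF _ subspace_span] by blast+
    thus ?thesis using that tau_span_xs tau_span_ys by auto
  qed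
  have tre: "\<tau> (re z) \<in> ?U" "\<tau> (im z) \<in> ?U" if "z \<in> set xs \<union> set ys" for z
  proof -
    have zV: "z \<in> V" using that xs_V ys_V by auto
    note c = csub_cj[OF csV zV]
    have "\<tau> (re z) = re (\<tau> z)" unfolding re_def
      using linD(3)[OF \<tau>(1) subspace_add[OF sV zV c]] linD(2)[OF \<tau>(1) zV c] \<tau>(3)[OF zV] by simp
    moreover have "\<tau> (im z) = im (\<tau> z)"
      unfolding im_def linD(3)[OF \<tau>(1) subspace_diff[OF sV zV c]] lin_diff[OF \<tau>(1) sV zV c] \<tau>(3)[OF zV]
      by (rule refl)
    ultimately show "\<tau> (re z) \<in> ?U" "\<tau> (im z) \<in> ?U" using csub_re[OF cU tz[OF that]] csub_im[OF cU tz[OF that]] by auto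
  qed
  have sc: "\<tau> (c *s re z) \<in> ?U" "\<tau> (c *s im z) \<in> ?U" if z: "z \<in> set xs \<union> set ys" for c z
  proof -
    have zV: "z \<in> V" using z xs_V ys_V by auto
    show "\<tau> (c *s re z) \<in> ?U" "\<tau> (c *s im z) \<in> ?U"
      unfolding linD(3)[OF \<tau>(1) csub_re[OF csV zV]] linD(3)[OF \<tau>(1) csub_im[OF csV zV]]
      using tre[OF z] span_scale by auto
  qed
  show "\<tau> u \<in> ?U" if um: "u \<in> set (?rx @ ?ry)" for u
  proof -
    consider "u \<in> set ?rx" | "u \<in> set ?ry" using um by auto
    thus ?thesis
    proof cases
      case 1 thus ?thesis
      proof (cases rule: rlist_mem)
        case (1 z) show ?thesis unfolding 1(2) by (rule sc(1)) (use 1(1) in simp)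
      next
        case (2 z) show ?thesis unfolding 2(2) by (rule sc(2)) (use 2(1) in simp)
      qed
    next
      case 2 thus ?thesis
      proof (cases rule: rlist_mem)
        case (1 z) show ?thesis unfolding 1(2) by (rule sc(1)) (use 1(1) in simp)
      next
        case (2 z) show ?thesis unfolding 2(2) by (rule sc(2)) (use 2(1) in simp)
      qed
    qed
  qed
  have k1: "\<kappa> * \<kappa> \<noteq> 1"
  proof
    assume h: "\<kappa> * \<kappa> = 1"
    have "cmod \<kappa> * cmod \<kappa> = 1" using arg_cong[OF h, of cmod] by (simp add: norm_mult)
    thus False using k(2) power2_eq_imp_eq[of "cmod \<kappa>" 1] by (simp add: power2_eq_square)
  qed
  have k2: "\<kappa> * cnj \<kappa> \<noteq> 1"
  proof
    assume h: "\<kappa> * cnj \<kappa> = 1"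
    have "cmod \<kappa> * cmod \<kappa> = 1" using arg_cong[OF h, of cmod] by (simp add: norm_mult)
    thus False using k(2) power2_eq_imp_eq[of "cmod \<kappa>" 1] by (simp add: power2_eq_square)
  qed
  have k3: "(1/\<kappa>) * (1/\<kappa>) \<noteq> 1" "(1/\<kappa>) * cnj (1/\<kappa>) \<noteq> 1" using k1 k2 k0 by (auto simp: field_simps)
  have k4: "\<kappa> * cnj (1/\<kappa>) \<noteq> 1" "1/\<kappa> * cnj \<kappa> \<noteq> 1"
  proof -
    have "\<kappa> \<noteq> cnj \<kappa>" using k(1) by (auto simp: complex_eq_iff)
    thus "\<kappa> * cnj (1/\<kappa>) \<noteq> 1" "1/\<kappa> * cnj \<kappa> \<noteq> 1" using k0 by (auto simp: field_simps)
  qed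
  have dx: "length xs = Suc n" "length ys = Suc n" by (rule len_xy)+
  have xx: "B (xs ! i) (xs ! j) = 0" "B (xs ! i) (cj (xs ! j)) = 0"
    and yy: "B (ys ! i) (ys ! j) = 0" "B (ys ! i) (cj (ys ! j)) = 0"
    and xy': "B (xs ! i) (cj (ys ! j)) = 0" and yx': "B (ys ! i) (cj (xs ! j)) = 0"
    if ij: "i < Suc n" "j < Suc n" for i j
  proof -
    have yE: "set ys \<subseteq> E (1/\<kappa>)" by (rule order.trans[OF ys_F FE[OF k0]])
    have m: "xs ! i \<in> E \<kappa>" "xs ! j \<in> E \<kappa>" "ys ! i \<in> E (1/\<kappa>)" "ys ! j \<in> E (1/\<kappa>)"
      by (rule set_mp[OF xs_E nth_mem] set_mp[OF yE nth_mem], simp add: len_xy ij)+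
    show "B (xs ! i) (xs ! j) = 0" by (rule orth[OF k1 m(1,2)])
    show "B (xs ! i) (cj (xs ! j)) = 0" by (rule orth[OF k2 m(1) E_cj[OF m(2)]])
    show "B (ys ! i) (ys ! j) = 0" by (rule orth[OF k3(1) m(3,4)])
    show "B (ys ! i) (cj (ys ! j)) = 0" by (rule orth[OF k3(2) m(3) E_cj[OF m(4)]])
    show "B (xs ! i) (cj (ys ! j)) = 0" by (rule orth[OF k4(1) m(1) E_cj[OF m(4)]])
    show "B (ys ! i) (cj (xs ! j)) = 0" by (rule orth[OF k4(2) m(3) E_cj[OF m(2)]])
  qed
  let ?k = "Suc n"
  show "rgram (?rx @ ?ry) (antiblock (2 * ?k) (C_block_mat ?k (Re \<kappa>) (Im \<kappa>)))"
  proof (rule rgram_antiblock[OF C_block_carrier])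
    show "length ?rx = 2 * ?k" "length ?ry = 2 * ?k" using dx by auto
    show "B (?rx ! i) (?rx ! j) = 0" if ij0: "i < 2 * ?k" "j < 2 * ?k" for i j
      by (rule pairs2[where k="Suc n" and Q="\<lambda>i j. B (?rx ! i) (?rx ! j) = 0", OF _ ij0])
         (simp_all add: dx rlist_nth B_simps B_reim xx)
    show "B (?ry ! i) (?ry ! j) = 0" if ij0: "i < 2 * ?k" "j < 2 * ?k" for i j
      by (rule pairs2[where k="Suc n" and Q="\<lambda>i j. B (?ry ! i) (?ry ! j) = 0", OF _ ij0])
         (simp_all add: dx rlist_nth B_simps B_reim yy)
    show "B (?rx ! i) (?ry ! j) = (if i = j then 1 else 0)" if ij0: "i < 2 * ?k" "j < 2 * ?k" for i j
    proof (rule pairs2[where k="Suc n" and Q="\<lambda>i j. B (?rx ! i) (?ry ! j) = (if i = j then 1 else 0)", OF _ ij0])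
      fix i j assume ij: "i < ?k" "j < ?k"
      have "2 * i \<noteq> Suc (2 * j)" "Suc (2 * i) \<noteq> 2 * j" by presburger+
      thus "B (?rx ! (2*i)) (?ry ! (2*j)) = (if 2*i = 2*j then 1 else 0) \<and> B (?rx ! (2*i)) (?ry ! Suc (2*j)) = (if 2*i = Suc (2*j) then 1 else 0)
        \<and> B (?rx ! Suc (2*i)) (?ry ! (2*j)) = (if Suc (2*i) = 2*j then 1 else 0) \<and> B (?rx ! Suc (2*i)) (?ry ! Suc (2*j)) = (if Suc (2*i) = Suc (2*j) then 1 else 0)"
        using ij by (simp add: dx rlist_nth B_simps B_reim Bxy xy')
    qed
    show "B (?ry ! i) (?rx ! j) = of_real (C_block_mat ?k (Re \<kappa>) (Im \<kappa>) $$ (i, j))" if ij0: "i < 2 * ?k" "j < 2 * ?k" for i j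
    proof (rule pairs2[where k="Suc n" and Q="\<lambda>i j. B (?ry ! i) (?rx ! j) = of_real (C_block_mat ?k (Re \<kappa>) (Im \<kappa>) $$ (i, j))", OF _ ij0])
      fix i j assume ij: "i < ?k" "j < ?k"
      show "B (?ry ! (2*i)) (?rx ! (2*j)) = of_real (C_block_mat ?k (Re \<kappa>) (Im \<kappa>) $$ (2*i, 2*j)) \<and>
        B (?ry ! (2*i)) (?rx ! Suc (2*j)) = of_real (C_block_mat ?k (Re \<kappa>) (Im \<kappa>) $$ (2*i, Suc (2*j)))
        \<and> B (?ry ! Suc (2*i)) (?rx ! (2*j)) = of_real (C_block_mat ?k (Re \<kappa>) (Im \<kappa>) $$ (Suc (2*i), 2*j)) \<and>
         B (?ry ! Suc (2*i)) (?rx ! Suc (2*j)) = of_real (C_block_mat ?k (Re \<kappa>) (Im \<kappa>) $$ (Suc (2*i), Suc (2*j)))"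
        unfolding C_block_index[OF ij] rlist_nth[OF ij(1)[folded dx(2)]] rlist_nth[OF ij(2)[folded dx(1)]]
        using ij by (simp add: B_simps B_reim Byx yx' jordan_block_def)
    qed
  qed
  show "nonsing (antiblock (2 * ?k) (C_block_mat ?k (Re \<kappa>) (Im \<kappa>)))"
    by (rule nonsing_antiblock[OF C_block_carrier nonsing_C_block[OF k(1)]])
qed

end

lemma hyper_step:
  assumes x0: "x0 \<in> E \<kappa>" "x0 \<noteq> 0" and k: "cmod \<kappa> < 1"
  shows "\<exists>us M. summand us M \<and> M \<in> type_iii \<union> type_iv"
proof -
  have main: ?thesis if x0: "x0 \<in> E \<kappa>" "x0 \<noteq> 0" and k: "cmod \<kappa> < 1" and im: "Im \<kappa> \<ge> 0" for x0 \<kappa>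
  proof -
    have k0: "\<kappa> \<noteq> 0" by (rule E_nonzero_lambda[OF x0])
    obtain n x y where h: "x \<in> E \<kappa>" "y \<in> F \<kappa>" "(N \<kappa> ^^ Suc n) x = 0" "(P \<kappa> ^^ Suc n) y = 0"
      "\<forall>m. B ((N \<kappa> ^^ m) x) y = (if m = n then 1 else 0)" "cnj \<kappa> = \<kappa> \<longrightarrow> cj x = x \<and> cj y = y"
      using hyper_chain[OF x0] by (elim exE conjE)
    show ?thesis
    proof (cases "Im \<kappa> = 0")
      case True
      have e: "\<kappa> = of_real (Re \<kappa>)" and c: "cnj \<kappa> = \<kappa>" using True by (auto simp: complex_eq_iff)
      have a: "\<bar>Re \<kappa>\<bar> < 1" "Re \<kappa> \<noteq> 0" using k k0 e abs_Re_le_cmod[of \<kappa>] by (auto simp: complex_eq_iff True)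
      have a2: "Re \<kappa> * Re \<kappa> \<noteq> 1" using a by (metis abs_mult_self_eq abs_1 less_irrefl square_eq_1_iff abs_minus_cancel)
      have "summand (xs \<kappa> n x @ ys \<kappa> n y) (H_mat (Suc n) (Re \<kappa>))"
        by (rule hyper_real[OF h(1-4) h(5)[rule_format] k0 e a2]) (use h(6) c in auto)
      moreover have "H_mat (Suc n) (Re \<kappa>) \<in> type_iii" unfolding type_iii_def using a by fastforce
      ultimately show ?thesis by blast
    next
      case False
      have "summand (rlist 1 1 (xs \<kappa> n x) @ rlist 2 (-2) (ys \<kappa> n y)) (H_hat_mat (Suc n) (Re \<kappa>) (Im \<kappa>))"
        by (rule hyper_complex[OF h(1-4) h(5)[rule_format] k0 False]) (use k in auto)
      moreover have "(Re \<kappa>)\<^sup>2 + (Im \<kappa>)\<^sup>2 < 1" using k cmod_power2[of \<kappa>] by (simp add: power_less_one_iff abs_square_less_1 flip: cmod_power2)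
      hence "H_hat_mat (Suc n) (Re \<kappa>) (Im \<kappa>) \<in> type_iv" unfolding type_iv_def using False im by fastforce
      ultimately show ?thesis by blast
    qed
  qed
  show ?thesis
  proof (cases "Im \<kappa> \<ge> 0")
    case True show ?thesis by (rule main[OF x0 k True])
  next
    case False
    \<comment> \<open>Conjugation carries \<open>E \<kappa>\<close> to
      \<open>E (cnj \<kappa>)\<close>, so a nonnegative imaginary part may be assumed.\<close>
    have "cj x0 \<noteq> 0" using x0(2) by (metis cj_cj cj_zero)
    thus ?thesis by (intro main[OF E_cj[OF x0(1)]]) (use k False in auto)
  qed
qed

end

section \<open>Summands of type (ii)\<close>

lemma minus_one_sq: "((-1::complex) ^ a) * ((-1) ^ a) = 1"
  by (simp flip: power_mult_distrib)

lemma minus_one_mul: "((-1::complex) ^ a) * (((-1) ^ a) * z) = z"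
  by (simp flip: mult.assoc add: minus_one_sq)

lemma minus_one_diff: "m \<le> n \<Longrightarrow> (-1::complex) ^ (n - m) = (-1) ^ n * (-1) ^ m"
proof -
  assume "m \<le> n"
  hence "(-1::complex) ^ n = (-1) ^ (n - m) * (-1) ^ m" by (simp flip: power_add)
  thus ?thesis by (simp add: minus_one_sq mult.assoc)
qed

context asym
begin

text \<open>For \<open>\<bar>\<kappa>\<bar> = 1\<close> the form \<open>B x (cj y)\<close> splits into the \<open>\<kappa>\<close>-hermitian part \<open>G\<close> and a
  \<open>-\<kappa>\<close>-hermitian part; on the generalized eigenspace of \<open>\<kappa>\<close> the first is nondegenerate and the
  second is \<open>- G (M x) y\<close> with \<open>M\<close> nilpotent and skew-adjoint (a Cayley transform of \<open>\<tau>\<close>).\<close>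

definition G :: "complex \<Rightarrow> 'v \<Rightarrow> 'v \<Rightarrow> complex" where
  "G \<kappa> x y = (B x (cj y) + cnj \<kappa> * B (cj y) x) / 2"

lemma G_simps:
  "G \<kappa> (x + x') y = G \<kappa> x y + G \<kappa> x' y" "G \<kappa> x (y + y') = G \<kappa> x y + G \<kappa> x y'"
  "G \<kappa> (c *s x) y = c * G \<kappa> x y" "G \<kappa> x (c *s y) = cnj c * G \<kappa> x y"
  "G \<kappa> (x - x') y = G \<kappa> x y - G \<kappa> x' y" "G \<kappa> x (y - y') = G \<kappa> x y - G \<kappa> x y'"
  "G \<kappa> 0 y = 0" "G \<kappa> x 0 = 0"
  unfolding G_def by (simp_all add: B_simps cj_simps field_simps)

context
  fixes \<kappa> :: complex
  assumes k1: "\<kappa> * cnj \<kappa> = 1"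
begin

lemma kk: "cnj \<kappa> * \<kappa> = 1" "\<kappa> \<noteq> 0" "1 / \<kappa> = cnj \<kappa>"
proof -
  show 1: "cnj \<kappa> * \<kappa> = 1" using k1 by (simp add: mult.commute)
  show 2: "\<kappa> \<noteq> 0" using k1 by auto
  show "1 / \<kappa> = cnj \<kappa>" using 2 by (simp add: divide_eq_eq 1)
qed

lemma G_herm: "cnj (G \<kappa> y x) = \<kappa> * G \<kappa> x y"
proof -
  have "cnj (B y (cj x)) = B (cj y) x" "cnj (B (cj x) y) = B x (cj y)"
    using B_cj[of y "cj x"] B_cj[of "cj x" y] by simp_all
  hence "cnj (G \<kappa> y x) = (B (cj y) x + \<kappa> * B x (cj y)) / 2" unfolding G_def by simp
  also have "\<dots> = \<kappa> * ((B x (cj y) + cnj \<kappa> * B (cj y) x) / 2)" using k1 by (simp add: algebra_simps)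
  finally show ?thesis unfolding G_def .
qed

lemma cjE: "x \<in> E \<kappa> \<Longrightarrow> cj x \<in> V" using csub_cj[OF csV] EV by blast

text \<open>On \<open>E \<kappa>\<close> the map 2\<kappa> + \<open>N \<kappa>\<close> is \<tau> +
  \<kappa>, invertible because \<kappa> is nonzero and \<open>N \<kappa>\<close> nilpotent. So
  \<open>M\<close> is the quotient of \<tau> - \<kappa> by \<tau> + \<kappa>.\<close>

lemma M_exists: "\<exists>M. \<forall>x\<in>E \<kappa>. M x \<in> E \<kappa> \<and> (2 * \<kappa>) *s M x + N \<kappa> (M x) = N \<kappa> x"
proof -
  have "\<exists>z\<in>E \<kappa>. (2 * \<kappa>) *s z + N \<kappa> z = N \<kappa> x" if x: "x \<in> E \<kappa>" for x
  proof -
    obtain m where m: "(N \<kappa> ^^ m) (N \<kappa> x) = 0" using NE[OF x] unfolding E_def by blast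
    have "2 * \<kappa> \<noteq> 0" using kk by simp
    from nilp_surj[OF linNE subE this NE[OF x] m] show ?thesis by (elim bexE conjE) (rule bexI)
  qed
  hence "\<forall>x\<in>E \<kappa>. \<exists>z. z \<in> E \<kappa> \<and> (2 * \<kappa>) *s z + N \<kappa> z = N \<kappa> x" by blast
  thus ?thesis by (rule bchoice)
qed

definition "M = (SOME M. \<forall>x\<in>E \<kappa>. M x \<in> E \<kappa> \<and> (2 * \<kappa>) *s M x + N \<kappa> (M x) = N \<kappa> x)"

lemma M_all: "\<forall>x\<in>E \<kappa>. M x \<in> E \<kappa> \<and> (2 * \<kappa>) *s M x + N \<kappa> (M x) = N \<kappa> x"
  unfolding M_def by (rule someI_ex[OF M_exists])

lemma ME: "x \<in> E \<kappa> \<Longrightarrow> M x \<in> E \<kappa>" using M_all by simp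
lemma M_eq: "x \<in> E \<kappa> \<Longrightarrow> (2 * \<kappa>) *s M x + N \<kappa> (M x) = N \<kappa> x" using M_all by simp

lemma inj2: assumes "z \<in> E \<kappa>" "(2 * \<kappa>) *s z + N \<kappa> z = 0" shows "z = 0"
proof -
  obtain m where m: "(N \<kappa> ^^ m) z = 0" using assms(1) unfolding E_def by blast
  show ?thesis by (rule nilp_inj[OF linNE subE _ assms(1) m assms(2)]) (use kk in simp)
qed

lemma M_unique: assumes "x \<in> E \<kappa>" "z \<in> E \<kappa>" "(2 * \<kappa>) *s z + N \<kappa> z = N \<kappa> x" shows "M x = z"
proof -
  have d: "M x - z \<in> E \<kappa>" by (rule subspace_diff[OF subE ME[OF assms(1)] assms(2)])
  have "(2 * \<kappa>) *s (M x - z) + N \<kappa> (M x - z) = 0"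
    unfolding lin_diff[OF linNE subE ME[OF assms(1)] assms(2)]
    using M_eq[OF assms(1)] assms(3) by (simp add: scale_right_diff_distrib algebra_simps)
  from inj2[OF d this] show ?thesis by simp
qed

lemma linM: "lin (E \<kappa>) M"
  unfolding lin_def
proof (intro conjI ballI allI)
  fix x y assume xy: "x \<in> E \<kappa>" "y \<in> E \<kappa>"
  note m = ME[OF xy(1)] ME[OF xy(2)]
  show "M (x + y) = M x + M y"
  proof (rule M_unique)
    show "(2 * \<kappa>) *s (M x + M y) + N \<kappa> (M x + M y) = N \<kappa> (x + y)"
      unfolding linD(2)[OF linNE m] linD(2)[OF linNE xy] M_eq[OF xy(1), symmetric] M_eq[OF xy(2), symmetric]
      by (simp add: scale_right_distrib algebra_simps)
  qed (use xy m subspace_add[OF subE] in auto)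
next
  fix c x assume x: "x \<in> E \<kappa>"
  note m = ME[OF x]
  show "M (c *s x) = c *s M x"
  proof (rule M_unique)
    show "(2 * \<kappa>) *s (c *s M x) + N \<kappa> (c *s M x) = N \<kappa> (c *s x)"
      unfolding linD(3)[OF linNE m] linD(3)[OF linNE x] M_eq[OF x, symmetric]
      by (simp add: scale_right_distrib mult.commute)
  qed (use x m subspace_scale[OF subE] in auto)
qed (rule ME)

lemma MEp: "x \<in> E \<kappa> \<Longrightarrow> (M ^^ m) x \<in> E \<kappa>" using linD(1)[OF lin_funpow[OF linM]] .

lemma M_nil: "x \<in> E \<kappa> \<Longrightarrow> (N \<kappa> ^^ m) x = 0 \<Longrightarrow> (M ^^ m) x = 0"
proof (induction m arbitrary: x)
  case (Suc m)
  have "(N \<kappa> ^^ m) (N \<kappa> x) = 0" using Suc.prems(2) by (simp add: funpow_comm)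
  moreover have "2 * \<kappa> \<noteq> 0" using kk by simp
  ultimately obtain z where z: "z \<in> E \<kappa>" "(2 * \<kappa>) *s z + N \<kappa> z = N \<kappa> x" "(N \<kappa> ^^ m) z = 0"
    using nilp_surj[OF linNE subE _ NE[OF Suc.prems(1)]] by blast
  have "M x = z" by (rule M_unique[OF Suc.prems(1) z(1,2)])
  hence "(M ^^ m) (M x) = 0" using Suc.IH[OF z(1,3)] by simp
  thus ?case by (simp add: funpow_comm)
qed simp

lemma G_tau: assumes "x \<in> E \<kappa>" "y \<in> E \<kappa>"
  shows "G \<kappa> x y = B (2 *s x + cnj \<kappa> *s N \<kappa> x) (cj y) / 2"
proof -
  have xV: "x \<in> V" using assms EV by blast
  have "B (cj y) x = B (\<tau> x) (cj y)" by (rule \<tau>(2)[OF xV cjE[OF assms(2)]])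
  also have "\<dots> = B (N \<kappa> x) (cj y) + \<kappa> * B x (cj y)" unfolding tau_N[of x \<kappa>] by (simp add: B_simps)
  finally have "cnj \<kappa> * B (cj y) x = cnj \<kappa> * B (N \<kappa> x) (cj y) + (cnj \<kappa> * \<kappa>) * B x (cj y)"
    by (simp add: algebra_simps)
  thus ?thesis unfolding G_def kk(1) by (simp add: B_simps)
qed

text \<open>By \<open>G_tau\<close>, \<open>G \<kappa>\<close> contains the factor 2\<kappa> +
  \<open>N \<kappa>\<close>, which cancels the denominator of \<open>M\<close>; only the
  complementary part of \<open>B x (cj y)\<close> remains.\<close>

lemma GM: assumes "x \<in> E \<kappa>" "y \<in> E \<kappa>"
  shows "G \<kappa> (M x) y = - (B x (cj y) - cnj \<kappa> * B (cj y) x) / 2"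
proof -
  have "2 *s M x + cnj \<kappa> *s N \<kappa> (M x) = cnj \<kappa> *s ((2 * \<kappa>) *s M x + N \<kappa> (M x))"
    using kk(1) by (simp add: scale_right_distrib flip: mult.assoc)
  also have "\<dots> = cnj \<kappa> *s N \<kappa> x" unfolding M_eq[OF assms(1)] ..
  finally have "G \<kappa> (M x) y = cnj \<kappa> * B (N \<kappa> x) (cj y) / 2"
    unfolding G_tau[OF ME[OF assms(1)] assms(2)] by (simp add: B_simps)
  also have "cnj \<kappa> * B (N \<kappa> x) (cj y) = 2 * G \<kappa> x y - 2 * B x (cj y)"
    unfolding G_tau[OF assms] by (simp add: B_simps field_simps)
  finally have "G \<kappa> (M x) y = G \<kappa> x y - B x (cj y)" by (simp add: diff_divide_distrib)
  thus ?thesis unfolding G_def[of \<kappa> x y] by (simp add: field_simps)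
qed

lemma h_G: assumes "x \<in> E \<kappa>" "y \<in> E \<kappa>" shows "B x (cj y) = G \<kappa> x y - G \<kappa> (M x) y"
  unfolding GM[OF assms] unfolding G_def by (simp add: field_simps)

lemma G_skew: assumes "x \<in> E \<kappa>" "y \<in> E \<kappa>" shows "G \<kappa> x (M y) = - G \<kappa> (M x) y"
proof -
  have c: "cnj (B y (cj x)) = B (cj y) x" "cnj (B (cj x) y) = B x (cj y)"
    using B_cj[of y "cj x"] B_cj[of "cj x" y] by simp_all
  have kz: "\<kappa> * (cnj \<kappa> * z) = z" for z using k1 by (simp flip: mult.assoc)
  have "\<kappa> * G \<kappa> x (M y) = cnj (G \<kappa> (M y) x)" using G_herm by simp
  also have "\<dots> = - (B (cj y) x - \<kappa> * B x (cj y)) / 2" unfolding GM[OF assms(2,1)] using c by simp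
  also have "\<dots> = \<kappa> * ((B x (cj y) - cnj \<kappa> * B (cj y) x) / 2)" by (simp add: field_simps kz)
  also have "\<dots> = \<kappa> * (- G \<kappa> (M x) y)" unfolding GM[OF assms] by (simp add: field_simps)
  finally show ?thesis using kk(2) unfolding mult_cancel_left by blast
qed

lemma G_skew_pow: assumes "x \<in> E \<kappa>" "y \<in> E \<kappa>" shows "G \<kappa> x ((M ^^ j) y) = (-1) ^ j * G \<kappa> ((M ^^ j) x) y"
  using assms(1)
proof (induction j arbitrary: x)
  case (Suc j)
  have "G \<kappa> x ((M ^^ Suc j) y) = - G \<kappa> (M x) ((M ^^ j) y)" using G_skew[OF Suc.prems MEp[OF assms(2)]] by simp
  also have "\<dots> = - ((-1) ^ j * G \<kappa> ((M ^^ j) (M x)) y)" unfolding Suc.IH[OF ME[OF Suc.prems]] ..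
  finally show ?case by (simp add: funpow_comm)
qed simp

lemma G_pow2: assumes "x \<in> E \<kappa>" "y \<in> E \<kappa>"
  shows "G \<kappa> ((M ^^ i) x) ((M ^^ j) y) = (-1) ^ j * G \<kappa> ((M ^^ (i + j)) x) y"
  using G_skew_pow[OF MEp[OF assms(1)] assms(2), of i j]
  by (simp add: add.commute[of i j] funpow_add)

text \<open>For unimodular \<kappa> the inverse is the conjugate, so conjugates of vectors in
  \<open>F \<kappa>\<close> lie in \<open>E \<kappa>\<close> again. Then \<open>pair_EF\<close>
  annihilates (2\<kappa> + \<open>N \<kappa>\<close>) x, and this operator is injective.\<close>

lemma G_nondeg: assumes "x \<in> E \<kappa>" "\<And>y. y \<in> E \<kappa> \<Longrightarrow> G \<kappa> x y = 0" shows "x = 0"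
proof -
  let ?v = "2 *s x + cnj \<kappa> *s N \<kappa> x"
  have v: "?v \<in> E \<kappa>" using assms(1) NE subspace_add[OF subE] subspace_scale[OF subE] by simp
  have "?v = 0"
  proof (rule pair_EF[OF v])
    fix y assume y: "y \<in> F \<kappa>"
    have "y \<in> E (1/\<kappa>)" by (rule set_mp[OF FE[OF kk(2)] y])
    hence "y \<in> E (cnj \<kappa>)" unfolding kk(3) .
    hence "cj y \<in> E \<kappa>" using E_cj[of y "cnj \<kappa>"] by simp
    from assms(2)[OF this] show "B ?v y = 0" unfolding G_tau[OF assms(1) \<open>cj y \<in> E \<kappa>\<close>] by simp
  qed
  hence "\<kappa> *s ?v = 0" by simp
  hence "(2 * \<kappa>) *s x + N \<kappa> x = 0" using k1 by (simp add: scale_right_distrib mult.commute)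
  thus ?thesis by (rule inj2[OF assms(1)])
qed

section \<open>Normalizing the generator of a chain\<close>

text \<open>Removes the values \<open>G (M\<^sup>m z) z\<close> with \<open>m < n\<close>, from the top down.\<close>

lemma straighten:
  assumes nil: "\<And>x m. x \<in> E \<kappa> \<Longrightarrow> m > n \<Longrightarrow> (M ^^ m) x = 0" and D: "D \<subseteq> E \<kappa>"
    and cl: "\<And>z m t. z \<in> D \<Longrightarrow> m < n \<Longrightarrow> t = - (G \<kappa> ((M ^^ m) z) z / (2 * G \<kappa> ((M ^^ n) z) z)) \<Longrightarrow> z + t *s (M ^^ (n - m)) z \<in> D"
    and z0: "z0 \<in> D" "G \<kappa> ((M ^^ n) z0) z0 \<noteq> 0"
  shows "\<exists>z\<in>D. G \<kappa> ((M ^^ n) z) z = G \<kappa> ((M ^^ n) z0) z0 \<and> (\<forall>m<n. G \<kappa> ((M ^^ m) z) z = 0)"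
proof -
  let ?T = "G \<kappa> ((M ^^ n) z0) z0"
  have "\<exists>z\<in>D. G \<kappa> ((M ^^ n) z) z = ?T \<and> (\<forall>m. n - d \<le> m \<and> m < n \<longrightarrow> G \<kappa> ((M ^^ m) z) z = 0)" if "d \<le> n" for d
    using that
  proof (induction d)
    case 0 show ?case using z0 by (intro bexI[of _ z0]) auto
  next
    case (Suc d)
    then obtain z where z: "z \<in> D" "G \<kappa> ((M ^^ n) z) z = ?T"
      and zc: "\<forall>m. n - d \<le> m \<and> m < n \<longrightarrow> G \<kappa> ((M ^^ m) z) z = 0" by auto
    define m where "m = n - Suc d"
    have m: "m < n" "n - d = Suc m" using Suc.prems unfolding m_def by auto
    define c where "c = (\<lambda>j. G \<kappa> ((M ^^ j) z) z)"
    have zE: "z \<in> E \<kappa>" using z D by blast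
    define t where "t = - (c m / (2 * c n))"
    define a where "a = n - m"
    define z' where "z' = z + t *s (M ^^ a) z"
    have a: "a + m = n" "a > 0" unfolding a_def using m by auto
    have c0: "c j = 0" if "j > n" for j unfolding c_def using nil[OF zE that] by (simp add: G_simps)
    have cn: "c n \<noteq> 0" unfolding c_def using z z0(2) by simp
    have ch: "cnj (c j) = \<kappa> * (-1) ^ j * c j" for j
      unfolding c_def G_herm using G_skew_pow[OF zE zE] by simp
    \<comment> \<open>Hermitian symmetry gives \<open>cnj (c j) = \<kappa> * (-1) ^ j * c j\<close>.
      Hence the two cross terms produced by \<open>z'\<close> are equal, which explains the 2 in the
      denominator of \<open>t\<close>.\<close>
    have t: "(-1) ^ a * cnj t = t"
    proof -
      have "cnj t = - (cnj (c m) / (2 * cnj (c n)))" unfolding t_def by simp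
      also have "\<dots> = - ((-1) ^ m * c m / (2 * ((-1) ^ n * c n)))" unfolding ch using kk(2) by (simp add: field_simps)
      also have "\<dots> = (-1) ^ m * (-1) ^ n * t" unfolding t_def using cn by (simp add: field_simps minus_one_mul minus_one_sq)
      finally have "cnj t = (-1) ^ m * (-1) ^ n * t" .
      thus ?thesis unfolding a(1)[symmetric] power_add by (simp add: mult.assoc minus_one_mul mult.left_commute[of "(-1)^m"])
    qed
    have pE: "(M ^^ a) z \<in> E \<kappa>" "t *s (M ^^ a) z \<in> E \<kappa>" using MEp[OF zE] subspace_scale[OF subE] by auto
    have exp: "G \<kappa> ((M ^^ j) z') z' = c j + (t + (-1) ^ a * cnj t) * c (j + a) + t * cnj t * ((-1) ^ a * c (j + a + a))" for j
    proof -
      have "(M ^^ j) z' = (M ^^ j) z + t *s (M ^^ (j + a)) z"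
        unfolding z'_def linD(2)[OF lin_funpow[OF linM] zE pE(2)] linD(3)[OF lin_funpow[OF linM] pE(1)]
        by (simp add: funpow_add)
      hence "G \<kappa> ((M ^^ j) z') z' = c j + t * c (j + a) + cnj t * G \<kappa> ((M ^^ j) z) ((M ^^ a) z) + t * (cnj t * G \<kappa> ((M ^^ (j + a)) z) ((M ^^ a) z))"
        unfolding c_def by (simp add: z'_def G_simps algebra_simps)
      thus ?thesis unfolding G_pow2[OF zE zE] c_def by (simp add: algebra_simps)
    qed
    have "z' \<in> D" unfolding z'_def a_def by (rule cl[OF z(1) m(1)]) (simp add: t_def c_def)
    moreover have "G \<kappa> ((M ^^ n) z') z' = ?T" unfolding exp using c0 a z(2) by (simp add: c_def)
    moreover have "G \<kappa> ((M ^^ j) z') z' = 0" if j: "n - Suc d \<le> j" "j < n" for j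
    proof (cases "j = m")
      case True
      have "j + a = n" "j + a + a > n" using True a by auto
      thus ?thesis unfolding exp using c0 t cn True by (simp add: t_def)
    next
      case False
      hence "m < j" using j unfolding m_def by auto
      hence "j + a > n" "j + a + a > n" using a by auto
      moreover have "c j = 0" unfolding c_def using zc \<open>m < j\<close> m j by simp
      ultimately show ?thesis unfolding exp using c0 by simp
    qed
    ultimately show ?case by (intro bexI[of _ z'] conjI allI impI) auto
  qed
  from this[of n] show ?thesis by simp
qed

text \<open>For real \<open>\<kappa>\<close> the bilinear values \<open>G (M\<^sup>m z) (cj z)\<close> can be removed as well, provided the
  top form is skew on real vectors.\<close>

lemma Gb_sym: assumes "cnj \<kappa> = \<kappa>" shows "G \<kappa> y (cj x) = \<kappa> * G \<kappa> x (cj y)"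
  unfolding G_def using assms k1 by (simp add: algebra_simps)

lemma M_cj: assumes "cnj \<kappa> = \<kappa>" "x \<in> E \<kappa>" shows "M (cj x) = cj (M x)"
proof (rule M_unique)
  have c: "cj z \<in> E \<kappa>" if "z \<in> E \<kappa>" for z using E_cj[OF that] assms(1) by simp
  show "cj x \<in> E \<kappa>" "cj (M x) \<in> E \<kappa>" using c assms(2) ME by auto
  have "cj ((2 * \<kappa>) *s M x + N \<kappa> (M x)) = cj (N \<kappa> x)" unfolding M_eq[OF assms(2)] ..
  moreover have "N \<kappa> (cj z) = cj (N \<kappa> z)" if "z \<in> E \<kappa>" for z using N_cj[of z \<kappa>] that EV assms(1) by auto
  ultimately show "(2 * \<kappa>) *s cj (M x) + N \<kappa> (cj (M x)) = N \<kappa> (cj x)"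
    using assms ME by (simp add: cj_simps)
qed

lemma M_cj_pow: assumes "cnj \<kappa> = \<kappa>" "x \<in> E \<kappa>" shows "(M ^^ j) (cj x) = cj ((M ^^ j) x)"
  by (induction j) (auto simp: M_cj[OF assms(1) MEp[OF assms(2)]])

text \<open>By symmetry the value at \<open>m\<close> can be nonzero only if
  \<open>\<kappa> * (-1) ^ m = 1\<close>; then n - m is odd. Adding \<open>t\<close> times the power
  n - m of \<open>M\<close> at \<open>cj z\<close> changes that value by -2 t times the top value
  and leaves the top value alone.\<close>

lemma isotropic:
  assumes r: "cnj \<kappa> = \<kappa>" and sk: "\<kappa> * (-1) ^ n = -1"
    and nil: "\<And>x m. x \<in> E \<kappa> \<Longrightarrow> m > n \<Longrightarrow> (M ^^ m) x = 0"
    and z0: "z0 \<in> E \<kappa>" "G \<kappa> ((M ^^ n) z0) z0 \<noteq> 0"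
  shows "\<exists>z\<in>E \<kappa>. G \<kappa> ((M ^^ n) z) z \<noteq> 0 \<and> (\<forall>m. G \<kappa> ((M ^^ m) z) (cj z) = 0)"
proof -
  let ?T = "G \<kappa> ((M ^^ n) z0) z0"
  have kkk: "\<kappa> * \<kappa> = 1" using k1 r by simp
  have cE: "cj z \<in> E \<kappa>" if "z \<in> E \<kappa>" for z using E_cj[OF that] r by simp
  have bsym: "G \<kappa> ((M ^^ m) z) (cj z) = \<kappa> * (-1) ^ m * G \<kappa> ((M ^^ m) z) (cj z)" if z: "z \<in> E \<kappa>" for z m
  proof -
    have "G \<kappa> ((M ^^ m) z) (cj z) = \<kappa> * G \<kappa> z (cj ((M ^^ m) z))" by (rule Gb_sym[OF r])
    also have "cj ((M ^^ m) z) = (M ^^ m) (cj z)" using M_cj_pow[OF r z] by simp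
    finally show ?thesis unfolding G_skew_pow[OF z cE[OF z]] by simp
  qed
  have b0: "G \<kappa> ((M ^^ m) z) (cj z) = 0" if "z \<in> E \<kappa>" "\<kappa> * (-1) ^ m \<noteq> 1" for z m
    using bsym[OF that(1), of m] that(2) by simp
  have "\<exists>z\<in>E \<kappa>. G \<kappa> ((M ^^ n) z) z \<noteq> 0 \<and> (\<forall>m. n - d \<le> m \<longrightarrow> G \<kappa> ((M ^^ m) z) (cj z) = 0)" if "d \<le> n" for d
    using that
  proof (induction d)
    case 0
    have "G \<kappa> ((M ^^ m) z0) (cj z0) = 0" if "n \<le> m" for m
    proof (cases "m = n")
      case True thus ?thesis using b0[OF z0(1), of n] sk by simp
    next
      case False thus ?thesis using nil[OF z0(1), of m] that by (simp add: G_simps)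
    qed
    thus ?case using z0 by (intro bexI[of _ z0]) auto
  next
    case (Suc d)
    then obtain z where z: "z \<in> E \<kappa>" "G \<kappa> ((M ^^ n) z) z \<noteq> 0"
      and zc: "\<forall>m. n - d \<le> m \<longrightarrow> G \<kappa> ((M ^^ m) z) (cj z) = 0" by auto
    define m where "m = n - Suc d"
    have m: "m < n" "n - d = Suc m" using Suc.prems unfolding m_def by auto
    define b where "b = (\<lambda>j. G \<kappa> ((M ^^ j) z) (cj z))"
    define c where "c = (\<lambda>j. G \<kappa> ((M ^^ j) z) z)"
    show ?case
    proof (cases "b m = 0")
      case True
      have "G \<kappa> ((M ^^ j) z) (cj z) = 0" if "n - Suc d \<le> j" for j
        using that True zc m unfolding b_def m_def by (cases "j = m") (auto simp: m_def)
      thus ?thesis using z by (intro bexI[of _ z]) auto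
    next
      case False
      have ms: "\<kappa> * (-1) ^ m = 1" using b0[OF z(1), of m] False unfolding b_def by blast
      define t where "t = b m / (2 * c n)"
      define a where "a = n - m"
      define z' where "z' = z + t *s (M ^^ a) (cj z)"
      have a: "a + m = n" "a > 0" unfolding a_def using m by auto
      have cn: "c n \<noteq> 0" unfolding c_def using z by simp
      have c0: "c j = 0" "b j = 0" "G \<kappa> ((M ^^ j) (cj z)) z = 0" if "j > n" for j
        unfolding c_def b_def using nil[OF z(1) that] nil[OF cE[OF z(1)] that] by (simp_all add: G_simps)
      have sa: "(-1::complex) ^ a = -1"
      proof -
        have "\<kappa> * (-1) ^ m * (-1) ^ a = -1" using sk unfolding a(1)[symmetric] power_add by (simp add: mult.commute mult.left_commute)
        thus ?thesis using ms by simp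
      qed
      have ccn: "G \<kappa> ((M ^^ j) (cj z)) (cj z) = cnj (c j)" for j
      proof -
        have "G \<kappa> ((M ^^ j) (cj z)) (cj z) = G \<kappa> (cj ((M ^^ j) z)) (cj z)" unfolding M_cj_pow[OF r z(1)] ..
        also have "\<dots> = cnj (c j)" unfolding c_def G_def using r B_cj1[of "(M ^^ j) z" z] B_cj[of "cj z" "(M ^^ j) z"] by simp
        finally show ?thesis .
      qed
      have chn: "cnj (c n) = - c n"
      proof -
        have "cnj (c n) = \<kappa> * (-1) ^ n * c n" unfolding c_def G_herm using G_skew_pow[OF z(1) z(1)] by simp
        thus ?thesis using sk by simp
      qed
      have pE: "(M ^^ a) (cj z) \<in> E \<kappa>" "t *s (M ^^ a) (cj z) \<in> E \<kappa>" using MEp[OF cE[OF z(1)]] subspace_scale[OF subE] by auto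
      have z'E: "z' \<in> E \<kappa>" unfolding z'_def by (rule subspace_add[OF subE z(1) pE(2)])
      have Mz': "(M ^^ j) z' = (M ^^ j) z + t *s (M ^^ (j + a)) (cj z)" for j
        unfolding z'_def linD(2)[OF lin_funpow[OF linM] z(1) pE(2)] linD(3)[OF lin_funpow[OF linM] pE(1)]
        by (simp add: funpow_add)
      have cz': "cj z' = cj z + cnj t *s (M ^^ a) z"
        unfolding z'_def M_cj_pow[OF r z(1)] by (simp add: cj_simps)
      have exp: "G \<kappa> ((M ^^ j) z') (cj z') = b j + t * cnj (c (j + a)) + t * ((-1) ^ a * c (j + a)) + t * t * ((-1) ^ a * G \<kappa> ((M ^^ (j + a + a)) (cj z)) z)" for j
      proof -
        have "G \<kappa> ((M ^^ j) z') (cj z') = b j + t * G \<kappa> ((M ^^ (j + a)) (cj z)) (cj z) + t * G \<kappa> ((M ^^ j) z) ((M ^^ a) z) + t * (t * G \<kappa> ((M ^^ (j + a)) (cj z)) ((M ^^ a) z))"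
          unfolding Mz' cz' b_def by (simp add: G_simps algebra_simps)
        thus ?thesis unfolding G_pow2[OF z(1) z(1)] G_pow2[OF cE[OF z(1)] z(1)] ccn c_def by (simp add: algebra_simps)
      qed
      have "G \<kappa> ((M ^^ n) z') z' = c n + t * G \<kappa> ((M ^^ (n + a)) (cj z)) z + cnj t * G \<kappa> ((M ^^ n) z) ((M ^^ a) (cj z)) + t * (cnj t * G \<kappa> ((M ^^ (n + a)) (cj z)) ((M ^^ a) (cj z)))"
        unfolding Mz' c_def by (simp add: z'_def G_simps algebra_simps)
      also have "\<dots> = c n" unfolding G_pow2[OF z(1) cE[OF z(1)]]
        using nil[OF z(1), of "n + a"] nil[OF cE[OF z(1)], of "n + a"] a by (simp add: G_simps)
      finally have top: "G \<kappa> ((M ^^ n) z') z' \<noteq> 0" using cn by simp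
      have "G \<kappa> ((M ^^ j) z') (cj z') = 0" if j: "n - Suc d \<le> j" for j
      proof (cases "j = m")
        case True
        have ja: "j + a = n" "j + a + a > n" using True a by auto
        have "b m = 2 * t * c n" unfolding t_def using cn by simp
        thus ?thesis unfolding exp ja(1) using c0(3)[OF ja(2)] ja chn sa True by simp
      next
        case False
        hence mj: "m < j" using j unfolding m_def by auto
        hence "j + a > n" "j + a + a > n" using a by auto
        moreover have "b j = 0" unfolding b_def using zc mj m by simp
        ultimately show ?thesis unfolding exp using c0 by simp
      qed
      thus ?thesis using z'E top by (intro bexI[of _ z'] conjI allI impI) auto
    qed
  qed
  from this[of n] show ?thesis by simp
qed


text \<open>If all diagonal values vanished, \<open>x + y\<close> would make the sum and
  \<open>x + \<i> *s y\<close> the difference of the two mixed values vanish.\<close>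

lemma polarize:
  assumes "x \<in> E \<kappa>" "y \<in> E \<kappa>" "G \<kappa> ((M ^^ n) x) y \<noteq> 0"
  shows "\<exists>z\<in>E \<kappa>. G \<kappa> ((M ^^ n) z) z \<noteq> 0"
proof (rule ccontr)
  assume "\<not> ?thesis"
  hence z: "G \<kappa> ((M ^^ n) z) z = 0" if "z \<in> E \<kappa>" for z using that by blast
  have iy: "\<i> *s y \<in> E \<kappa>" by (rule subspace_scale[OF subE assms(2)])
  have "G \<kappa> ((M ^^ n) (x + y)) (x + y) = 0" "G \<kappa> ((M ^^ n) (x + \<i> *s y)) (x + \<i> *s y) = 0"
    using z subspace_add[OF subE] assms iy by auto
  hence "G \<kappa> ((M ^^ n) x) y + G \<kappa> ((M ^^ n) y) x = 0"
    "- \<i> * G \<kappa> ((M ^^ n) x) y + \<i> * G \<kappa> ((M ^^ n) y) x = 0"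
    unfolding linD(2)[OF lin_funpow[OF linM] assms(1,2)] linD(2)[OF lin_funpow[OF linM] assms(1) iy]
      linD(3)[OF lin_funpow[OF linM] assms(2)]
    using z[OF assms(1)] z[OF assms(2)] by (simp_all add: G_simps)
  hence "G \<kappa> ((M ^^ n) x) y = 0" by (simp add: complex_eq_iff)
  thus False using assms(3) by simp
qed

context
  fixes n z
  assumes nil: "\<And>x m. x \<in> E \<kappa> \<Longrightarrow> m > n \<Longrightarrow> (M ^^ m) x = 0"
    and zE: "z \<in> E \<kappa>" and z0: "\<forall>m<n. G \<kappa> ((M ^^ m) z) z = 0"
begin

section \<open>The summand spanned by one chain of \<open>M\<close>\<close>

definition "fs = map (\<lambda>i. (M ^^ (n - i)) z) [0..<Suc n]"

lemma fs_len: "length fs = Suc n" unfolding fs_def by simp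
lemma fs_nth: "i < Suc n \<Longrightarrow> fs ! i = (M ^^ (n - i)) z" unfolding fs_def by (simp del: upt_Suc)
lemma fs_E: "set fs \<subseteq> E \<kappa>" unfolding fs_def using MEp[OF zE] by (auto simp del: upt_Suc)
lemma fs_V: "set fs \<subseteq> V" by (rule order.trans[OF fs_E EV])

text \<open>By \<open>h_G\<close> an entry is a difference of values of \<open>G\<close> with
  exponent sums 2n - i - j and one more. Only the sum \<open>n\<close> survives, so the first term
  lives on i + j = n and the second on i + j = n + 1: the two antidiagonals for size n + 1, counted
  from 0.\<close>

lemma h_chain: assumes "i < Suc n" "j < Suc n"
  shows "B (fs ! i) (cj (fs ! j)) = (-1) ^ n * G \<kappa> ((M ^^ n) z) z * of_real (Gamma_mat (Suc n) $$ (i, j))"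
proof -
  define c where "c = (\<lambda>m. G \<kappa> ((M ^^ m) z) z)"
  have c: "c m = (if m = n then G \<kappa> ((M ^^ n) z) z else 0)" for m
    using z0 nil[OF zE, of m] by (cases m n rule: linorder_cases) (auto simp: c_def G_simps)
  have "B (fs ! i) (cj (fs ! j)) = G \<kappa> ((M ^^ (n - i)) z) ((M ^^ (n - j)) z) - G \<kappa> ((M ^^ Suc (n - i)) z) ((M ^^ (n - j)) z)"
    unfolding fs_nth[OF assms(1)] fs_nth[OF assms(2)] h_G[OF MEp[OF zE] MEp[OF zE]] by simp
  also have "\<dots> = (-1) ^ (n - j) * (c (n - i + (n - j)) - c (Suc (n - i) + (n - j)))"
    unfolding G_pow2[OF zE zE] c_def by (simp add: algebra_simps)
  finally have e: "B (fs ! i) (cj (fs ! j)) = (-1) ^ (n - j) * (c (n - i + (n - j)) - c (Suc (n - i) + (n - j)))" .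
  consider "i + j = n" | "i + j = Suc n" | "i + j \<noteq> n" "i + j \<noteq> Suc n" by blast
  thus ?thesis
  proof cases
    case 1
    have "n - j = i" "n - i + (n - j) = n" using 1 by auto
    thus ?thesis unfolding e c using 1 assms minus_one_diff[of i n]
      by (simp add: Gamma_mat_def mult.left_commute minus_one_mul minus_one_sq mult.assoc)
  next
    case 2
    have a: "n - j = i - 1" "Suc (n - i) + (n - j) = n" "n - i + (n - j) \<noteq> n" "i > 0" using 2 assms by auto
    have "(-1::complex) ^ i = - ((-1) ^ (i - 1))" using a(4) by (cases i) auto
    thus ?thesis unfolding e c using 2 a assms minus_one_diff[of i n]
      by (simp add: Gamma_mat_def mult.left_commute minus_one_mul minus_one_sq mult.assoc)
  next
    case 3
    have "n - i + (n - j) \<noteq> n" "Suc (n - i) + (n - j) \<noteq> n" using 3 assms by auto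
    thus ?thesis unfolding e c using 3 assms by (simp add: Gamma_mat_def)
  qed
qed

text \<open>The Cayley relation solved for \<tau>: it maps \<open>M u - u\<close> to - \<kappa> (u +
  \<open>M u\<close>). On the \<open>M\<close>-stable span \<open>M\<close> is nilpotent, so every
  vector has the form \<open>M u - u\<close>.\<close>

lemma tau_fs: assumes "s \<in> span (set fs)" shows "\<tau> s \<in> span (set fs)"
proof -
  let ?S = "span (set fs)"
  have SE: "?S \<subseteq> E \<kappa>" by (rule span_minimal[OF fs_E subE])
  have Mf: "M f \<in> ?S" if fm: "f \<in> set fs" for f
  proof -
    obtain i where i: "i < Suc n" "f = fs ! i" using fm fs_len by (auto simp: in_set_conv_nth)
    have e: "M f = (M ^^ Suc (n - i)) z" unfolding i(2) fs_nth[OF i(1)] by simp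
    show ?thesis
    proof (cases "i = 0")
      case True thus ?thesis unfolding e using nil[OF zE, of "Suc n"] by (simp add: span_zero)
    next
      case False
      hence "Suc (n - i) = n - (i - 1)" "i - 1 < Suc n" using i by auto
      hence "M f = fs ! (i - 1)" unfolding e using fs_nth[of "i - 1"] by simp
      thus ?thesis using \<open>i - 1 < Suc n\<close> fs_len by (simp add: span_base)
    qed
  qed
  have MS: "M x \<in> ?S" if x: "x \<in> ?S" for x
  proof -
    obtain d where d: "x = lc fs d" by (rule span_listE[OF x refl])
    have "set (map M fs) \<subseteq> ?S" using Mf by auto
    thus ?thesis unfolding d lin_lc[OF linM subE fs_E] by (rule lc_in[OF subspace_span])
  qed
  have "(M ^^ Suc n) s = 0" by (rule nil) (use assms SE in auto)
  then obtain u where u: "u \<in> ?S" "(-1) *s u + M u = s"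
    using nilp_surj[OF lin_subset[OF linM SE MS] subspace_span, of "-1" s "Suc n"] assms by auto
  have uE: "u \<in> E \<kappa>" using u(1) SE by blast
  have uV: "u \<in> V" "M u \<in> V" using uE ME[OF uE] EV by auto
  have "\<tau> s = \<tau> (M u - u)" using u(2) by (simp add: algebra_simps)
  also have "\<dots> = \<tau> (M u) - \<tau> u" by (rule lin_diff[OF \<tau>(1) sV uV(2,1)])
  also have "\<dots> = (N \<kappa> (M u) + \<kappa> *s M u) - (N \<kappa> u + \<kappa> *s u)" unfolding tau_N[of "M u" \<kappa>] tau_N[of u \<kappa>] ..
  also have "\<dots> = - (\<kappa> *s (u + M u))"
    using M_eq[OF uE] scale_left_distrib[of \<kappa> \<kappa> "M u"] by (simp add: algebra_simps scale_right_distrib)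
  finally show ?thesis using u(1) MS[OF u(1)] by (simp add: span_add span_scale span_neg)
qed

lemma real_summand:
  assumes r: "cnj \<kappa> = \<kappa>" "cj z = z" and T: "(-1) ^ n * G \<kappa> ((M ^^ n) z) z = of_real s" "s \<noteq> 0"
  shows "summand fs (Gsgn s (Suc n))"
  unfolding summand_def
proof (intro conjI ballI)
  show "fs \<noteq> []" using fs_len by auto
  show "set fs \<subseteq> V" by (rule fs_V)
  show real: "cj u = u" if "u \<in> set fs" for u
    using that M_cj_pow[OF r(1) zE] r(2) unfolding fs_def by (auto simp del: upt_Suc)
  show "\<tau> u \<in> span (set fs)" if "u \<in> set fs" for u by (rule tau_fs[OF span_base[OF that]])
  show "rgram fs (Gsgn s (Suc n))" unfolding rgram_def fs_len Gsgn_dim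
  proof (intro conjI allI impI refl)
    fix i j assume ij: "i < Suc n" "j < Suc n"
    have "cj (fs ! j) = fs ! j" using real ij fs_len by simp
    thus "B (fs ! i) (fs ! j) = of_real (Gsgn s (Suc n) $$ (i, j))"
      using h_chain[OF ij] unfolding T(1) Gsgn_index[OF ij] by simp
  qed
  show "nonsing (Gsgn s (Suc n))" by (rule nonsing_Gsgn[OF T(2)])
qed

text \<open>With the bilinear values gone, \<open>B_reim\<close> leaves halves of the real and
  imaginary part of \<open>w\<close>, and each entry of Gamma becomes a multiple of C(Re w / 2, - Im
  w / 2). The sign \<open>\<sigma>\<close> on the imaginary parts lets b be made positive.\<close>

lemma complex_summand:
  fixes \<sigma> :: real
  assumes iso: "\<And>i j. B ((M ^^ i) z) ((M ^^ j) z) = 0" and s: "\<sigma> * \<sigma> = 1"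
    and w: "w = (-1) ^ n * G \<kappa> ((M ^^ n) z) z" "Im w \<noteq> 0"
  shows "summand (rlist 1 (of_real \<sigma>) fs) (Gamma_mat (Suc n) \<otimes>\<^sub>K C_mat (Re w / 2) (- \<sigma> * Im w / 2))"
  unfolding summand_def
proof (intro conjI ballI)
  let ?us = "rlist 1 (of_real \<sigma>) fs" and ?a = "Re w / 2" and ?b = "- \<sigma> * Im w / 2"
  have s0: "\<sigma> \<noteq> 0" using s by auto
  show "?us \<noteq> []" using rlist_length[of 1 "of_real \<sigma>" fs] fs_len by (metis length_0_conv mult_is_0 nat.distinct(1) numeral_2_eq_2)
  show sub: "set ?us \<subseteq> V" by (rule rlist_sub[OF csV fs_V])
  show re: "cj u = u" if "u \<in> set ?us" for u by (rule rlist_real[OF _ _ that]) simp_all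
  let ?U = "span (set ?us)"
  have cU: "csub ?U" by (rule span_real_csub[OF re])
  have zU: "set fs \<subseteq> ?U" using rlist_span[of 1 "of_real \<sigma>" _ fs] s0 by auto
  have tz: "\<tau> f \<in> ?U" if "f \<in> set fs" for f
    by (rule set_mp[OF span_minimal[OF zU subspace_span] tau_fs[OF span_base[OF that]]])
  have tre: "\<tau> (c *s re f) \<in> ?U" "\<tau> (c *s im f) \<in> ?U" if f: "f \<in> set fs" for f c
  proof -
    have fV: "f \<in> V" using f fs_V by auto
    note d = csub_cj[OF csV fV]
    have "\<tau> (re f) = re (\<tau> f)"
      unfolding re_def linD(3)[OF \<tau>(1) subspace_add[OF sV fV d]] linD(2)[OF \<tau>(1) fV d] \<tau>(3)[OF fV] by (rule refl)
    moreover have "\<tau> (im f) = im (\<tau> f)"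
      unfolding im_def linD(3)[OF \<tau>(1) subspace_diff[OF sV fV d]] lin_diff[OF \<tau>(1) sV fV d] \<tau>(3)[OF fV] by (rule refl)
    ultimately show "\<tau> (c *s re f) \<in> ?U" "\<tau> (c *s im f) \<in> ?U"
      unfolding linD(3)[OF \<tau>(1) csub_re[OF csV fV]] linD(3)[OF \<tau>(1) csub_im[OF csV fV]]
      using csub_re[OF cU tz[OF f]] csub_im[OF cU tz[OF f]] span_scale by auto
  qed
  show "\<tau> u \<in> ?U" if um: "u \<in> set ?us" for u using um
  proof (cases rule: rlist_mem)
    case (1 f) show ?thesis unfolding 1(2) by (rule tre(1)[OF 1(1)])
  next
    case (2 f) show ?thesis unfolding 2(2) by (rule tre(2)[OF 2(1)])
  qed
  have g0: "B (fs ! i) (fs ! j) = 0" if "i < Suc n" "j < Suc n" for i j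
    unfolding fs_nth[OF that(1)] fs_nth[OF that(2)] by (rule iso)
  have h0: "B (fs ! i) (cj (fs ! j)) = w * of_real (Gamma_mat (Suc n) $$ (i, j))" if "i < Suc n" "j < Suc n" for i j
    unfolding w(1) by (rule h_chain[OF that])
  have ss: "of_real \<sigma> * (of_real \<sigma> * v) = v" for v :: complex using s by (metis mult.assoc mult_1 of_real_1 of_real_mult)
  let ?M = "Gamma_mat (Suc n) \<otimes>\<^sub>K C_mat ?a ?b"
  show "rgram ?us ?M" unfolding rgram_def kron_C_dim rlist_length fs_len
  proof (intro conjI allI impI refl)
    fix i j assume ij0: "i < 2 * Suc n" "j < 2 * Suc n"
    show "B (?us ! i) (?us ! j) = of_real (?M $$ (i, j))"
    proof (rule pairs2[where k="Suc n" and Q="\<lambda>i j. B (?us ! i) (?us ! j) = of_real (?M $$ (i, j))", OF _ ij0])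
      fix i j assume ij: "i < Suc n" "j < Suc n"
      show "B (?us ! (2*i)) (?us ! (2*j)) = of_real (?M $$ (2*i, 2*j)) \<and>
        B (?us ! (2*i)) (?us ! Suc (2*j)) = of_real (?M $$ (2*i, Suc (2*j))) \<and>
        B (?us ! Suc (2*i)) (?us ! (2*j)) = of_real (?M $$ (Suc (2*i), 2*j)) \<and>
        B (?us ! Suc (2*i)) (?us ! Suc (2*j)) = of_real (?M $$ (Suc (2*i), Suc (2*j)))"
        unfolding kron_C_index[OF ij] rlist_nth[OF ij(1)[folded fs_len]] rlist_nth[OF ij(2)[folded fs_len]]
        by (simp add: B_scl B_scr B_reim g0[OF ij] h0[OF ij] ss)
    qed
  qed
  show "nonsing ?M" by (rule nonsing_GC) (use s0 w in simp)
qed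

end

text \<open>The top form is hermitian up to the factor \<open>\<kappa> * (-1) ^ n\<close>. If this
  factor is 1 (and hence \<kappa> real), the form is real and symmetric on real vectors and a real
  generator gives N = 1 or N = -1; in all other cases an isotropic complex generator gives some
  C(a,b).\<close>

lemma unit_step:
  assumes x0: "x0 \<in> E \<kappa>" "x0 \<noteq> 0"
  shows "\<exists>us M. summand us M \<and> M \<in> type_ii"
proof -
  obtain K where K: "\<forall>x\<in>E \<kappa>. (N \<kappa> ^^ K) x = 0" using E_K by blast
  have "\<forall>x\<in>E \<kappa>. (M ^^ K) x = 0" using K M_nil by simp
  from nil_index[OF linM subE this x0] obtain n where
    n0: "\<forall>x\<in>E \<kappa>. (M ^^ Suc n) x = 0" and ex: "\<exists>x\<in>E \<kappa>. (M ^^ n) x \<noteq> 0" by (elim exE conjE)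
  have nil: "(M ^^ m) x = 0" if "x \<in> E \<kappa>" "m > n" for x m
    by (rule funpow_le_zero[OF linM subE bspec[OF n0 that(1)]]) (use that in simp)
  from ex obtain x1 where x1: "x1 \<in> E \<kappa>" "(M ^^ n) x1 \<noteq> 0" by (elim bexE)
  have "\<exists>y\<in>E \<kappa>. G \<kappa> ((M ^^ n) x1) y \<noteq> 0"
  proof (rule ccontr)
    assume "\<not> ?thesis"
    hence "G \<kappa> ((M ^^ n) x1) y = 0" if "y \<in> E \<kappa>" for y using that by blast
    hence "(M ^^ n) x1 = 0" by (rule G_nondeg[OF MEp[OF x1(1)]])
    thus False using x1(2) by simp
  qed
  then obtain y1 where y1: "y1 \<in> E \<kappa>" "G \<kappa> ((M ^^ n) x1) y1 \<noteq> 0" by (elim bexE)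
  have herm_top: "cnj (G \<kappa> ((M ^^ n) y) x) = \<kappa> * (-1) ^ n * G \<kappa> ((M ^^ n) x) y" if "x \<in> E \<kappa>" "y \<in> E \<kappa>" for x y
    unfolding G_herm G_skew_pow[OF that] by simp
  show ?thesis
  proof (cases "cnj \<kappa> = \<kappa> \<and> \<kappa> * (-1) ^ n = 1")
    case True
    hence r: "cnj \<kappa> = \<kappa>" and kn: "\<kappa> * (-1) ^ n = 1" by auto
    have cE: "cj z \<in> E \<kappa>" if "z \<in> E \<kappa>" for z using E_cj[OF that] r by simp
    note cs = csub_E[OF r]
    have Gr: "cnj (G \<kappa> x y) = G \<kappa> x y" if "cj x = x" "cj y = y" for x y
      unfolding G_def using that r B_cj[of x y] B_cj[of y x] by simp
    have l1: "linf (E \<kappa>) (\<lambda>x. G \<kappa> ((M ^^ n) x) y1)"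
      unfolding linf_def using linD(2,3)[OF lin_funpow[OF linM]] by (auto simp: G_simps)
    obtain x where x: "x \<in> E \<kappa>" "cj x = x" "G \<kappa> ((M ^^ n) x) y1 \<noteq> 0"
      using real_witness_lin[OF cs l1 x1(1) y1(2)] by (elim bexE conjE)
    have l2: "linf (E \<kappa>) (\<lambda>y. G \<kappa> ((M ^^ n) x) (cj y))" unfolding linf_def by (auto simp: G_simps cj_simps)
    have x3: "G \<kappa> ((M ^^ n) x) (cj (cj y1)) \<noteq> 0" using x(3) by simp
    obtain y where y: "y \<in> E \<kappa>" "cj y = y" "G \<kappa> ((M ^^ n) x) (cj y) \<noteq> 0"
      using real_witness_lin[OF cs l2 cE[OF y1(1)] x3] by (elim bexE conjE)
    have Mr: "cj ((M ^^ j) z) = (M ^^ j) z" if "z \<in> E \<kappa>" "cj z = z" for z j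
      using M_cj_pow[OF r that(1), of j] that(2) by simp
    have "G \<kappa> ((M ^^ n) y) x = cnj (G \<kappa> ((M ^^ n) y) x)" using Gr[OF Mr[OF y(1,2)] x(2)] by simp
    also have "\<dots> = G \<kappa> ((M ^^ n) x) y" unfolding herm_top[OF x(1) y(1)] kn by simp
    finally have sym: "G \<kappa> ((M ^^ n) y) x = G \<kappa> ((M ^^ n) x) y" .
    have "G \<kappa> ((M ^^ n) (x + y)) (x + y) = G \<kappa> ((M ^^ n) x) x + G \<kappa> ((M ^^ n) y) y + 2 * G \<kappa> ((M ^^ n) x) y"
      unfolding linD(2)[OF lin_funpow[OF linM] x(1) y(1)] G_simps sym by simp
    \<comment> \<open>Polarization over the reals: symmetry makes the single combination
      \<open>x + y\<close> sufficient.\<close>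
    hence pol: "G \<kappa> ((M ^^ n) x) x \<noteq> 0 \<or> G \<kappa> ((M ^^ n) y) y \<noteq> 0 \<or> G \<kappa> ((M ^^ n) (x + y)) (x + y) \<noteq> 0"
      using y(3) unfolding y(2) by auto
    have xy: "x + y \<in> E \<kappa>" "cj (x + y) = x + y" using subspace_add[OF subE x(1) y(1)] x y by (auto simp: cj_add)
    have "\<exists>z\<in>E \<kappa>. cj z = z \<and> G \<kappa> ((M ^^ n) z) z \<noteq> 0"
      using pol by (elim disjE) (rule bexI[OF _ x(1)] bexI[OF _ y(1)] bexI[OF _ xy(1)], use x y xy in simp)+
    then obtain z0 where z0: "z0 \<in> E \<kappa>" "cj z0 = z0" "G \<kappa> ((M ^^ n) z0) z0 \<noteq> 0" by (elim bexE conjE)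
    define T where "T = Re (G \<kappa> ((M ^^ n) z0) z0)"
    have T: "G \<kappa> ((M ^^ n) z0) z0 = of_real T" unfolding T_def using Gr[OF Mr[OF z0(1,2)] z0(2)] by (simp add: complex_eq_iff)
    have T0: "T \<noteq> 0" using T z0(3) by auto
    \<comment> \<open>Scales the top value to absolute value 1; its sign cannot be changed.\<close>
    define c where "c = complex_of_real (1 / sqrt \<bar>T\<bar>)"
    define z1 where "z1 = c *s z0"
    have z1E: "z1 \<in> E \<kappa>" unfolding z1_def by (rule subspace_scale[OF subE z0(1)])
    have z1r: "cj z1 = z1" unfolding z1_def cj_sc z0(2) c_def by simp
    have cc: "c * cnj c = of_real (1 / \<bar>T\<bar>)" unfolding c_def by (simp flip: of_real_mult)
    have "G \<kappa> ((M ^^ n) z1) z1 = (c * cnj c) * of_real T"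
      unfolding z1_def linD(3)[OF lin_funpow[OF linM] z0(1)] G_simps T by simp
    also have "\<dots> = of_real (sgn T)" unfolding cc using T0 by (simp add: sgn_if abs_if)
    finally have T1: "G \<kappa> ((M ^^ n) z1) z1 = of_real (sgn T)" .
    have "\<exists>z\<in>{z \<in> E \<kappa>. cj z = z}. G \<kappa> ((M ^^ n) z) z = G \<kappa> ((M ^^ n) z1) z1 \<and> (\<forall>m<n. G \<kappa> ((M ^^ m) z) z = 0)"
    proof (rule straighten[OF nil])
      show "{z \<in> E \<kappa>. cj z = z} \<subseteq> E \<kappa>" by blast
      show "z1 \<in> {z \<in> E \<kappa>. cj z = z}" using z1E z1r by blast
      show "G \<kappa> ((M ^^ n) z1) z1 \<noteq> 0" unfolding T1 using T0 by (simp add: sgn_if)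
      fix z m t assume zt: "z \<in> {z \<in> E \<kappa>. cj z = z}" "t = - (G \<kappa> ((M ^^ m) z) z / (2 * G \<kappa> ((M ^^ n) z) z))"
      hence z: "z \<in> E \<kappa>" "cj z = z" by auto
      have "cnj t = t" unfolding zt(2) using Gr[OF Mr[OF z] z(2)] by simp
      hence "cj (z + t *s (M ^^ (n - m)) z) = z + t *s (M ^^ (n - m)) z"
        unfolding cj_add cj_sc Mr[OF z] z(2) by simp
      moreover have "z + t *s (M ^^ (n - m)) z \<in> E \<kappa>"
        by (rule subspace_add[OF subE z(1) subspace_scale[OF subE MEp[OF z(1)]]])
      ultimately show "z + t *s (M ^^ (n - m)) z \<in> {z \<in> E \<kappa>. cj z = z}" by blast
    qed
    then obtain z where z: "z \<in> E \<kappa>" "cj z = z" "G \<kappa> ((M ^^ n) z) z = of_real (sgn T)"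
      and zz: "\<forall>m<n. G \<kappa> ((M ^^ m) z) z = 0" unfolding T1 by blast
    let ?s = "(-1) ^ n * sgn T"
    have s1: "?s = 1 \<or> ?s = -1" using T0 by (cases "even n") (auto simp: sgn_if)
    have "summand (fs n z) (Gsgn ?s (Suc n))"
      by (rule real_summand[OF nil z(1) zz r z(2)]) (use z(3) s1 in auto)
    moreover have "Gsgn ?s (Suc n) \<in> type_ii"
    proof -
      have "?s \<cdot>\<^sub>m 1\<^sub>m 1 \<in> N_mats" using s1 unfolding N_mats_def by (auto intro!: eq_matI)
      thus ?thesis unfolding type_ii_def Gsgn_def by fastforce
    qed
    ultimately show ?thesis by blast
  next
    case False
    have "\<exists>z\<in>E \<kappa>. G \<kappa> ((M ^^ n) z) z \<noteq> 0 \<and> (\<forall>i j. B ((M ^^ i) z) ((M ^^ j) z) = 0)"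
    proof (cases "cnj \<kappa> = \<kappa>")
      case True
      have cE: "cj z \<in> E \<kappa>" if "z \<in> E \<kappa>" for z using E_cj[OF that] True by simp
      obtain z0 where z0: "z0 \<in> E \<kappa>" "G \<kappa> ((M ^^ n) z0) z0 \<noteq> 0" using polarize[OF x1(1) y1] by (elim bexE)
      have "\<kappa> * \<kappa> = 1" using k1 True by simp
      hence "\<kappa> = 1 \<or> \<kappa> = -1" by (simp add: square_eq_1_iff)
      hence "\<kappa> * (-1) ^ n = -1" using False True by (cases "even n") auto
      have "\<exists>z\<in>E \<kappa>. G \<kappa> ((M ^^ n) z) z \<noteq> 0 \<and> (\<forall>m. G \<kappa> ((M ^^ m) z) (cj z) = 0)"
        by (rule isotropic[OF True \<open>\<kappa> * (-1) ^ n = -1\<close> _ z0]) (rule nil)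
      then obtain z where z: "z \<in> E \<kappa>" "G \<kappa> ((M ^^ n) z) z \<noteq> 0"
        and zb: "\<forall>m. G \<kappa> ((M ^^ m) z) (cj z) = 0" by (elim bexE conjE)
      have "B ((M ^^ i) z) ((M ^^ j) z) = 0" for i j
      proof -
        have "B ((M ^^ i) z) ((M ^^ j) z) = B ((M ^^ i) z) (cj ((M ^^ j) (cj z)))" unfolding M_cj_pow[OF True z(1)] by simp
        also have "\<dots> = G \<kappa> ((M ^^ i) z) ((M ^^ j) (cj z)) - G \<kappa> ((M ^^ Suc i) z) ((M ^^ j) (cj z))"
          unfolding h_G[OF MEp[OF z(1)] MEp[OF cE[OF z(1)]]] by simp
        also have "\<dots> = 0" unfolding G_pow2[OF z(1) cE[OF z(1)]] zb[rule_format] by simp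
        finally show ?thesis .
      qed
      thus ?thesis using z by blast
    next
      case False
      obtain z where z: "z \<in> E \<kappa>" "G \<kappa> ((M ^^ n) z) z \<noteq> 0" using polarize[OF x1(1) y1] by (elim bexE)
      \<comment> \<open>For non-real \<kappa> isotropy is free: \<open>orth\<close> applied to
        \<open>E \<kappa>\<close> with itself.\<close>
      have "\<kappa> * \<kappa> \<noteq> 1"
      proof
        assume "\<kappa> * \<kappa> = 1"
        hence "\<kappa> = 1 \<or> \<kappa> = -1" by (simp add: square_eq_1_iff)
        thus False using False by auto
      qed
      hence "B ((M ^^ i) z) ((M ^^ j) z) = 0" for i j by (rule orth[OF _ MEp[OF z(1)] MEp[OF z(1)]])
      thus ?thesis using z by blast
    qed
    then obtain z0 where z0: "z0 \<in> E \<kappa>" "G \<kappa> ((M ^^ n) z0) z0 \<noteq> 0" "\<forall>i j. B ((M ^^ i) z0) ((M ^^ j) z0) = 0"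
      by (elim bexE conjE)
    define T where "T = G \<kappa> ((M ^^ n) z0) z0"
    \<comment> \<open>Absolute value 2 for the top value, because the cell has entries Re w / 2 and
      Im w / 2 whose squares must add up to 1.\<close>
    define c where "c = complex_of_real (sqrt (2 / cmod T))"
    define z1 where "z1 = c *s z0"
    have cT: "cmod T > 0" unfolding T_def using z0 by simp
    have cc: "c * cnj c = of_real (2 / cmod T)" unfolding c_def by (simp flip: of_real_mult)
    have Mz1: "(M ^^ j) z1 = c *s (M ^^ j) z0" for j unfolding z1_def by (rule linD(3)[OF lin_funpow[OF linM] z0(1)])
    have "G \<kappa> ((M ^^ n) z1) z1 = (c * cnj c) * T"
      unfolding Mz1 T_def by (simp add: z1_def G_simps)
    hence T1: "cmod (G \<kappa> ((M ^^ n) z1) z1) = 2" unfolding cc using cT by (simp add: norm_mult norm_divide)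
    let ?D = "{z \<in> E \<kappa>. \<forall>i j. B ((M ^^ i) z) ((M ^^ j) z) = 0}"
    have "\<exists>z\<in>?D. G \<kappa> ((M ^^ n) z) z = G \<kappa> ((M ^^ n) z1) z1 \<and> (\<forall>m<n. G \<kappa> ((M ^^ m) z) z = 0)"
    proof (rule straighten[OF nil])
      show "?D \<subseteq> E \<kappa>" by blast
      have "z1 \<in> E \<kappa>" unfolding z1_def by (rule subspace_scale[OF subE z0(1)])
      moreover have "B ((M ^^ i) z1) ((M ^^ j) z1) = 0" for i j
        unfolding Mz1 B_scl B_scr z0(3)[rule_format] by simp
      ultimately show "z1 \<in> ?D" by blast
      show "G \<kappa> ((M ^^ n) z1) z1 \<noteq> 0" using T1 by auto
      fix z m and t :: complex assume z: "z \<in> ?D"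
      hence zE: "z \<in> E \<kappa>" and b: "\<And>i j. B ((M ^^ i) z) ((M ^^ j) z) = 0" by auto
      let ?a = "n - m"
      have pE: "(M ^^ ?a) z \<in> E \<kappa>" "t *s (M ^^ ?a) z \<in> E \<kappa>" using MEp[OF zE] subspace_scale[OF subE] by auto
      have "(M ^^ j) (z + t *s (M ^^ ?a) z) = (M ^^ j) z + t *s (M ^^ (j + ?a)) z" for j
        unfolding linD(2)[OF lin_funpow[OF linM] zE pE(2)] linD(3)[OF lin_funpow[OF linM] pE(1)] by (simp add: funpow_add)
      hence "B ((M ^^ i) (z + t *s (M ^^ ?a) z)) ((M ^^ j) (z + t *s (M ^^ ?a) z)) = 0" for i j
        by (simp add: B_simps b)
      moreover have "z + t *s (M ^^ ?a) z \<in> E \<kappa>" by (rule subspace_add[OF subE zE pE(2)])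
      ultimately show "z + t *s (M ^^ ?a) z \<in> ?D" by blast
    qed
    then obtain z where z: "z \<in> E \<kappa>" "\<forall>i j. B ((M ^^ i) z) ((M ^^ j) z) = 0" "G \<kappa> ((M ^^ n) z) z = G \<kappa> ((M ^^ n) z1) z1"
      and zz: "\<forall>m<n. G \<kappa> ((M ^^ m) z) z = 0" by blast
    define w where "w = (-1) ^ n * G \<kappa> ((M ^^ n) z) z"
    have cw: "cmod w = 2" unfolding w_def z(3) norm_mult T1 by (simp add: norm_power)
    \<comment> \<open>A real \<open>w\<close> would force \<open>\<kappa> * (-1) ^ n = 1\<close> by
      hermitian symmetry, so \<kappa> would be real too: the case already treated.\<close>
    have Im: "Im w \<noteq> 0"
    proof
      assume "Im w = 0"
      hence "cnj w = w" by (simp add: complex_eq_iff)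
      moreover have "cnj w = \<kappa> * (-1) ^ n * w" unfolding w_def using herm_top[OF z(1) z(1)] by simp
      ultimately have "\<kappa> * (-1) ^ n * w = 1 * w" by simp
      moreover have "w \<noteq> 0" using cw by auto
      ultimately have k1n: "\<kappa> * (-1) ^ n = 1" by (simp only: mult_cancel_right) simp
      moreover have "cnj \<kappa> = \<kappa>"
      proof -
        have "\<kappa> = \<kappa> * ((-1) ^ n * (-1) ^ n)" unfolding minus_one_sq by simp
        also have "\<dots> = (-1) ^ n" unfolding mult.assoc[symmetric] k1n by simp
        finally show ?thesis by simp
      qed
      ultimately show False using False by blast
    qed
    define \<sigma> :: real where "\<sigma> = (if Im w < 0 then 1 else -1)"
    have s: "\<sigma> * \<sigma> = 1" "- \<sigma> * Im w / 2 > 0" unfolding \<sigma>_def using Im by auto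
    have "summand (rlist 1 (of_real \<sigma>) (fs n z)) (Gamma_mat (Suc n) \<otimes>\<^sub>K C_mat (Re w / 2) (- \<sigma> * Im w / 2))"
      by (rule complex_summand[OF nil z(1) zz z(2)[rule_format] s(1) w_def Im])
    moreover have "(Re w / 2)\<^sup>2 + (- \<sigma> * Im w / 2)\<^sup>2 = 1"
    proof -
      have "(- \<sigma> * Im w / 2)\<^sup>2 = (\<sigma> * \<sigma>) * (Im w)\<^sup>2 / 4" by (simp add: power2_eq_square)
      hence "(Re w / 2)\<^sup>2 + (- \<sigma> * Im w / 2)\<^sup>2 = ((Re w)\<^sup>2 + (Im w)\<^sup>2) / 4" unfolding s(1) by (simp add: power2_eq_square add_divide_distrib)
      also have "\<dots> = 1" unfolding cmod_power2[symmetric] cw by simp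
      finally show ?thesis .
    qed
    hence "C_mat (Re w / 2) (- \<sigma> * Im w / 2) \<in> N_mats" unfolding N_mats_def using s(2) by blast
    hence "Gamma_mat (Suc n) \<otimes>\<^sub>K C_mat (Re w / 2) (- \<sigma> * Im w / 2) \<in> type_ii" unfolding type_ii_def by fastforce
    ultimately show ?thesis by blast
  qed
qed

end
end

section \<open>Degenerate forms\<close>

context cform
begin

section \<open>Canonical form of a nondegenerate form\<close>

lemma rgram_Nil: "rgram [] (diag_block_mat [])" unfolding rgram_def by simp

lemma rgram_diag_Cons:
  assumes "rgram us M" "rgram ws (diag_block_mat Bs)"
    and "\<And>u w. u \<in> set us \<Longrightarrow> w \<in> set ws \<Longrightarrow> B u w = 0 \<and> B w u = 0"
  shows "rgram (us @ ws) (diag_block_mat (M # Bs))"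
  using rgram_append[OF assms] by (simp add: Let_def)

text \<open>Any eigenvector of \<tau> yields a summand to split off. An eigenvalue outside the unit
  disc is traded for its inverse: the dual chain starts at a nonzero vector of
  \<open>F \<kappa>\<close>, which lies in \<open>E (1 / \<kappa>)\<close>.\<close>

theorem regular_canonical:
  assumes "nondeg (*s) cj B V"
  shows "\<exists>es Bs. rbasis V es \<and> rgram es (diag_block_mat Bs) \<and> set Bs \<subseteq> type_ii \<union> type_iii \<union> type_iv"
  using assms
proof (induction "dim V" arbitrary: V rule: less_induct)
  case less
  interpret V: nondeg "(*s)" cj B V by (rule less.prems)
  show ?case
  proof (cases "V = {0}")
    case True
    have "rbasis V []" unfolding rbasis_def True by simp
    thus ?thesis using rgram_Nil by (intro exI[of _ "[]"]) auto
  next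
    case False
    then obtain v where v: "v \<in> V" "v \<noteq> 0" using subspace_0[OF V.sV] by auto
    obtain \<tau> \<rho> where "asym (*s) cj B V \<tau> \<rho>" using V.asym_exists by (elim exE)
    then interpret A: asym "(*s)" cj B V \<tau> \<rho> .
    obtain \<kappa> x where x: "x \<in> V" "x \<noteq> 0" "\<tau> x = \<kappa> *s x" using eigen_exists[OF V.fV A.\<tau>(1) v] by (elim exE bexE conjE)
    have "(A.N \<kappa> ^^ 1) x = 0" unfolding A.N_def x(3) by (simp add: A.N_def x(3))
    hence xE: "x \<in> A.E \<kappa>" unfolding A.E_def using x(1) by blast
    have "\<exists>us M. A.summand us M \<and> M \<in> type_ii \<union> type_iii \<union> type_iv"
    proof (cases "cmod \<kappa>" "1::real" rule: linorder_cases)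
      case less
      show ?thesis using A.hyper_step[OF xE x(2) less] by blast
    next
      case equal
      have "\<kappa> * cnj \<kappa> = 1" using complex_norm_square[of \<kappa>] equal by simp
      thus ?thesis using A.unit_step[OF _ xE x(2)] by blast
    next
      case greater
      obtain n x' y where y: "y \<in> A.F \<kappa>" "\<forall>m. B ((A.N \<kappa> ^^ m) x') y = (if m = n then 1 else 0)"
        using A.hyper_chain[OF xE x(2)] by (elim exE conjE)
      have "B ((A.N \<kappa> ^^ n) x') y = 1" using y(2) by simp
      hence y0: "y \<noteq> 0" by auto
      have k0: "\<kappa> \<noteq> 0" using greater by auto
      have yE: "y \<in> A.E (1 / \<kappa>)" by (rule set_mp[OF A.FE[OF k0] y(1)])
      have "cmod (1 / \<kappa>) < 1" using greater by (auto simp: norm_divide divide_less_eq_1)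
      from A.hyper_step[OF yE y0 this] show ?thesis by blast
    qed
    then obtain us M where us: "A.summand us M" "M \<in> type_ii \<union> type_iii \<union> type_iv" by (elim exE conjE)
    have u: "us \<noteq> []" "set us \<subseteq> V" "rgram us M" "nonsing M"
      and ur: "\<And>u. u \<in> set us \<Longrightarrow> cj u = u" "\<And>u. u \<in> set us \<Longrightarrow> \<tau> u \<in> span (set us)"
      using us(1) unfolding A.summand_def by auto
    obtain W where W: "nondeg (*s) cj B W" "\<forall>u\<in>set us. \<forall>w\<in>W. B u w = 0 \<and> B w u = 0"
       "\<forall>ws. rbasis W ws \<longrightarrow> rbasis V (us @ ws)"
    proof -
      have "\<exists>W. nondeg (*s) cj B W \<and> (\<forall>u\<in>set us. \<forall>w\<in>W. B u w = 0 \<and> B w u = 0) \<and>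
        (\<forall>ws. rbasis W ws \<longrightarrow> rbasis V (us @ ws))"
        by (rule A.split_off[OF u(2) _ u(3,4)]) (rule ur, assumption)+
      thus ?thesis using that by (elim exE conjE)
    qed
    obtain w0 where w0: "rbasis W w0" using rbasis_exists[OF nondeg.csV[OF W(1)]] by (elim exE)
    have "dim W < dim V"
    proof -
      have "length us > 0" using u(1) by simp
      thus ?thesis using rbasis_dim[OF w0] rbasis_dim[OF W(3)[rule_format, OF w0]]
        unfolding length_append by linarith
    qed
    from less.hyps[OF this W(1)] obtain es Bs where es: "rbasis W es" "rgram es (diag_block_mat Bs)"
      "set Bs \<subseteq> type_ii \<union> type_iii \<union> type_iv" by (elim exE conjE)
    have "rbasis V (us @ es)" using W(3) es(1) by simp
    moreover have "rgram (us @ es) (diag_block_mat (M # Bs))"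
      by (rule rgram_diag_Cons[OF u(3) es(2)]) (use W(2) rbasisD(4)[OF es(1)] in blast)
    moreover have "set (M # Bs) \<subseteq> type_ii \<union> type_iii \<union> type_iv" using us(2) es(3) by simp
    ultimately show ?thesis by blast
  qed
qed

subsection \<open>Splitting off the nilpotent Jordan blocks\<close>

definition chains_gram :: "'v list list \<Rightarrow> bool" where
  "chains_gram ess \<longleftrightarrow> (\<forall>a<length ess. \<forall>b<length ess. \<forall>i<length (ess ! a). \<forall>j<length (ess ! b).
     B (ess ! a ! i) (ess ! b ! j) = (if a = b \<and> Suc i = j then 1 else 0))"

text \<open>\<open>rs\<close> spans the nondegenerate part, orthogonal on both sides to the chains.
  The last vector of each chain lies in the left kernel; a chain of length 1 is a 1 x 1 zero
  block.\<close>

definition jdec :: "'v set \<Rightarrow> 'v list \<Rightarrow> 'v list list \<Rightarrow> bool" where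
  "jdec V rs ess \<longleftrightarrow> rbasis V (rs @ concat ess) \<and> nondeg (*s) cj B (span (set rs)) \<and>
     (\<forall>u\<in>set rs. \<forall>e\<in>set (concat ess). B u e = 0 \<and> B e u = 0) \<and> chains_gram ess \<and> [] \<notin> set ess"

lemma chains_gram_diag:
  "chains_gram ess \<Longrightarrow> rgram (concat ess) (diag_block_mat (map (\<lambda>e. jordan_block (length e) 0) ess))"
proof (induction ess)
  case Nil show ?case using rgram_Nil by simp
next
  case (Cons e ess)
  have "chains_gram ess" unfolding chains_gram_def
  proof (intro allI impI)
    fix a b i j assume "a < length ess" "b < length ess" "i < length (ess ! a)" "j < length (ess ! b)"
    thus "B (ess ! a ! i) (ess ! b ! j) = (if a = b \<and> Suc i = j then 1 else 0)"
      using Cons.prems[unfolded chains_gram_def, rule_format, of "Suc a" "Suc b" i j] by simp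
  qed
  hence 1: "rgram (concat ess) (diag_block_mat (map (\<lambda>e. jordan_block (length e) 0) ess))" by (rule Cons.IH)
  have 2: "rgram e (jordan_block (length e) 0)" unfolding rgram_def
    using Cons.prems[unfolded chains_gram_def, rule_format, of 0 0] by (auto simp: jordan_block_def)
  have 3: "B u w = 0 \<and> B w u = 0" if uw: "u \<in> set e" "w \<in> set (concat ess)" for u w
  proof -
    obtain i where i: "i < length e" "u = e ! i" using uw(1) by (auto simp: in_set_conv_nth)
    obtain f where f: "f \<in> set ess" "w \<in> set f" using uw(2) by auto
    obtain b where b: "b < length ess" "f = ess ! b" using f(1) by (auto simp: in_set_conv_nth)
    obtain j where j: "j < length f" "w = f ! j" using f(2) by (auto simp: in_set_conv_nth)
    show ?thesis using Cons.prems[unfolded chains_gram_def, rule_format, of 0 "Suc b" i j]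
        Cons.prems[unfolded chains_gram_def, rule_format, of "Suc b" 0 j i] i b j by simp
  qed
  have "rgram (e @ concat ess) (diag_block_mat (jordan_block (length e) 0 # map (\<lambda>e. jordan_block (length e) 0) ess))"
    by (rule rgram_diag_Cons[OF 2 1 3])
  thus ?case by simp
qed

lemma independent_indl: assumes "independent (set es)" "distinct es" shows "indl es"
  unfolding indl_def
proof (intro allI impI)
  fix c i assume h: "lc es c = 0" "i < length es"
  define idx where "idx = (\<lambda>x. THE i. i < length es \<and> es ! i = x)"
  have idx: "idx (es ! i) = i" if "i < length es" for i
    unfolding idx_def by (rule the_equality) (use that assms(2) in \<open>auto simp: nth_eq_iff_index_eq\<close>)
  have "(\<Sum>x\<in>set es. c (idx x) *s x) = (\<Sum>i<length es. c (idx (es ! i)) *s es ! i)"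
    using assms(2) by (intro sum.reindex_bij_betw[OF bij_betw_nth, symmetric]) auto
  also have "\<dots> = lc es c" unfolding lc_def by (rule sum.cong) (auto simp: idx)
  finally have "(\<Sum>x\<in>set es. c (idx x) *s x) = 0" using h(1) by simp
  from independentD[OF assms(1) finite_set subset_refl this, of "es ! i"] show "c i = 0" using h(2) idx by simp
qed

lemma spanning_length_indl:
  assumes bs: "rbasis V bs" and es: "set es \<subseteq> V" "V \<subseteq> span (set es)" "length es \<le> length bs"
  shows "indl es"
proof -
  have le: "length bs \<le> card T" if "finite T" "V \<subseteq> span T" for T
    by (rule indl_length[OF rbasisD(1)[OF bs] _ that(1)]) (use rbasisD(4)[OF bs] that(2) in blast)
  have "length es \<le> card (set es)" using le[OF finite_set es(2)] es(3) by simp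
  hence d: "distinct es" by (simp add: card_distinct card_length le_antisym)
  have "independent (set es)"
  proof (rule ccontr)
    assume "\<not> ?thesis"
    then obtain a where a: "a \<in> set es" "a \<in> span (set es - {a})" unfolding dependent_def by blast
    have "span (set es) \<subseteq> span (set es - {a})"
    proof (rule span_minimal[OF _ subspace_span])
      show "set es \<subseteq> span (set es - {a})" using a(2) span_base[of _ "set es - {a}"] by blast
    qed
    hence "length bs \<le> card (set es - {a})" using le[of "set es - {a}"] es(2) by blast
    also have "\<dots> < card (set es)" using a(1) by (intro psubset_card_mono) auto
    also have "\<dots> \<le> length es" by (rule card_length)
    finally show False using es(3) by simp
  qed
  thus ?thesis using d by (rule independent_indl)
qed

lemma span_append_split:
  assumes "x \<in> span (set (es @ fs))" obtains a b where "x = a + b" "a \<in> span (set es)" "b \<in> span (set fs)"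
proof -
  obtain c where c: "x = lc (es @ fs) c" by (rule span_listE[OF assms refl])
  show ?thesis by (rule that[OF c[unfolded lc_append] lc_span lc_span])
qed

text \<open>The induction step. Let L be the left kernel and V1 the set of \<open>v\<close> with
  \<open>B v l = 0\<close> for all l in L; V1 contains L, and \<open>W\<close> is a complement of L
  in V1, already decomposed. A complement of V1 in \<open>V\<close> is paired with part of L, and
  each chain of \<open>W\<close> is continued by one vector of that complement and its partner in
  L.\<close>

context
  fixes V rs ess W ls0
  assumes V: "csub V"
    and W: "W \<subseteq> V" and dec: "jdec W rs ess"
    and ls0: "rbasis {l \<in> V. \<forall>v\<in>V. B l v = 0} ls0"
    and V1: "rbasis {v \<in> V. \<forall>l\<in>{l \<in> V. \<forall>v\<in>V. B l v = 0}. B v l = 0} (ls0 @ rs @ concat ess)"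
begin

definition "L = {l \<in> V. \<forall>v\<in>V. B l v = 0}"
definition "VW = {v \<in> V. \<forall>w\<in>W. B w v = 0}"

lemma wb: "rbasis W (rs @ concat ess)" and nd: "nondeg (*s) cj B (span (set rs))"
  and ortho: "\<And>u e. u \<in> set rs \<Longrightarrow> e \<in> set (concat ess) \<Longrightarrow> B u e = 0 \<and> B e u = 0"
  and cg: "\<And>a b i j. a < length ess \<Longrightarrow> b < length ess \<Longrightarrow> i < length (ess ! a) \<Longrightarrow> j < length (ess ! b) \<Longrightarrow>
     B (ess ! a ! i) (ess ! b ! j) = (if a = b \<and> Suc i = j then 1 else 0)"
  and ne: "[] \<notin> set ess"
proof -
  show "rbasis W (rs @ concat ess)" "nondeg (*s) cj B (span (set rs))" "[] \<notin> set ess"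
    using dec unfolding jdec_def by blast+
  have o: "\<forall>u\<in>set rs. \<forall>e\<in>set (concat ess). B u e = 0 \<and> B e u = 0" and c: "chains_gram ess"
    using dec unfolding jdec_def by blast+
  show "B u e = 0 \<and> B e u = 0" if "u \<in> set rs" "e \<in> set (concat ess)" for u e using o that by blast
  show "B (ess ! a ! i) (ess ! b ! j) = (if a = b \<and> Suc i = j then 1 else 0)"
    if "a < length ess" "b < length ess" "i < length (ess ! a)" "j < length (ess ! b)" for a b i j
    by (rule c[unfolded chains_gram_def, rule_format, OF that])
qed

lemma sV: "subspace V" by (rule csub_subspace[OF V])
lemma LV: "L \<subseteq> V" unfolding L_def by blast
lemma L0: "l \<in> L \<Longrightarrow> v \<in> V \<Longrightarrow> B l v = 0" unfolding L_def by blast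
lemma csL: "csub L" unfolding L_def by (rule rbasisD(6)[OF ls0])
lemma spL: "span (set ls0) = L" unfolding L_def by (rule rbasisD(2)[OF ls0])
lemma spW: "span (set (rs @ concat ess)) = W" by (rule rbasisD(2)[OF wb])
lemma csW: "csub W" by (rule rbasisD(6)[OF wb])
lemma spV1: "span (set (ls0 @ rs @ concat ess)) = {v \<in> V. \<forall>l\<in>L. B v l = 0}"
  unfolding L_def by (rule rbasisD(2)[OF V1])
lemma WL: assumes "w \<in> W" "l \<in> L" shows "B w l = 0"
proof -
  have "W \<subseteq> span (set (ls0 @ rs @ concat ess))" unfolding spW[symmetric] by (rule span_mono) auto
  hence "w \<in> {v \<in> V. \<forall>l\<in>L. B v l = 0}" using assms(1) unfolding spV1 by (rule set_mp)
  thus ?thesis using assms(2) by simp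
qed

lemma WL0: assumes "w \<in> W" "w \<in> L" shows "w = 0"
proof -
  have "w \<in> span (set ls0) \<inter> span (set (rs @ concat ess))" unfolding spL spW using assms by (intro IntI)
  thus ?thesis using set_mp[OF indl_appendD(3)[OF rbasisD(1)[OF V1]]] by simp
qed

text \<open>As \<open>W\<close> meets \<open>L\<close> only in 0, the functionals \<open>B w\<close>
  on \<open>V\<close> for a basis of \<open>W\<close> are independent, and
  \<open>dual_family_real\<close> applies.\<close>

lemma dual_w: assumes "e0 \<in> set (rs @ concat ess)"
  shows "\<exists>d\<in>V. cj d = d \<and> (\<forall>e\<in>set (rs @ concat ess). B e d = (if e = e0 then 1 else 0))"
proof -
  let ?w = "rs @ concat ess"
  have "\<exists>s. \<forall>j<length ?w. s j \<in> V \<and> cj (s j) = s j \<and> (\<forall>i<length ?w. B (?w ! i) (s j) = (if i = j then 1 else 0))"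
  proof (rule dual_family_real[OF V])
    show "linf V (B (?w ! i))" for i unfolding linf_def by (auto simp: B_simps)
    show "B (?w ! i) (cj v) = cnj (B (?w ! i) v)" if "i < length ?w" for i v
      using B_cj[of "?w ! i" v] rbasisD(3)[OF wb nth_mem[OF that]] by simp
    fix c assume h: "\<And>v. v \<in> V \<Longrightarrow> (\<Sum>i<length ?w. c i * B (?w ! i) v) = 0"
    have "lc ?w c \<in> W" using lc_span[of ?w c] spW by simp
    moreover have "lc ?w c \<in> L" unfolding L_def using \<open>lc ?w c \<in> W\<close> W h by (auto simp: lc_def B_suml B_scl)
    ultimately have "lc ?w c = 0" by (rule WL0)
    thus "\<forall>i<length ?w. c i = 0" using rbasisD(1)[OF wb] unfolding indl_def by blast
  qed
  then obtain s where s: "\<And>j. j < length ?w \<Longrightarrow> s j \<in> V \<and> cj (s j) = s j"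
    "\<And>i j. j < length ?w \<Longrightarrow> i < length ?w \<Longrightarrow> B (?w ! i) (s j) = (if i = j then 1 else 0)" by blast
  obtain j where j: "j < length ?w" "?w ! j = e0" using assms[unfolded in_set_conv_nth] by (elim exE conjE)
  have "B e (s j) = (if e = e0 then 1 else 0)" if em: "e \<in> set ?w" for e
  proof -
    obtain i where i: "i < length ?w" "?w ! i = e" using em[unfolded in_set_conv_nth] by (elim exE conjE)
    show ?thesis using s(2)[OF j(1) i(1)] i j nth_eq_iff_index_eq[OF indl_distinct[OF rbasisD(1)[OF wb]] i(1) j(1)] by auto
  qed
  hence "\<forall>e\<in>set ?w. B e (s j) = (if e = e0 then 1 else 0)" by (rule ballI)
  with s(1)[OF j(1)] show ?thesis by (intro bexI[of _ "s j"]) simp_all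
qed

text \<open>The future successor of the last vector of chain \<open>a\<close>: it is seen by that
  vector alone among the basis of \<open>W\<close>.\<close>

definition "yy = (\<lambda>a. SOME d. d \<in> V \<and> cj d = d \<and> (\<forall>e\<in>set (rs @ concat ess). B e d = (if e = last (ess ! a) then 1 else 0)))"

lemma mem_ess: "a < length ess \<Longrightarrow> i < length (ess ! a) \<Longrightarrow> ess ! a ! i \<in> set (concat ess)"
  by (auto intro: nth_mem)

lemma ess_len: "a < length ess \<Longrightarrow> 0 < length (ess ! a)"
  using ne nth_mem[of a ess] by (cases "ess ! a") auto

lemma last_mem: assumes "a < length ess" shows "last (ess ! a) = ess ! a ! (length (ess ! a) - 1)" "last (ess ! a) \<in> set (concat ess)"
proof -
  show l: "last (ess ! a) = ess ! a ! (length (ess ! a) - 1)" using ess_len[OF assms] by (intro last_conv_nth) auto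
  show "last (ess ! a) \<in> set (concat ess)" unfolding l using mem_ess[OF assms] ess_len[OF assms] by simp
qed

lemma yy: assumes "a < length ess"
  shows "yy a \<in> V" "cj (yy a) = yy a" "\<And>e. e \<in> set (rs @ concat ess) \<Longrightarrow> B e (yy a) = (if e = last (ess ! a) then 1 else 0)"
proof -
  have "\<exists>d. d \<in> V \<and> cj d = d \<and> (\<forall>e\<in>set (rs @ concat ess). B e d = (if e = last (ess ! a) then 1 else 0))"
  proof -
    have "last (ess ! a) \<in> set (rs @ concat ess)" using last_mem(2)[OF assms] by simp
    from dual_w[OF this] show ?thesis unfolding Bex_def .
  qed
  from someI_ex[OF this] show "yy a \<in> V" "cj (yy a) = yy a"
    "\<And>e. e \<in> set (rs @ concat ess) \<Longrightarrow> B e (yy a) = (if e = last (ess ! a) then 1 else 0)"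
    unfolding yy_def by blast+
qed

lemma ess_inj: assumes "a < length ess" "b < length ess" "i < length (ess ! a)" "j < length (ess ! b)"
  "ess ! a ! i = ess ! b ! j" shows "a = b \<and> i = j"
proof -
  have d: "distinct (concat ess)" using indl_distinct[OF rbasisD(1)[OF wb]] by simp
  have ab: "a = b"
  proof (rule ccontr)
    assume "a \<noteq> b"
    hence "set (ess ! a) \<inter> set (ess ! b) = {}" using d assms(1,2) ne
      by (metis distinct_concat_iff nth_eq_iff_index_eq nth_mem removeAll_id)
    thus False using assms(3,4,5) nth_mem by (metis disjoint_iff)
  qed
  have "distinct (ess ! a)" using d assms(1) by (simp add: distinct_concat_iff)
  thus ?thesis using ab assms by (simp add: nth_eq_iff_index_eq)
qed

lemma e_y: assumes "a < length ess" "b < length ess" "i < length (ess ! a)"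
  shows "B (ess ! a ! i) (yy b) = (if a = b \<and> Suc i = length (ess ! b) then 1 else 0)"
proof -
  have m: "ess ! a ! i \<in> set (rs @ concat ess)" using mem_ess[OF assms(1,3)] by simp
  have "ess ! a ! i = last (ess ! b) \<longleftrightarrow> a = b \<and> Suc i = length (ess ! b)"
  proof
    assume "ess ! a ! i = last (ess ! b)"
    hence "a = b \<and> i = length (ess ! b) - 1" unfolding last_mem(1)[OF assms(2)]
      using ess_inj[OF assms(1,2,3), of "length (ess ! b) - 1"] ess_len[OF assms(2)] by simp
    thus "a = b \<and> Suc i = length (ess ! b)" using ess_len[OF assms(2)] by simp
  next
    assume h: "a = b \<and> Suc i = length (ess ! b)"
    hence "length (ess ! b) - 1 = i" by (metis diff_Suc_1)
    thus "ess ! a ! i = last (ess ! b)" unfolding last_mem(1)[OF assms(2)] using h by simp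
  qed
  thus ?thesis unfolding yy(3)[OF assms(2) m] by simp
qed

lemma rs_y: assumes "u \<in> set rs" "b < length ess" shows "B u (yy b) = 0"
proof -
  have "u \<noteq> last (ess ! b)"
    using indl_distinct[OF rbasisD(1)[OF wb]] assms(1) last_mem(2)[OF assms(2)] by auto
  thus ?thesis using yy(3)[OF assms(2), of u] assms(1) by simp
qed

definition "Ys = map yy [0..<length ess]"

lemma Ys_nth: "a < length ess \<Longrightarrow> Ys ! a = yy a" and Ys_len: "length Ys = length ess" unfolding Ys_def by auto
lemma Ys_V: "set Ys \<subseteq> V" unfolding Ys_def using yy(1) by auto

text \<open>Every functional on \<open>W\<close> is represented by a vector of \<open>W\<close> plus a combination of the \<open>yy a\<close>.\<close>

lemma represent: assumes "e0 \<in> set (rs @ concat ess)"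
  shows "\<exists>u\<in>span (W \<union> set Ys). \<forall>e\<in>set (rs @ concat ess). B e u = (if e = e0 then 1 else 0)"
proof -
  have WS: "W \<subseteq> span (W \<union> set Ys)" "set Ys \<subseteq> span (W \<union> set Ys)" using span_base by blast+
  have dis: "distinct (rs @ concat ess)" by (rule indl_distinct[OF rbasisD(1)[OF wb]])
  show ?thesis
  proof (cases "e0 \<in> set rs")
    case True
    interpret R: nondeg "(*s)" cj B "span (set rs)" by (rule nd)
    have ir: "indl rs" by (rule indl_appendD(1)[OF rbasisD(1)[OF wb]])
    obtain s where s: "\<forall>j<length rs. s j \<in> span (set rs) \<and> (\<forall>i<length rs. B (rs ! i) (s j) = (if i = j then 1 else 0))"
      using R.dual_basis[OF ir span_superset] by (elim exE)
    obtain j where j: "j < length rs" "rs ! j = e0" using True by (auto simp: in_set_conv_nth)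
    have sR: "s j \<in> span (set rs)" using s j by blast
    have "span (set rs) \<subseteq> W" unfolding spW[symmetric] by (rule span_mono) auto
    hence 1: "s j \<in> span (W \<union> set Ys)" using sR WS by blast
    have "B e (s j) = (if e = e0 then 1 else 0)" if e: "e \<in> set (rs @ concat ess)" for e
    proof (cases "e \<in> set rs")
      case True
      then obtain i where i: "i < length rs" "rs ! i = e" by (auto simp: in_set_conv_nth)
      have "B (rs ! i) (s j) = (if i = j then 1 else 0)" using s i j by blast
      thus ?thesis using i j nth_eq_iff_index_eq[OF indl_distinct[OF ir] i(1) j(1)] by auto
    next
      case False
      hence ec: "e \<in> set (concat ess)" using e by simp
      obtain c where c: "s j = lc rs c" by (rule span_listE[OF sR refl])
      have "B e (rs ! i) = 0" if "i < length rs" for i using ortho[OF nth_mem[OF that] ec] by simp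
      hence "B e (s j) = 0" unfolding c lc_def B_sumr B_scr by simp
      thus ?thesis using False True by auto
    qed
    thus ?thesis using 1 by blast
  next
    case False
    hence ec: "e0 \<in> set (concat ess)" using assms by simp
    then obtain f where f: "f \<in> set ess" "e0 \<in> set f" by auto
    obtain a where a: "a < length ess" "f = ess ! a" using f(1) by (auto simp: in_set_conv_nth)
    obtain i where i: "i < length f" "e0 = f ! i" using f(2) by (auto simp: in_set_conv_nth)
    have ai: "i < length (ess ! a)" "e0 = ess ! a ! i" using a i by auto
    define u where "u = (if Suc i < length (ess ! a) then ess ! a ! Suc i else yy a)"
    have uS: "u \<in> span (W \<union> set Ys)"
    proof (cases "Suc i < length (ess ! a)")
      case True
      have "ess ! a ! Suc i \<in> W" unfolding spW[symmetric] using mem_ess[OF a(1) True] by (intro span_base) simp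
      thus ?thesis unfolding u_def using True WS by auto
    next
      case False
      have "yy a \<in> set Ys" unfolding Ys_def using a(1) by auto
      thus ?thesis unfolding u_def using False WS by auto
    qed
    have "B e u = (if e = e0 then 1 else 0)" if e: "e \<in> set (rs @ concat ess)" for e
    proof (cases "e \<in> set rs")
      case True
      have "B e u = 0" unfolding u_def using ortho[OF True mem_ess[OF a(1)]] rs_y[OF True a(1)] by auto
      thus ?thesis using True False by auto
    next
      case False
      then obtain g where g: "g \<in> set ess" "e \<in> set g" using e by auto
      obtain b where b: "b < length ess" "g = ess ! b" using g(1) by (auto simp: in_set_conv_nth)
      obtain j where j: "j < length g" "e = g ! j" using g(2) by (auto simp: in_set_conv_nth)
      have bj: "j < length (ess ! b)" "e = ess ! b ! j" using b j by auto
      have ee: "e = e0 \<longleftrightarrow> b = a \<and> j = i" unfolding bj(2) ai(2) using ess_inj[OF b(1) a(1) bj(1) ai(1)] by auto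
      show ?thesis
      proof (cases "Suc i < length (ess ! a)")
        case True
        show ?thesis unfolding u_def ee using True cg[OF b(1) a(1) bj(1) True] bj(2) by simp
      next
        case False
        hence si: "length (ess ! a) = Suc i" using ai(1) by simp
        show ?thesis unfolding u_def ee using False e_y[OF b(1) a(1) bj(1)] bj(2) si by simp
      qed
    qed
    thus ?thesis using uS by blast
  qed
qed

lemma represent_all: assumes "v \<in> V" shows "\<exists>u\<in>span (W \<union> set Ys). v - u \<in> VW"
proof -
  let ?w = "rs @ concat ess"
  have "\<forall>i\<in>{..<length ?w}. \<exists>u. u \<in> span (W \<union> set Ys) \<and> (\<forall>e\<in>set ?w. B e u = (if e = ?w ! i then 1 else 0))"
  proof
    fix i assume "i \<in> {..<length ?w}"
    hence "?w ! i \<in> set ?w" by (intro nth_mem) simp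
    from represent[OF this] show "\<exists>u. u \<in> span (W \<union> set Ys) \<and> (\<forall>e\<in>set ?w. B e u = (if e = ?w ! i then 1 else 0))"
      unfolding Bex_def .
  qed
  from bchoice[OF this] obtain u where
    u0: "\<forall>i\<in>{..<length ?w}. u i \<in> span (W \<union> set Ys) \<and> (\<forall>e\<in>set ?w. B e (u i) = (if e = ?w ! i then 1 else 0))"
    by (elim exE)
  have u1: "u i \<in> span (W \<union> set Ys) \<and> (\<forall>e\<in>set ?w. B e (u i) = (if e = ?w ! i then 1 else 0))" if "i < length ?w" for i
    by (rule bspec[OF u0]) (use that in \<open>simp only: lessThan_iff\<close>)
  note u = conjunct1[OF u1] bspec[OF conjunct2[OF u1]]
  define x where "x = (\<Sum>i<length ?w. B (?w ! i) v *s u i)"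
  have xS: "x \<in> span (W \<union> set Ys)" unfolding x_def using u(1) by (intro span_sum span_scale) auto
  have "span (W \<union> set Ys) \<subseteq> V" by (rule span_minimal[OF _ sV]) (use W Ys_V in blast)
  hence xV: "v - x \<in> V" using xS assms subspace_diff[OF sV] by blast
  have z: "B e (v - x) = 0" if em: "e \<in> set ?w" for e
  proof -
    obtain j where j: "j < length ?w" "?w ! j = e" using em[unfolded in_set_conv_nth] by (elim exE conjE)
    have "B e x = (\<Sum>i<length ?w. if i = j then B e v else 0)"
      unfolding x_def B_sumr B_scr
    proof (rule sum.cong[OF refl])
      fix i assume "i \<in> {..<length ?w}"
      hence i: "i < length ?w" by simp
      show "B (?w ! i) v * B e (u i) = (if i = j then B e v else 0)"
        unfolding u(2)[OF i em] using j nth_eq_iff_index_eq[OF indl_distinct[OF rbasisD(1)[OF wb]] i j(1)] by auto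
    qed
    also have "\<dots> = B e v" using j by simp
    finally show ?thesis by (simp add: B_diff)
  qed
  have "B w (v - x) = 0" if "w \<in> W" for w
    by (rule B_span_zero[OF z that[folded spW]])
  hence "v - x \<in> VW" unfolding VW_def using xV by simp
  thus ?thesis by (rule bexI[OF _ xS])
qed

text \<open>The last vector t of chain \<open>a\<close> is a test functional: \<open>B t\<close>
  vanishes on the chains and on \<open>rs\<close>, and on \<open>L\<close> by \<open>WL\<close>,
  hence on all of V1, but it takes the value 1 on \<open>yy a\<close> and 0 on the other
  \<open>yy b\<close>.\<close>

lemma indl_V1Ys: "indl ((ls0 @ rs @ concat ess) @ Ys)"
proof (rule indl_appendI[OF rbasisD(1)[OF V1]])
  have key: "\<forall>a<length ess. d a = 0" if x: "lc Ys d \<in> span (set (ls0 @ rs @ concat ess))" for d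
  proof (intro allI impI)
    fix a assume a: "a < length ess"
    obtain l w where lw: "lc Ys d = l + w" "l \<in> span (set ls0)" "w \<in> span (set (rs @ concat ess))"
      using x by (rule span_append_split)
    let ?t = "last (ess ! a)"
    have tm: "?t \<in> set (concat ess)" by (rule last_mem(2)[OF a])
    hence tW: "?t \<in> W" unfolding spW[symmetric] by (intro span_base) simp
    have t0: "B ?t e = 0" if e: "e \<in> set (rs @ concat ess)" for e
    proof (cases "e \<in> set rs")
      case True thus ?thesis using ortho tm by blast
    next
      case False
      then obtain g where g: "g \<in> set ess" "e \<in> set g" using e by auto
      obtain b where b: "b < length ess" "g = ess ! b" using g(1) by (auto simp: in_set_conv_nth)
      obtain j where j: "j < length g" "e = g ! j" using g(2) by (auto simp: in_set_conv_nth)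
      show ?thesis unfolding last_mem(1)[OF a] j(2) b(2) using cg[OF a b(1), of "length (ess ! a) - 1" j] ess_len[OF a] j b by auto
    qed
    obtain c where c: "w = lc (rs @ concat ess) c" by (rule span_listE[OF lw(3) refl])
    have "B ?t w = 0" unfolding c lc_def B_sumr B_scr
    proof (rule sum.neutral, rule ballI)
      fix i assume "i \<in> {..<length (rs @ concat ess)}"
      hence "(rs @ concat ess) ! i \<in> set (rs @ concat ess)" by (intro nth_mem) simp
      from t0[OF this] show "c i * B ?t ((rs @ concat ess) ! i) = 0" by simp
    qed
    moreover have "B ?t l = 0" by (rule WL[OF tW lw(2)[unfolded spL]])
    ultimately have "B ?t (lc Ys d) = 0" unfolding lw(1) by (simp add: B_simps)
    moreover have "B ?t (lc Ys d) = (\<Sum>b<length ess. if b = a then d a else 0)"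
      unfolding lc_def Ys_len B_sumr B_scr
    proof (rule sum.cong[OF refl])
      fix b assume "b \<in> {..<length ess}"
      hence b: "b < length ess" by simp
      show "d b * B ?t (Ys ! b) = (if b = a then d a else 0)"
        unfolding Ys_nth[OF b] last_mem(1)[OF a] using e_y[OF a b, of "length (ess ! a) - 1"] ess_len[OF a] by auto
    qed
    ultimately show "d a = 0" using a by simp
  qed
  show "indl Ys" unfolding indl_def
  proof (intro allI impI)
    fix d i assume "lc Ys d = 0" "i < length Ys"
    thus "d i = 0" using key[of d] Ys_len span_zero by simp
  qed
  show "span (set (ls0 @ rs @ concat ess)) \<inter> span (set Ys) \<subseteq> {0}"
  proof
    fix x assume x: "x \<in> span (set (ls0 @ rs @ concat ess)) \<inter> span (set Ys)"
    then obtain d where d: "x = lc Ys d" using span_listE[of x _ Ys, OF _ refl] by blast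
    have "lc Ys d \<in> span (set (ls0 @ rs @ concat ess))" using x d by simp
    from key[OF this] show "x \<in> {0}" unfolding d lc_def Ys_len by simp
  qed
qed


text \<open>By \<open>represent_all\<close>, \<open>V\<close> is the sum of \<open>W\<close>, the
  span of \<open>Ys\<close> and \<open>VW\<close>. So a basis can be completed by real vectors of
  \<open>VW\<close>; nothing in \<open>W\<close> pairs with them from the left, which makes them
  starting points of new chains.\<close>

lemma ys_exist: "\<exists>fs. set fs \<subseteq> {v \<in> VW. cj v = v} \<and> indl ((ls0 @ rs @ concat ess) @ (Ys @ fs)) \<and>
  V \<subseteq> span (set ((ls0 @ rs @ concat ess) @ (Ys @ fs)))"
proof -
  let ?v1 = "ls0 @ rs @ concat ess"
  have sVW: "subspace VW" unfolding VW_def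
    by (rule subspaceI) (auto simp: B_simps subspace_0[OF sV] subspace_add[OF sV] subspace_scale[OF sV])
  have cVW: "csub VW"
  proof (rule csub_sub[OF V sVW])
    show "VW \<subseteq> V" unfolding VW_def by blast
    fix x assume x: "x \<in> VW"
    have "B w (cj x) = 0" if w: "w \<in> W" for w
    proof -
      have "B (cj w) x = 0" using x csub_cj[OF csW w] unfolding VW_def by blast
      thus ?thesis using B_cj[of "cj w" x] by simp
    qed
    thus "cj x \<in> VW" using x csub_cj[OF V] unfolding VW_def by simp
  qed
  obtain T where T: "finite T" "V \<subseteq> span T" using V unfolding csub_def fds_def by (elim conjE exE)
  have v1V: "set ?v1 \<subseteq> V" using rbasisD(4)[OF V1] by blast
  have 1: "set (?v1 @ Ys) \<subseteq> span T" using v1V Ys_V T(2) by auto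
  have 2: "{v \<in> VW. cj v = v} \<subseteq> span T" using T(2) unfolding VW_def by auto
  from extend_list[OF indl_V1Ys T(1) 1 2] obtain fs where fs: "set fs \<subseteq> {v \<in> VW. cj v = v}"
    "indl ((?v1 @ Ys) @ fs)" "{v \<in> VW. cj v = v} \<subseteq> span (set ((?v1 @ Ys) @ fs))" by (elim exE conjE)
  let ?S = "span (set ((?v1 @ Ys) @ fs))"
  have VWS: "VW \<subseteq> ?S" by (rule order.trans[OF span_real[OF cVW] span_minimal[OF fs(3) subspace_span]])
  have "W \<subseteq> ?S" unfolding spW[symmetric] by (rule span_mono) auto
  moreover have "set Ys \<subseteq> ?S" by (rule order.trans[OF _ span_superset]) auto
  ultimately have WS: "span (W \<union> set Ys) \<subseteq> ?S" by (intro span_minimal[OF _ subspace_span]) simp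
  have "V \<subseteq> ?S"
  proof
    fix v assume "v \<in> V"
    from represent_all[OF this] obtain u where u: "u \<in> span (W \<union> set Ys)" "v - u \<in> VW" by (elim bexE)
    have "u + (v - u) \<in> ?S" by (rule span_add[OF set_mp[OF WS u(1)] set_mp[OF VWS u(2)]])
    thus "v \<in> ?S" by simp
  qed
  thus ?thesis using fs(1,2) by (intro exI[of _ fs]) simp
qed

text \<open>Every chain of \<open>W\<close> grows by two vectors, further chains of length 2 start
  at the vectors of \<open>fs\<close>, and the two-sided kernel supplies chains of length 1. A
  correction by left-kernel vectors removes the unwanted products without disturbing the form on
  \<open>W\<close>.\<close>

theorem jdec_extend: "\<exists>rs' ess'. jdec V rs' ess'"
proof -
  let ?v1 = "ls0 @ rs @ concat ess"
  obtain fs where fs: "set fs \<subseteq> {v \<in> VW. cj v = v}" "indl (?v1 @ (Ys @ fs))"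
    "V \<subseteq> span (set (?v1 @ (Ys @ fs)))" using ys_exist by (elim exE conjE)
  define ys where "ys = Ys @ fs"
  define m where "m = length ys"
  define r where "r = length ess"
  have rm: "r \<le> m" unfolding m_def ys_def r_def Ys_len[symmetric] by simp
  have ysV: "set ys \<subseteq> V" unfolding ys_def using Ys_V fs(1) unfolding VW_def by auto
  have ysr: "cj y = y" if "y \<in> set ys" for y using that yy(2) fs(1) unfolding ys_def Ys_def by auto
  have v1V: "set ?v1 \<subseteq> V" using rbasisD(4)[OF V1] by blast
  have ymem: "j < m \<Longrightarrow> ys ! j \<in> V" for j using ysV nth_mem unfolding m_def by blast
  have rsW: "set rs \<subseteq> W" "set (concat ess) \<subseteq> W" using rbasisD(4)[OF wb] by auto
  have ry: "B u (ys ! j) = 0" if "u \<in> set rs" "j < m" for u j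
  proof (cases "j < r")
    case True
    thus ?thesis using rs_y[OF that(1)] Ys_nth Ys_len unfolding ys_def r_def by (simp add: nth_append)
  next
    case False
    hence "ys ! j \<in> set fs" using that(2) Ys_len unfolding ys_def m_def r_def by (simp add: nth_append)
    thus ?thesis using fs(1) that(1) rsW unfolding VW_def by blast
  qed
  have ey: "B (ess ! a ! i) (ys ! j) = (if a = j \<and> Suc i = length (ess ! a) then 1 else 0)"
    if "a < r" "i < length (ess ! a)" "j < m" for a i j
  proof (cases "j < r")
    case True
    have "ys ! j = yy j" using True Ys_nth Ys_len unfolding ys_def r_def by (simp add: nth_append)
    thus ?thesis using e_y[of a j i] that True unfolding r_def by auto
  next
    case False
    hence "ys ! j \<in> set fs" using that(3) Ys_len unfolding ys_def m_def r_def by (simp add: nth_append)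
    moreover have "ess ! a ! i \<in> W" using mem_ess[of a i] that rsW unfolding r_def by auto
    ultimately have "B (ess ! a ! i) (ys ! j) = 0" using fs(1) unfolding VW_def by blast
    thus ?thesis using False that by auto
  qed
  have iy: "indl ys" using indl_appendD(2)[OF fs(2)] unfolding ys_def .
  have int: "span (set ?v1) \<inter> span (set ys) \<subseteq> {0}" using indl_appendD(3)[OF fs(2)] unfolding ys_def .
  \<comment> \<open>Independence: a combination of \<open>ys\<close> that pairs to 0 with
    \<open>L\<close> lies in V1, whose intersection with the span of \<open>ys\<close> is 0.\<close>
  have "\<exists>s. \<forall>j<m. s j \<in> L \<and> cj (s j) = s j \<and> (\<forall>i<m. B (ys ! i) (s j) = (if i = j then 1 else 0))"
  proof (rule dual_family_real[OF csL])
    show "linf L (B (ys ! i))" for i unfolding linf_def by (auto simp: B_simps)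
    show "B (ys ! i) (cj v) = cnj (B (ys ! i) v)" if "i < m" for i v
      using B_cj[of "ys ! i" v] ysr[OF nth_mem[of i ys]] that unfolding m_def by simp
    fix c assume h: "\<And>v. v \<in> L \<Longrightarrow> (\<Sum>i<m. c i * B (ys ! i) v) = 0"
    have "B (lc ys c) l = 0" if "l \<in> L" for l using h[OF that] unfolding lc_def B_suml B_scl m_def .
    moreover have "lc ys c \<in> V" by (rule lc_in[OF sV ysV])
    ultimately have "lc ys c \<in> span (set ?v1)" unfolding spV1 by simp
    hence "lc ys c = 0" using int lc_span[of ys c] by blast
    thus "\<forall>i<m. c i = 0" using iy unfolding indl_def m_def by blast
  qed
  then obtain l where l0: "\<forall>j<m. l j \<in> L \<and> cj (l j) = l j \<and> (\<forall>i<m. B (ys ! i) (l j) = (if i = j then 1 else 0))" by (elim exE)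
  have l: "l j \<in> L" "cj (l j) = l j" "i < m \<Longrightarrow> B (ys ! i) (l j) = (if i = j then 1 else 0)" if "j < m" for i j
    using l0[rule_format, OF that] by simp_all
  define p where "p = (\<lambda>v. \<Sum>i<m. B (ys ! i) v *s l i)"
  have pL: "p v \<in> L" for v unfolding p_def
    by (intro subspace_sum[OF csub_subspace[OF csL]] subspace_scale[OF csub_subspace[OF csL]]) (simp add: l(1))
  have yp: "B (ys ! i) (p v) = B (ys ! i) v" if "i < m" for i v
    unfolding p_def B_sumr B_scr using l(3) that
    by (simp add: if_distrib[of "(*) _"] sum.delta' sum.delta cong: sum.cong_simp if_cong)
  \<comment> \<open>Subtracting a left-kernel vector never changes products in which the vector is
    the left factor. \<open>p\<close> is chosen so that every \<open>ys ! i\<close> pairs to 0 with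
    every \<open>K v\<close>; as \<open>W\<close> pairs to 0 with \<open>L\<close>, products with
    left factor in \<open>W\<close> survive.\<close>
  define K where "K = (\<lambda>v. v - p v)"
  have KV: "K v \<in> V" if "v \<in> V" for v unfolding K_def using that pL LV subspace_diff[OF sV] by blast
  have KK: "B (K u) (K v) = B u v - B u (p v)" if "u \<in> V" "v \<in> V" for u v
    using L0[OF pL KV[OF that(2)]] unfolding K_def by (simp add: B_diff)
  have KW: "B (K u) (K v) = B u v" if "u \<in> W" "v \<in> V" for u v
    using KK[of u v] that W WL[OF that(1) pL] by auto
  have Ky: "B (K (ys ! i)) (K v) = 0" if "i < m" "v \<in> V" for i v
    using KK[OF ymem[OF that(1)] that(2)] yp[OF that(1)] by simp
  have Kl: "B (K u) x = B u x" if "u \<in> V" "x \<in> L" for u x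
    using L0[OF pL, of x u] that LV unfolding K_def by (auto simp: B_diff)
  have preal: "cj (p v) = p (cj v)" for v
    unfolding p_def cj_sum cj_sc
  proof (rule sum.cong[OF refl])
    fix i assume "i \<in> {..<m}"
    hence i: "i < m" by simp
    have "cj (ys ! i) = ys ! i" using ysr i unfolding m_def by simp
    hence "cnj (B (ys ! i) v) = B (ys ! i) (cj v)" using B_cj[of "ys ! i" v] by simp
    thus "cnj (B (ys ! i) v) *s cj (l i) = B (ys ! i) (cj v) *s l i" using l(2)[OF i] by simp
  qed
  have Kr: "cj (K v) = K v" if "cj v = v" for v unfolding K_def cj_diff preal that ..
  define L0' where "L0' = {x \<in> L. \<forall>v\<in>V. B v x = 0}"
  have csL0: "csub L0'"
  proof (rule csub_sub[OF csL])
    show "L0' \<subseteq> L" unfolding L0'_def by blast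
    show "subspace L0'" unfolding L0'_def
      by (rule subspaceI) (auto simp: B_simps subspace_0[OF csub_subspace[OF csL]] subspace_add[OF csub_subspace[OF csL]] subspace_scale[OF csub_subspace[OF csL]])
    fix x assume x: "x \<in> L0'"
    have "B v (cj x) = 0" if v: "v \<in> V" for v
    proof -
      have "B (cj v) x = 0" using x csub_cj[OF V v] unfolding L0'_def by blast
      thus ?thesis using B_cj[of "cj v" x] by simp
    qed
    thus "cj x \<in> L0'" using x csub_cj[OF csL] unfolding L0'_def by simp
  qed
  obtain zs where zs: "rbasis L0' zs" using rbasis_exists[OF csL0] by (elim exE)
  have z0: "z \<in> L" "\<And>v. v \<in> V \<Longrightarrow> B v z = 0" if "z \<in> set zs" for z
    using rbasisD(4)[OF zs] that unfolding L0'_def by auto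
  define ll where "ll = map l [0..<m]"
  have ll: "length ll = m" "\<And>j. j < m \<Longrightarrow> ll ! j = l j" unfolding ll_def by auto
  have Bll: "B (ys ! i) (lc ll c) = c i" if "i < m" for i c
    unfolding lc_def ll(1) B_sumr B_scr using l(3) that ll(2)
    by (simp add: if_distrib[of "(*) _"] sum.delta' sum.delta cong: sum.cong_simp if_cong)
  have llz: "indl (ll @ zs)"
  proof (rule indl_appendI[OF _ rbasisD(1)[OF zs]])
    show "indl ll" unfolding indl_def
    proof (intro allI impI)
      fix c i assume "lc ll c = 0" "i < length ll"
      thus "c i = 0" using Bll[of i c] ll(1) by simp
    qed
    show "span (set ll) \<inter> span (set zs) \<subseteq> {0}"
    proof
      fix x assume x: "x \<in> span (set ll) \<inter> span (set zs)"
      hence xs: "x \<in> span (set ll)" by simp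
      obtain c where c: "x = lc ll c" by (rule span_listE[OF xs refl])
      have "x \<in> L0'" using x rbasisD(2)[OF zs] by blast
      hence "c i = 0" if "i < m" for i using Bll[OF that, of c] ymem[OF that] c unfolding L0'_def by simp
      thus "x \<in> {0}" unfolding c lc_def ll(1) by simp
    qed
  qed
  have llL: "set ll \<subseteq> L" unfolding ll_def using l(1) by auto
  have zsL: "set zs \<subseteq> L" using z0(1) by blast
  have mz: "m + length zs \<le> length ls0"
  proof -
    have "set (ll @ zs) \<subseteq> span (set ls0)" unfolding spL using llL zsL by simp
    from indl_length[OF llz this finite_set] show ?thesis using ll(1) card_length[of ls0] by simp
  qed
  have Lsub: "L \<subseteq> span (set ll \<union> set zs)"
  proof
    fix x assume x: "x \<in> L"
    have pll: "p x \<in> span (set ll \<union> set zs)" unfolding p_def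
    proof (intro span_sum span_scale span_base)
      fix i assume "i \<in> {..<m}" thus "l i \<in> set ll \<union> set zs" unfolding ll_def by simp
    qed
    have xp: "x - p x \<in> L" by (rule subspace_diff[OF csub_subspace[OF csL] x pL])
    have "B v (x - p x) = 0" if v: "v \<in> V" for v
    proof -
      have "v \<in> span (set (?v1 @ ys))" using v fs(3) unfolding ys_def by blast
      then obtain a b where ab: "v = a + b" "a \<in> span (set ?v1)" "b \<in> span (set ys)" by (rule span_append_split)
      have "B a (x - p x) = 0" using ab(2) xp unfolding spV1 by blast
      moreover have "B b (x - p x) = 0"
      proof (rule B_span_zero[OF _ ab(3)])
        fix u assume "u \<in> set ys"
        then obtain i where "i < m" "u = ys ! i" unfolding m_def by (auto simp: in_set_conv_nth)
        thus "B u (x - p x) = 0" using yp by (simp add: B_diff)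
      qed
      ultimately show ?thesis unfolding ab(1) by (simp add: B_addl)
    qed
    hence "x - p x \<in> L0'" unfolding L0'_def using xp by simp
    hence "x - p x \<in> span (set zs)" using rbasisD(2)[OF zs] by simp
    hence "x - p x \<in> span (set ll \<union> set zs)" by (rule set_mp[OF span_mono, rotated]) simp
    from span_add[OF this pll] show "x \<in> span (set ll \<union> set zs)" by simp
  qed
  \<comment> \<open>Indices below \<open>r\<close> continue the chains of \<open>W\<close>, those
    from \<open>r\<close> to below \<open>m\<close> give chains of length 2, the remaining ones the
    vectors of the two-sided kernel.\<close>
  define Ec where "Ec = (\<lambda>j. if j < m then (if j < r then map K (ess ! j) else []) @ [K (ys ! j), l j] else [zs ! (j - m)])"
  define q where "q = m + length zs"
  define ess' where "ess' = map Ec [0..<q]"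
  define rs' where "rs' = map K rs"
  have len: "length ess' = q" and nth: "\<And>j. j < q \<Longrightarrow> ess' ! j = Ec j" unfolding ess'_def by auto
  have mem: "x \<in> set (concat ess')" if "j < q" "x \<in> set (Ec j)" for x j
    using that unfolding ess'_def by auto
  have memE: "\<exists>j<q. x \<in> set (Ec j)" if "x \<in> set (concat ess')" for x
    using that unfolding ess'_def by auto
  let ?new = "rs' @ concat ess'"
  have Ec_cases: "(\<exists>a i. a < r \<and> i < length (ess ! a) \<and> x = K (ess ! a ! i)) \<or> (\<exists>j<m. x = K (ys ! j)) \<or> (\<exists>j<m. x = l j) \<or> x \<in> set zs"
    if x: "j < q" "x \<in> set (Ec j)" for x j
  proof (cases "j < m")
    case False
    hence "x = zs ! (j - m)" "j - m < length zs" using x unfolding Ec_def q_def by auto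
    thus ?thesis by simp
  next
    case True
    hence "x = K (ys ! j) \<or> x = l j \<or> (j < r \<and> x \<in> set (map K (ess ! j)))" using x unfolding Ec_def by (auto split: if_splits)
    thus ?thesis
    proof (elim disjE conjE)
      assume a: "j < r" "x \<in> set (map K (ess ! j))"
      then obtain i where "i < length (ess ! j)" "x = K (ess ! j ! i)" by (auto simp: in_set_conv_nth)
      thus ?thesis using a(1) by blast
    qed (use True in blast)+
  qed
  have eV: "ess ! a ! i \<in> W" "ess ! a ! i \<in> V" if "a < r" "i < length (ess ! a)" for a i
    using mem_ess[of a i] that rsW W unfolding r_def by auto
  have realnew: "cj x = x" if x: "x \<in> set ?new" for x
  proof -
    have rw: "cj e = e" if "e \<in> set (rs @ concat ess)" for e by (rule rbasisD(3)[OF wb that])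
    consider "x \<in> set rs'" | "x \<in> set (concat ess')" using x by auto
    thus ?thesis
    proof cases
      case 1 thus ?thesis unfolding rs'_def using Kr rw by auto
    next
      case 2
      from memE[OF 2] obtain j where j: "j < q" "x \<in> set (Ec j)" by (elim exE conjE)
      from Ec_cases[OF j] show ?thesis
      proof (elim disjE exE conjE)
        fix a i assume h: "a < r" "i < length (ess ! a)" "x = K (ess ! a ! i)"
        have "ess ! a ! i \<in> set (concat ess)" using mem_ess[of a i] h unfolding r_def by simp
        hence "cj (ess ! a ! i) = ess ! a ! i" by (intro rw) simp
        thus ?thesis unfolding h(3) by (rule Kr)
      next
        fix j assume h: "j < m" "x = K (ys ! j)"
        have "cj (ys ! j) = ys ! j" using h(1) ysr unfolding m_def by simp
        thus ?thesis unfolding h(2) by (rule Kr)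
      next
        fix j assume "j < m" "x = l j" thus ?thesis using l(2) by simp
      next
        assume "x \<in> set zs" thus ?thesis using rbasisD(3)[OF zs] by simp
      qed
    qed
  qed
  have newV: "set ?new \<subseteq> V"
  proof
    fix x assume x: "x \<in> set ?new"
    consider "x \<in> set rs'" | "x \<in> set (concat ess')" using x by auto
    thus "x \<in> V"
    proof cases
      case 1 thus ?thesis unfolding rs'_def using KV rsW W by auto
    next
      case 2
      from memE[OF 2] obtain j where j: "j < q" "x \<in> set (Ec j)" by (elim exE conjE)
      from Ec_cases[OF j] show ?thesis
        by (elim disjE exE conjE) (use KV eV ymem l(1) LV zsL in auto)
    qed
  qed
  have lin_new: "l j \<in> set ?new" "K (ys ! j) \<in> set ?new" if "j < m" for j
    using mem[of j "l j"] mem[of j "K (ys ! j)"] that unfolding Ec_def q_def by auto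
  have zs_new: "set zs \<subseteq> set ?new"
  proof
    fix z assume "z \<in> set zs"
    then obtain i where "i < length zs" "z = zs ! i" by (auto simp: in_set_conv_nth)
    thus "z \<in> set ?new" using mem[of "m + i" z] unfolding Ec_def q_def by auto
  qed
  have LN: "L \<subseteq> span (set ?new)"
  proof (rule order.trans[OF Lsub span_mono])
    have "x \<in> set ?new" if x: "x \<in> set ll" for x
    proof -
      obtain j where "j < m" "x = l j" using x unfolding ll_def by auto
      thus ?thesis using lin_new(1) by blast
    qed
    hence "set ll \<subseteq> set ?new" by (rule subsetI)
    thus "set ll \<union> set zs \<subseteq> set ?new" using zs_new by (rule Un_least)
  qed
  have KN: "v \<in> span (set ?new)" if "K v \<in> set ?new" for v
  proof -
    have e: "v = K v + p v" unfolding K_def by simp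
    show ?thesis by (subst e) (rule span_add[OF span_base[OF that] set_mp[OF LN pL]])
  qed
  have VN: "V \<subseteq> span (set ?new)"
  proof (rule order.trans[OF fs(3) span_minimal[OF _ subspace_span]], rule subsetI)
    fix x assume "x \<in> set (?v1 @ Ys @ fs)"
    then consider "x \<in> set ls0" | "x \<in> set rs" | "x \<in> set (concat ess)" | "x \<in> set ys" unfolding ys_def by auto
    thus "x \<in> span (set ?new)"
    proof cases
      case 1 thus ?thesis using LN span_base[of x "set ls0"] unfolding spL by blast
    next
      case 2 thus ?thesis by (intro KN) (simp add: rs'_def)
    next
      case 3
      then obtain f where f: "f \<in> set ess" "x \<in> set f" by auto
      obtain a where a: "a < r" "f = ess ! a" using f(1) unfolding r_def by (auto simp: in_set_conv_nth)
      have "K x \<in> set (Ec a)" unfolding Ec_def using a rm f(2) by auto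
      moreover have "a < q" using a rm unfolding q_def by simp
      ultimately show ?thesis using mem by (intro KN) auto
    next
      case 4
      then obtain j where "j < m" "x = ys ! j" unfolding m_def by (auto simp: in_set_conv_nth)
      thus ?thesis using lin_new(2) by (intro KN) simp
    qed
  qed
  have lenc: "length (concat ess') = length (concat ess) + 2 * m + length zs"
  proof -
    have "length (concat ess') = (\<Sum>j<q. length (Ec j))"
      unfolding ess'_def length_concat map_map by (simp add: interv_sum_list_conv_sum_set_nat atLeast0LessThan comp_def)
    also have "\<dots> = (\<Sum>j<m. length (Ec j)) + (\<Sum>j<length zs. length (Ec (m + j)))" unfolding q_def by (rule sum_split)
    also have "(\<Sum>j<length zs. length (Ec (m + j))) = length zs" unfolding Ec_def by simp
    also have "(\<Sum>j<m. length (Ec j)) = (\<Sum>j<m. (if j < r then length (ess ! j) else 0) + 2)"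
      by (rule sum.cong) (auto simp: Ec_def)
    also have "\<dots> = (\<Sum>j<m. if j < r then length (ess ! j) else 0) + 2 * m" by (subst sum.distrib) simp
    also have "(\<Sum>j<m. if j < r then length (ess ! j) else 0) = (\<Sum>j<r. length (ess ! j))"
      using rm by (intro sum.mono_neutral_cong_right) auto
    also have "\<dots> = length (concat ess)" unfolding length_concat r_def by (simp add: sum_list_sum_nth atLeast0LessThan)
    finally show ?thesis by simp
  qed
  have basisV: "rbasis V (?v1 @ ys)" unfolding rbasis_def
  proof (intro conjI ballI)
    show "cj e = e" if "e \<in> set (?v1 @ ys)" for e using that rbasisD(3)[OF V1] ysr by auto
    show "indl (?v1 @ ys)" using fs(2) unfolding ys_def .
    show "span (set (?v1 @ ys)) = V"
      using span_minimal[OF _ sV, of "set (?v1 @ ys)"] v1V ysV fs(3) unfolding ys_def by auto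
  qed
  have bnew: "rbasis V ?new" unfolding rbasis_def
  proof (intro conjI ballI)
    show "cj e = e" if "e \<in> set ?new" for e by (rule realnew[OF that])
    \<comment> \<open>Independence by counting: the new family spans \<open>V\<close>, and by
      \<open>mz\<close> and \<open>lenc\<close> it is no longer than the known basis.\<close>
    show "indl ?new"
      by (rule spanning_length_indl[OF basisV newV VN]) (use mz lenc in \<open>simp add: rs'_def m_def\<close>)
    show "span (set ?new) = V" by (rule equalityI[OF span_minimal[OF newV sV] VN])
  qed
  have Kadd: "K (x + y) = K x + K y" "K (c *s x) = c *s K x" for x y c
    unfolding K_def p_def by (simp_all add: B_simps scale_left_distrib sum.distrib scale_right_diff_distrib scale_sum_right)
  have Klc: "K (lc rs c) = lc rs' c" for c
  proof -
    have "K (\<Sum>i<k. c i *s rs ! i) = (\<Sum>i<k. c i *s K (rs ! i))" for k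
    proof (induction k)
      case 0 show ?case unfolding K_def p_def by simp
    next
      case (Suc k) thus ?case by (simp add: Kadd)
    qed
    thus ?thesis unfolding lc_def rs'_def by simp
  qed
  have nd': "nondeg (*s) cj B (span (set rs'))"
  proof unfold_locales
    show "csub (span (set rs'))" by (rule span_real_csub) (use realnew in simp)
    fix x assume x: "x \<in> span (set rs')" "\<And>y. y \<in> span (set rs') \<Longrightarrow> B x y = 0"
    obtain c where c: "x = lc rs' c" by (rule span_listE[OF x(1) refl])
    have spR: "span (set rs) \<subseteq> W" unfolding spW[symmetric] by (rule span_mono) auto
    have "lc rs c = 0"
    proof (rule nondeg.nondeg_left[OF nd lc_span])
      fix y assume y: "y \<in> span (set rs)"
      obtain d where d: "y = lc rs d" by (rule span_listE[OF y refl])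
      have "B (lc rs c) y = B (K (lc rs c)) (K y)"
        by (rule KW[OF set_mp[OF spR lc_span] set_mp[OF W set_mp[OF spR y]], symmetric])
      also have "\<dots> = 0" unfolding d Klc c[symmetric] by (rule x(2)[OF lc_span])
      finally show "B (lc rs c) y = 0" .
    qed
    thus "x = 0" unfolding c Klc[symmetric] K_def p_def by simp
  qed
  have orth': "B u e = 0 \<and> B e u = 0" if u: "u \<in> set rs'" and e: "e \<in> set (concat ess')" for u e
  proof -
    obtain u0 where u0: "u0 \<in> set rs" "u = K u0" using u unfolding rs'_def by auto
    have uW: "u0 \<in> W" "u0 \<in> V" "u \<in> V" using u0 rsW W KV by auto
    from memE[OF e] obtain j where j: "j < q" "e \<in> set (Ec j)" by (elim exE conjE)
    from Ec_cases[OF j] show ?thesis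
    proof (elim disjE exE conjE)
      fix a i assume h: "a < r" "i < length (ess ! a)" "e = K (ess ! a ! i)"
      have "ess ! a ! i \<in> set (concat ess)" using mem_ess[of a i] h unfolding r_def by simp
      thus ?thesis unfolding h(3) u0(2) using ortho[OF u0(1)] KW[OF uW(1) eV(2)[OF h(1,2)]] KW[OF eV(1)[OF h(1,2)] uW(2)] by simp
    next
      fix j assume h: "j < m" "e = K (ys ! j)"
      show ?thesis unfolding h(2) u0(2) using KW[OF uW(1) ymem[OF h(1)]] ry[OF u0(1) h(1)] Ky[OF h(1) uW(2)] by simp
    next
      fix j assume h: "j < m" "e = l j"
      show ?thesis unfolding h(2) using L0[OF l(1)[OF h(1)] uW(3)] Kl[OF uW(2) l(1)[OF h(1)]] WL[OF uW(1) l(1)[OF h(1)]] u0(2) by simp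
    next
      assume "e \<in> set zs"
      thus ?thesis using z0 L0[OF z0(1) uW(3)] uW by auto
    qed
  qed
  have Lnull: "B (l j) x = 0" if "j < m" "x \<in> V" for j x by (rule L0[OF l(1)[OF that(1)] that(2)])
  have EcV: "Ec a ! i \<in> V" if "a < q" "i < length (Ec a)" for a i
    using mem[OF that(1) nth_mem[OF that(2)]] newV by auto
  define k where "k = (\<lambda>a. if a < r then length (ess ! a) else 0)"
  have Ec_len: "length (Ec a) = (if a < m then k a + 2 else 1)" for a unfolding Ec_def k_def by auto
  have Ec_nth: "Ec a ! i = (if i < k a then K (ess ! a ! i) else if i = k a then K (ys ! a) else l a)"
    if "a < m" "i < length (Ec a)" for a i
    using that unfolding Ec_len unfolding Ec_def k_def by (auto simp: nth_append nth_Cons')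
  have cg': "chains_gram ess'" unfolding chains_gram_def len
  proof (intro allI impI)
    fix a b i j assume h0: "a < q" "b < q" "i < length (ess' ! a)" "j < length (ess' ! b)"
    hence h: "a < q" "b < q" "i < length (Ec a)" "j < length (Ec b)" using nth by auto
    show "B (ess' ! a ! i) (ess' ! b ! j) = (if a = b \<and> Suc i = j then 1 else 0)"
      unfolding nth[OF h(1)] nth[OF h(2)]
    proof (cases "a < m")
      case False
      hence i0: "i = 0" "Ec a ! i \<in> set zs" using h(1,3) unfolding Ec_len unfolding Ec_def q_def by auto
      have "B (Ec a ! i) (Ec b ! j) = 0" by (rule L0[OF z0(1)[OF i0(2)] EcV[OF h(2,4)]])
      moreover have "\<not> (a = b \<and> Suc i = j)" using h(4) False i0 unfolding Ec_len by auto
      ultimately show "B (Ec a ! i) (Ec b ! j) = (if a = b \<and> Suc i = j then 1 else 0)" by simp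
    next
      case am: True
      show "B (Ec a ! i) (Ec b ! j) = (if a = b \<and> Suc i = j then 1 else 0)"
      proof (cases "b < m")
        case False
        have "Ec b ! j \<in> set zs" using False h(2,4) unfolding Ec_len unfolding Ec_def q_def by auto
        hence "B (Ec a ! i) (Ec b ! j) = 0" by (rule z0(2)[OF _ EcV[OF h(1,3)]])
        thus ?thesis using am False by auto
      next
        case bm: True
        have ilen: "i < k a + 2" "j < k b + 2" using h(3,4) am bm unfolding Ec_len by auto
        note ni = Ec_nth[OF am h(3)] and nj = Ec_nth[OF bm h(4)]
        consider (e) "i < k a" | (y) "i = k a" | (l) "i = Suc (k a)" using ilen by linarith
        thus ?thesis
        proof cases
          case e
          hence ar: "a < r" "i < length (ess ! a)" unfolding k_def by (auto split: if_splits)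
          have ka: "k a = length (ess ! a)" unfolding k_def using ar by simp
          consider (e') "j < k b" | (y') "j = k b" | (l') "j = Suc (k b)" using ilen by linarith
          thus ?thesis
          proof cases
            case e'
            hence br: "b < r" "j < length (ess ! b)" unfolding k_def by (auto split: if_splits)
            show ?thesis unfolding ni nj using e e' KW[OF eV(1)[OF ar] eV(2)[OF br]] cg[of a b i j] ar br unfolding r_def by simp
          next
            case y'
            have "B (Ec a ! i) (Ec b ! j) = (if a = b \<and> Suc i = length (ess ! a) then 1 else 0)"
              unfolding ni nj using e y' KW[OF eV(1)[OF ar] ymem[OF bm]] ey[OF ar bm] by simp
            thus ?thesis using y' ka by auto
          next
            case l'
            have "B (Ec a ! i) (Ec b ! j) = 0"
              unfolding ni nj using e l' Kl[OF eV(2)[OF ar] l(1)[OF bm]] WL[OF eV(1)[OF ar] l(1)[OF bm]] by simp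
            thus ?thesis using l' e by auto
          qed
        next
          case y
          show ?thesis
          proof (cases "j = Suc (k b)")
            case True
            have "B (Ec a ! i) (Ec b ! j) = (if a = b then 1 else 0)"
              unfolding ni nj using y True Kl[OF ymem[OF am] l(1)[OF bm]] l(3)[OF bm am] by simp
            thus ?thesis using y True by auto
          next
            case False
            hence jb: "j \<le> k b" using ilen by linarith
            have "\<exists>v\<in>V. Ec b ! j = K v"
            proof (cases "j < k b")
              case True
              hence br: "b < r" "j < length (ess ! b)" unfolding k_def by (auto split: if_splits)
              show ?thesis unfolding nj using True eV(2)[OF br] by auto
            next
              case False thus ?thesis unfolding nj using jb ymem[OF bm] by auto
            qed
            then obtain v where v: "v \<in> V" "Ec b ! j = K v" by (elim bexE)
            have "B (Ec a ! i) (Ec b ! j) = 0" unfolding v(2) ni using y Ky[OF am v(1)] by simp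
            thus ?thesis using y jb by auto
          qed
        next
          case l
          have "B (Ec a ! i) (Ec b ! j) = 0" using l Lnull[OF am EcV[OF h(2,4)]] unfolding ni by simp
          thus ?thesis using l ilen by auto
        qed
      qed
    qed
  qed
  have ne': "[] \<notin> set ess'" unfolding ess'_def Ec_def by auto
  have "jdec V rs' ess'" unfolding jdec_def using bnew nd' orth' cg' ne' by (intro conjI ballI) auto
  thus ?thesis by blast
qed

end

theorem jdec_exists: assumes "csub V" shows "\<exists>rs ess. jdec V rs ess"
  using assms
proof (induction "dim V" arbitrary: V rule: less_induct)
  case less
  note V = less.prems
  note sV = csub_subspace[OF V]
  let ?L = "{l \<in> V. \<forall>v\<in>V. B l v = 0}"
  let ?V1 = "{v \<in> V. \<forall>l\<in>?L. B v l = 0}"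
  have csL: "csub ?L"
  proof (rule csub_sub[OF V])
    show "subspace ?L"
      by (rule subspaceI) (auto simp: B_simps subspace_0[OF sV] subspace_add[OF sV] subspace_scale[OF sV])
    fix x assume x: "x \<in> ?L"
    have "B (cj x) v = 0" if v: "v \<in> V" for v
      using x csub_cj[OF V v] B_cj1[of x v] by simp
    thus "cj x \<in> ?L" using x csub_cj[OF V] by simp
  qed blast
  have csV1: "csub ?V1"
  proof (rule csub_sub[OF V])
    show "subspace ?V1"
      by (rule subspaceI) (auto simp: B_simps subspace_0[OF sV] subspace_add[OF sV] subspace_scale[OF sV])
    fix x assume x: "x \<in> ?V1"
    have "B (cj x) v = 0" if v: "v \<in> ?L" for v
    proof -
      have "B x (cj v) = 0" using x csub_cj[OF csL v] by blast
      thus ?thesis using B_cj1[of x v] by simp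
    qed
    thus "cj x \<in> ?V1" using x csub_cj[OF V] by simp
  qed blast
  obtain ls0 where ls0: "rbasis ?L ls0" using rbasis_exists[OF csL] by (elim exE)
  show ?case
  proof (cases "ls0 = []")
    case True
    hence "?L = {0}" using rbasisD(2)[OF ls0] by simp
    hence "nondeg (*s) cj B V" by unfold_locales (use V in auto)
    moreover obtain rs where rs: "rbasis V rs" using rbasis_exists[OF V] by (elim exE)
    ultimately have "jdec V rs []" unfolding jdec_def chains_gram_def using rbasisD(2)[OF rs] by simp
    thus ?thesis by blast
  next
    case False
    have "?L \<subseteq> ?V1" by auto
    hence "set ls0 \<subseteq> ?V1" using rbasisD(4)[OF ls0] by (rule_tac order.trans)
    from extend_rbasis[OF csV1 rbasisD(1)[OF ls0] this] obtain ws where ws: "rbasis ?V1 (ls0 @ ws)"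
      using rbasisD(3)[OF ls0] by blast
    define W where "W = span (set ws)"
    have wW: "rbasis W ws" unfolding W_def rbasis_def
      using indl_appendD(2)[OF rbasisD(1)[OF ws]] rbasisD(3)[OF ws] by auto
    have "set ws \<subseteq> V" using rbasisD(4)[OF ws] by auto
    hence WV: "W \<subseteq> V" unfolding W_def by (rule span_minimal[OF _ sV])
    obtain T where T: "rbasis V ((ls0 @ ws) @ T)"
    proof -
      have "set (ls0 @ ws) \<subseteq> V" using rbasisD(4)[OF ws] by auto
      from extend_rbasis[OF V rbasisD(1)[OF ws] this] show ?thesis using rbasisD(3)[OF ws] that by blast
    qed
    have "length ls0 > 0" using False by simp
    hence "dim W < dim V" using rbasis_dim[OF wW] rbasis_dim[OF T] unfolding length_append by linarith
    from less.hyps[OF this rbasisD(6)[OF wW]] obtain rs ess where d: "jdec W rs ess" by (elim exE)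
    have b: "rbasis W (rs @ concat ess)" using d unfolding jdec_def by blast
    have V1: "rbasis ?V1 (ls0 @ rs @ concat ess)"
      unfolding rbasis_def
    proof (intro conjI ballI)
      show "cj e = e" if "e \<in> set (ls0 @ rs @ concat ess)" for e
        using that rbasisD(3)[OF ls0] rbasisD(3)[OF b] by auto
      have sp: "span (set (rs @ concat ess)) = span (set ws)" using rbasisD(2)[OF b] unfolding W_def .
      show "indl (ls0 @ rs @ concat ess)"
        by (rule indl_appendI[OF rbasisD(1)[OF ls0] rbasisD(1)[OF b]])
           (unfold sp, rule indl_appendD(3)[OF rbasisD(1)[OF ws]])
      have "span (set (ls0 @ rs @ concat ess)) = span (set (ls0 @ ws))"
      proof (rule antisym; rule span_minimal[OF _ subspace_span])
        have 1: "set ls0 \<subseteq> span (set (ls0 @ ws))" by (rule order.trans[OF _ span_superset]) auto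
        have "set (rs @ concat ess) \<subseteq> span (set ws)" unfolding sp[symmetric] by (rule span_superset)
        also have "\<dots> \<subseteq> span (set (ls0 @ ws))" by (rule span_mono) auto
        finally show "set (ls0 @ rs @ concat ess) \<subseteq> span (set (ls0 @ ws))" using 1 by simp
        have 2: "set ls0 \<subseteq> span (set (ls0 @ rs @ concat ess))" by (rule order.trans[OF _ span_superset]) auto
        have "set ws \<subseteq> span (set (rs @ concat ess))" unfolding sp by (rule span_superset)
        also have "\<dots> \<subseteq> span (set (ls0 @ rs @ concat ess))" by (rule span_mono) auto
        finally show "set (ls0 @ ws) \<subseteq> span (set (ls0 @ rs @ concat ess))" using 2 by simp
      qed
      thus "span (set (ls0 @ rs @ concat ess)) = ?V1" unfolding rbasisD(2)[OF ws] .
    qed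
    show ?thesis by (rule jdec_extend[OF V WV d ls0 V1])
  qed
qed

theorem canonical_form:
  assumes "csub V"
  shows "\<exists>es Bs. rbasis V es \<and> rgram es (diag_block_mat Bs) \<and> set Bs \<subseteq> type_i \<union> type_ii \<union> type_iii \<union> type_iv"
proof -
  obtain rs ess where d: "jdec V rs ess" using jdec_exists[OF assms] by (elim exE)
  have b: "rbasis V (rs @ concat ess)" and nd: "nondeg (*s) cj B (span (set rs))"
    and o: "\<forall>u\<in>set rs. \<forall>e\<in>set (concat ess). B u e = 0 \<and> B e u = 0" and c: "chains_gram ess" "[] \<notin> set ess"
    using d unfolding jdec_def by blast+
  obtain es Bs where es: "rbasis (span (set rs)) es" "rgram es (diag_block_mat Bs)" "set Bs \<subseteq> type_ii \<union> type_iii \<union> type_iv"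
    using regular_canonical[OF nd] by (elim exE conjE)
  let ?J = "map (\<lambda>e. jordan_block (length e) (0::real)) ess"
  have sp: "span (set es) = span (set rs)" by (rule rbasisD(2)[OF es(1)])
  have J: "rgram (concat ess) (diag_block_mat ?J)" by (rule chains_gram_diag[OF c(1)])
  have o1: "B u e = 0 \<and> B e u = 0" if u: "u \<in> set es" and e: "e \<in> set (concat ess)" for u e
  proof -
    have ur: "u \<in> span (set rs)" using u unfolding sp[symmetric] by (rule span_base)
    obtain c where c: "u = lc rs c" by (rule span_listE[OF ur refl])
    have z: "B (rs ! i) e = 0 \<and> B e (rs ! i) = 0" if "i < length rs" for i using o nth_mem[OF that] e by blast
    show ?thesis unfolding c lc_def B_suml B_sumr B_scl B_scr using z by simp
  qed
  have "rgram (concat ess @ es) (diag_block_mat (?J @ Bs))"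
  proof -
    have "B u w = 0 \<and> B w u = 0" if "u \<in> set (concat ess)" "w \<in> set es" for u w using o1[of w u] that by simp
    note X = rgram_append[OF J es(2) this]
    from X
    show ?thesis unfolding diag_block_mat_append Let_def .
  qed
  moreover have "rbasis V (concat ess @ es)" unfolding rbasis_def
  proof (intro conjI ballI)
    show "cj e = e" if "e \<in> set (concat ess @ es)" for e using that rbasisD(3)[OF b] rbasisD(3)[OF es(1)] by auto
    have "span (set (concat ess)) \<inter> span (set rs) \<subseteq> {0}" using indl_appendD(3)[OF rbasisD(1)[OF b]] by blast
    thus "indl (concat ess @ es)"
      by (intro indl_appendI[OF indl_appendD(2)[OF rbasisD(1)[OF b]] rbasisD(1)[OF es(1)]]) (unfold sp)
    have "span (set (concat ess @ es)) = span (set (rs @ concat ess))"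
    proof (rule antisym; rule span_minimal[OF _ subspace_span])
      have "set es \<subseteq> span (set rs)" unfolding sp[symmetric] by (rule span_superset)
      also have "\<dots> \<subseteq> span (set (rs @ concat ess))" by (rule span_mono) auto
      finally show "set (concat ess @ es) \<subseteq> span (set (rs @ concat ess))" using span_superset[of "set (rs @ concat ess)"] by auto
      have "set rs \<subseteq> span (set es)" unfolding sp by (rule span_superset)
      also have "\<dots> \<subseteq> span (set (concat ess @ es))" by (rule span_mono) auto
      finally show "set (rs @ concat ess) \<subseteq> span (set (concat ess @ es))" using span_superset[of "set (concat ess @ es)"] by auto
    qed
    thus "span (set (concat ess @ es)) = V" unfolding rbasisD(2)[OF b] .
  qed
  moreover have "set ?J \<subseteq> type_i"
  proof
    fix M assume "M \<in> set ?J"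
    then obtain e where e: "e \<in> set ess" "M = jordan_block (length e) 0" by auto
    have "e \<noteq> []" using e(1) c(2) by metis
    hence "length e \<ge> 1" by (cases e) simp_all
    thus "M \<in> type_i" unfolding type_i_def e(2) by blast
  qed
  ultimately show ?thesis using es(3) by (intro exI[of _ "concat ess @ es"] exI[of _ "?J @ Bs"]) auto
qed

end

section \<open>Real congruence\<close>

lemma real_congruentI:
  assumes "A \<in> carrier_mat n n" "S \<in> carrier_mat n n" "T \<in> carrier_mat n n" "S * T = 1\<^sub>m n"
    and "S * A * transpose_mat S = B"
  shows "real_congruent n A B"
proof -
  have "T * S = 1\<^sub>m n" by (rule mat_mult_left_right_inverse[OF assms(2-4)])
  hence "invertible_mat S" unfolding invertible_mat_def inverts_mat_def using assms(2-4) by (auto intro: exI[of _ T])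
  moreover have "B \<in> carrier_mat n n" using assms by auto
  ultimately show ?thesis unfolding real_congruent_def using assms by blast
qed

lemma real_congruentE:
  assumes "real_congruent n A B"
  obtains S T where "A \<in> carrier_mat n n" "B \<in> carrier_mat n n" "S \<in> carrier_mat n n" "T \<in> carrier_mat n n"
    "S * T = 1\<^sub>m n" "T * S = 1\<^sub>m n" "B = S * A * transpose_mat S"
proof -
  from assms obtain S where S: "A \<in> carrier_mat n n" "B \<in> carrier_mat n n" "S \<in> carrier_mat n n" "invertible_mat S"
    "S * A * transpose_mat S = B" unfolding real_congruent_def by blast
  obtain T where T: "S * T = 1\<^sub>m n" "T * S = 1\<^sub>m (dim_row T)"
    using S(3,4) unfolding invertible_mat_def inverts_mat_def by auto
  have "dim_col T = n" using arg_cong[OF T(1), of dim_col] by simp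
  moreover have "dim_row T = n" using arg_cong[OF T(2), of dim_col] S(3) by simp
  ultimately show ?thesis using that S T by auto
qed

lemma transpose_inverse:
  assumes "S \<in> carrier_mat n n" "T \<in> carrier_mat n n" "S * T = (1\<^sub>m n :: real mat)"
  shows "transpose_mat T * transpose_mat S = 1\<^sub>m n"
  using transpose_mult[OF assms(1,2)] assms(3) by simp

lemma real_congruent_refl: "A \<in> carrier_mat n n \<Longrightarrow> real_congruent n A A"
  by (rule real_congruentI[of _ _ "1\<^sub>m n" "1\<^sub>m n"]) auto

lemma real_congruent_sym: assumes "real_congruent n A B" shows "real_congruent n B A"
proof -
  obtain S T where h: "A \<in> carrier_mat n n" "B \<in> carrier_mat n n" "S \<in> carrier_mat n n" "T \<in> carrier_mat n n"
    "S * T = 1\<^sub>m n" "T * S = 1\<^sub>m n" "B = S * A * transpose_mat S" using real_congruentE[OF assms] .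
  have t: "transpose_mat S * transpose_mat T = 1\<^sub>m n" by (rule transpose_inverse[OF h(4,3,6)])
  have "T * B * transpose_mat T = T * (S * (A * (transpose_mat S * transpose_mat T)))"
    using h(1-4) unfolding h(7) by (simp add: assoc_mult_mat[of _ n n _ n _ n])
  also have "\<dots> = (T * S) * A" using h(1,3,4) unfolding t by (simp add: assoc_mult_mat[of _ n n _ n _ n])
  also have "\<dots> = A" using h(1) unfolding h(6) by simp
  finally show ?thesis by (intro real_congruentI[OF h(2,4,3,6)])
qed

lemma real_congruent_trans: assumes "real_congruent n A B" "real_congruent n B C" shows "real_congruent n A C"
proof -
  obtain S T where h: "A \<in> carrier_mat n n" "B \<in> carrier_mat n n" "S \<in> carrier_mat n n" "T \<in> carrier_mat n n"
    "S * T = 1\<^sub>m n" "T * S = 1\<^sub>m n" "B = S * A * transpose_mat S" using real_congruentE[OF assms(1)] .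
  obtain S' T' where h': "B \<in> carrier_mat n n" "C \<in> carrier_mat n n" "S' \<in> carrier_mat n n" "T' \<in> carrier_mat n n"
    "S' * T' = 1\<^sub>m n" "T' * S' = 1\<^sub>m n" "C = S' * B * transpose_mat S'" using real_congruentE[OF assms(2)] .
  have t: "transpose_mat (S' * S) = transpose_mat S * transpose_mat S'" by (rule transpose_mult[OF h'(3) h(3)])
  show ?thesis
  proof (rule real_congruentI[OF h(1), of "S' * S" "T * T'"])
    have "S' * S * (T * T') = S' * ((S * T) * T')" using h(3,4) h'(3,4) by (simp add: assoc_mult_mat[of _ n n _ n _ n])
    thus "S' * S * (T * T') = 1\<^sub>m n" using h'(4,5) unfolding h(5) by simp
    show "S' * S * A * transpose_mat (S' * S) = C"
      unfolding t h'(7) h(7) using h(1,3) h'(3) by (simp add: assoc_mult_mat[of _ n n _ n _ n])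
  qed (use h h' in auto)
qed

abbreviation dsum :: "real mat \<Rightarrow> real mat \<Rightarrow> real mat" where
  "dsum A B \<equiv> four_block_mat A (0\<^sub>m (dim_row A) (dim_col B)) (0\<^sub>m (dim_row B) (dim_col A)) B"

lemma real_congruent_dsum:
  assumes "real_congruent n A B" "real_congruent m C D"
  shows "real_congruent (n + m) (dsum A C) (dsum B D)"
proof -
  obtain S T where h: "A \<in> carrier_mat n n" "B \<in> carrier_mat n n" "S \<in> carrier_mat n n" "T \<in> carrier_mat n n"
    "S * T = 1\<^sub>m n" "T * S = 1\<^sub>m n" "B = S * A * transpose_mat S" using real_congruentE[OF assms(1)] .
  obtain S' T' where h': "C \<in> carrier_mat m m" "D \<in> carrier_mat m m" "S' \<in> carrier_mat m m" "T' \<in> carrier_mat m m"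
    "S' * T' = 1\<^sub>m m" "T' * S' = 1\<^sub>m m" "D = S' * C * transpose_mat S'" using real_congruentE[OF assms(2)] .
  have mul: "four_block_mat X (0\<^sub>m n m) (0\<^sub>m m n) Y * four_block_mat X' (0\<^sub>m n m) (0\<^sub>m m n) Y' =
    four_block_mat (X * X') (0\<^sub>m n m) (0\<^sub>m m n) (Y * Y')"
    if "X \<in> carrier_mat n n" "X' \<in> carrier_mat n n" "Y \<in> carrier_mat m m" "Y' \<in> carrier_mat m m" for X X' Y Y' :: "real mat"
    by (subst mult_four_block_mat[of _ n n _ m _ m _ _ n _ m]) (use that in auto)
  have tr: "transpose_mat (four_block_mat S (0\<^sub>m n m) (0\<^sub>m m n) S') =
    four_block_mat (transpose_mat S) (0\<^sub>m n m) (0\<^sub>m m n) (transpose_mat S')"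
    by (subst transpose_four_block_mat[of _ n n _ m _ m]) (use h h' in auto)
  have d: "dsum A C = four_block_mat A (0\<^sub>m n m) (0\<^sub>m m n) C" "dsum B D = four_block_mat B (0\<^sub>m n m) (0\<^sub>m m n) D"
    using h h' by auto
  show ?thesis unfolding d
  proof (rule real_congruentI[of _ _ "four_block_mat S (0\<^sub>m n m) (0\<^sub>m m n) S'" "four_block_mat T (0\<^sub>m n m) (0\<^sub>m m n) T'"])
    show "four_block_mat S (0\<^sub>m n m) (0\<^sub>m m n) S' * four_block_mat T (0\<^sub>m n m) (0\<^sub>m m n) T' = 1\<^sub>m (n + m)"
      using h(3-5) h'(3-5) by (subst mul) auto
    show "four_block_mat S (0\<^sub>m n m) (0\<^sub>m m n) S' * four_block_mat A (0\<^sub>m n m) (0\<^sub>m m n) C *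
      transpose_mat (four_block_mat S (0\<^sub>m n m) (0\<^sub>m m n) S') = four_block_mat B (0\<^sub>m n m) (0\<^sub>m m n) D"
      unfolding tr using h(1,3) h'(1,3) unfolding h(7) h'(7) by (simp add: mul)
  qed (use h h' in auto)
qed

lemma mult_index:
  assumes "X \<in> carrier_mat n m" "Y \<in> carrier_mat m k" "i < n" "j < k"
  shows "(X * Y) $$ (i, j) = (\<Sum>a<m. X $$ (i, a) * Y $$ (a, j))"
  using assms by (auto simp: scalar_prod_def atLeast0LessThan intro!: sum.cong)

lemma congruence_index:
  assumes "S \<in> carrier_mat n n" "A \<in> carrier_mat n n" "i < n" "j < n"
  shows "(S * A * transpose_mat S) $$ (i, j) = (\<Sum>a<n. \<Sum>b<n. S $$ (i, a) * A $$ (a, b) * S $$ (j, b))"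
proof -
  have "(S * A * transpose_mat S) $$ (i, j) = (\<Sum>b<n. (S * A) $$ (i, b) * transpose_mat S $$ (b, j))"
    by (rule mult_index[of _ n n _ n]) (use assms in auto)
  also have "\<dots> = (\<Sum>b<n. (\<Sum>a<n. S $$ (i, a) * A $$ (a, b)) * S $$ (j, b))"
    using assms by (intro sum.cong refl arg_cong2[where f="(*)"] mult_index[of _ n n _ n]) auto
  also have "\<dots> = (\<Sum>b<n. \<Sum>a<n. S $$ (i, a) * A $$ (a, b) * S $$ (j, b))" by (simp add: sum_distrib_right)
  also have "\<dots> = (\<Sum>a<n. \<Sum>b<n. S $$ (i, a) * A $$ (a, b) * S $$ (j, b))" by (rule sum.swap)
  finally show ?thesis .
qed

lemma real_congruent_perm:
  assumes A: "A \<in> carrier_mat n n" and f: "bij_betw f {..<n} {..<n}"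
  shows "real_congruent n A (mat n n (\<lambda>(i, j). A $$ (f i, f j)))"
proof -
  let ?S = "mat n n (\<lambda>(i, j). if j = f i then 1 else (0::real))"
  have fl: "f i < n" if "i < n" for i using f that unfolding bij_betw_def by auto
  have fi: "f i = f j \<longleftrightarrow> i = j" if "i < n" "j < n" for i j using f that unfolding bij_betw_def inj_on_def by auto
  show ?thesis
  proof (rule real_congruentI[OF A, of ?S "transpose_mat ?S"])
    show "?S * transpose_mat ?S = 1\<^sub>m n"
    proof (rule eq_matI)
      fix i j assume "i < dim_row (1\<^sub>m n :: real mat)" "j < dim_col (1\<^sub>m n :: real mat)"
      hence ij: "i < n" "j < n" by auto
      have "(?S * transpose_mat ?S) $$ (i, j) = (\<Sum>a<n. ?S $$ (i, a) * transpose_mat ?S $$ (a, j))"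
        by (rule mult_index[of _ n n _ n]) (use ij in auto)
      also have "\<dots> = (\<Sum>a<n. if a = f i then (if f i = f j then 1 else 0) else 0)" using ij by (intro sum.cong) auto
      also have "\<dots> = 1\<^sub>m n $$ (i, j)" using fl[OF ij(1)] fi[OF ij] ij by (simp add: sum.delta)
      finally show "(?S * transpose_mat ?S) $$ (i, j) = 1\<^sub>m n $$ (i, j)" .
    qed auto
    show "?S * A * transpose_mat ?S = mat n n (\<lambda>(i, j). A $$ (f i, f j))"
    proof (rule eq_matI)
      fix i j assume "i < dim_row (mat n n (\<lambda>(i, j). A $$ (f i, f j)))" "j < dim_col (mat n n (\<lambda>(i, j). A $$ (f i, f j)))"
      hence ij: "i < n" "j < n" by auto
      have "(?S * A * transpose_mat ?S) $$ (i, j) = (\<Sum>a<n. \<Sum>b<n. ?S $$ (i, a) * A $$ (a, b) * ?S $$ (j, b))"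
        by (rule congruence_index[OF _ A ij]) simp
      also have "\<dots> = (\<Sum>a<n. \<Sum>b<n. if b = f j then (if a = f i then A $$ (f i, f j) else 0) else 0)"
        using ij by (intro sum.cong) auto
      also have "\<dots> = A $$ (f i, f j)" using fl ij by (simp add: sum.delta)
      finally show "(?S * A * transpose_mat ?S) $$ (i, j) = mat n n (\<lambda>(i, j). A $$ (f i, f j)) $$ (i, j)" using ij by simp
    qed (use A in auto)
  qed auto
qed

lemma dsum_swap:
  assumes A: "A \<in> carrier_mat n n" and C: "C \<in> carrier_mat m m"
  shows "real_congruent (n + m) (dsum A C) (dsum C A)"
proof -
  let ?f = "\<lambda>i. if i < m then n + i else i - m"
  have "bij_betw ?f {..<n + m} {..<n + m}"
    by (rule bij_betwI[where g="\<lambda>i. if i < n then m + i else i - n"]) auto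
  moreover have "dsum A C \<in> carrier_mat (n + m) (n + m)" using A C by simp
  ultimately have "real_congruent (n + m) (dsum A C) (mat (n + m) (n + m) (\<lambda>(i, j). dsum A C $$ (?f i, ?f j)))"
    by (intro real_congruent_perm)
  also have "mat (n + m) (n + m) (\<lambda>(i, j). dsum A C $$ (?f i, ?f j)) = dsum C A"
    by (rule eq_matI) (use A C in auto)
  finally show ?thesis .
qed

section \<open>Direct sums of lists of blocks: blockwise congruence and permutation\<close>

definition sq :: "real mat list \<Rightarrow> bool" where "sq Bs \<longleftrightarrow> (\<forall>B\<in>set Bs. square_mat B)"

definition siz :: "real mat list \<Rightarrow> nat" where "siz Bs = sum_list (map dim_row Bs)"

lemma diag_carrier: "sq Bs \<Longrightarrow> diag_block_mat Bs \<in> carrier_mat (siz Bs) (siz Bs)"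
  using dim_diag_block_mat[of Bs] diag_block_mat_square[of Bs] unfolding sq_def siz_def by (intro carrier_matI) auto

lemma diag_Cons: "diag_block_mat (B # Bs) = dsum B (diag_block_mat Bs)" by (simp add: Let_def)

lemma siz_simps [simp]: "siz [] = 0" "siz (B # Bs) = dim_row B + siz Bs" "siz (Bs @ Cs) = siz Bs + siz Cs"
  unfolding siz_def by auto

lemma sq_simps [simp]: "sq []" "sq (B # Bs) \<longleftrightarrow> square_mat B \<and> sq Bs" "sq (Bs @ Cs) \<longleftrightarrow> sq Bs \<and> sq Cs"
  unfolding sq_def by auto

lemma diag_list_all2:
  "list_all2 (\<lambda>B C. real_congruent (dim_row B) B C) Bs Cs \<Longrightarrow>
    real_congruent (siz Bs) (diag_block_mat Bs) (diag_block_mat Cs)"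
proof (induction rule: list_all2_induct)
  case Nil show ?case using real_congruent_refl[OF diag_carrier[of "[]"]] by simp
next
  case (Cons B Bs C Cs)
  show ?case unfolding diag_Cons siz_simps by (rule real_congruent_dsum[OF Cons(1,3)])
qed

lemma diag_move:
  "sq (xs @ y # ys) \<Longrightarrow> real_congruent (siz (xs @ y # ys)) (diag_block_mat (xs @ y # ys)) (diag_block_mat (y # xs @ ys))"
proof (induction xs)
  case Nil thus ?case using real_congruent_refl[OF diag_carrier[of "y # ys"]] by simp
next
  case (Cons x xs)
  let ?D = "diag_block_mat (xs @ ys)"
  have c: "x \<in> carrier_mat (dim_row x) (dim_row x)" "y \<in> carrier_mat (dim_row y) (dim_row y)" using Cons.prems by auto
  have D: "?D \<in> carrier_mat (siz (xs @ ys)) (siz (xs @ ys))" using Cons.prems by (intro diag_carrier) simp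
  have N: "siz (x # xs @ y # ys) = dim_row x + siz (xs @ y # ys)" "dim_row x + siz (xs @ y # ys) = dim_row x + dim_row y + siz (xs @ ys)"
    by simp_all
  have 1: "real_congruent (dim_row x + siz (xs @ y # ys)) (dsum x (diag_block_mat (xs @ y # ys))) (dsum x (diag_block_mat (y # xs @ ys)))"
    using Cons by (intro real_congruent_dsum[OF real_congruent_refl[OF c(1)]]) simp
  have 2: "dsum x (diag_block_mat (y # xs @ ys)) = dsum (dsum x y) ?D"
    unfolding diag_Cons by (rule assoc_four_block_mat)
  have 3: "real_congruent (dim_row x + dim_row y + siz (xs @ ys)) (dsum (dsum x y) ?D) (dsum (dsum y x) ?D)"
    by (rule real_congruent_dsum[OF dsum_swap[OF c] real_congruent_refl[OF D]])
  have 4: "dsum (dsum y x) ?D = dsum y (dsum x ?D)" by (rule assoc_four_block_mat[symmetric])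
  have "real_congruent (siz (x # xs @ y # ys)) (dsum x (diag_block_mat (xs @ y # ys))) (dsum y (dsum x ?D))"
    using real_congruent_trans[OF 1[unfolded 2 N(2)] 3] unfolding 4 N .
  thus ?case by (simp only: append_Cons diag_Cons)
qed

lemma diag_perm:
  "mset Bs = mset Cs \<Longrightarrow> sq Bs \<Longrightarrow> real_congruent (siz Bs) (diag_block_mat Bs) (diag_block_mat Cs)"
proof (induction Bs arbitrary: Cs)
  case Nil thus ?case using real_congruent_refl[OF diag_carrier[of "[]"]] by simp
next
  case (Cons B Bs)
  have "B \<in> set Cs" using Cons.prems(1) by (metis list.set_intros(1) set_mset_mset)
  then obtain xs ys where Cs: "Cs = xs @ B # ys" by (meson split_list)
  have m: "mset Bs = mset (xs @ ys)" using Cons.prems(1) unfolding Cs by simp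
  have setsq: "sq Cs" using Cons.prems unfolding sq_def by (metis set_mset_mset)
  have siz: "siz Cs = siz (B # Bs)" using Cons.prems(1) unfolding siz_def by (metis mset_map sum_mset_sum_list)
  have c: "B \<in> carrier_mat (dim_row B) (dim_row B)" using Cons.prems by auto
  have "real_congruent (siz (B # Bs)) (diag_block_mat (B # Bs)) (diag_block_mat (B # xs @ ys))"
    unfolding diag_Cons siz_simps using Cons by (intro real_congruent_dsum[OF real_congruent_refl[OF c]] Cons.IH[OF m]) simp
  moreover have "real_congruent (siz (B # Bs)) (diag_block_mat Cs) (diag_block_mat (B # xs @ ys))"
    using diag_move[of xs B ys] setsq unfolding siz[symmetric] Cs by simp
  ultimately show ?case using real_congruent_sym real_congruent_trans by blast
qed

text \<open>The model is the space of complex sequences that vanish from \<open>n\<close> on, with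
  coordinatewise conjugation. The real basis vectors found there are the rows of \<open>S\<close>,
  so their Gram matrix is the congruent matrix.\<close>

theorem matrix_canonical:
  fixes A :: "real mat"
  assumes A: "A \<in> carrier_mat n n"
  shows "\<exists>Bs. set Bs \<subseteq> type_i \<union> type_ii \<union> type_iii \<union> type_iv \<and> real_congruent n A (diag_block_mat Bs)"
proof -
  define sc :: "complex \<Rightarrow> (nat \<Rightarrow> complex) \<Rightarrow> nat \<Rightarrow> complex" where "sc = (\<lambda>c f i. c * f i)"
  define cj :: "(nat \<Rightarrow> complex) \<Rightarrow> nat \<Rightarrow> complex" where "cj = (\<lambda>f i. cnj (f i))"
  define B where "B = (\<lambda>x y. \<Sum>i<n. \<Sum>j<n. x i * of_real (A $$ (i, j)) * (y j :: complex))"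
  interpret F: cform sc cj B
    by unfold_locales (auto simp: sc_def cj_def B_def fun_eq_iff algebra_simps sum.distrib sum_distrib_left)
  define us :: "(nat \<Rightarrow> complex) list" where "us = map (\<lambda>i j. if j = i then 1 else 0) [0..<n]"
  have us: "length us = n" "\<And>i. i < n \<Longrightarrow> us ! i = (\<lambda>j. if j = i then 1 else 0)" unfolding us_def by auto
  have lcapp: "F.lc es c j = (\<Sum>i<length es. c i * (es ! i) j)" for es c j
  proof -
    have "(sum f I) j = (\<Sum>i\<in>I. f i j)" for f :: "nat \<Rightarrow> nat \<Rightarrow> complex" and I by (induction I rule: infinite_finite_induct) auto
    thus ?thesis unfolding F.lc_def by (simp add: sc_def)
  qed
  have lcu: "F.lc us c j = (if j < n then c j else 0)" for c j
    unfolding lcapp us(1) using us(2) by (simp add: if_distrib[of "(*) _"] sum.delta sum.delta' cong: if_cong sum.cong_simp)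
  let ?V = "{f::nat \<Rightarrow> complex. \<forall>j\<ge>n. f j = 0}"
  have rb: "F.rbasis ?V us" unfolding F.rbasis_def
  proof (intro conjI ballI)
    show "cj e = e" if "e \<in> set us" for e using that unfolding us_def cj_def by auto
    show "F.indl us" unfolding F.indl_def us(1)
    proof (intro allI impI)
      fix c i assume "F.lc us c = 0" "i < n"
      thus "c i = 0" using lcu[of c i] by simp
    qed
    show "F.span (set us) = ?V" unfolding F.span_list
    proof (intro equalityI subsetI)
      fix f assume "f \<in> range (F.lc us)"
      then obtain c where "f = F.lc us c" by (elim imageE)
      thus "f \<in> ?V" using lcu by simp
    next
      fix f assume "f \<in> ?V"
      hence "f j = F.lc us f j" for j using lcu[of f j] by (cases "j < n") simp_all
      hence e: "f = F.lc us f" by (rule ext)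
      show "f \<in> range (F.lc us)" by (rule ssubst[OF e, where P="\<lambda>t. t \<in> range (F.lc us)"]) (rule rangeI)
    qed
  qed
  obtain es Bs where es: "F.rbasis ?V es" "F.rgram es (diag_block_mat Bs)"
    "set Bs \<subseteq> type_i \<union> type_ii \<union> type_iii \<union> type_iv"
    using F.canonical_form[OF F.rbasisD(6)[OF rb]] by (elim exE conjE)
  have len: "length es = n" using F.rbasis_dim[OF es(1)] F.rbasis_dim[OF rb] us(1) by simp
  have real: "(es ! i) j = of_real (Re ((es ! i) j))" if "i < n" for i j
    using fun_cong[OF F.rbasisD(3)[OF es(1) nth_mem[of i es]], of j] that len unfolding cj_def by (auto simp: complex_eq_iff)
  define S where "S = mat n n (\<lambda>(i, j). Re ((es ! i) j))"
  have Sc: "S \<in> carrier_mat n n" unfolding S_def by simp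
  have Sr: "(es ! i) j = of_real (S $$ (i, j))" if "i < n" "j < n" for i j using real[OF that(1)] that unfolding S_def by simp
  \<comment> \<open>A kernel vector of the transpose would be a linear relation among the rows, that
    is, among basis vectors.\<close>
  have "det (transpose_mat S) \<noteq> 0"
  proof
    assume "det (transpose_mat S) = 0"
    then obtain v where v: "v \<in> carrier_vec n" "v \<noteq> 0\<^sub>v n" "transpose_mat S *\<^sub>v v = 0\<^sub>v n"
      using det_0_iff_vec_prod_zero_field[of "transpose_mat S" n] Sc by auto
    have "F.lc es (\<lambda>i. of_real (v $ i)) = 0"
    proof (rule ext)
      fix j show "F.lc es (\<lambda>i. of_real (v $ i)) j = 0 j"
      proof (cases "j < n")
        case True
        have "F.lc es (\<lambda>i. of_real (v $ i)) j = (\<Sum>i<n. of_real (S $$ (i, j) * v $ i))"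
          unfolding lcapp len using Sr True by (intro sum.cong) auto
        also have "\<dots> = of_real ((transpose_mat S *\<^sub>v v) $ j)"
          using True Sc v(1) by (simp add: scalar_prod_def atLeast0LessThan)
        finally show ?thesis using v(3) True by simp
      next
        case False
        have "(es ! i) j = 0" if i: "i < n" for i
        proof -
          have "es ! i \<in> set es" using i len by simp
          hence "es ! i \<in> ?V" by (rule set_mp[OF F.rbasisD(4)[OF es(1)]])
          thus ?thesis using False by simp
        qed
        thus ?thesis unfolding lcapp len by simp
      qed
    qed
    hence "of_real (v $ i) = (0::complex)" if i: "i < n" for i
      by (rule F.rbasisD(1)[OF es(1), unfolded F.indl_def len, THEN spec, THEN mp, THEN spec, THEN mp, OF _ i])
    hence "v = 0\<^sub>v n" using v(1) by (intro eq_vecI) auto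
    thus False using v(2) by simp
  qed
  hence "det S \<noteq> 0" using det_transpose[OF Sc] by simp
  from det_non_zero_imp_unit[OF Sc this, of undefined] obtain T where T: "T \<in> carrier_mat n n" "S * T = 1\<^sub>m n"
    unfolding Units_def by (auto simp: ring_mat_simps)
  have "S * A * transpose_mat S = diag_block_mat Bs"
  proof (rule eq_matI)
    have d: "dim_row (diag_block_mat Bs) = n" "dim_col (diag_block_mat Bs) = n" using es(2) len unfolding F.rgram_def by auto
    show "dim_row (S * A * transpose_mat S) = dim_row (diag_block_mat Bs)"
      "dim_col (S * A * transpose_mat S) = dim_col (diag_block_mat Bs)" using d Sc by auto
    fix i j assume "i < dim_row (diag_block_mat Bs)" "j < dim_col (diag_block_mat Bs)"
    hence ij: "i < n" "j < n" using d by auto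
    have "complex_of_real ((S * A * transpose_mat S) $$ (i, j)) = (\<Sum>a<n. \<Sum>b<n. (es ! i) a * of_real (A $$ (a, b)) * (es ! j) b)"
      unfolding congruence_index[OF Sc A ij] using Sr ij by simp
    also have "\<dots> = B (es ! i) (es ! j)" unfolding B_def ..
    also have "\<dots> = of_real (diag_block_mat Bs $$ (i, j))" using es(2) ij len unfolding F.rgram_def by blast
    finally show "(S * A * transpose_mat S) $$ (i, j) = diag_block_mat Bs $$ (i, j)" by simp
  qed
  from real_congruentI[OF A Sc T this] show ?thesis using es(3) by blast
qed

section \<open>Counting chains\<close>

lemma ap_cong: "(\<And>j. j < dim_col A \<Longrightarrow> x j = y j) \<Longrightarrow> ap A x i = ap A y i"
  unfolding ap_def by (intro sum.cong) auto

lemma apT_cong: "(\<And>j. j < dim_row A \<Longrightarrow> x j = y j) \<Longrightarrow> apT A x i = apT A y i"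
  unfolding apT_def by (intro sum.cong) auto

lemma ap_sum: "ap A (\<lambda>i. \<Sum>m<p. c m * x m i) j = (\<Sum>m<p. c m * ap A (x m) j)"
proof -
  have "ap A (\<lambda>i. \<Sum>m<p. c m * x m i) j = (\<Sum>i<dim_col A. \<Sum>m<p. c m * (of_real (A $$ (j, i)) * x m i))"
    unfolding ap_def by (simp add: sum_distrib_left mult.left_commute)
  also have "\<dots> = (\<Sum>m<p. \<Sum>i<dim_col A. c m * (of_real (A $$ (j, i)) * x m i))" by (rule sum.swap)
  finally show ?thesis unfolding ap_def by (simp add: sum_distrib_left)
qed

lemma apT_sum: "apT A (\<lambda>i. \<Sum>m<p. c m * x m i) j = (\<Sum>m<p. c m * apT A (x m) j)"
proof -
  have "apT A (\<lambda>i. \<Sum>m<p. c m * x m i) j = (\<Sum>i<dim_row A. \<Sum>m<p. c m * (of_real (A $$ (i, j)) * x m i))"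
    unfolding apT_def by (simp add: sum_distrib_left mult.left_commute)
  also have "\<dots> = (\<Sum>m<p. \<Sum>i<dim_row A. c m * (of_real (A $$ (i, j)) * x m i))" by (rule sum.swap)
  finally show ?thesis unfolding apT_def by (simp add: sum_distrib_left)
qed

lemma ap_zero [simp]: "ap A (\<lambda>i. 0) j = 0" "apT A (\<lambda>i. 0) j = 0" unfolding ap_def apT_def by simp_all

lemma ap_lin: "ap A (\<lambda>i. x i - y i) j = ap A x j - ap A y j" "ap A (\<lambda>i. x i + y i) j = ap A x j + ap A y j"
  "ap A (\<lambda>i. c * x i) j = c * ap A x j"
  unfolding ap_def by (simp_all add: algebra_simps sum.distrib sum_subtractf sum_distrib_left)

lemma ap_mult:
  assumes "A \<in> carrier_mat n m" "B \<in> carrier_mat m k" "i < n"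
  shows "ap (A * B) x i = ap A (ap B x) i"
proof -
  have "ap (A * B) x i = (\<Sum>j<k. of_real (\<Sum>a<m. A $$ (i, a) * B $$ (a, j)) * x j)"
    unfolding ap_def using assms by (intro sum.cong) (auto simp: mult_index simp del: index_mult_mat(1))
  also have "\<dots> = (\<Sum>j<k. \<Sum>a<m. of_real (A $$ (i, a)) * (of_real (B $$ (a, j)) * x j))"
    by (simp add: sum_distrib_right mult.assoc)
  also have "\<dots> = (\<Sum>a<m. \<Sum>j<k. of_real (A $$ (i, a)) * (of_real (B $$ (a, j)) * x j))" by (rule sum.swap)
  finally show ?thesis using assms unfolding ap_def by (simp add: sum_distrib_left)
qed

lemma ap_transpose: "i < dim_col A \<Longrightarrow> ap (transpose_mat A) x i = apT A x i"
  unfolding ap_def apT_def by simp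

lemma apT_transpose: "i < dim_row A \<Longrightarrow> apT (transpose_mat A) x i = ap A x i"
  unfolding ap_def apT_def by simp

lemma apT_mult:
  assumes "A \<in> carrier_mat n m" "B \<in> carrier_mat m k" "i < k"
  shows "apT (A * B) x i = apT B (apT A x) i"
proof -
  have "apT (A * B) x i = ap (transpose_mat B * transpose_mat A) x i"
    using assms ap_transpose[of i "A * B" x] transpose_mult[OF assms(1,2)] by simp
  also have "\<dots> = ap (transpose_mat B) (ap (transpose_mat A) x) i" by (rule ap_mult[of _ k m _ n]) (use assms in auto)
  also have "\<dots> = ap (transpose_mat B) (apT A x) i" by (rule ap_cong) (use assms ap_transpose in auto)
  also have "\<dots> = apT B (apT A x) i" using assms ap_transpose by simp
  finally show ?thesis .
qed

lemma ap_one: "i < n \<Longrightarrow> ap (1\<^sub>m n) x i = x i" "i < n \<Longrightarrow> apT (1\<^sub>m n) x i = x i"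
  unfolding ap_def apT_def using sum_one[of i n x] sum_oneT[of i n x] by (simp_all del: index_one_mat(1))

lemma ap_adjoint:
  assumes "S \<in> carrier_mat n n"
  shows "(\<Sum>i<n. cnj (x i) * ap S y i) = (\<Sum>i<n. cnj (apT S x i) * y i)"
proof -
  have "(\<Sum>i<n. cnj (x i) * ap S y i) = (\<Sum>i<n. \<Sum>j<n. cnj (x i) * (of_real (S $$ (i, j)) * y j))"
    unfolding ap_def using assms by (simp add: sum_distrib_left)
  also have "\<dots> = (\<Sum>j<n. \<Sum>i<n. cnj (x i) * (of_real (S $$ (i, j)) * y j))" by (rule sum.swap)
  finally show ?thesis using assms unfolding apT_def by (simp add: sum_distrib_left sum_distrib_right mult_ac)
qed

lemma ap_dsum:
  assumes "A \<in> carrier_mat n n" "C \<in> carrier_mat m m"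
  shows "i < n \<Longrightarrow> ap (dsum A C) x i = ap A x i" "i < m \<Longrightarrow> ap (dsum A C) x (n + i) = ap C (\<lambda>j. x (n + j)) i"
    "i < n \<Longrightarrow> apT (dsum A C) x i = apT A x i" "i < m \<Longrightarrow> apT (dsum A C) x (n + i) = apT C (\<lambda>j. x (n + j)) i"
  using assms unfolding ap_def apT_def by (simp_all add: sum_split)

text \<open>Filled up with zero rows to a square matrix, the system has determinant 0 and hence a
  nontrivial solution.\<close>

lemma underdetermined:
  fixes M :: "nat \<Rightarrow> nat \<Rightarrow> complex"
  assumes "p' < p"
  shows "\<exists>c. (\<exists>m<p. c m \<noteq> 0) \<and> (\<forall>e<p'. (\<Sum>m<p. M e m * c m) = 0)"
proof -
  let ?M = "mat p p (\<lambda>(i, j). if i < p' then M i j else 0)"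
  have M: "?M \<in> carrier_mat p p" by simp
  have "det ?M = 0" using laplace_expansion_row[OF M assms] assms by simp
  then obtain v where v: "v \<in> carrier_vec p" "v \<noteq> 0\<^sub>v p" "?M *\<^sub>v v = 0\<^sub>v p"
    using det_0_iff_vec_prod_zero_field[OF M] by auto
  have "\<exists>m<p. v $ m \<noteq> 0"
  proof (rule ccontr)
    assume "\<not> ?thesis" hence "v = 0\<^sub>v p" using v(1) by (intro eq_vecI) auto
    thus False using v(2) by simp
  qed
  moreover have "(\<Sum>m<p. M e m * v $ m) = 0" if "e < p'" for e
  proof -
    have "(?M *\<^sub>v v) $ e = (\<Sum>m<p. M e m * v $ m)"
      using that assms v(1) by (simp add: scalar_prod_def atLeast0LessThan)
    thus ?thesis using v(3) that assms by simp
  qed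
  ultimately show ?thesis by (intro exI[of _ "\<lambda>m. v $ m"]) simp
qed

section \<open>Counts bracketed from below and above\<close>

context
  fixes k :: nat and l :: complex and z :: bool and s :: complex
begin

text \<open>The flag \<open>z\<close> asks that the chain end in the zero vector. With eigenvalue 0
  such chains with nonzero start occur, among the canonical blocks, only in nilpotent Jordan blocks
  of odd size.\<close>

definition wit :: "real mat \<Rightarrow> (nat \<Rightarrow> nat \<Rightarrow> complex) \<Rightarrow> bool" where
  "wit A X \<longleftrightarrow> (\<forall>r<k. \<forall>i<dim_row A. ap A (X r) i = l * apT A (X r) i + (if r = 0 then 0 else apT A (X (r - 1)) i)) \<and>
     (z \<longrightarrow> (\<forall>i<dim_row A. X (k - 1) i = 0))"

text \<open>\<open>s = 0\<close> encodes the squared norm of the first vector, which merely counts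
  dimensions. A nonzero \<open>s\<close> is the factor that aligns the sesquilinear form of the
  chain with the real axis.\<close>

definition val :: "real mat \<Rightarrow> (nat \<Rightarrow> nat \<Rightarrow> complex) \<Rightarrow> real" where
  "val A X = (if s = 0 then (\<Sum>i<dim_row A. (cmod (X 0 i))\<^sup>2)
     else Re (s * (\<Sum>i<dim_row A. cnj (X (k - 1) i) * apT A (X 0) i)))"

text \<open>A bound for the number of positive squares that needs no diagonalization;
  \<open>upper\<close> is its counterpart, with conditions on the first vector alone.\<close>

definition lower :: "real mat \<Rightarrow> nat \<Rightarrow> bool" where
  "lower A p \<longleftrightarrow> (\<exists>Xs. (\<forall>m<p. wit A (Xs m)) \<and>
     (\<forall>c. (\<exists>m<p. c m \<noteq> 0) \<longrightarrow> val A (\<lambda>r i. \<Sum>m<p. c m * Xs m r i) > 0))"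

definition upper :: "real mat \<Rightarrow> nat \<Rightarrow> bool" where
  "upper A p \<longleftrightarrow> (\<exists>w. \<forall>X. wit A X \<longrightarrow> (\<forall>m<p. (\<Sum>i<dim_row A. w m i * X 0 i) = 0) \<longrightarrow> val A X \<le> 0)"

lemma wit_cong:
  assumes "A \<in> carrier_mat n n" "\<And>r i. i < n \<Longrightarrow> X r i = Y r i"
  shows "wit A X = wit A Y"
proof -
  have "ap A (X r) i = ap A (Y r) i" "apT A (X r) i = apT A (Y r) i" for r i
    by (rule ap_cong apT_cong; use assms in simp)+
  thus ?thesis unfolding wit_def using assms by simp
qed

lemma val_cong:
  assumes "A \<in> carrier_mat n n" "\<And>r i. i < n \<Longrightarrow> X r i = Y r i"
  shows "val A X = val A Y"
proof -
  have "apT A (X r) i = apT A (Y r) i" for r i by (rule apT_cong) (use assms in simp)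
  thus ?thesis unfolding val_def using assms by (simp cong: sum.cong_simp)
qed

lemma wit_zero: "wit A (\<lambda>r i. 0)" unfolding wit_def by simp

lemma val_zero: "val A (\<lambda>r i. 0) = 0" unfolding val_def by simp

lemma wit_comb:
  assumes "\<And>m. m < p \<Longrightarrow> wit A (Xs m)"
  shows "wit A (\<lambda>r i. \<Sum>m<p. c m * Xs m r i)"
  unfolding wit_def ap_sum apT_sum
proof (intro conjI allI impI)
  fix r i assume ri: "r < k" "i < dim_row A"
  have "(\<Sum>m<p. c m * ap A (Xs m r) i) =
    (\<Sum>m<p. c m * (l * apT A (Xs m r) i + (if r = 0 then 0 else apT A (Xs m (r - 1)) i)))"
    using assms ri unfolding wit_def by (intro sum.cong) auto
  also have "\<dots> = l * (\<Sum>m<p. c m * apT A (Xs m r) i) + (if r = 0 then 0 else \<Sum>m<p. c m * apT A (Xs m (r - 1)) i)"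
    by (simp add: algebra_simps sum.distrib sum_distrib_left)
  finally show "(\<Sum>m<p. c m * ap A (Xs m r) i) =
    l * (\<Sum>m<p. c m * apT A (Xs m r) i) + (if r = 0 then 0 else \<Sum>m<p. c m * apT A (Xs m (r - 1)) i)" .
next
  fix i assume "z" "i < dim_row A"
  hence "Xs m (k - 1) i = 0" if "m < p" for m using assms[OF that] unfolding wit_def by blast
  thus "(\<Sum>m<p. c m * Xs m (k - 1) i) = 0" by (intro sum.neutral) simp
qed

lemma all_less_add: "(\<forall>i<n + m. Q i) \<longleftrightarrow> (\<forall>i<n. Q i) \<and> (\<forall>i<m. Q (n + i))" for n m :: nat
proof (intro iffI allI impI; (elim conjE)?)
  fix i assume h: "i < n + m" "\<forall>i<n. Q i" "\<forall>i<m. Q (n + i)"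
  show "Q i"
  proof (cases "i < n")
    case False thus ?thesis using h(1) h(3)[rule_format, of "i - n"] by simp
  qed (use h(2) in simp)
qed auto

lemma wit_dsum:
  assumes "A \<in> carrier_mat n n" "C \<in> carrier_mat m m"
  shows "wit (dsum A C) X \<longleftrightarrow> wit A X \<and> wit C (\<lambda>r i. X r (n + i))"
proof -
  define D where "D = dsum A C"
  have d: "dim_row D = n + m" "dim_row A = n" "dim_row C = m" using assms unfolding D_def by auto
  show ?thesis unfolding D_def[symmetric] unfolding wit_def d all_less_add
    by (simp add: ap_dsum[OF assms, folded D_def] imp_conjR all_conj_distrib conj_ac)
qed

lemma val_dsum:
  assumes "A \<in> carrier_mat n n" "C \<in> carrier_mat m m"
  shows "val (dsum A C) X = val A X + val C (\<lambda>r i. X r (n + i))"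
proof -
  define D where "D = dsum A C"
  have d: "dim_row D = n + m" "dim_row A = n" "dim_row C = m" using assms unfolding D_def by auto
  show ?thesis unfolding D_def[symmetric] unfolding val_def d sum_split
    by (simp add: ap_dsum(3,4)[OF assms, folded D_def] distrib_left)
qed

lemma lower_dsum:
  assumes A: "A \<in> carrier_mat n n" and C: "C \<in> carrier_mat m m" and lA: "lower A p" and lC: "lower C p'"
  shows "lower (dsum A C) (p + p')"
proof -
  obtain Xs where X: "\<And>m. m < p \<Longrightarrow> wit A (Xs m)" "\<And>c. (\<exists>m<p. c m \<noteq> 0) \<Longrightarrow> val A (\<lambda>r i. \<Sum>m<p. c m * Xs m r i) > 0"
    using lA unfolding lower_def by blast
  obtain Ys where Y: "\<And>m. m < p' \<Longrightarrow> wit C (Ys m)" "\<And>c. (\<exists>m<p'. c m \<noteq> 0) \<Longrightarrow> val C (\<lambda>r i. \<Sum>m<p'. c m * Ys m r i) > 0"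
    using lC unfolding lower_def by blast
  define Z where "Z = (\<lambda>a r i. if a < p then (if i < n then Xs a r i else 0) else (if i < n then 0 else Ys (a - p) r (i - n)))"
  have nX: "val A (\<lambda>r i. \<Sum>m<p. c m * Xs m r i) \<ge> 0" for c
  proof (cases "\<exists>m<p. c m \<noteq> 0")
    case True thus ?thesis using X(2)[of c] by simp
  next
    case False
    hence "(\<lambda>r i. \<Sum>m<p. c m * Xs m r i) = (\<lambda>r i. 0)" by simp
    thus ?thesis using val_zero[of A] by simp
  qed
  have nY: "val C (\<lambda>r i. \<Sum>m<p'. c m * Ys m r i) \<ge> 0" for c
  proof (cases "\<exists>m<p'. c m \<noteq> 0")
    case True thus ?thesis using Y(2)[of c] by simp
  next
    case False
    hence "(\<lambda>r i. \<Sum>m<p'. c m * Ys m r i) = (\<lambda>r i. 0)" by simp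
    thus ?thesis using val_zero[of C] by simp
  qed
  have "wit (dsum A C) (Z a)" if a: "a < p + p'" for a unfolding wit_dsum[OF A C]
  proof (cases "a < p")
    case True
    have 1: "wit A (Z a) = wit A (Xs a)" by (rule wit_cong[OF A]) (use True in \<open>simp add: Z_def\<close>)
    have 2: "(\<lambda>r i. Z a r (n + i)) = (\<lambda>r i. 0)" using True by (simp add: Z_def)
    show "wit A (Z a) \<and> wit C (\<lambda>r i. Z a r (n + i))" unfolding 1 2 using wit_zero X(1)[OF True] by simp
  next
    case False
    have 1: "wit A (Z a) = wit A (\<lambda>r i. 0)" by (rule wit_cong[OF A]) (use False in \<open>simp add: Z_def\<close>)
    have 2: "(\<lambda>r i. Z a r (n + i)) = Ys (a - p)" using False by (simp add: Z_def)
    show "wit A (Z a) \<and> wit C (\<lambda>r i. Z a r (n + i))" unfolding 1 2 using wit_zero Y(1)[of "a - p"] a False by simp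
  qed
  moreover have "val (dsum A C) (\<lambda>r i. \<Sum>m<p + p'. c m * Z m r i) > 0" if c: "\<exists>m<p + p'. c m \<noteq> 0" for c
  proof -
    have 1: "val A (\<lambda>r i. \<Sum>m<p + p'. c m * Z m r i) = val A (\<lambda>r i. \<Sum>m<p. c m * Xs m r i)"
      by (rule val_cong[OF A]) (simp add: sum_split Z_def)
    have 2: "(\<lambda>r i. \<Sum>m<p + p'. c m * Z m r (n + i)) = (\<lambda>r i. \<Sum>m<p'. c (p + m) * Ys m r i)"
      by (simp add: sum_split Z_def)
    from c obtain m where m: "m < p + p'" "c m \<noteq> 0" by blast
    have "val A (\<lambda>r i. \<Sum>m<p. c m * Xs m r i) > 0 \<or> val C (\<lambda>r i. \<Sum>m<p'. c (p + m) * Ys m r i) > 0"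
    proof (cases "m < p")
      case True thus ?thesis using X(2)[of c] m(2) by blast
    next
      case False
      have "\<exists>m<p'. c (p + m) \<noteq> 0" by (rule exI[of _ "m - p"]) (use False m in simp)
      thus ?thesis using Y(2)[of "\<lambda>m. c (p + m)"] by simp
    qed
    thus ?thesis unfolding val_dsum[OF A C] 1 2 using nX[of c] nY[of "\<lambda>m. c (p + m)"] by linarith
  qed
  ultimately show ?thesis unfolding lower_def by (intro exI[of _ Z]) blast
qed

lemma upper_dsum:
  assumes A: "A \<in> carrier_mat n n" and C: "C \<in> carrier_mat m m" and uA: "upper A p" and uC: "upper C p'"
  shows "upper (dsum A C) (p + p')"
proof -
  have d: "dim_row (dsum A C) = n + m" "dim_row A = n" "dim_row C = m" using A C by auto
  obtain v where v: "\<And>X. wit A X \<Longrightarrow> (\<forall>m<p. (\<Sum>i<n. v m i * X 0 i) = 0) \<Longrightarrow> val A X \<le> 0"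
    using uA unfolding upper_def d by blast
  obtain w where w: "\<And>X. wit C X \<Longrightarrow> (\<forall>a<p'. (\<Sum>i<m. w a i * X 0 i) = 0) \<Longrightarrow> val C X \<le> 0"
    using uC unfolding upper_def d by blast
  define u where "u = (\<lambda>a i. if a < p then (if i < n then v a i else 0) else (if i < n then 0 else w (a - p) (i - n)))"
  have "val (dsum A C) X \<le> 0" if X: "wit (dsum A C) X" "\<forall>a<p + p'. (\<Sum>i<n + m. u a i * X 0 i) = 0" for X
  proof -
    have "(\<Sum>i<n. v a i * X 0 i) = 0" if "a < p" for a
      using X(2)[rule_format, of a] that unfolding sum_split by (simp add: u_def)
    moreover have "(\<Sum>i<m. w a i * X 0 (n + i)) = 0" if "a < p'" for a
      using X(2)[rule_format, of "p + a"] that unfolding sum_split by (simp add: u_def)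
    ultimately show ?thesis unfolding val_dsum[OF A C] using X(1) v[of X] w[of "\<lambda>r i. X r (n + i)"]
      unfolding wit_dsum[OF A C] by (simp add: add_nonpos_nonpos)
  qed
  thus ?thesis unfolding upper_def d(1) by (intro exI[of _ u]) blast
qed

text \<open>The transpose of \<open>S\<close> carries chains of \<open>B\<close> to chains of
  \<open>A\<close>. The sesquilinear form is preserved; the norm is not, but injectivity keeps it
  positive.\<close>

lemma lower_congruent:
  assumes AB: "real_congruent n A B" and lB: "lower B p"
  shows "lower A p"
proof -
  obtain S T where h: "A \<in> carrier_mat n n" "B \<in> carrier_mat n n" "S \<in> carrier_mat n n" "T \<in> carrier_mat n n"
    "S * T = 1\<^sub>m n" "T * S = 1\<^sub>m n" "B = S * A * transpose_mat S" using real_congruentE[OF AB] .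
  obtain Xs where X: "\<And>m. m < p \<Longrightarrow> wit B (Xs m)" "\<And>c. (\<exists>m<p. c m \<noteq> 0) \<Longrightarrow> val B (\<lambda>r i. \<Sum>m<p. c m * Xs m r i) > 0"
    using lB unfolding lower_def by blast
  have SA: "S * A \<in> carrier_mat n n" "transpose_mat S \<in> carrier_mat n n" "S * transpose_mat A \<in> carrier_mat n n" using h(1,3) by auto
  have apB: "ap B x i = ap S (ap A (apT S x)) i" if "i < n" for x i
  proof -
    have "ap B x i = ap S (ap A (ap (transpose_mat S) x)) i"
      unfolding h(7) ap_mult[OF SA(1,2) that] ap_mult[OF h(3,1) that] ..
    also have "\<dots> = ap S (ap A (apT S x)) i"
    proof (rule ap_cong)
      fix j show "ap A (ap (transpose_mat S) x) j = ap A (apT S x) j"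
        by (rule ap_cong) (use h(1,3) ap_transpose in auto)
    qed
    finally show ?thesis .
  qed
  have apTB: "apT B x i = ap S (apT A (apT S x)) i" if "i < n" for x i
  proof -
    have "apT B x i = apT (transpose_mat S) (apT (S * A) x) i" unfolding h(7) by (rule apT_mult[OF SA(1,2) that])
    also have "\<dots> = ap S (apT (S * A) x) i" using that h(3) by (intro apT_transpose) simp
    also have "\<dots> = ap S (apT A (apT S x)) i" by (rule ap_cong) (use h(3) apT_mult[OF h(3,1)] in auto)
    finally show ?thesis .
  qed
  have inv: "ap T (ap S x) i = x i" if "i < n" for x i using ap_mult[OF h(4,3) that, of x] that unfolding h(6) by (simp add: ap_one)
  have invT: "apT T (apT S x) i = x i" if "i < n" for x i using apT_mult[OF h(3,4) that, of x] that unfolding h(5) by (simp add: ap_one)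
  have d: "dim_row A = n" "dim_row B = n" using h by auto
  have wit: "wit A (\<lambda>r. apT S (X r))" if w: "wit B X" for X unfolding wit_def d
  proof (intro conjI allI impI)
    fix r i assume ri: "r < k" "i < n"
    let ?u = "\<lambda>i. ap A (apT S (X r)) i - (l * apT A (apT S (X r)) i + (if r = 0 then 0 else apT A (apT S (X (r - 1))) i))"
    have "ap S ?u j = 0" if j: "j < n" for j
    proof -
      have "ap S ?u j = ap B (X r) j - (l * apT B (X r) j + (if r = 0 then 0 else apT B (X (r - 1)) j))"
        unfolding ap_lin apB[OF j] apTB[OF j] by (simp add: ap_lin)
      thus ?thesis using w ri(1) j unfolding wit_def d by simp
    qed
    hence "ap T (ap S ?u) i = ap T (\<lambda>i. 0) i" using h(4) by (intro ap_cong) simp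
    hence "?u i = 0" using inv[OF ri(2)] by simp
    thus "ap A (apT S (X r)) i = l * apT A (apT S (X r)) i + (if r = 0 then 0 else apT A (apT S (X (r - 1))) i)" by simp
  next
    fix i assume "z" "i < n"
    have "\<forall>i<n. X (k - 1) i = 0" using w \<open>z\<close> unfolding wit_def d by blast
    hence "apT S (X (k - 1)) i = apT S (\<lambda>i. 0) i" by (intro apT_cong) (use h(3) in auto)
    thus "apT S (X (k - 1)) i = 0" by simp
  qed
  have val: "val A (\<lambda>r. apT S (X r)) > 0" if v: "val B X > 0" for X
  proof (cases "s = 0")
    case True
    have "\<exists>i<n. apT S (X 0) i \<noteq> 0"
    proof (rule ccontr)
      assume a: "\<not> ?thesis"
      have "apT T (apT S (X 0)) i = apT T (\<lambda>i. 0) i" for i by (rule apT_cong) (use a h(4) in auto)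
      hence "X 0 i = 0" if "i < n" for i using invT[OF that, of "X 0"] by simp
      thus False using v True unfolding val_def d by simp
    qed
    then obtain i where i: "i < n" "apT S (X 0) i \<noteq> 0" by blast
    have "0 < (cmod (apT S (X 0) i))\<^sup>2" using i by simp
    also have "\<dots> \<le> (\<Sum>i<n. (cmod (apT S (X 0) i))\<^sup>2)" using i by (intro member_le_sum) auto
    finally show ?thesis unfolding val_def d using True by simp
  next
    case False
    have "(\<Sum>i<n. cnj (X (k - 1) i) * apT B (X 0) i) = (\<Sum>i<n. cnj (apT S (X (k - 1)) i) * apT A (apT S (X 0)) i)"
      unfolding ap_adjoint[OF h(3), symmetric] using apTB by simp
    thus ?thesis using v False unfolding val_def d by simp
  qed
  show ?thesis unfolding lower_def
  proof (intro exI[of _ "\<lambda>m r. apT S (Xs m r)"] conjI allI impI)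
    show "wit A (\<lambda>r. apT S (Xs m r))" if "m < p" for m by (rule wit[OF X(1)[OF that]])
    fix c :: "nat \<Rightarrow> complex" assume "\<exists>m<p. c m \<noteq> 0"
    from val[OF X(2)[OF this]] have "0 < val A (\<lambda>r i. apT S (\<lambda>i. \<Sum>m<p. c m * Xs m r i) i)" .
    thus "0 < val A (\<lambda>r i. \<Sum>m<p. c m * apT S (Xs m r) i)" unfolding apT_sum .
  qed
qed

text \<open>Fewer conditions than witnesses leave a nontrivial combination satisfying all of them;
  its value would be positive and nonpositive.\<close>

lemma lower_le_upper:
  assumes "lower A p" "upper A p'"
  shows "p \<le> p'"
proof (rule ccontr)
  assume "\<not> p \<le> p'"
  hence pp: "p' < p" by simp
  obtain Xs where X: "\<And>m. m < p \<Longrightarrow> wit A (Xs m)" "\<And>c. (\<exists>m<p. c m \<noteq> 0) \<Longrightarrow> val A (\<lambda>r i. \<Sum>m<p. c m * Xs m r i) > 0"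
    using assms(1) unfolding lower_def by blast
  obtain w where w: "\<And>X. wit A X \<Longrightarrow> (\<forall>m<p'. (\<Sum>i<dim_row A. w m i * X 0 i) = 0) \<Longrightarrow> val A X \<le> 0"
    using assms(2) unfolding upper_def by blast
  obtain c where c: "\<exists>m<p. c m \<noteq> 0" "\<forall>e<p'. (\<Sum>m<p. (\<Sum>i<dim_row A. w e i * Xs m 0 i) * c m) = 0"
    using underdetermined[OF pp, of "\<lambda>e m. \<Sum>i<dim_row A. w e i * Xs m 0 i"] by blast
  have "val A (\<lambda>r i. \<Sum>m<p. c m * Xs m r i) \<le> 0"
  proof (rule w[OF wit_comb[OF X(1)]], assumption, intro allI impI)
    fix e assume e: "e < p'"
    have "(\<Sum>i<dim_row A. w e i * (\<Sum>m<p. c m * Xs m 0 i)) = (\<Sum>i<dim_row A. \<Sum>m<p. w e i * Xs m 0 i * c m)"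
      by (simp add: sum_distrib_left mult_ac)
    also have "\<dots> = (\<Sum>m<p. \<Sum>i<dim_row A. w e i * Xs m 0 i * c m)" by (rule sum.swap)
    also have "\<dots> = 0" using c(2) e by (simp add: sum_distrib_right)
    finally show "(\<Sum>i<dim_row A. w e i * (\<Sum>m<p. c m * Xs m 0 i)) = 0" .
  qed
  thus False using X(2)[OF c(1)] by simp
qed

definition cert :: "real mat \<Rightarrow> nat \<Rightarrow> bool" where "cert A p \<longleftrightarrow> lower A p \<and> upper A p"

lemma cert_diag:
  assumes "\<And>c. c \<in> set cs \<Longrightarrow> square_mat (M c) \<and> cert (M c) (f c)"
  shows "cert (diag_block_mat (map M cs)) (sum_list (map f cs))"
  using assms
proof (induction cs)
  case Nil show ?case unfolding cert_def lower_def upper_def val_def by auto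
next
  case (Cons c cs)
  have c: "M c \<in> carrier_mat (dim_row (M c)) (dim_row (M c))" "cert (M c) (f c)" using Cons.prems by auto
  have "sq (map M cs)" unfolding sq_def using Cons.prems by auto
  note D = diag_carrier[OF this]
  have "cert (diag_block_mat (map M cs)) (sum_list (map f cs))" using Cons by simp
  thus ?case using lower_dsum[OF c(1) D] upper_dsum[OF c(1) D] c(2)
    unfolding list.map diag_Cons sum_list.Cons cert_def by blast
qed

lemma cert_congruent_le: "real_congruent n A B \<Longrightarrow> lower B p \<Longrightarrow> cert A p' \<Longrightarrow> p \<le> p'"
  using lower_le_upper lower_congruent unfolding cert_def by blast

end

section \<open>Chains in the canonical blocks\<close>

text \<open>For the block with identity and J(\<mu>) off the diagonal the chain equations decouple:
  the upper half of the coordinates satisfies \<open>uch\<close>, the lower half \<open>vch\<close>,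
  where the transposed Jordan block occurs.\<close>

definition uch :: "nat \<Rightarrow> complex \<Rightarrow> complex \<Rightarrow> nat \<Rightarrow> (nat \<Rightarrow> nat \<Rightarrow> complex) \<Rightarrow> bool" where
  "uch k l \<mu> n u \<longleftrightarrow> (\<forall>r<k. \<forall>i<n. \<mu> * u r i + (if Suc i < n then u r (Suc i) else 0) = l * u r i + (if r = 0 then 0 else u (r - 1) i))"

definition vch :: "nat \<Rightarrow> complex \<Rightarrow> complex \<Rightarrow> nat \<Rightarrow> (nat \<Rightarrow> nat \<Rightarrow> complex) \<Rightarrow> bool" where
  "vch k l \<mu> n v \<longleftrightarrow> (\<forall>r<k. \<forall>i<n. v r i = l * (\<mu> * v r i + (if 0 < i then v r (i - 1) else 0)) +
     (if r = 0 then 0 else \<mu> * v (r - 1) i + (if 0 < i then v (r - 1) (i - 1) else 0)))"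

text \<open>The equations for Gamma times a complex scalar \<open>w\<close>, as met in one complex
  component of the product with C(a,b). Conjugation separates the scalar of the matrix from that of
  its transpose.\<close>

definition gch :: "nat \<Rightarrow> complex \<Rightarrow> complex \<Rightarrow> nat \<Rightarrow> (nat \<Rightarrow> nat \<Rightarrow> complex) \<Rightarrow> bool" where
  "gch k l w n y \<longleftrightarrow> (\<forall>r<k. \<forall>i<n.
     cnj w * (-1) ^ (n - Suc i) * (y r (n - Suc i) + (if 0 < i then y r (n - i) else 0)) =
     l * (w * (-1) ^ i * (y r (n - Suc i) - (if 0 < i then y r (n - i) else 0))) +
     (if r = 0 then 0 else w * (-1) ^ i * (y (r - 1) (n - Suc i) - (if 0 < i then y (r - 1) (n - i) else 0))))"

lemma uch_zero: assumes "uch k l \<mu> n u" "\<mu> \<noteq> l" shows "r < k \<Longrightarrow> i < n \<Longrightarrow> u r i = 0"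
proof (induction r arbitrary: i)
  case 0
  show ?case
  proof (rule down_zero[of "\<mu> - l" n "u 0" i])
    fix j assume "j < n"
    thus "(\<mu> - l) * u 0 j + (if Suc j < n then u 0 (Suc j) else 0) = 0"
      using assms(1) 0(1) unfolding uch_def by (fastforce simp: algebra_simps)
  qed (use assms(2) 0 in auto)
next
  case (Suc r)
  show ?case
  proof (rule down_zero[of "\<mu> - l" n "u (Suc r)" i])
    fix j assume j: "j < n"
    have "u r j = 0" using Suc.IH[of j] Suc.prems j by simp
    moreover have "\<mu> * u (Suc r) j + (if Suc j < n then u (Suc r) (Suc j) else 0) = l * u (Suc r) j + u r j"
      using assms(1)[unfolded uch_def, rule_format, OF Suc.prems(1) j] by simp
    ultimately show "(\<mu> - l) * u (Suc r) j + (if Suc j < n then u (Suc r) (Suc j) else 0) = 0"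
      by (simp add: algebra_simps)
  qed (use assms(2) Suc.prems in auto)
qed

lemma vch_zero: assumes "vch k l \<mu> n v" "l * \<mu> \<noteq> 1" shows "r < k \<Longrightarrow> i < n \<Longrightarrow> v r i = 0"
proof (induction r arbitrary: i rule: less_induct)
  case (less r)
  have p: "r > 0 \<Longrightarrow> i < n \<Longrightarrow> v (r - 1) i = 0" for i using less.IH[of "r - 1" i] less.prems by simp
  show ?case using less.prems(2)
  proof (induction i)
    case 0
    have "v r 0 = l * (\<mu> * v r 0)" using assms(1)[unfolded vch_def, rule_format, OF less.prems(1) 0] p[OF _ 0] by (simp split: if_splits)
    hence "(1 - l * \<mu>) * v r 0 = 0" by (simp add: algebra_simps)
    thus ?case using assms(2) by simp
  next
    case (Suc i)
    have "v r i = 0" using Suc by simp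
    hence "v r (Suc i) = l * (\<mu> * v r (Suc i))"
      using assms(1)[unfolded vch_def, rule_format, OF less.prems(1) Suc.prems] p[OF _ Suc.prems] p[of i] Suc.prems by (simp split: if_splits)
    hence "(1 - l * \<mu>) * v r (Suc i) = 0" by (simp add: algebra_simps)
    thus ?case using assms(2) by simp
  qed
qed

text \<open>At the eigenvalue the equations are pure shifts: coordinate i of one vector becomes
  coordinate i + 1 of the next. So the first vector lives in coordinate 0, and a chain longer than
  the block would push it over the edge.\<close>

lemma uch_eig:
  assumes "uch k l l n u" "0 < k" "0 < n"
  shows "0 < i \<Longrightarrow> i < n \<Longrightarrow> u 0 i = 0" "n < k \<Longrightarrow> u 0 0 = 0"
proof -
  have 1: "Suc i < n \<Longrightarrow> u r (Suc i) = (if r = 0 then 0 else u (r - 1) i)" "Suc i = n \<Longrightarrow> 0 < r \<Longrightarrow> u (r - 1) i = 0" if "r < k" for r i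
    using assms(1)[unfolded uch_def, rule_format, OF that, of i] by (auto split: if_splits)
  show "u 0 i = 0" if "0 < i" "i < n" using 1(1)[OF assms(2), of "i - 1"] that by simp
  assume nk: "n < k"
  have d: "r < n \<Longrightarrow> u r r = u 0 0" for r
  proof (induction r)
    case (Suc r) thus ?case using 1(1)[of "Suc r" r] nk by simp
  qed (rule refl)
  show "u 0 0 = 0" using 1(2)[OF nk, of "n - 1"] assms(3) d[of "n - 1"] by simp
qed

lemma uch_ex: assumes "k \<le> n" shows "uch k l l n (\<lambda>r i. if i = r then 1 else 0)"
  unfolding uch_def using assms by auto

text \<open>Solves \<open>vch\<close> for \<open>l * \<mu> = 1\<close>: the terms at the current
  coordinate cancel and the preceding coordinate is determined by the previous vector. The index
  counts coordinates from the end.\<close>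

primrec hv :: "complex \<Rightarrow> nat \<Rightarrow> nat \<Rightarrow> complex" where
  "hv \<mu> 0 = (\<lambda>j. if j = 0 then 1 else 0)"
| "hv \<mu> (Suc r) = (\<lambda>j. case j of 0 \<Rightarrow> 0 | Suc j \<Rightarrow> - \<mu> * (\<mu> * hv \<mu> r j + hv \<mu> r (Suc j)))"

lemma hv_support: "r < j \<Longrightarrow> hv \<mu> r j = 0"
  by (induction r arbitrary: j) (auto split: nat.splits)

lemma vch_ex: assumes lm: "l * \<mu> = 1" shows "vch n l \<mu> n (\<lambda>r j. hv \<mu> r (n - Suc j))"
  unfolding vch_def
proof (intro allI impI)
  fix r i assume ri: "r < n" "i < n"
  define j where "j = n - Suc i"
  have l: "l * (\<mu> * x) = x" for x using lm by (simp add: mult.assoc[symmetric])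
  show "hv \<mu> r (n - Suc i) = l * (\<mu> * hv \<mu> r (n - Suc i) + (if 0 < i then hv \<mu> r (n - Suc (i - 1)) else 0)) +
     (if r = 0 then 0 else \<mu> * hv \<mu> (r - 1) (n - Suc i) + (if 0 < i then hv \<mu> (r - 1) (n - Suc (i - 1)) else 0))"
  proof (cases "0 < i")
    case True
    hence j: "n - Suc (i - 1) = Suc j" using ri unfolding j_def by simp
    show ?thesis
    proof (cases r)
      case 0 thus ?thesis unfolding j j_def[symmetric] using True by (simp add: distrib_left l)
    next
      case (Suc q)
      have "hv \<mu> (Suc q) (Suc j) = - \<mu> * (\<mu> * hv \<mu> q j + hv \<mu> q (Suc j))" by simp
      thus ?thesis unfolding j j_def[symmetric] Suc using True by (simp add: distrib_left right_diff_distrib l del: hv.simps)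
    qed
  next
    case False
    have "r \<noteq> 0 \<Longrightarrow> hv \<mu> (r - 1) (n - Suc i) = 0" using False ri by (intro hv_support) simp
    thus ?thesis using False l by simp
  qed
qed

text \<open>Multiplying equation i by the sign of i leaves one global sign, independent of the
  row.\<close>

lemma gch_norm:
  "gch k l w n y \<longleftrightarrow> (\<forall>r<k. \<forall>i<n.
     (-1) ^ (n - 1) * cnj w * (y r (n - Suc i) + (if 0 < i then y r (n - i) else 0)) =
     l * (w * (y r (n - Suc i) - (if 0 < i then y r (n - i) else 0))) +
     (if r = 0 then 0 else w * (y (r - 1) (n - Suc i) - (if 0 < i then y (r - 1) (n - i) else 0))))"
proof -
  have "(cnj w * (-1) ^ (n - Suc i) * a = l * (w * (-1) ^ i * b) + (if r = 0 then 0 else w * (-1) ^ i * c)) \<longleftrightarrow>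
    ((-1) ^ (n - 1) * cnj w * a = l * (w * b) + (if r = 0 then 0 else w * c))" if i: "i < n" for i a b c and r :: nat
  proof -
    have m: "(-1::complex) ^ i * (-1) ^ i = 1" by (simp add: power_add[symmetric] mult_2[symmetric])
    have e: "(-1::complex) ^ (n - Suc i) * (-1) ^ i = (-1) ^ (n - 1)" using i by (simp add: power_add[symmetric])
    have a: "(-1) ^ i * (cnj w * (-1) ^ (n - Suc i) * a) = (-1) ^ (n - 1) * cnj w * a" unfolding e[symmetric] by simp
    have "(-1) ^ i * (l * (w * (-1) ^ i * b) + (if r = 0 then 0 else w * (-1) ^ i * c)) =
      ((-1) ^ i * (-1) ^ i) * (l * (w * b) + (if r = 0 then 0 else w * c))" by (simp add: algebra_simps)
    hence b: "(-1) ^ i * (l * (w * (-1) ^ i * b) + (if r = 0 then 0 else w * (-1) ^ i * c)) = l * (w * b) + (if r = 0 then 0 else w * c)"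
      unfolding m by simp
    have "(-1::complex) ^ i \<noteq> 0" by simp
    thus ?thesis unfolding a[symmetric] b[symmetric] by (simp only: mult_cancel_left) simp
  qed
  thus ?thesis unfolding gch_def by (intro all_cong1 imp_cong refl) blast
qed

lemma gch_zero:
  assumes "gch k l w n y" "(-1) ^ (n - 1) * cnj w \<noteq> l * w"
  shows "r < k \<Longrightarrow> i < n \<Longrightarrow> y r i = 0"
proof (induction r arbitrary: i rule: less_induct)
  case (less r)
  have p: "r > 0 \<Longrightarrow> i < n \<Longrightarrow> y (r - 1) i = 0" for i using less.IH[of "r - 1" i] less.prems by simp
  have eq: "(-1) ^ (n - 1) * cnj w * (y r (n - Suc i) + (if 0 < i then y r (n - i) else 0)) =
     l * (w * (y r (n - Suc i) - (if 0 < i then y r (n - i) else 0)))" if i: "i < n" for i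
  proof -
    have "(if r = 0 then 0 else w * (y (r - 1) (n - Suc i) - (if 0 < i then y (r - 1) (n - i) else 0))) = 0" using p i by simp
    thus ?thesis using assms(1)[unfolded gch_norm, rule_format, OF less.prems(1) i] by simp
  qed
  have "i < n \<Longrightarrow> y r (n - Suc i) = 0" for i
  proof (induction i)
    case 0
    have "((-1) ^ (n - 1) * cnj w - l * w) * y r (n - Suc 0) = 0" using eq[OF 0] by (simp add: algebra_simps)
    thus ?case using assms(2) by simp
  next
    case (Suc i)
    have "y r (n - Suc i) = 0" using Suc by simp
    hence "((-1) ^ (n - 1) * cnj w - l * w) * y r (n - Suc (Suc i)) = 0" using eq[OF Suc.prems] by (simp add: algebra_simps)
    thus ?case using assms(2) by simp
  qed
  from this[of "n - Suc i"] show ?case using less.prems(2) by (simp add: Suc_diff_Suc)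
qed

text \<open>At the eigenvalue the terms at n - 1 - i cancel and twice the term at n - i remains, so
  each coordinate is expressed by the preceding vector of the chain; \<open>\<kappa>\<close>
  collects the constants.\<close>

lemma gch_eig:
  assumes e: "(-1) ^ (n - 1) * cnj w = l * w" and w: "w \<noteq> 0" and n: "0 < n"
  defines "\<kappa> \<equiv> w / (2 * (-1) ^ (n - 1) * cnj w)"
  shows "gch k l w n y \<longleftrightarrow> (\<forall>r<k. (0 < r \<longrightarrow> y (r - 1) (n - 1) = 0) \<and>
    (\<forall>j. 0 < j \<and> j < n \<longrightarrow> y r j = (if r = 0 then 0 else \<kappa> * (y (r - 1) (j - 1) - y (r - 1) j))))"
proof -
  define \<eta> where "\<eta> = (-1) ^ (n - 1) * cnj w"
  have \<eta>: "\<eta> \<noteq> 0" "\<kappa> = w / (2 * \<eta>)" unfolding \<eta>_def \<kappa>_def using w by simp_all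
  have e': "l * (w * x) = \<eta> * x" for x using e unfolding \<eta>_def by (simp add: mult.assoc[symmetric])
  have "(\<forall>i<n. \<eta> * (y r (n - Suc i) + (if 0 < i then y r (n - i) else 0)) =
     \<eta> * (y r (n - Suc i) - (if 0 < i then y r (n - i) else 0)) +
     (if r = 0 then 0 else w * (y (r - 1) (n - Suc i) - (if 0 < i then y (r - 1) (n - i) else 0)))) \<longleftrightarrow>
     (0 < r \<longrightarrow> y (r - 1) (n - 1) = 0) \<and>
     (\<forall>j. 0 < j \<and> j < n \<longrightarrow> y r j = (if r = 0 then 0 else \<kappa> * (y (r - 1) (j - 1) - y (r - 1) j)))" (is "?L = ?R") for r
  proof
    assume L: ?L
    show ?R
    proof (intro conjI allI impI; (elim conjE)?)
      show "y (r - 1) (n - 1) = 0" if "0 < r" using L[rule_format, OF n] that w by simp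
      fix j assume j: "0 < j" "j < n"
      have "\<eta> * (y r (j - 1) + y r j) = \<eta> * (y r (j - 1) - y r j) + (if r = 0 then 0 else w * (y (r - 1) (j - 1) - y (r - 1) j))"
        using L[rule_format, of "n - j"] j by (simp add: Suc_diff_Suc)
      hence "2 * \<eta> * y r j = (if r = 0 then 0 else w * (y (r - 1) (j - 1) - y (r - 1) j))" by (simp add: algebra_simps split: if_splits)
      thus "y r j = (if r = 0 then 0 else \<kappa> * (y (r - 1) (j - 1) - y (r - 1) j))"
        unfolding \<eta>(2) using \<eta>(1) by (simp add: field_simps split: if_splits)
    qed
  next
    assume R: ?R
    show ?L
    proof (intro allI impI)
      fix i assume i: "i < n"
      show "\<eta> * (y r (n - Suc i) + (if 0 < i then y r (n - i) else 0)) =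
     \<eta> * (y r (n - Suc i) - (if 0 < i then y r (n - i) else 0)) +
     (if r = 0 then 0 else w * (y (r - 1) (n - Suc i) - (if 0 < i then y (r - 1) (n - i) else 0)))"
      proof (cases "0 < i")
        case True
        have *: "n - i - 1 = n - Suc i" by simp
        have "y r (n - i) = (if r = 0 then 0 else \<kappa> * (y (r - 1) (n - Suc i) - y (r - 1) (n - i)))"
          using R i True unfolding *[symmetric] by simp
        hence "2 * \<eta> * y r (n - i) = (if r = 0 then 0 else w * (y (r - 1) (n - Suc i) - y (r - 1) (n - i)))"
          unfolding \<eta>(2) using \<eta>(1) by (simp add: field_simps split: if_splits)
        thus ?thesis using True by (simp add: algebra_simps split: if_splits)
      qed (use R in auto)
    qed
  qed
  thus ?thesis unfolding gch_norm e' \<eta>_def[symmetric] by blast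
qed

text \<open>The recursion is triangular: one more coordinate can become nonzero at each step, with
  diagonal factor \<open>\<kappa>\<close>. A chain longer than \<open>n\<close> requires the last
  coordinate to vanish where it would be a nonzero multiple of the first entry.\<close>

lemma gch_eig_supp:
  assumes y: "gch k l w n y" and e: "(-1) ^ (n - 1) * cnj w = l * w" and w: "w \<noteq> 0" and n: "0 < n"
  defines "\<kappa> \<equiv> w / (2 * (-1) ^ (n - 1) * cnj w)"
  shows "r < k \<Longrightarrow> r < j \<Longrightarrow> j < n \<Longrightarrow> y r j = 0" "r < k \<Longrightarrow> r < n \<Longrightarrow> y r r = \<kappa> ^ r * y 0 0"
    "n < k \<Longrightarrow> y 0 0 = 0"
proof -
  note y' = y[unfolded gch_eig[OF e w n], folded \<kappa>_def, rule_format]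
  show s: "r < k \<Longrightarrow> r < j \<Longrightarrow> j < n \<Longrightarrow> y r j = 0" for r j
  proof (induction r arbitrary: j)
    case 0 thus ?case using y'[of 0] by simp
  next
    case (Suc r)
    have "y r (j - 1) = 0" "y r j = 0" using Suc by auto
    thus ?case using y'[of "Suc r"] Suc.prems by simp
  qed
  show d: "r < k \<Longrightarrow> r < n \<Longrightarrow> y r r = \<kappa> ^ r * y 0 0" for r
  proof (induction r)
    case (Suc r)
    have "y r (Suc r) = 0" using s[of r "Suc r"] Suc.prems by simp
    thus ?case using Suc y'[of "Suc r"] by simp
  qed simp
  assume "n < k"
  hence "y (n - 1) (n - 1) = 0" "n - 1 < k" using y'[of n] n by auto
  moreover have "\<kappa> \<noteq> 0" unfolding \<kappa>_def using w by simp
  ultimately show "y 0 0 = 0" using d[of "n - 1"] n by simp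
qed

text \<open>The recursion of \<open>gch_eig\<close> started at the first unit vector.\<close>

primrec gy :: "complex \<Rightarrow> nat \<Rightarrow> nat \<Rightarrow> complex" where
  "gy \<kappa> 0 = (\<lambda>j. if j = 0 then 1 else 0)"
| "gy \<kappa> (Suc r) = (\<lambda>j. \<kappa> * ((if j = 0 then 0 else gy \<kappa> r (j - 1)) - gy \<kappa> r j))"

lemma gy_support: "r < j \<Longrightarrow> gy \<kappa> r j = 0"
  by (induction r arbitrary: j) auto

lemma gch_ex:
  assumes e: "(-1) ^ (n - 1) * cnj w = l * w" and w: "w \<noteq> 0" and n: "0 < n"
  shows "gch n l w n (gy (w / (2 * (-1) ^ (n - 1) * cnj w)))"
  unfolding gch_eig[OF e w n]
proof (intro allI impI conjI; (elim conjE)?)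
  fix r assume r: "r < n"
  show "gy (w / (2 * (-1) ^ (n - 1) * cnj w)) (r - 1) (n - 1) = 0" if "0 < r" using that r by (intro gy_support) simp
  fix j assume "0 < j" "j < n"
  thus "gy (w / (2 * (-1) ^ (n - 1) * cnj w)) r j = (if r = 0 then 0 else w / (2 * (-1) ^ (n - 1) * cnj w) *
    (gy (w / (2 * (-1) ^ (n - 1) * cnj w)) (r - 1) (j - 1) - gy (w / (2 * (-1) ^ (n - 1) * cnj w)) (r - 1) j))"
    by (cases r) simp_all
qed

text \<open>The sesquilinear form of \<open>val\<close> for one complex component, before scaling by
  \<open>s\<close>.\<close>

definition gform :: "complex \<Rightarrow> nat \<Rightarrow> nat \<Rightarrow> (nat \<Rightarrow> nat \<Rightarrow> complex) \<Rightarrow> complex" where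
  "gform w n k y = (\<Sum>i<n. cnj (y (k - 1) i) * (w * (-1) ^ i * (y 0 (n - Suc i) - (if 0 < i then y 0 (n - i) else 0))))"

text \<open>The first vector is a multiple of the first unit vector, so its image under the
  transpose sits in the last coordinate. There the last vector of the chain vanishes if k < n, and
  the first vector itself vanishes if k > n; only equal sizes contribute.\<close>

lemma gform_eig:
  assumes y: "gch k l w n y" and e: "(-1) ^ (n - 1) * cnj w = l * w" and w: "w \<noteq> 0" and n: "0 < n" "0 < k"
  shows "gform w n k y = (if n = k then of_real ((cmod (y 0 0))\<^sup>2) * (cnj (w / (2 * (-1) ^ (n - 1) * cnj w)) ^ (k - 1) * w * (-1) ^ (k - 1)) else 0)"
proof -
  note s = gch_eig_supp[OF y e w n(1)]
  have z: "0 < j \<Longrightarrow> j < n \<Longrightarrow> y 0 j = 0" for j using s(1)[of 0 j] n by simp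
  have "gform w n k y = (\<Sum>i<n. if i = n - 1 then cnj (y (k - 1) (n - 1)) * (w * (-1) ^ (n - 1) * y 0 0) else 0)"
    unfolding gform_def
  proof (rule sum.cong[OF refl])
    fix i assume "i \<in> {..<n}"
    hence i: "i < n" by simp
    have 1: "(if 0 < i then y 0 (n - i) else 0) = 0" using z[of "n - i"] i by simp
    show "cnj (y (k - 1) i) * (w * (-1) ^ i * (y 0 (n - Suc i) - (if 0 < i then y 0 (n - i) else 0))) =
      (if i = n - 1 then cnj (y (k - 1) (n - 1)) * (w * (-1) ^ (n - 1) * y 0 0) else 0)"
      unfolding 1 using z[of "n - Suc i"] i by auto
  qed
  also have "\<dots> = cnj (y (k - 1) (n - 1)) * (w * (-1) ^ (n - 1) * y 0 0)" using n by (simp add: sum.delta)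
  also have "\<dots> = (if n = k then of_real ((cmod (y 0 0))\<^sup>2) * (cnj (w / (2 * (-1) ^ (n - 1) * cnj w)) ^ (k - 1) * w * (-1) ^ (k - 1)) else 0)"
  proof -
    consider "n < k" | "n = k" | "k < n" by linarith
    thus ?thesis
    proof cases
      case 1 thus ?thesis using s(3) by simp
    next
      case 2
      have "y (k - 1) (n - 1) = (w / (2 * (-1) ^ (n - 1) * cnj w)) ^ (k - 1) * y 0 0" using s(2)[of "k - 1"] n 2 by simp
      moreover have "of_real ((cmod (y 0 0))\<^sup>2) = cnj (y 0 0) * y 0 0" by (subst complex_norm_square) (rule mult.commute)
      ultimately show ?thesis using 2 by (simp add: mult_ac)
    next
      case 3
      have "y (k - 1) (n - 1) = 0" using s(1)[of "k - 1" "n - 1"] n 3 by simp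
      thus ?thesis using 3 by simp
    qed
  qed
  finally show ?thesis .
qed

text \<open>The conjugate of the coefficient found in \<open>gform_eig\<close>, so that the block
  with scalar \<open>w\<close> itself gets positive values.\<close>

definition gs :: "nat \<Rightarrow> complex \<Rightarrow> complex" where
  "gs k w = cnj (cnj (w / (2 * (-1) ^ (k - 1) * cnj w)) ^ (k - 1) * w * (-1) ^ (k - 1))"

text \<open>The solution l of \<open>(-1) ^ (k - 1) * cnj w = l * w\<close> for unimodular
  \<open>w\<close>.\<close>

definition gl :: "nat \<Rightarrow> complex \<Rightarrow> complex" where "gl k w = (-1) ^ (k - 1) * (cnj w)\<^sup>2"

lemma unit_cnj: "cmod w = 1 \<Longrightarrow> w * cnj w = 1" "cmod w = 1 \<Longrightarrow> cnj w * w = 1"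
  by (metis complex_norm_square of_real_1 one_power2 mult.commute)+

lemma gs_nonzero: "cmod w = 1 \<Longrightarrow> gs k w \<noteq> 0" unfolding gs_def by auto

lemma eig_unit: assumes "cmod w = 1" "cmod w' = 1"
  shows "(-1) ^ (n - 1) * cnj w' = gl k w * w' \<longleftrightarrow> (-1) ^ (n - 1) * (cnj w')\<^sup>2 = (-1) ^ (k - 1) * (cnj w)\<^sup>2"
proof -
  have "cnj w' \<noteq> 0" using assms by auto
  hence i: "(-1) ^ (n - 1) * cnj w' = gl k w * w' \<longleftrightarrow> cnj w' * ((-1) ^ (n - 1) * cnj w') = cnj w' * (gl k w * w')"
    by (simp only: mult_cancel_left) simp
  have a: "cnj w' * ((-1) ^ (n - 1) * cnj w') = (-1) ^ (n - 1) * (cnj w')\<^sup>2" by (simp add: power2_eq_square)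
  have "cnj w' * (gl k w * w') = gl k w * (cnj w' * w')" by (simp only: mult.left_commute)
  hence c: "cnj w' * (gl k w * w') = gl k w" unfolding unit_cnj(2)[OF assms(2)] by simp
  show ?thesis unfolding i a c unfolding gl_def ..
qed

text \<open>The scalars \<open>w\<close> and \<open>- w\<close> share size and eigenvalue but have
  opposite signs of the form; for real \<open>w\<close> this is what separates N = 1 from N =
  -1.\<close>

lemma gform_val:
  assumes y: "gch k (gl k w) w' n y" and w: "cmod w = 1" "cmod w' = 1" and n: "0 < n" "0 < k"
  shows "Re (gs k w * gform w' n k y) = (if n = k \<and> w' = w then (cmod (y 0 0))\<^sup>2 * (cmod (gs k w))\<^sup>2
    else if n = k \<and> w' = - w then - ((cmod (y 0 0))\<^sup>2 * (cmod (gs k w))\<^sup>2) else 0)"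
proof -
  have w0: "w' \<noteq> 0" "w \<noteq> 0" using w by auto
  have nn: "gs k w * cnj (gs k w) = of_real ((cmod (gs k w))\<^sup>2)" by (rule complex_norm_square[symmetric])
  have pm: "w' \<noteq> - w" if "w' = w" using that w0 by auto
  show ?thesis
  proof (cases "(-1) ^ (n - 1) * cnj w' = gl k w * w'")
    case False
    have "y 0 i = 0" if "i < n" for i by (rule gch_zero[OF y False n(2) that])
    hence "gform w' n k y = 0" "y 0 0 = 0" unfolding gform_def using n by (auto intro!: sum.neutral)
    thus ?thesis by simp
  next
    case True
    note f = gform_eig[OF y True w0(1) n]
    show ?thesis
    proof (cases "n = k")
      case False thus ?thesis unfolding f by simp
    next
      case nk: True
      have "(cnj w')\<^sup>2 = (cnj w)\<^sup>2" using True[unfolded eig_unit[OF w]] nk by simp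
      hence "cnj w' = cnj w \<or> cnj w' = cnj (- w)" unfolding power2_eq_iff complex_cnj_minus .
      hence pm': "w' = w \<or> w' = - w" unfolding complex_cnj_cancel_iff .
      have k: "w' / (2 * (-1) ^ (n - 1) * cnj w') = w / (2 * (-1) ^ (k - 1) * cnj w)" using pm' nk by auto
      have "gform w' n k y = of_real ((cmod (y 0 0))\<^sup>2) * (if w' = w then 1 else -1) * cnj (gs k w)"
        unfolding f k gs_def using nk pm' pm by auto
      hence "gs k w * gform w' n k y = of_real ((cmod (y 0 0))\<^sup>2 * (if w' = w then 1 else -1)) * (gs k w * cnj (gs k w))"
        by (simp add: mult_ac)
      also have "\<dots> = of_real ((cmod (y 0 0))\<^sup>2 * (if w' = w then 1 else -1) * (cmod (gs k w))\<^sup>2)" unfolding nn by simp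
      finally have "Re (gs k w * gform w' n k y) = (cmod (y 0 0))\<^sup>2 * (if w' = w then 1 else -1) * (cmod (gs k w))\<^sup>2" by simp
      thus ?thesis using nk pm' pm by auto
    qed
  qed
qed

section \<open>Splitting 2 x 2 cells into conjugate components\<close>

definition comp :: "complex \<Rightarrow> (nat \<Rightarrow> nat \<Rightarrow> complex) \<Rightarrow> nat \<Rightarrow> nat \<Rightarrow> complex" where
  "comp e X = (\<lambda>r j. X r (2 * j) + e * X r (Suc (2 * j)))"

text \<open>Populates the component \<open>e\<close> only: it is recovered with a factor 2 and the
  conjugate component is 0.\<close>

definition lift :: "complex \<Rightarrow> (nat \<Rightarrow> nat \<Rightarrow> complex) \<Rightarrow> nat \<Rightarrow> nat \<Rightarrow> complex" where
  "lift e g = (\<lambda>r i. if even i then g r (i div 2) else - e * g r (i div 2))"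

lemma comp_lift: assumes "e * e = -1" "e' * e' = -1"
  shows "comp e' (lift e g) = (\<lambda>r j. (if e' = e then 2 else 0) * g r j)"
proof -
  have 0: "comp e' (lift e g) r j = g r j + e' * (- e * g r j)" for r j unfolding comp_def lift_def by simp
  have 1: "e * (- e * x) = x" "- e * (- e * x) = - x" for x using assms(1) by (simp_all add: mult.assoc[symmetric])
  have "e' = e \<or> e' = - e" using e_square[OF assms(1)] e_square[OF assms(2)] by auto
  moreover have "e \<noteq> - e" using e_square[OF assms(1)] by (auto simp: complex_eq_iff)
  ultimately have "comp e' (lift e g) r j = (if e' = e then 2 else 0) * g r j" for r j
    unfolding 0 by (elim disjE) (simp_all only: 1, simp_all)
  thus ?thesis by (intro ext)
qed

lemma pairs_zeroD: assumes "\<And>e r j. e * e = -1 \<Longrightarrow> r < k \<Longrightarrow> j < n \<Longrightarrow> comp e X r j = 0" "r < k" "i < 2 * n"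
  shows "X r i = 0"
proof -
  have "\<forall>i<2*n. X r i = 0" unfolding all_less_double
    using pairs_zero assms(1,2) unfolding comp_def by blast
  thus ?thesis using assms(3) by blast
qed

lemma pair_iff: "(P = P' \<and> Q = Q') \<longleftrightarrow> (\<forall>e. e * e = -1 \<longrightarrow> P + e * Q = P' + e * (Q'::complex))"
proof (intro iffI allI impI)
  assume "\<forall>e. e * e = -1 \<longrightarrow> P + e * Q = P' + e * Q'"
  hence eq: "P + e * Q = P' + e * Q'" if "e * e = -1" for e using that by blast
  have "(P - P') + e * (Q - Q') = 0" if "e * e = -1" for e using eq[OF that] by (simp add: algebra_simps)
  from pairs_zero[OF this] show "P = P' \<and> Q = Q'" by simp
qed simp

lemma wit_pair:
  fixes f g h :: "nat \<Rightarrow> complex"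
  shows "(\<forall>i<2*n. f i = l * g i + (if b then 0 else h i)) \<longleftrightarrow> (\<forall>e. e * e = -1 \<longrightarrow> (\<forall>i<n.
     f (2*i) + e * f (Suc (2*i)) = l * (g (2*i) + e * g (Suc (2*i))) + (if b then 0 else h (2*i) + e * h (Suc (2*i)))))"
  unfolding all_less_double pair_iff
proof (intro iffI allI impI)
  fix e :: complex and i assume h: "\<forall>j<n. \<forall>e. e * e = - 1 \<longrightarrow> f (2 * j) + e * f (Suc (2 * j)) =
    l * g (2 * j) + (if b then 0 else h (2 * j)) + e * (l * g (Suc (2 * j)) + (if b then 0 else h (Suc (2 * j))))"
    and i: "e * e = -1" "i < n"
  from h[rule_format, OF i(2,1)] show "f (2*i) + e * f (Suc (2*i)) = l * (g (2*i) + e * g (Suc (2*i))) + (if b then 0 else h (2*i) + e * h (Suc (2*i)))"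
    by (simp add: algebra_simps split: if_splits)
next
  fix e :: complex and j assume h: "\<forall>e. e * e = -1 \<longrightarrow> (\<forall>i<n.
     f (2*i) + e * f (Suc (2*i)) = l * (g (2*i) + e * g (Suc (2*i))) + (if b then 0 else h (2*i) + e * h (Suc (2*i))))"
    and i: "e * e = -1" "j < n"
  from h[rule_format, OF i] show "f (2 * j) + e * f (Suc (2 * j)) =
    l * g (2 * j) + (if b then 0 else h (2 * j)) + e * (l * g (Suc (2 * j)) + (if b then 0 else h (Suc (2 * j))))"
    by (simp add: algebra_simps split: if_splits)
qed

section \<open>Chain equations of the canonical blocks\<close>

lemma wit_J: "wit k l z (jordan_block n 0) X \<longleftrightarrow> (\<forall>r<k. \<forall>i<n. (if Suc i < n then X r (Suc i) else 0) =
    l * (if 0 < i then X r (i - 1) else 0) + (if r = 0 then 0 else if 0 < i then X (r - 1) (i - 1) else 0)) \<and> (z \<longrightarrow> (\<forall>i<n. X (k - 1) i = 0))"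
  unfolding wit_def by (simp add: ap_jordan apT_jordan)

lemma wit_H: "wit k l z (H_mat n a) X \<longleftrightarrow> uch k l (of_real a) n X \<and> vch k l (of_real a) n (\<lambda>r i. X r (n + i)) \<and>
    (z \<longrightarrow> (\<forall>i<n + n. X (k - 1) i = 0))"
proof -
  have d: "dim_row (H_mat n a) = n + n" unfolding H_mat_def by simp
  have c: "jordan_block n a \<in> carrier_mat n n" by simp
  show ?thesis unfolding wit_def d unfolding all_less_add uch_def vch_def H_mat_anti
    by (simp add: ap_antiblock[OF c] apT_antiblock[OF c] ap_jordan apT_jordan imp_conjR all_conj_distrib conj_ac)
qed

lemma wit_Hhat: "wit k l z (H_hat_mat n a b) X \<longleftrightarrow> (\<forall>e. e * e = -1 \<longrightarrow>
    uch k l (of_real a - e * of_real b) n (comp e X) \<and> vch k l (of_real a + e * of_real b) n (comp e (\<lambda>r i. X r (2 * n + i)))) \<and>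
    (z \<longrightarrow> (\<forall>i<2 * n + 2 * n. X (k - 1) i = 0))"
proof -
  have d: "dim_row (H_hat_mat n a b) = 2 * n + 2 * n" unfolding H_hat_mat_def using C_block_carrier[of n a b] by simp
  note c = C_block_carrier[of n a b]
  let ?C = "C_block_mat n a b"
  let ?V = "\<lambda>r i. X r (2 * n + i)"
  have 1: "(\<forall>i<2*n. X r (2*n+i) = l * apT ?C (?V r) i + (if r = 0 then 0 else apT ?C (?V (r - 1)) i)) \<longleftrightarrow>
    (\<forall>e. e * e = -1 \<longrightarrow> (\<forall>i<n. comp e ?V r i = l * ((of_real a + e * of_real b) * comp e ?V r i + (if 0 < i then comp e ?V r (i - 1) else 0)) +
     (if r = 0 then 0 else (of_real a + e * of_real b) * comp e ?V (r - 1) i + (if 0 < i then comp e ?V (r - 1) (i - 1) else 0))))" for r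
    unfolding wit_pair by (intro all_cong1 imp_cong refl) (simp add: apT_C_block comp_def)
  have 2: "(\<forall>i<2*n. ap ?C (X r) i = l * X r i + (if r = 0 then 0 else X (r - 1) i)) \<longleftrightarrow>
    (\<forall>e. e * e = -1 \<longrightarrow> (\<forall>i<n. (of_real a - e * of_real b) * comp e X r i + (if Suc i < n then comp e X r (Suc i) else 0) =
     l * comp e X r i + (if r = 0 then 0 else comp e X (r - 1) i)))" for r
    unfolding wit_pair by (intro all_cong1 imp_cong refl) (simp add: ap_C_block[simplified] comp_def)
  have "wit k l z (H_hat_mat n a b) X \<longleftrightarrow> (\<forall>r<k.
    (\<forall>i<2*n. X r (2*n+i) = l * apT ?C (?V r) i + (if r = 0 then 0 else apT ?C (?V (r - 1)) i)) \<and>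
    (\<forall>i<2*n. ap ?C (X r) i = l * X r i + (if r = 0 then 0 else X (r - 1) i))) \<and> (z \<longrightarrow> (\<forall>i<2 * n + 2 * n. X (k - 1) i = 0))"
    unfolding wit_def d unfolding all_less_add[of "2 * n" "2 * n"] H_hat_anti
    by (simp add: ap_antiblock[OF c] apT_antiblock[OF c] imp_conjR all_conj_distrib conj_ac)
  thus ?thesis unfolding 1 2 uch_def vch_def by blast
qed

lemma wit_Gsgn: "wit k l z (Gsgn s n) X \<longleftrightarrow> gch k l (of_real s) n X \<and> (z \<longrightarrow> (\<forall>i<n. X (k - 1) i = 0))"
  unfolding wit_def Gsgn_dim gch_def by (simp add: ap_Gsgn apT_Gsgn)

lemma wit_GC: "wit k l z (Gamma_mat n \<otimes>\<^sub>K C_mat a b) X \<longleftrightarrow> (\<forall>e. e * e = -1 \<longrightarrow> gch k l (of_real a + e * of_real b) n (comp e X)) \<and>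
    (z \<longrightarrow> (\<forall>i<2 * n. X (k - 1) i = 0))"
proof -
  let ?C = "Gamma_mat n \<otimes>\<^sub>K C_mat a b"
  have cn: "cnj (of_real a + e * of_real b) = of_real a - e * of_real b" if "e * e = -1" for e
    using e_square[OF that] by auto
  have 1: "(\<forall>i<2*n. ap ?C (X r) i = l * apT ?C (X r) i + (if r = 0 then 0 else apT ?C (X (r - 1)) i)) \<longleftrightarrow>
    (\<forall>e. e * e = -1 \<longrightarrow> (\<forall>i<n.
     cnj (of_real a + e * of_real b) * (-1) ^ (n - Suc i) * (comp e X r (n - Suc i) + (if 0 < i then comp e X r (n - i) else 0)) =
     l * ((of_real a + e * of_real b) * (-1) ^ i * (comp e X r (n - Suc i) - (if 0 < i then comp e X r (n - i) else 0))) +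
     (if r = 0 then 0 else (of_real a + e * of_real b) * (-1) ^ i * (comp e X (r - 1) (n - Suc i) - (if 0 < i then comp e X (r - 1) (n - i) else 0)))))" for r
    unfolding wit_pair
  proof (intro all_cong1 imp_cong refl)
    fix e :: complex and i assume "e * e = -1" "i < n"
    thus "(ap ?C (X r) (2 * i) + e * ap ?C (X r) (Suc (2 * i)) =
      l * (apT ?C (X r) (2 * i) + e * apT ?C (X r) (Suc (2 * i))) + (if r = 0 then 0 else apT ?C (X (r - 1)) (2 * i) + e * apT ?C (X (r - 1)) (Suc (2 * i)))) =
      (cnj (of_real a + e * of_real b) * (-1) ^ (n - Suc i) * (comp e X r (n - Suc i) + (if 0 < i then comp e X r (n - i) else 0)) =
     l * ((of_real a + e * of_real b) * (-1) ^ i * (comp e X r (n - Suc i) - (if 0 < i then comp e X r (n - i) else 0))) +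
     (if r = 0 then 0 else (of_real a + e * of_real b) * (-1) ^ i * (comp e X (r - 1) (n - Suc i) - (if 0 < i then comp e X (r - 1) (n - i) else 0))))"
      unfolding comp_def by (simp only: ap_GC apT_GC cn)
  qed
  show ?thesis unfolding wit_def kron_C_dim(1) 1 gch_def by blast
qed

lemma lower_0: "lower k l z s A 0" unfolding lower_def by simp

lemma val_zero0: assumes "\<And>i. i < dim_row A \<Longrightarrow> X 0 i = 0" shows "val k s A X = 0"
proof -
  have "apT A (X 0) i = apT A (\<lambda>i. 0) i" for i by (rule apT_cong) (use assms in auto)
  thus ?thesis unfolding val_def using assms by simp
qed

lemma upper_I0: assumes "\<And>X. wit k l z A X \<Longrightarrow> val k s A X \<le> 0" shows "upper k l z s A p"
  unfolding upper_def using assms by blast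

lemma cert_0: assumes "\<And>X. wit k l z A X \<Longrightarrow> val k s A X \<le> 0" shows "cert k l z s A 0"
  unfolding cert_def using lower_0 upper_I0[OF assms] by simp

lemma cert_zero: assumes "\<And>X i. wit k l z A X \<Longrightarrow> i < dim_row A \<Longrightarrow> X 0 i = 0" shows "cert k l z s A 0"
  using assms val_zero0 by (intro cert_0) (metis order_refl)

lemma lower_1: assumes w: "wit k l z A X" and v: "val k s A X > 0" shows "lower k l z s A 1"
  unfolding lower_def
proof (intro exI[of _ "\<lambda>_. X"] conjI allI impI)
  fix c :: "nat \<Rightarrow> complex" assume "\<exists>m<1. c m \<noteq> 0"
  hence c: "c 0 \<noteq> 0" by simp
  have "val k s A (\<lambda>r i. c 0 * X r i) = (cmod (c 0))\<^sup>2 * val k s A X"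
  proof -
    have 1: "apT A (\<lambda>i. c 0 * X 0 i) i = c 0 * apT A (X 0) i" for i
      unfolding apT_def by (simp add: sum_distrib_left mult.left_commute)
    have "s * (\<Sum>i<dim_row A. cnj (c 0 * X (k - 1) i) * (c 0 * apT A (X 0) i)) =
      (c 0 * cnj (c 0)) * (s * (\<Sum>i<dim_row A. cnj (X (k - 1) i) * apT A (X 0) i))"
      by (simp add: sum_distrib_left mult_ac)
    hence 2: "s * (\<Sum>i<dim_row A. cnj (c 0 * X (k - 1) i) * (c 0 * apT A (X 0) i)) =
      of_real ((cmod (c 0))\<^sup>2) * (s * (\<Sum>i<dim_row A. cnj (X (k - 1) i) * apT A (X 0) i))" unfolding complex_norm_square .
    show ?thesis unfolding val_def 1 2 by (simp add: norm_mult power_mult_distrib sum_distrib_left)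
  qed
  thus "val k s A (\<lambda>r i. \<Sum>m<1. c m * X r i) > 0" using c v by simp
qed (rule w)

lemma upper_1: assumes "0 < dim_row A" "\<And>X. wit k l z A X \<Longrightarrow> X 0 0 = 0 \<Longrightarrow> val k s A X \<le> 0" shows "upper k l z s A 1"
  unfolding upper_def
proof (intro exI[of _ "\<lambda>m i. if i = 0 then 1 else 0"] allI impI)
  fix X assume h: "wit k l z A X" "\<forall>m<1::nat. (\<Sum>i<dim_row A. (if i = 0 then 1 else 0) * X 0 i) = 0"
  have "X 0 0 = 0" using h(2) assms(1) sum_delta_mult[of 0 1 "X 0" "dim_row A"] by simp
  thus "val k s A X \<le> 0" using assms(2) h(1) by blast
qed

lemma upper_1c: assumes "1 < dim_row A" "\<And>X. wit k l z A X \<Longrightarrow> comp e X 0 0 = 0 \<Longrightarrow> val k s A X \<le> 0" shows "upper k l z s A 1"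
  unfolding upper_def
proof (intro exI[of _ "\<lambda>m i. (if i = 0 then 1 else 0) + (if i = Suc 0 then e else 0)"] allI impI)
  fix X assume h: "wit k l z A X" "\<forall>m<1::nat. (\<Sum>i<dim_row A. ((if i = 0 then 1 else 0) + (if i = Suc 0 then e else 0)) * X 0 i) = 0"
  have "comp e X 0 0 = 0" using h(2) assms(1) sum_delta_mult[of 0 1 "X 0" "dim_row A"] sum_delta_mult[of "Suc 0" e "X 0" "dim_row A"]
    unfolding comp_def by (simp add: distrib_right sum.distrib)
  thus "val k s A X \<le> 0" using assms(2) h(1) by blast
qed

lemma val_D_pos: assumes "i < dim_row A" "X 0 i \<noteq> 0" shows "val k 0 A X > 0"
proof -
  have "0 < (cmod (X 0 i))\<^sup>2" using assms by simp
  also have "\<dots> \<le> (\<Sum>i<dim_row A. (cmod (X 0 i))\<^sup>2)" using assms by (intro member_le_sum) auto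
  finally show ?thesis unfolding val_def by simp
qed

text \<open>Counts are attached to parameters instead of matrices, so that inequality of blocks with
  different parameters need not be settled beforehand. In \<open>CG\<close>, a real scalar stands
  for N = 1 or N = -1.\<close>

datatype code = CJ nat | CG nat complex | CH nat real | CHH nat real real

fun base :: "code \<Rightarrow> real mat" where
  "base (CJ k) = jordan_block k 0"
| "base (CG k w) = (if Im w = 0 then Gsgn (Re w) k else Gamma_mat k \<otimes>\<^sub>K C_mat (Re w) (Im w))"
| "base (CH k a) = H_mat k a"
| "base (CHH k a b) = H_hat_mat k a b"

fun valid :: "code \<Rightarrow> bool" where
  "valid (CJ k) \<longleftrightarrow> 0 < k"
| "valid (CG k w) \<longleftrightarrow> 0 < k \<and> cmod w = 1 \<and> (0 < Im w \<or> Im w = 0)"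
| "valid (CH k a) \<longleftrightarrow> 0 < k \<and> a \<noteq> 0 \<and> \<bar>a\<bar> < 1"
| "valid (CHH k a b) \<longleftrightarrow> 0 < k \<and> a\<^sup>2 + b\<^sup>2 < 1 \<and> 0 < b"

text \<open>The dimension of the space of starting vectors for an eigenvalue in the open disc. A
  nilpotent block of odd size gives a singular pencil and has chains of every length for every l;
  one of even size n acts at l = 0 like a Jordan block of size n / 2.\<close>

fun pD :: "nat \<Rightarrow> complex \<Rightarrow> code \<Rightarrow> nat" where
  "pD k l (CJ n) = (if odd n \<or> l = 0 \<and> 2 * k \<le> n then 1 else 0)"
| "pD k l (CG n w) = 0"
| "pD k l (CH n a) = (if l = of_real a \<and> k \<le> n then 1 else 0)"
| "pD k l (CHH n a b) = (if l = Complex a b \<and> k \<le> n then 1 else 0)"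

text \<open>Supplements \<open>pD\<close>, which cannot tell odd sizes apart: only odd blocks of
  size below 2m are counted.\<close>

fun pF :: "nat \<Rightarrow> code \<Rightarrow> nat" where
  "pF m (CJ n) = (if odd n \<and> n div 2 < m then 1 else 0)"
| "pF m c = 0"

lemma base_dim:
  "dim_row (base c) = (case c of CJ n \<Rightarrow> n | CG n w \<Rightarrow> (if Im w = 0 then n else 2 * n) | CH n a \<Rightarrow> 2 * n | CHH n a b \<Rightarrow> 4 * n)"
  "square_mat (base c)"
  using C_block_carrier by (cases c; auto simp: Gsgn_dim kron_C_dim H_mat_def H_hat_mat_def)+

lemma uch_scale: "uch k l \<mu> n u \<Longrightarrow> uch k l \<mu> n (\<lambda>r i. c * u r i)"
  unfolding uch_def
proof (intro allI impI)
  fix r i assume h: "\<forall>r<k. \<forall>i<n. \<mu> * u r i + (if Suc i < n then u r (Suc i) else 0) = l * u r i + (if r = 0 then 0 else u (r - 1) i)"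
    and ri: "r < k" "i < n"
  have "c * (\<mu> * u r i + (if Suc i < n then u r (Suc i) else 0)) = c * (l * u r i + (if r = 0 then 0 else u (r - 1) i))"
    unfolding h[rule_format, OF ri] ..
  thus "\<mu> * (c * u r i) + (if Suc i < n then c * u r (Suc i) else 0) = l * (c * u r i) + (if r = 0 then 0 else c * u (r - 1) i)"
    by (simp add: algebra_simps split: if_splits)
qed

lemma vch_scale: "vch k l \<mu> n v \<Longrightarrow> vch k l \<mu> n (\<lambda>r i. c * v r i)"
  unfolding vch_def
proof (intro allI impI)
  fix r i assume h: "\<forall>r<k. \<forall>i<n. v r i = l * (\<mu> * v r i + (if 0 < i then v r (i - 1) else 0)) +
     (if r = 0 then 0 else \<mu> * v (r - 1) i + (if 0 < i then v (r - 1) (i - 1) else 0))"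
    and ri: "r < k" "i < n"
  have "c * v r i = c * (l * (\<mu> * v r i + (if 0 < i then v r (i - 1) else 0)) +
     (if r = 0 then 0 else \<mu> * v (r - 1) i + (if 0 < i then v (r - 1) (i - 1) else 0)))"
    by (rule arg_cong[OF h[rule_format, OF ri]])
  also have "\<dots> = l * (\<mu> * (c * v r i) + (if 0 < i then c * v r (i - 1) else 0)) +
     (if r = 0 then 0 else \<mu> * (c * v (r - 1) i) + (if 0 < i then c * v (r - 1) (i - 1) else 0))"
    by (simp add: distrib_left mult.left_commute)
  finally show "c * v r i = l * (\<mu> * (c * v r i) + (if 0 < i then c * v r (i - 1) else 0)) +
     (if r = 0 then 0 else \<mu> * (c * v (r - 1) i) + (if 0 < i then c * v (r - 1) (i - 1) else 0))" .
qed

lemma gch_scale: "gch k l w n y \<Longrightarrow> gch k l w n (\<lambda>r i. c * y r i)"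
  unfolding gch_def
proof (intro allI impI)
  fix r i assume h: "\<forall>r<k. \<forall>i<n. cnj w * (-1) ^ (n - Suc i) * (y r (n - Suc i) + (if 0 < i then y r (n - i) else 0)) =
     l * (w * (-1) ^ i * (y r (n - Suc i) - (if 0 < i then y r (n - i) else 0))) +
     (if r = 0 then 0 else w * (-1) ^ i * (y (r - 1) (n - Suc i) - (if 0 < i then y (r - 1) (n - i) else 0)))"
    and ri: "r < k" "i < n"
  have "cnj w * (-1) ^ (n - Suc i) * (c * y r (n - Suc i) + (if 0 < i then c * y r (n - i) else 0)) =
    c * (cnj w * (-1) ^ (n - Suc i) * (y r (n - Suc i) + (if 0 < i then y r (n - i) else 0)))"
    by (simp add: distrib_left mult.left_commute)
  also have "\<dots> = c * (l * (w * (-1) ^ i * (y r (n - Suc i) - (if 0 < i then y r (n - i) else 0))) +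
     (if r = 0 then 0 else w * (-1) ^ i * (y (r - 1) (n - Suc i) - (if 0 < i then y (r - 1) (n - i) else 0))))"
    by (rule arg_cong[OF h[rule_format, OF ri]])
  also have "\<dots> = l * (w * (-1) ^ i * (c * y r (n - Suc i) - (if 0 < i then c * y r (n - i) else 0))) +
     (if r = 0 then 0 else w * (-1) ^ i * (c * y (r - 1) (n - Suc i) - (if 0 < i then c * y (r - 1) (n - i) else 0)))"
    by (simp add: distrib_left right_diff_distrib mult.left_commute)
  finally show "cnj w * (-1) ^ (n - Suc i) * (c * y r (n - Suc i) + (if 0 < i then c * y r (n - i) else 0)) =
     l * (w * (-1) ^ i * (c * y r (n - Suc i) - (if 0 < i then c * y r (n - i) else 0))) +
     (if r = 0 then 0 else w * (-1) ^ i * (c * y (r - 1) (n - Suc i) - (if 0 < i then c * y (r - 1) (n - i) else 0)))" .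
qed

section \<open>Counts for nilpotent Jordan blocks\<close>

lemma J_eq: assumes "wit k l z (jordan_block n 0) X" "r < k" "i < n"
  shows "(if Suc i < n then X r (Suc i) else 0) =
    l * (if 0 < i then X r (i - 1) else 0) + (if r = 0 then 0 else if 0 < i then X (r - 1) (i - 1) else 0)"
  using assms unfolding wit_J by blast

text \<open>The first equation makes coordinate 1 vanish, and the equations proceed in steps of
  two.\<close>

lemma J_odd: assumes "wit k l z (jordan_block n 0) X" shows "r < k \<Longrightarrow> Suc (2 * j) < n \<Longrightarrow> X r (Suc (2 * j)) = 0"
proof (induction r arbitrary: j rule: less_induct)
  case (less r)
  show ?case using less.prems(2)
  proof (induction j)
    case 0 thus ?case using J_eq[OF assms less.prems(1), of 0] by simp
  next
    case (Suc j)
    have "X r (Suc (2 * j)) = 0" using Suc by simp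
    moreover have "r \<noteq> 0 \<Longrightarrow> X (r - 1) (Suc (2 * j)) = 0" using less.IH[of "r - 1" j] less.prems(1) Suc.prems by simp
    ultimately show ?case using J_eq[OF assms less.prems(1), of "2 * Suc j"] Suc.prems by (simp split: if_splits)
  qed
qed

text \<open>All vectors of the chain live on even coordinates while the transpose shifts by one, so
  no product survives: type (i) is invisible to the hermitian counts.\<close>

lemma J_form: assumes w: "wit k l z (jordan_block n 0) X" and k: "0 < k" and s: "s \<noteq> 0"
  shows "val k s (jordan_block n 0) X = 0"
proof -
  have "cnj (X (k - 1) i) * apT (jordan_block n 0) (X 0) i = 0" if i: "i < n" for i
  proof (cases "even i")
    case True
    then obtain b where b: "i = 2 * b" by (elim evenE)
    have "X 0 (i - 1) = 0" if "0 < i"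
    proof -
      obtain c where c: "b = Suc c" using \<open>0 < i\<close> b by (cases b) auto
      show ?thesis using J_odd[OF w k, of c] i unfolding b c by simp
    qed
    thus ?thesis using i by (simp add: apT_jordan)
  next
    case False
    hence "X (k - 1) i = 0" using J_odd[OF w, of "k - 1" "i div 2"] k i by (auto elim!: oddE)
    thus ?thesis by simp
  qed
  thus ?thesis unfolding val_def using s by (simp add: sum.neutral)
qed

text \<open>With eigenvalue 0 each chain step moves the entry by two coordinates.\<close>

lemma J_shift: assumes w: "wit k 0 z (jordan_block n 0) X" and k: "0 < k"
  shows "0 < i \<Longrightarrow> i < n \<Longrightarrow> X 0 i = 0" "r < k \<Longrightarrow> 2 * r < n \<Longrightarrow> X r (2 * r) = X 0 0"
    "0 < r \<Longrightarrow> r < k \<Longrightarrow> n = 2 * r \<Longrightarrow> X 0 0 = 0"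
proof -
  show "X 0 i = 0" if "0 < i" "i < n" using J_eq[OF w k, of "i - 1"] that by simp
  show d: "r < k \<Longrightarrow> 2 * r < n \<Longrightarrow> X r (2 * r) = X 0 0" for r
  proof (induction r)
    case (Suc r)
    have "X (Suc r) (2 * Suc r) = X r (2 * r)" using J_eq[OF w Suc.prems(1), of "Suc (2 * r)"] Suc.prems(2) by simp
    thus ?case using Suc by simp
  qed simp
  assume r: "0 < r" "r < k" "n = 2 * r"
  have "X (r - 1) (n - 2) = 0" using J_eq[OF w r(2), of "n - 1"] r by (simp add: numeral_2_eq_2)
  moreover have "2 * (r - 1) = n - 2" using r by simp
  ultimately show "X 0 0 = 0" using d[of "r - 1"] r by (metis diff_less less_imp_diff_less less_numeral_extra(1) mult_less_cancel1 zero_less_numeral)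
qed

text \<open>The vectors are unit vectors, or 0 once the index leaves the block. The excluded n = 2r
  is the case in which the last equation would demand that the previous vector end in 0.\<close>

lemma J_ex: assumes "k \<le> Suc m" "\<And>r. r < k \<Longrightarrow> n \<noteq> 2 * r" "z \<Longrightarrow> n \<le> 2 * (k - 1)"
  shows "wit k 0 z (jordan_block n 0) (\<lambda>r i. if i = 2 * r then 1 else 0)"
  unfolding wit_J
proof (intro conjI allI impI)
  fix r i assume ri: "r < k" "i < n"
  have "Suc i = 2 * r \<Longrightarrow> Suc i < n" using assms(2)[OF ri(1)] ri(2) by linarith
  moreover have "Suc i = 2 * r \<longleftrightarrow> r \<noteq> 0 \<and> 0 < i \<and> i - 1 = 2 * (r - 1)" by (cases r; cases i) auto
  ultimately show "(if Suc i < n then if Suc i = 2 * r then 1 else 0 else 0) =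
    0 * (if 0 < i then if i - 1 = 2 * r then 1 else 0 else 0) +
    (if r = 0 then 0 else if 0 < i then if i - 1 = 2 * (r - 1) then 1 else 0 else (0::complex))" by auto
qed (use assms(3) in auto)

lemma cert_1I: assumes "lower k l z s A 1" "upper k l z s A 1" shows "cert k l z s A 1"
  using assms unfolding cert_def by simp

lemma J_cert_D:
  assumes k: "0 < k" and n: "0 < n"
  shows "cert k l False 0 (jordan_block n 0) (pD k l (CJ n))"
proof (cases "odd n")
  case True
  have "cert k l False 0 (jordan_block n 0) 1"
  proof (rule cert_1I)
    \<comment> \<open>The starting vector lists the powers of l on even coordinates; the chain
      consists of its divided derivatives in l, and Pascal's rule is the chain equation.\<close>
    let ?X = "\<lambda>r i. if even i then of_nat ((i div 2) choose r) * l ^ (i div 2 - r) else (0::complex)"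
    show "lower k l False 0 (jordan_block n 0) 1"
    proof (rule lower_1[of _ _ _ _ ?X])
      show "0 < val k 0 (jordan_block n 0) ?X" by (rule val_D_pos[of 0]) (use n in auto)
      show "wit k l False (jordan_block n 0) ?X" unfolding wit_J
      proof (intro conjI allI impI)
        fix r i assume ri: "r < k" "i < n"
        show "(if Suc i < n then ?X r (Suc i) else 0) = l * (if 0 < i then ?X r (i - 1) else 0) +
          (if r = 0 then 0 else if 0 < i then ?X (r - 1) (i - 1) else 0)"
        proof (cases "even i")
          case True thus ?thesis by auto
        next
          case False
          then obtain j where j: "i = Suc (2 * j)" by (auto elim: oddE)
          have i: "Suc i < n" using ri(2) True False by (metis Suc_lessI even_Suc)
          have "of_nat (Suc j choose r) * l ^ (Suc j - r) = l * (of_nat (j choose r) * l ^ (j - r)) +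
            (if r = 0 then 0 else of_nat (j choose (r - 1)) * l ^ (j - (r - 1)))"
          proof (cases r)
            case (Suc q)
            have "of_nat (j choose Suc q) * l ^ (j - q) = l * (of_nat (j choose Suc q) * l ^ (j - Suc q))"
            proof (cases "q < j")
              case True
              hence "j - q = Suc (j - Suc q)" by simp
              thus ?thesis by simp
            qed simp
            thus ?thesis unfolding Suc by (simp add: distrib_right)
          qed simp
          thus ?thesis using i unfolding j by simp
        qed
      qed simp
    qed
    show "upper k l False 0 (jordan_block n 0) 1"
    proof (rule upper_1)
      fix X assume w: "wit k l False (jordan_block n 0) X" and z: "X 0 0 = 0"
      have e: "2 * j < n \<Longrightarrow> X 0 (2 * j) = 0" for j
      proof (induction j)
        case (Suc j) thus ?case using J_eq[OF w k, of "Suc (2 * j)"] by simp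
      qed (simp add: z)
      have "X 0 i = 0" if "i < n" for i
        using e[of "i div 2"] J_odd[OF w k, of "i div 2"] that by (cases "even i") (auto elim!: evenE oddE)
      thus "val k 0 (jordan_block n 0) X \<le> 0" using val_zero0[of "jordan_block n 0" X k 0] by simp
    qed (use n in simp)
  qed
  thus ?thesis using True by simp
next
  case False
  then obtain m where m: "n = 2 * m" by (auto elim: evenE)
  show ?thesis
  proof (cases "l = 0")
    case l: False
    have "cert k l False 0 (jordan_block n 0) 0"
    proof (rule cert_zero)
      fix X i assume w: "wit k l False (jordan_block n 0) X" and i: "i < dim_row (jordan_block n (0::real))"
      \<comment> \<open>Backwards from the end: the last equation forces the last even coordinate to
        0 because l is nonzero, and each earlier one follows.\<close>
      have e: "j < m \<Longrightarrow> X 0 (2 * (m - Suc j)) = 0" for j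
      proof (induction j)
        case 0
        have "Suc (2 * (m - Suc 0)) < n" "\<not> Suc (Suc (2 * (m - Suc 0))) < n" using 0 m by auto
        thus ?case using J_eq[OF w k, of "Suc (2 * (m - Suc 0))"] l by simp
      next
        case (Suc j)
        define c where "c = m - Suc (Suc j)"
        have c: "m - Suc j = Suc c" "Suc (2 * c) < n" "Suc (Suc (2 * c)) < n" using Suc.prems m unfolding c_def by auto
        have "X 0 (2 * Suc c) = 0" using Suc unfolding c by simp
        hence "X 0 (2 * c) = 0" using J_eq[OF w k c(2)] c(3) l by simp
        thus ?case unfolding c_def .
      qed
      have e': "X 0 (2 * j) = 0" if "j < m" for j using e[of "m - Suc j"] that by (simp add: Suc_diff_Suc)
      show "X 0 i = 0" using e'[of "i div 2"] J_odd[OF w k, of "i div 2"] i m by (cases "even i") (auto elim!: evenE oddE)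
    qed
    thus ?thesis using False l by simp
  next
    case l: True
    show ?thesis
    proof (cases "k \<le> m")
      case True
      have "cert k 0 False 0 (jordan_block n 0) 1"
      proof (rule cert_1I)
        show "lower k 0 False 0 (jordan_block n 0) 1"
        proof (rule lower_1[OF J_ex[of k k n False] val_D_pos[of 0]])
          show "n \<noteq> 2 * r" if "r < k" for r using that True m by simp
        qed (use n in auto)
        show "upper k 0 False 0 (jordan_block n 0) 1"
        proof (rule upper_1)
          fix X assume w: "wit k 0 False (jordan_block n 0) X" and z: "X 0 0 = 0"
          have "X 0 i = 0" if "i < n" for i using J_shift(1)[OF w k, of i] z that by (cases "i = 0") auto
          thus "val k 0 (jordan_block n 0) X \<le> 0" using val_zero0[of "jordan_block n 0" X k 0] by simp
        qed (use n in simp)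
      qed
      thus ?thesis using l True m by simp
    next
      case km: False
      have "cert k 0 False 0 (jordan_block n 0) 0"
      proof (rule cert_zero)
        fix X i assume w: "wit k 0 False (jordan_block n 0) X" and i: "i < dim_row (jordan_block n (0::real))"
        have "X 0 0 = 0" by (rule J_shift(3)[OF w k, of m]) (use km m n in auto)
        thus "X 0 i = 0" using J_shift(1)[OF w k, of i] i by (cases "i = 0") auto
      qed
      thus ?thesis using l km m by simp
    qed
  qed
qed

text \<open>In size at least 2m + 1 the starting entry is still present after m steps and must be 0;
  in smaller even size \<open>J_shift\<close> excludes it. In smaller odd size it has left the block
  freely.\<close>

lemma J_cert_F:
  assumes n: "0 < n"
  shows "cert (Suc m) 0 True 0 (jordan_block n 0) (pF m (CJ n))"
proof (cases "odd n \<and> n div 2 < m")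
  case True
  hence nm: "n \<le> 2 * m" by (auto elim!: oddE)
  have "cert (Suc m) 0 True 0 (jordan_block n 0) 1"
  proof (rule cert_1I)
    show "lower (Suc m) 0 True 0 (jordan_block n 0) 1"
    proof (rule lower_1[OF J_ex[of "Suc m" m n True] val_D_pos[of 0]])
      show "n \<noteq> 2 * r" for r using True by auto
    qed (use n nm in auto)
    show "upper (Suc m) 0 True 0 (jordan_block n 0) 1"
    proof (rule upper_1)
      fix X assume w: "wit (Suc m) 0 True (jordan_block n 0) X" and z: "X 0 0 = 0"
      have "X 0 i = 0" if "i < n" for i using J_shift(1)[OF w, of i] z that by (cases "i = 0") auto
      thus "val (Suc m) 0 (jordan_block n 0) X \<le> 0" using val_zero0[of "jordan_block n 0" X "Suc m" 0] by simp
    qed (use n in simp)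
  qed
  thus ?thesis using True by simp
next
  case False
  have "cert (Suc m) 0 True 0 (jordan_block n 0) 0"
  proof (rule cert_zero)
    fix X i assume w: "wit (Suc m) 0 True (jordan_block n 0) X" and i: "i < dim_row (jordan_block n (0::real))"
    have z: "X m j = 0" if "j < n" for j using w that unfolding wit_J by simp
    have "X 0 0 = 0"
    proof (cases "2 * m < n")
      case True thus ?thesis using J_shift(2)[OF w, of m] z[of "2 * m"] by simp
    next
      case nm: False
      have "even n" using False nm by presburger
      then obtain t where "n = 2 * t" by (auto elim: evenE)
      thus ?thesis using J_shift(3)[OF w, of t] n nm by simp
    qed
    thus "X 0 i = 0" using J_shift(1)[OF w, of i] i by (cases "i = 0") auto
  qed
  thus ?thesis using False by auto
qed

section \<open>Counts for types (iii) and (iv)\<close>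

lemma H_zero: assumes "0 < k" "of_real a \<noteq> l" "l * of_real a \<noteq> 1" shows "cert k l z s (H_mat n a) 0"
proof (rule cert_zero)
  fix X i assume w: "wit k l z (H_mat n a) X" and "i < dim_row (H_mat n a)"
  hence i: "i < n + n" unfolding H_mat_def by simp
  have u: "X 0 i = 0" if "i < n" for i using uch_zero[of k l "of_real a" n X 0 i] w assms that unfolding wit_H by simp
  have v: "X 0 (n + i) = 0" if "i < n" for i using vch_zero[of k l "of_real a" n "\<lambda>r i. X r (n + i)" 0 i] w assms that unfolding wit_H by simp
  show "X 0 i = 0" using u[of i] v[of "i - n"] i by (cases "i < n") auto
qed

lemma H_cert_D: assumes k: "0 < k" and n: "0 < n" and a: "\<bar>a\<bar> < 1"
  shows "cert k (of_real a) False 0 (H_mat n a) (if k \<le> n then 1 else 0)"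
proof -
  have d: "dim_row (H_mat n a) = n + n" unfolding H_mat_def by simp
  have "cmod (of_real a * of_real a) < 1" unfolding norm_mult using a mult_strict_mono[of "\<bar>a\<bar>" 1 "\<bar>a\<bar>" 1] by simp
  hence aa: "complex_of_real a * of_real a \<noteq> 1" by (metis norm_one less_irrefl)
  have v: "X 0 i = 0" if w: "wit k (of_real a) False (H_mat n a) X" and z: "X 0 0 = 0" and i: "i < n + n" for X i
  proof (cases "i < n")
    case True
    thus ?thesis using uch_eig(1)[of k "of_real a" n X i] w k n z unfolding wit_H by (cases "i = 0") auto
  next
    case False
    thus ?thesis using vch_zero[of k "of_real a" "of_real a" n "\<lambda>r i. X r (n + i)" 0 "i - n"] aa w k i unfolding wit_H by simp
  qed
  show ?thesis
  proof (cases "k \<le> n")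
    case True
    have "cert k (of_real a) False 0 (H_mat n a) 1"
    proof (rule cert_1I)
      show "lower k (of_real a) False 0 (H_mat n a) 1"
      proof (rule lower_1[OF _ val_D_pos[of 0]])
        show "wit k (of_real a) False (H_mat n a) (\<lambda>r i. if i = r then 1 else 0)"
          unfolding wit_H using uch_ex[OF True] True by (auto simp: vch_def)
      qed (use n d in auto)
      show "upper k (of_real a) False 0 (H_mat n a) 1"
        by (rule upper_1) (use v d n val_zero0[of "H_mat n a" _ k 0] in auto)
    qed
    thus ?thesis using True by simp
  next
    case False
    have "cert k (of_real a) False 0 (H_mat n a) 0"
    proof (rule cert_zero)
      fix X i assume w: "wit k (of_real a) False (H_mat n a) X" and i: "i < dim_row (H_mat n a)"
      have "X 0 0 = 0" using uch_eig(2)[of k "of_real a" n X] w k n False unfolding wit_H by simp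
      thus "X 0 i = 0" using v[OF w] i d by simp
    qed
    thus ?thesis using False by simp
  qed
qed

lemma Hhat_dim: "dim_row (H_hat_mat n a b) = 2 * n + 2 * n" unfolding H_hat_mat_def using C_block_carrier[of n a b] by simp

lemma Hhat_upper_half:
  assumes w: "wit k l z (H_hat_mat n a b) X" and k: "0 < k" and i: "i < 2 * n"
    and ne: "\<And>e. e * e = -1 \<Longrightarrow> l * (of_real a + e * of_real b) \<noteq> 1"
  shows "X 0 (2 * n + i) = 0"
proof (rule pairs_zeroD[where X="\<lambda>r i. X r (2 * n + i)" and k=k and n=n and r=0])
  fix e :: complex and r j assume h: "e * e = -1" "r < k" "j < n"
  have "vch k l (of_real a + e * of_real b) n (comp e (\<lambda>r i. X r (2 * n + i)))" using w h(1) unfolding wit_Hhat by blast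
  thus "comp e (\<lambda>r i. X r (2 * n + i)) r j = 0" by (rule vch_zero[OF _ ne[OF h(1)] h(2,3)])
qed (use k i in auto)

lemma Hhat_zero: assumes k: "0 < k" and ne: "\<And>e. e * e = -1 \<Longrightarrow> of_real a - e * of_real b \<noteq> l \<and> l * (of_real a + e * of_real b) \<noteq> 1"
  shows "cert k l z s (H_hat_mat n a b) 0"
proof (rule cert_zero)
  fix X i assume w: "wit k l z (H_hat_mat n a b) X" and "i < dim_row (H_hat_mat n a b)"
  hence i: "i < 2 * n + 2 * n" unfolding Hhat_dim by simp
  have u: "X 0 i = 0" if "i < 2 * n" for i
  proof (rule pairs_zeroD[where X=X and k=k and n=n and r=0])
    fix e :: complex and r j assume h: "e * e = -1" "r < k" "j < n"
    have "uch k l (of_real a - e * of_real b) n (comp e X)" using w h(1) unfolding wit_Hhat by blast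
    thus "comp e X r j = 0" by (rule uch_zero[OF _ conjunct1[OF ne[OF h(1)]] h(2,3)])
  qed (use k that in auto)
  have v: "X 0 (2 * n + i) = 0" if "i < 2 * n" for i
    by (rule Hhat_upper_half[OF w k that]) (use ne in blast)
  show "X 0 i = 0" using u[of i] v[of "i - 2 * n"] i by (cases "i < 2 * n") auto
qed

lemma cmod_ab: "e * e = -1 \<Longrightarrow> (cmod (of_real a + e * of_real b))\<^sup>2 = a\<^sup>2 + b\<^sup>2"
  "e * e = -1 \<Longrightarrow> (cmod (of_real a - e * of_real b))\<^sup>2 = a\<^sup>2 + b\<^sup>2"
  by (drule e_square, auto simp: cmod_def)+

lemma cmod_ab_lt: assumes "a\<^sup>2 + b\<^sup>2 < 1" "e * e = -1"
  shows "cmod (of_real a + e * of_real b) < 1" "cmod (of_real a - e * of_real b) < 1"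
  by (rule power_less_imp_less_base[of _ 2 1]; use assms(1) cmod_ab[OF assms(2), of a b] in simp)+

lemma norm_mult_ne: assumes "cmod x \<le> 1" "cmod y < 1" shows "x * y \<noteq> 1"
proof
  assume "x * y = 1"
  hence "cmod x * cmod y = 1" by (metis norm_mult norm_one)
  moreover have "cmod x * cmod y \<le> 1 * cmod y" using assms by (intro mult_right_mono) auto
  ultimately show False using assms by simp
qed

lemma Hhat_cert_D: assumes k: "0 < k" and n: "0 < n" and ab: "a\<^sup>2 + b\<^sup>2 < 1" "0 < b"
  shows "cert k (Complex a b) False 0 (H_hat_mat n a b) (if k \<le> n then 1 else 0)"
proof -
  let ?l = "Complex a b" and ?H = "H_hat_mat n a b"
  have ii: "(- \<i>) * (- \<i>) = -1" "\<i> * \<i> = -1" by simp_all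
  \<comment> \<open>The eigenvalue a + ib belongs to the component \<open>e = - \<i>\<close>; the
    other one has a - ib, which differs because b > 0.\<close>
  have l: "?l = of_real a - (- \<i>) * of_real b" "?l = of_real a + \<i> * of_real b" by (simp_all add: complex_eq_iff)
  have lne: "?l \<noteq> of_real a - \<i> * of_real b" using ab(2) by (simp add: complex_eq_iff)
  have l1: "cmod ?l \<le> 1" using cmod_ab_lt(1)[OF ab(1) ii(2)] unfolding l(2) by simp
  have lm: "?l * (of_real a + e * of_real b) \<noteq> 1" if "e * e = -1" for e
    by (rule norm_mult_ne[OF l1 cmod_ab_lt(1)[OF ab(1) that]])
  have U: "uch k ?l ?l n (comp (- \<i>) X)" "uch k ?l (of_real a - \<i> * of_real b) n (comp \<i> X)" if w: "wit k ?l False ?H X" for X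
    using w ii unfolding wit_Hhat l(1)[symmetric] by (metis l(1))+
  have v: "X 0 i = 0" if w: "wit k ?l False ?H X" and z: "comp (- \<i>) X 0 0 = 0" and i: "i < dim_row ?H" for X i
  proof (cases "i < 2 * n")
    case True
    have c: "comp e X 0 j = 0" if e: "e * e = -1" and j: "j < n" for e j
    proof -
      have "e = \<i> \<or> e = - \<i>" by (rule e_square[OF e])
      thus ?thesis
      proof
        assume e: "e = \<i>"
        show ?thesis unfolding e by (rule uch_zero[OF U(2)[OF w] _ k j]) (use lne in auto)
      next
        assume e: "e = - \<i>"
        show ?thesis unfolding e using uch_eig(1)[OF U(1)[OF w] k n, of j] z j by (cases "j = 0") auto
      qed
    qed
    show ?thesis by (rule pairs_zeroD[where k=1 and r=0 and n=n and X=X]) (use c True in auto)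
  next
    case False
    hence i': "i - 2 * n < 2 * n" using i unfolding Hhat_dim by simp
    have "X 0 (2 * n + (i - 2 * n)) = 0"
      by (rule Hhat_upper_half[OF w k i' lm])
    thus ?thesis using False by simp
  qed
  show ?thesis
  proof (cases "k \<le> n")
    case True
    let ?g = "\<lambda>r i. if i = r then 1 else (0::complex)"
    let ?X = "lift (- \<i>) ?g"
    have "cert k ?l False 0 ?H 1"
    proof (rule cert_1I)
      show "lower k ?l False 0 ?H 1"
      proof (rule lower_1[OF _ val_D_pos[of 0]])
        show "wit k ?l False ?H ?X" unfolding wit_Hhat
        proof (intro conjI allI impI)
          fix e :: complex assume e: "e * e = -1"
          show "uch k ?l (of_real a - e * of_real b) n (comp e ?X)"
          proof (cases "e = - \<i>")
            case eq: True
            show ?thesis unfolding comp_lift[OF ii(1) e] unfolding eq l(1)[symmetric] by (rule uch_scale[OF uch_ex[OF True]])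
          next
            case False
            thus ?thesis unfolding comp_lift[OF ii(1) e] by (simp add: uch_def)
          qed
          have "comp e (\<lambda>r i. ?X r (2 * n + i)) r j = 0" if "r < k" for r j
            using that True unfolding comp_def lift_def by simp
          thus "vch k ?l (of_real a + e * of_real b) n (comp e (\<lambda>r i. ?X r (2 * n + i)))" unfolding vch_def by simp
        qed auto
        show "0 < dim_row ?H" using n unfolding Hhat_dim by simp
        show "?X 0 0 \<noteq> 0" unfolding lift_def by simp
      qed
      show "upper k ?l False 0 ?H 1"
      proof (rule upper_1c[where e="- \<i>"])
        show "1 < dim_row ?H" using n unfolding Hhat_dim by simp
        fix X assume "wit k ?l False ?H X" "comp (- \<i>) X 0 0 = 0"
        thus "val k 0 ?H X \<le> 0" using v val_zero0[of ?H X k 0] by simp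
      qed
    qed
    thus ?thesis using True by simp
  next
    case False
    have "cert k ?l False 0 ?H 0"
    proof (rule cert_zero)
      fix X i assume w: "wit k ?l False ?H X" and i: "i < dim_row ?H"
      show "X 0 i = 0" by (rule v[OF w uch_eig(2)[OF U(1)[OF w] k n] i]) (use False in simp)
    qed
    thus ?thesis using False by simp
  qed
qed

text \<open>The eigenvalue condition equates two numbers of modulus 1 and cmod l.\<close>

lemma CG_zero: assumes v: "valid (CG n w)" and k: "0 < k" and l: "cmod l \<noteq> 1" shows "cert k l z s (base (CG n w)) 0"
proof -
  have ne: "(-1) ^ (n - 1) * cnj w' \<noteq> l * w'" if "cmod w' = 1" for w'
  proof
    assume "(-1) ^ (n - 1) * cnj w' = l * w'"
    hence "cmod ((-1) ^ (n - 1) * cnj w') = cmod (l * w')" by simp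
    thus False using that l by (simp add: norm_mult norm_power)
  qed
  show ?thesis
  proof (cases "Im w = 0")
    case True
    hence w: "of_real (Re w) = w" by (simp add: complex_eq_iff)
    have b: "base (CG n w) = Gsgn (Re w) n" using True by simp
    show ?thesis unfolding b
    proof (rule cert_zero)
      fix X i assume h: "wit k l z (Gsgn (Re w) n) X" "i < dim_row (Gsgn (Re w) n)"
      have g: "gch k l w n X" "i < n" using h unfolding wit_Gsgn w Gsgn_dim by blast+
      have "cmod w = 1" using v by simp
      thus "X 0 i = 0" by (rule gch_zero[OF g(1) ne k g(2)])
    qed
  next
    case False
    have cw: "cmod (of_real (Re w) + e * of_real (Im w)) = 1" if "e * e = -1" for e
      using e_square[OF that] v by (auto simp: cmod_def)
    have b: "base (CG n w) = Gamma_mat n \<otimes>\<^sub>K C_mat (Re w) (Im w)" using False by simp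
    show ?thesis unfolding b
    proof (rule cert_zero)
      fix X i assume w: "wit k l z (Gamma_mat n \<otimes>\<^sub>K C_mat (Re w) (Im w)) X" and i: "i < dim_row (Gamma_mat n \<otimes>\<^sub>K C_mat (Re w) (Im w))"
      show "X 0 i = 0"
      proof (rule pairs_zeroD[where k=k and n=n])
        fix e :: complex and r j assume e: "e * e = -1" and rj: "r < k" "j < n"
        have "gch k l (of_real (Re w) + e * of_real (Im w)) n (comp e X)" using w e unfolding wit_GC by blast
        thus "comp e X r j = 0" by (rule gch_zero[OF _ ne[OF cw[OF e]] rj])
      qed (use k i kron_C_dim in auto)
    qed
  qed
qed

text \<open>A block of type (iv) has both conjugate eigenvalues; restricting l to the closed upper
  half plane lets it be counted once.\<close>

lemma cert_D: assumes v: "valid c" and k: "0 < k" and l: "cmod l < 1" "0 \<le> Im l" shows "cert k l False 0 (base c) (pD k l c)"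
proof (cases c)
  case (CJ n) thus ?thesis using J_cert_D[OF k, of n l] v by simp
next
  case (CG n w) thus ?thesis using CG_zero[of n w k l False 0] v k l by simp
next
  case (CH n a)
  show ?thesis
  proof (cases "l = of_real a")
    case True thus ?thesis using H_cert_D[OF k, of n a] v CH by simp
  next
    case False
    have "l * of_real a \<noteq> 1" using norm_mult_ne[of l "of_real a"] l v CH by simp
    thus ?thesis using H_zero[OF k, of a l] False CH by auto
  qed
next
  case (CHH n a b)
  show ?thesis
  proof (cases "l = Complex a b")
    case True thus ?thesis using Hhat_cert_D[OF k, of n a b] v CHH by simp
  next
    case False
    have "of_real a - e * of_real b \<noteq> l \<and> l * (of_real a + e * of_real b) \<noteq> 1" if e: "e * e = -1" for e
    proof
      show "of_real a - e * of_real b \<noteq> l" using e_square[OF e] False l(2) v CHH by (auto simp: complex_eq_iff)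
      show "l * (of_real a + e * of_real b) \<noteq> 1" using norm_mult_ne[of l] l cmod_ab_lt(1)[OF _ e, of a b] v CHH by simp
    qed
    thus ?thesis using Hhat_zero[OF k, of a b l] False CHH by simp
  qed
qed

lemma cert_F: assumes v: "valid c" shows "cert (Suc m) 0 True 0 (base c) (pF m c)"
proof (cases c)
  case (CJ n) thus ?thesis using J_cert_F[of n m] v by simp
next
  case (CG n w) thus ?thesis using CG_zero[of n w "Suc m" 0 True 0] v by simp
next
  case (CH n a) thus ?thesis using H_zero[of "Suc m" a 0] v by simp
next
  case (CHH n a b)
  have "of_real a - e * of_real b \<noteq> 0" if e: "e * e = -1" for e :: complex using e_square[OF e] v CHH by (auto simp: complex_eq_iff)
  thus ?thesis using Hhat_zero[of "Suc m" a b 0] CHH by simp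
qed

text \<open>The change from (p, q) to (p + iq, p - iq) is the square root of 2 times a unitary
  map.\<close>

lemma pair_sum: "(\<Sum>i<2*n. cnj (x i) * t i) =
  ((\<Sum>j<n. cnj (x (2*j) + \<i> * x (Suc (2*j))) * (t (2*j) + \<i> * t (Suc (2*j)))) +
   (\<Sum>j<n. cnj (x (2*j) + (-\<i>) * x (Suc (2*j))) * (t (2*j) + (-\<i>) * t (Suc (2*j))))) / 2"
proof -
  have h: "cnj p * u + cnj q * v = (cnj (p + \<i> * q) * (u + \<i> * v) + cnj (p + (-\<i>) * q) * (u + (-\<i>) * v)) / 2" for p q u v :: complex
    by (simp add: complex_eq_iff algebra_simps)
  have "(\<Sum>i<2*n. cnj (x i) * t i) = (\<Sum>j<n. cnj (x (2*j)) * t (2*j) + cnj (x (Suc (2*j))) * t (Suc (2*j)))" by (rule sum_pairs)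
  also have "\<dots> = (\<Sum>j<n. (cnj (x (2*j) + \<i> * x (Suc (2*j))) * (t (2*j) + \<i> * t (Suc (2*j))) +
    cnj (x (2*j) + (-\<i>) * x (Suc (2*j))) * (t (2*j) + (-\<i>) * t (Suc (2*j)))) / 2)" by (intro sum.cong refl h)
  finally show ?thesis unfolding sum_divide_distrib[symmetric] sum.distrib .
qed

lemma gl_norm: "cmod w = 1 \<Longrightarrow> cmod (gl k w) = 1" unfolding gl_def by (simp add: norm_mult norm_power)

lemma val_Gsgn: assumes "s \<noteq> 0"
  shows "val k s (Gsgn t n) X = Re (s * gform (of_real t) n k X)"
  unfolding val_def gform_def Gsgn_dim using assms by (simp add: apT_Gsgn)

lemma val_GC: assumes "s \<noteq> 0"
  shows "val k s (Gamma_mat n \<otimes>\<^sub>K C_mat (Re w) (Im w)) X =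
    (Re (s * gform w n k (comp \<i> X)) + Re (s * gform (cnj w) n k (comp (-\<i>) X))) / 2"
proof -
  let ?C = "Gamma_mat n \<otimes>\<^sub>K C_mat (Re w) (Im w)"
  have w: "of_real (Re w) + \<i> * of_real (Im w) = w" "of_real (Re w) + (-\<i>) * of_real (Im w) = cnj w" by (simp_all add: complex_eq_iff)
  have ii: "\<i> * \<i> = -1" "(-\<i>) * (-\<i>) = -1" by simp_all
  have f: "(\<Sum>j<n. cnj (X (k-1) (2*j) + e * X (k-1) (Suc (2*j))) * (apT ?C (X 0) (2*j) + e * apT ?C (X 0) (Suc (2*j)))) =
    gform (of_real (Re w) + e * of_real (Im w)) n k (comp e X)" if e: "e * e = -1" for e
    unfolding gform_def
  proof (rule sum.cong[OF refl])
    fix j assume "j \<in> {..<n}"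
    hence j: "j < n" by simp
    show "cnj (X (k-1) (2*j) + e * X (k-1) (Suc (2*j))) * (apT ?C (X 0) (2*j) + e * apT ?C (X 0) (Suc (2*j))) =
      cnj (comp e X (k-1) j) * ((of_real (Re w) + e * of_real (Im w)) * (-1) ^ j * (comp e X 0 (n - Suc j) - (if 0 < j then comp e X 0 (n - j) else 0)))"
      unfolding apT_GC[OF j e] comp_def ..
  qed
  have "(\<Sum>i<2*n. cnj (X (k-1) i) * apT ?C (X 0) i) = (gform w n k (comp \<i> X) + gform (cnj w) n k (comp (-\<i>) X)) / 2"
    unfolding pair_sum f[OF ii(1)] f[OF ii(2)] w ..
  thus ?thesis unfolding val_def kron_C_dim using assms by (simp add: distrib_left right_diff_distrib add_divide_distrib diff_divide_distrib)
qed

text \<open>Components with scalar \<open>- w\<close> contribute negative squares, invisible to the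
  count. A conjugate component never equals \<open>w\<close>, since valid codes have nonnegative
  imaginary part and the block is non-real; so exactly the code itself is counted.\<close>

lemma cert_G: assumes v: "valid c" and vw: "valid (CG k w)"
  shows "cert k (gl k w) False (gs k w) (base c) (if c = CG k w then 1 else 0)"
proof -
  have k: "0 < k" and w1: "cmod w = 1" using vw by auto
  have s: "gs k w \<noteq> 0" by (rule gs_nonzero[OF w1])
  have l1: "cmod (gl k w) \<le> 1" "cmod (gl k w) = 1" using gl_norm[OF w1] by simp_all
  show ?thesis
  proof (cases c)
    case (CJ n)
    have "cert k (gl k w) False (gs k w) (jordan_block n 0) 0" by (rule cert_0) (use J_form[OF _ k s] in simp)
    thus ?thesis using CJ by simp
  next
    case (CH n a)
    have "complex_of_real a \<noteq> gl k w" using l1 v CH by (metis less_irrefl norm_of_real valid.simps(3))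
    moreover have "gl k w * of_real a \<noteq> 1" by (rule norm_mult_ne[OF l1(1)]) (use v CH in simp)
    ultimately show ?thesis using H_zero[OF k] CH by simp
  next
    case (CHH n a b)
    have "of_real a - e * of_real b \<noteq> gl k w \<and> gl k w * (of_real a + e * of_real b) \<noteq> 1" if e: "e * e = -1" for e
      using cmod_ab_lt[OF _ e, of a b] norm_mult_ne[OF l1(1), of "of_real a + e * of_real b"] v CHH l1(2) by auto
    thus ?thesis using Hhat_zero[OF k, of a b "gl k w"] CHH by simp
  next
    case (CG n w')
    have n: "0 < n" and w1': "cmod w' = 1" "cmod (cnj w') = 1" using v CG by auto
    note gv = gform_val[OF _ w1 _ n k]
    have e: "(-1) ^ (n - 1) * cnj w = gl k w * w" if "n = k" using that unfolding eig_unit[OF w1 w1] by simp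
    have w0: "w \<noteq> 0" using w1 by auto
    let ?y = "gy (w / (2 * (-1) ^ (n - 1) * cnj w))"
    show ?thesis
    proof (cases "Im w' = 0")
      case True
      hence r: "of_real (Re w') = w'" by (simp add: complex_eq_iff)
      have b: "base c = Gsgn (Re w') n" using True CG by simp
      have vl: "val k (gs k w) (Gsgn (Re w') n) X = (if n = k \<and> w' = w then (cmod (X 0 0))\<^sup>2 * (cmod (gs k w))\<^sup>2
          else if n = k \<and> w' = - w then - ((cmod (X 0 0))\<^sup>2 * (cmod (gs k w))\<^sup>2) else 0)" if "gch k (gl k w) w' n X" for X
        unfolding val_Gsgn[OF s] r by (rule gv[OF that w1'(1)])
      show ?thesis
      proof (cases "n = k \<and> w' = w")
        case eq: True
        have "cert k (gl k w) False (gs k w) (Gsgn (Re w') n) 1"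
        proof (rule cert_1I)
          have g: "gch k (gl k w) w' n ?y" using gch_ex[OF e w0 n] eq by simp
          show "lower k (gl k w) False (gs k w) (Gsgn (Re w') n) 1"
          proof (rule lower_1)
            show "wit k (gl k w) False (Gsgn (Re w') n) ?y" unfolding wit_Gsgn r using g by simp
            show "0 < val k (gs k w) (Gsgn (Re w') n) ?y" unfolding vl[OF g] using eq s by simp
          qed
          show "upper k (gl k w) False (gs k w) (Gsgn (Re w') n) 1"
          proof (rule upper_1)
            fix X assume h: "wit k (gl k w) False (Gsgn (Re w') n) X" "X 0 0 = 0"
            have "gch k (gl k w) w' n X" using h(1) unfolding wit_Gsgn r by blast
            from vl[OF this] show "val k (gs k w) (Gsgn (Re w') n) X \<le> 0" using h(2) by simp
          qed (use n Gsgn_dim in simp)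
        qed
        thus ?thesis unfolding b using eq CG by simp
      next
        case False
        have "cert k (gl k w) False (gs k w) (Gsgn (Re w') n) 0"
        proof (rule cert_0)
          fix X assume h: "wit k (gl k w) False (Gsgn (Re w') n) X"
          have "gch k (gl k w) w' n X" using h unfolding wit_Gsgn r by blast
          from vl[OF this] show "val k (gs k w) (Gsgn (Re w') n) X \<le> 0" using False by auto
        qed
        thus ?thesis unfolding b using False CG by auto
      qed
    next
      case False
      let ?C = "Gamma_mat n \<otimes>\<^sub>K C_mat (Re w') (Im w')"
      have b: "base c = ?C" using False CG by simp
      have im: "0 < Im w'" using v CG False by auto
      have cw: "cnj w' \<noteq> w" using im vw by (auto simp: complex_eq_iff)
      have W: "of_real (Re w') + \<i> * of_real (Im w') = w'" "of_real (Re w') + (-\<i>) * of_real (Im w') = cnj w'" by (simp_all add: complex_eq_iff)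
      have ii: "\<i> * \<i> = -1" "(-\<i>) * (-\<i>) = -1" by simp_all
      have vl: "val k (gs k w) ?C X = ((if n = k \<and> w' = w then (cmod (comp \<i> X 0 0))\<^sup>2 * (cmod (gs k w))\<^sup>2
          else if n = k \<and> w' = - w then - ((cmod (comp \<i> X 0 0))\<^sup>2 * (cmod (gs k w))\<^sup>2) else 0) +
          (if n = k \<and> cnj w' = - w then - ((cmod (comp (-\<i>) X 0 0))\<^sup>2 * (cmod (gs k w))\<^sup>2) else 0)) / 2"
        if h: "wit k (gl k w) False ?C X" for X
      proof -
        have gg: "gch k (gl k w) (of_real (Re w') + e * of_real (Im w')) n (comp e X)" if "e * e = -1" for e
          using h that unfolding wit_GC by blast
        have g: "gch k (gl k w) w' n (comp \<i> X)" using gg[OF ii(1)] unfolding W .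
        have g': "gch k (gl k w) (cnj w') n (comp (-\<i>) X)" using gg[OF ii(2)] unfolding W .
        show ?thesis unfolding val_GC[OF s] gv[OF g w1'(1)] gv[OF g' w1'(2)] using cw by simp
      qed
      show ?thesis
      proof (cases "n = k \<and> w' = w")
        case eq: True
        let ?X = "lift \<i> ?y"
        have c1: "comp \<i> ?X 0 0 = 2" "comp (-\<i>) ?X 0 0 = 0" unfolding comp_lift[OF ii(1) ii(1)] comp_lift[OF ii(1) ii(2)] by simp_all
        have h: "wit k (gl k w) False ?C ?X" unfolding wit_GC
        proof (intro conjI allI impI)
          fix e' :: complex assume e': "e' * e' = -1"
          have "gch k (gl k w) w' n ?y" using gch_ex[OF e w0 n] eq by simp
          hence "e' = \<i> \<Longrightarrow> gch k (gl k w) (of_real (Re w') + e' * of_real (Im w')) n (\<lambda>r j. 2 * ?y r j)" using gch_scale W(1) by simp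
          moreover have "gch k (gl k w) (of_real (Re w') + e' * of_real (Im w')) n (\<lambda>r j. 0)" unfolding gch_def by simp
          ultimately show "gch k (gl k w) (of_real (Re w') + e' * of_real (Im w')) n (comp e' ?X)"
            unfolding comp_lift[OF ii(1) e'] by (cases "e' = \<i>") simp_all
        qed auto
        have "cert k (gl k w) False (gs k w) ?C 1"
        proof (rule cert_1I)
          show "lower k (gl k w) False (gs k w) ?C 1"
          proof (rule lower_1[OF h])
            show "0 < val k (gs k w) ?C ?X" unfolding vl[OF h] c1 using eq s by simp
          qed
          show "upper k (gl k w) False (gs k w) ?C 1"
          proof (rule upper_1c[where e="\<i>"])
            show "1 < dim_row ?C" using n unfolding kron_C_dim by simp
            fix X assume h: "wit k (gl k w) False ?C X" and z: "comp \<i> X 0 0 = 0"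
            show "val k (gs k w) ?C X \<le> 0" unfolding vl[OF h]
              by (intro divide_nonpos_pos add_nonpos_nonpos) (use z in auto)
          qed
        qed
        thus ?thesis unfolding b using eq CG by simp
      next
        case ne: False
        have "cert k (gl k w) False (gs k w) ?C 0"
        proof (rule cert_0)
          fix X assume h: "wit k (gl k w) False ?C X"
          show "val k (gs k w) ?C X \<le> 0" unfolding vl[OF h]
            by (intro divide_nonpos_pos add_nonpos_nonpos) (use ne in auto)
        qed
        thus ?thesis unfolding b using ne CG by auto
      qed
    qed
  qed
qed

section \<open>Uniqueness and the alternative blocks\<close>

lemma sum_eq:
  assumes rc: "real_congruent n (diag_block_mat (map base cs)) (diag_block_mat (map base ds))"
    and v: "\<And>c. c \<in> set cs \<union> set ds \<Longrightarrow> cert k l z s (base c) (f c)"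
  shows "sum_list (map f cs) = sum_list (map f ds)"
proof -
  have 1: "cert k l z s (diag_block_mat (map base cs)) (sum_list (map f cs))" by (rule cert_diag) (use v base_dim in auto)
  have 2: "cert k l z s (diag_block_mat (map base ds)) (sum_list (map f ds))" by (rule cert_diag) (use v base_dim in auto)
  show ?thesis
    using cert_congruent_le[OF rc _ 1] cert_congruent_le[OF real_congruent_sym[OF rc] _ 2] 1 2 unfolding cert_def by (meson le_antisym)
qed

lemma count_sum: "count (mset xs) c = sum_list (map (\<lambda>x. if x = c then 1 else 0) xs)"
  by (induction xs) auto

lemma count_step:
  assumes "\<And>x. x \<in> set xs \<Longrightarrow> f x = g x + (if x = c then 1 else (0::nat))"
  shows "sum_list (map f xs) = sum_list (map g xs) + count (mset xs) c"
proof -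
  have "map f xs = map (\<lambda>x. g x + (if x = c then 1 else 0)) xs" using assms by simp
  thus ?thesis unfolding count_sum by (simp only: sum_list_addf)
qed

lemma pF_step: "pF (Suc m) x = pF m x + (if x = CJ (Suc (2 * m)) then 1 else 0)"
proof (cases x)
  case (CJ n)
  have "odd n \<and> n div 2 < Suc m \<longleftrightarrow> (odd n \<and> n div 2 < m) \<or> n = Suc (2 * m)" by presburger
  thus ?thesis using CJ by auto
qed auto

lemma pD_step_J: "valid x \<Longrightarrow> pD m 0 x = pD (Suc m) 0 x + (if x = CJ (2 * m) then 1 else 0)"
proof (cases x)
  case (CJ n)
  have "(odd n \<or> 2 * m \<le> n) \<longleftrightarrow> (odd n \<or> 2 * Suc m \<le> n) \<or> n = 2 * m" "\<not> (odd n \<or> 2 * Suc m \<le> n) \<or> n \<noteq> 2 * m" by presburger+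
  thus ?thesis using CJ by auto
qed (auto simp: complex_eq_iff)

lemma pD_step_H: "valid (CH k a) \<Longrightarrow> valid x \<Longrightarrow> pD k (of_real a) x = pD (Suc k) (of_real a) x + (if x = CH k a then 1 else 0)"
  by (cases x) (auto simp: complex_eq_iff)

lemma pD_step_HH: "valid (CHH k a b) \<Longrightarrow> valid x \<Longrightarrow> pD k (Complex a b) x = pD (Suc k) (Complex a b) x + (if x = CHH k a b then 1 else 0)"
  by (cases x) (auto simp: complex_eq_iff)

lemma cmod_Complex_lt: "a\<^sup>2 + b\<^sup>2 < 1 \<Longrightarrow> cmod (Complex a b) < 1"
  by (simp add: cmod_def)

text \<open>For type (ii) the count is the multiplicity. For the others it is a difference of two
  consecutive counts: of \<open>pD\<close> in the chain length for types (iii), (iv) and even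
  nilpotent blocks, of \<open>pF\<close> for odd ones.\<close>

theorem codes_unique:
  assumes rc: "real_congruent n (diag_block_mat (map base cs)) (diag_block_mat (map base ds))"
    and v: "\<And>c. c \<in> set cs \<union> set ds \<Longrightarrow> valid c"
  shows "mset cs = mset ds"
proof (rule multiset_eqI)
  fix c
  have eqD: "sum_list (map (pD k l) cs) = sum_list (map (pD k l) ds)" if "0 < k" "cmod l < 1" "0 \<le> Im l" for k l
    by (rule sum_eq[OF rc cert_D[OF v that]])
  have stepD: "count (mset cs) c = count (mset ds) c"
    if "\<And>x. valid x \<Longrightarrow> pD k l x = pD (Suc k) l x + (if x = c then 1 else 0)" "0 < k" "cmod l < 1" "0 \<le> Im l" for k l
    using count_step[of cs "pD k l" "pD (Suc k) l" c] count_step[of ds "pD k l" "pD (Suc k) l" c]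
      eqD[of k l] eqD[of "Suc k" l] that v by simp
  show "count (mset cs) c = count (mset ds) c"
  proof (cases "valid c")
    case False
    hence "c \<notin> set cs" "c \<notin> set ds" using v by auto
    hence "c \<notin># mset cs" "c \<notin># mset ds" by simp_all
    thus ?thesis unfolding not_in_iff by (rule trans[OF _ sym])
  next
    case vc: True
    show ?thesis
    proof (cases c)
      case (CJ m)
      show ?thesis
      proof (cases "even m")
        case True
        then obtain j where j: "m = 2 * j" by (elim evenE)
        show ?thesis by (rule stepD[of j 0]) (use pD_step_J[of _ j] CJ vc j in auto)
      next
        case False
        then obtain j where j: "m = Suc (2 * j)" by (auto elim: oddE)
        have e: "sum_list (map (pF i) cs) = sum_list (map (pF i) ds)" for i by (rule sum_eq[OF rc cert_F[OF v]])
        have "sum_list (map (pF (Suc j)) xs) = sum_list (map (pF j) xs) + count (mset xs) c" for xs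
          unfolding CJ j by (rule count_step) (rule pF_step)
        thus ?thesis using e[of j] e[of "Suc j"] by simp
      qed
    next
      case (CG k w)
      have "cert k (gl k w) False (gs k w) (base x) (if x = c then 1 else 0)" if x: "x \<in> set cs \<union> set ds" for x
        using cert_G[OF v[OF x] vc[unfolded CG]] unfolding CG .
      from sum_eq[OF rc this] show ?thesis unfolding count_sum by simp
    next
      case (CH k a)
      show ?thesis by (rule stepD[of k "of_real a"]) (use pD_step_H[of k a] CH vc in auto)
    next
      case (CHH k a b)
      show ?thesis by (rule stepD[of k "Complex a b"]) (use pD_step_HH[of k a b] cmod_Complex_lt[of a b] CHH vc in auto)
    qed
  qed
qed

section \<open>Passing between codes and matrices\<close>

lemma base_pos: "valid c \<Longrightarrow> 0 < dim_row (base c)" unfolding base_dim(1) by (cases c) auto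

lemma Gsgn_pm: "Gsgn 1 k = Gamma_mat k \<otimes>\<^sub>K 1\<^sub>m 1" "Gsgn (-1) k = Gamma_mat k \<otimes>\<^sub>K (- 1\<^sub>m 1)"
proof -
  have "1 \<cdot>\<^sub>m 1\<^sub>m 1 = (1\<^sub>m 1 :: real mat)" "(-1) \<cdot>\<^sub>m 1\<^sub>m 1 = (- 1\<^sub>m 1 :: real mat)" by (rule eq_matI; simp)+
  thus "Gsgn 1 k = Gamma_mat k \<otimes>\<^sub>K 1\<^sub>m 1" "Gsgn (-1) k = Gamma_mat k \<otimes>\<^sub>K (- 1\<^sub>m 1)" unfolding Gsgn_def by simp_all
qed

lemma unit_real: assumes "cmod w = 1" "Im w = 0" shows "w = 1 \<or> w = -1"
proof -
  have "\<bar>Re w\<bar> = 1" using assms by (simp add: cmod_def)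
  thus ?thesis using assms(2) by (auto simp: complex_eq_iff abs_if split: if_splits)
qed

lemma code_ii: assumes "k \<ge> 1" "N \<in> N_mats"
  shows "\<exists>w. valid (CG k w) \<and> base (CG k w) = Gamma_mat k \<otimes>\<^sub>K N \<and> (Im w = 0 \<longrightarrow> N = 1\<^sub>m 1 \<or> N = - 1\<^sub>m 1) \<and> (Im w \<noteq> 0 \<longrightarrow> N = C_mat (Re w) (Im w))"
proof -
  consider "N = 1\<^sub>m 1" | "N = - 1\<^sub>m 1" | a b where "N = C_mat a b" "a\<^sup>2 + b\<^sup>2 = 1" "b > 0" using assms(2) unfolding N_mats_def by blast
  thus ?thesis
  proof cases
    case 1 thus ?thesis using Gsgn_pm(1)[of k] assms(1) by (intro exI[of _ 1]) auto
  next
    case 2 thus ?thesis using Gsgn_pm(2)[of k] assms(1) by (intro exI[of _ "-1"]) auto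
  next
    case (3 a b) thus ?thesis using assms(1) by (intro exI[of _ "Complex a b"]) (auto simp: cmod_def)
  qed
qed

lemma base_codes:
  assumes "set Bs \<subseteq> type_i \<union> type_ii \<union> type_iii \<union> type_iv"
  shows "\<exists>cs. Bs = map base cs \<and> (\<forall>c\<in>set cs. valid c)"
proof -
  have "\<exists>c. B = base c \<and> valid c" if B: "B \<in> set Bs" for B
  proof -
    consider "B \<in> type_i" | "B \<in> type_ii" | "B \<in> type_iii" | "B \<in> type_iv" using B assms by blast
    thus ?thesis
    proof cases
      case 1 then obtain k where "k \<ge> 1" "B = jordan_block k 0" unfolding type_i_def by blast
      thus ?thesis by (intro exI[of _ "CJ k"]) simp
    next
      case 2 then obtain k N where kN: "k \<ge> 1" "N \<in> N_mats" "B = Gamma_mat k \<otimes>\<^sub>K N" unfolding type_ii_def by blast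
      from code_ii[OF kN(1,2)] obtain w where "valid (CG k w)" "base (CG k w) = Gamma_mat k \<otimes>\<^sub>K N" by blast
      thus ?thesis using kN(3) by metis
    next
      case 3 then obtain k a where "k \<ge> 1" "B = H_mat k a" "0 < \<bar>a\<bar>" "\<bar>a\<bar> < 1" unfolding type_iii_def by blast
      thus ?thesis by (intro exI[of _ "CH k a"]) simp
    next
      case 4 then obtain k a b where "k \<ge> 1" "B = H_hat_mat k a b" "a\<^sup>2 + b\<^sup>2 < 1" "b > 0" unfolding type_iv_def by blast
      thus ?thesis by (intro exI[of _ "CHH k a b"]) simp
    qed
  qed
  then obtain f where f: "\<And>B. B \<in> set Bs \<Longrightarrow> B = base (f B) \<and> valid (f B)" by metis
  have "map base (map f Bs) = Bs" unfolding map_map by (rule map_idI) (use f in simp)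
  thus ?thesis using f by (intro exI[of _ "map f Bs"]) auto
qed

lemma sum_list_zero: "(\<And>x. x \<in> set xs \<Longrightarrow> f x = (0::nat)) \<Longrightarrow> sum_list (map f xs) = 0"
  by (induction xs) auto

text \<open>\<open>A\<close> has some canonical form. A chain for \<open>l\<close> in
  \<open>A\<close> forces a block that is counted at \<open>l\<close>; odd nilpotent blocks are
  ruled out by \<open>F\<close>. By \<open>sel\<close> this block already has the full size, so it
  is alone and must be \<open>c0\<close>.\<close>

lemma alternate_congruent:
  assumes v: "valid c0" and A: "A \<in> carrier_mat N N" and N: "N = dim_row (base c0)"
    and k: "0 < k" and l: "cmod l < 1" "0 \<le> Im l" and low: "lower k l False 0 A 1" and F: "\<And>m. upper (Suc m) 0 True 0 A 0"
    and sel: "\<And>c. valid c \<Longrightarrow> pD k l c \<noteq> 0 \<Longrightarrow> (\<And>n. c = CJ n \<Longrightarrow> even n) \<Longrightarrow> N \<le> dim_row (base c) \<and> (dim_row (base c) = N \<longrightarrow> c = c0)"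
  shows "real_congruent N (base c0) A"
proof -
  obtain Bs where Bs: "set Bs \<subseteq> type_i \<union> type_ii \<union> type_iii \<union> type_iv" "real_congruent N A (diag_block_mat Bs)"
    using matrix_canonical[OF A] by blast
  obtain cs where cs: "Bs = map base cs" "\<And>c. c \<in> set cs \<Longrightarrow> valid c" using base_codes[OF Bs(1)] by blast
  let ?D = "diag_block_mat (map base cs)"
  have rc: "real_congruent N A ?D" using Bs(2) unfolding cs(1) .
  have "cert k l False 0 ?D (sum_list (map (pD k l) cs))" by (rule cert_diag) (use cert_D[OF cs(2) k l] base_dim in auto)
  hence "1 \<le> sum_list (map (pD k l) cs)"
    using lower_le_upper lower_congruent[OF real_congruent_sym[OF rc] low] unfolding cert_def by blast
  hence "\<exists>c\<in>set cs. pD k l c \<noteq> 0" using sum_list_zero[of cs "pD k l"] by fastforce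
  then obtain c where c: "c \<in> set cs" "pD k l c \<noteq> 0" by blast
  \<comment> \<open>An odd nilpotent block would give a positive \<open>pF\<close> count, while
    \<open>F\<close> bounds that count by 0.\<close>
  have ev: "even n" if "c = CJ n" for n
  proof (rule ccontr)
    assume o: "odd n"
    let ?m = "n div 2"
    have "cert (Suc (Suc ?m)) 0 True 0 ?D (sum_list (map (pF (Suc ?m)) cs))" by (rule cert_diag) (use cert_F[OF cs(2)] base_dim in auto)
    hence "sum_list (map (pF (Suc ?m)) cs) \<le> 0"
      using lower_le_upper[OF lower_congruent[OF rc] F[of "Suc ?m"]] unfolding cert_def by blast
    moreover have "pF (Suc ?m) c \<le> sum_list (map (pF (Suc ?m)) cs)" using c(1) by (intro member_le_sum_list) auto
    moreover have "pF (Suc ?m) c = 1" using that o by simp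
    ultimately show False by linarith
  qed
  have s: "N \<le> dim_row (base c)" "dim_row (base c) = N \<Longrightarrow> c = c0" using sel[OF cs(2)[OF c(1)] c(2) ev] by auto
  obtain xs ys where xy: "cs = xs @ c # ys" using c(1) by (meson split_list)
  have sqc: "sq (map base cs)" unfolding sq_def using base_dim by auto
  have "?D \<in> carrier_mat N N" using rc unfolding real_congruent_def by blast
  hence "siz (map base cs) = N" using carrier_matD(1)[OF diag_carrier[OF sqc]] carrier_matD(1)[of ?D N N] by metis
  hence sz: "siz (map base xs) + dim_row (base c) + siz (map base ys) = N" unfolding xy by simp
  have nil: "zs = []" if "siz (map base zs) = 0" "set zs \<subseteq> set cs" for zs
  proof (cases zs)
    case (Cons x xs) thus ?thesis using that base_pos[OF cs(2), of x] by simp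
  qed
  have "xs = []" "ys = []" using nil[of xs] nil[of ys] sz s(1) xy by auto
  hence "cs = [c0]" using xy sz s by simp
  hence D: "?D = base c0" by (simp only: list.map diag_block_mat_singleton)
  show ?thesis using real_congruent_sym[OF rc] unfolding D .
qed

lemma H_inverse: assumes v: "valid (CH n a)" shows "real_congruent (2 * n) (H_mat n a) (H_mat n (1 / a))"
proof -
  let ?A = "H_mat n (1 / a)"
  have n: "0 < n" "a \<noteq> 0" using v by auto
  have d: "?A \<in> carrier_mat (2 * n) (2 * n)" "dim_row ?A = n + n" unfolding H_mat_def mult_2 by auto
  have lm: "of_real a * of_real (1 / a) = (1::complex)" using n(2) by (simp add: of_real_mult[symmetric] del: of_real_mult)
  have "real_congruent (2 * n) (base (CH n a)) ?A"
  proof (rule alternate_congruent[OF v d(1), of n "of_real a"])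
    show "lower n (of_real a) False 0 ?A 1"
    proof (rule lower_1[OF _ val_D_pos[of "n + (n - 1)"]])
      \<comment> \<open>Supported on the lower half, where the parameter 1/a meets the eigenvalue a
        with product 1.\<close>
      show "wit n (of_real a) False ?A (\<lambda>r i. if i < n then 0 else hv (of_real (1 / a)) r (n - Suc (i - n)))"
        unfolding wit_H using vch_ex[OF lm, of n] by (simp add: uch_def)
    qed (use n d in auto)
    show "upper (Suc m) 0 True 0 ?A 0" for m using H_zero[of "Suc m" "1 / a" 0 True 0 n] n(2) unfolding cert_def by simp
    fix c assume c: "valid c" "pD n (of_real a) c \<noteq> 0" "\<And>m. c = CJ m \<Longrightarrow> even m"
    show "2 * n \<le> dim_row (base c) \<and> (dim_row (base c) = 2 * n \<longrightarrow> c = CH n a)"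
      using c n(2) unfolding base_dim(1) by (cases c) (auto simp: complex_eq_iff split: if_splits)
  next
    show "2 * n = dim_row (base (CH n a))" unfolding base_dim(1) by simp
  qed (use v in auto)
  thus ?thesis by simp
qed

lemma Hhat_inverse: assumes v: "valid (CHH n a b)"
  shows "real_congruent (4 * n) (H_hat_mat n a b) (H_hat_mat n (a / (a\<^sup>2 + b\<^sup>2)) (b / (a\<^sup>2 + b\<^sup>2)))"
proof -
  define r where "r = a\<^sup>2 + b\<^sup>2"
  have r: "r > 0" "b > 0" "0 < n" "r < 1" using v unfolding r_def by (auto intro: add_nonneg_pos)
  let ?a = "a / r" and ?b = "b / r"
  let ?A = "H_hat_mat n ?a ?b" and ?l = "Complex a b"
  have d: "?A \<in> carrier_mat (4 * n) (4 * n)" "dim_row ?A = 2 * n + 2 * n"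
    using Hhat_dim[of n ?a ?b] C_block_carrier[of n ?a ?b] unfolding H_hat_mat_def by (auto intro!: carrier_matI)
  have ii: "(- \<i>) * (- \<i>) = (-1::complex)" by simp
  \<comment> \<open>The factor of the component \<open>e = - \<i>\<close> in the lower half; it is
    the inverse of \<open>?l\<close>.\<close>
  let ?\<mu> = "of_real ?a + (- \<i>) * of_real ?b"
  have lm: "?l * ?\<mu> = 1"
  proof -
    have "?\<mu> = cnj ?l / of_real r" using r(1) by (simp add: complex_eq_iff)
    moreover have "?l * cnj ?l = of_real r" unfolding r_def complex_norm_square[symmetric] by (simp add: cmod_power2)
    ultimately show ?thesis using r(1) by simp
  qed
  let ?g = "\<lambda>r j. hv ?\<mu> r (n - Suc j)"
  let ?X = "\<lambda>r i. if i < 2 * n then 0 else lift (- \<i>) ?g r (i - 2 * n)"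
  have "real_congruent (4 * n) (base (CHH n a b)) ?A"
  proof (rule alternate_congruent[OF v d(1), of n ?l])
    show "lower n ?l False 0 ?A 1"
    proof (rule lower_1[OF _ val_D_pos[of "2 * n + 2 * (n - 1)"]])
      show "wit n ?l False ?A ?X" unfolding wit_Hhat
      proof (intro conjI allI impI)
        fix e :: complex assume e: "e * e = -1"
        have "comp e ?X r j = 0" if "j < n" for r j using that unfolding comp_def by simp
        thus "uch n ?l (of_real ?a - e * of_real ?b) n (comp e ?X)" unfolding uch_def by simp
        have V: "(\<lambda>r i. ?X r (2 * n + i)) = lift (- \<i>) ?g" by (intro ext) simp
        show "vch n ?l (of_real ?a + e * of_real ?b) n (comp e (\<lambda>r i. ?X r (2 * n + i)))"
        proof (cases "e = - \<i>")
          case True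
          show ?thesis unfolding V comp_lift[OF ii e] unfolding True by (rule vch_scale[OF vch_ex[OF lm]])
        next
          case False thus ?thesis unfolding V comp_lift[OF ii e] by (simp add: vch_def)
        qed
      qed auto
      show "?X 0 (2 * n + 2 * (n - 1)) \<noteq> 0" using r(3) unfolding lift_def by simp
    qed (use r d in auto)
    show "upper (Suc m) 0 True 0 ?A 0" for m
    proof -
      have "of_real ?a - e * of_real ?b \<noteq> 0" if "e * e = -1" for e :: complex
        using e_square[OF that] r by (auto simp: complex_eq_iff)
      thus ?thesis using Hhat_zero[of "Suc m" ?a ?b 0 True 0 n] unfolding cert_def by simp
    qed
    fix c assume c: "valid c" "pD n ?l c \<noteq> 0" "\<And>m. c = CJ m \<Longrightarrow> even m"
    show "4 * n \<le> dim_row (base c) \<and> (dim_row (base c) = 4 * n \<longrightarrow> c = CHH n a b)"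
      using c r(2) unfolding base_dim(1) by (cases c) (auto simp: complex_eq_iff split: if_splits)
  next
    show "4 * n = dim_row (base (CHH n a b))" unfolding base_dim(1) by simp
    show "cmod ?l < 1" using v by (intro cmod_Complex_lt) simp
  qed (use r in auto)
  thus ?thesis unfolding r_def by simp
qed

section \<open>Interchanging the Kronecker factors, and congruence of all replacements\<close>

lemma Gamma_dim: "dim_row (Gamma_mat k) = k" "dim_col (Gamma_mat k) = k" using Gamma_carrier[of k] by auto

lemma kron_scalar: assumes "dim_row N = 1" "dim_col N = 1" shows "N \<otimes>\<^sub>K Gamma_mat k = Gamma_mat k \<otimes>\<^sub>K N"
  by (rule eq_matI) (auto simp: kronecker_def assms Gamma_dim)

lemma kron_swap: "real_congruent (2 * k) (Gamma_mat k \<otimes>\<^sub>K C_mat a b) (C_mat a b \<otimes>\<^sub>K Gamma_mat k)"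
proof (cases "k = 0")
  case True
  have "Gamma_mat k \<otimes>\<^sub>K C_mat a b = C_mat a b \<otimes>\<^sub>K Gamma_mat k"
    by (rule eq_matI) (auto simp: kronecker_def Gamma_dim True)
  moreover have "Gamma_mat k \<otimes>\<^sub>K C_mat a b \<in> carrier_mat (2 * k) (2 * k)" using kron_C_dim by (intro carrier_matI) auto
  ultimately show ?thesis using real_congruent_refl by metis
next
  case False
  \<comment> \<open>The perfect shuffle: quotient and remainder of the index exchange their
    roles.\<close>
  let ?f = "\<lambda>i. 2 * (i mod k) + i div k"
  let ?A = "Gamma_mat k \<otimes>\<^sub>K C_mat a b"
  have dk: "i div k < 2" if "i < 2 * k" for i using that by (simp add: less_mult_imp_div_less)
  have fl: "?f i < 2 * k" if "i < 2 * k" for i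
  proof -
    have "i mod k < k" using False by simp
    thus ?thesis using dk[OF that] by linarith
  qed
  have ar: "p = p' \<and> q = q'" if "2 * p + q = 2 * p' + q'" "q < 2" "q' < 2" for p p' q q' :: nat using that by presburger
  have inj: "inj_on ?f {..<2 * k}"
  proof (rule inj_onI)
    fix i j assume h: "i \<in> {..<2 * k}" "j \<in> {..<2 * k}" "?f i = ?f j"
    have "i div k < 2" "j div k < 2" using dk h by auto
    hence "i mod k = j mod k \<and> i div k = j div k" using ar h(3) by blast
    thus "i = j" by (metis div_mult_mod_eq)
  qed
  have "?f ` {..<2 * k} = {..<2 * k}"
    by (rule card_subset_eq) (use fl card_image[OF inj] in auto)
  hence "bij_betw ?f {..<2 * k} {..<2 * k}" using inj unfolding bij_betw_def by simp
  moreover have "?A \<in> carrier_mat (2 * k) (2 * k)" using kron_C_dim by (intro carrier_matI) auto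
  ultimately have "real_congruent (2 * k) ?A (mat (2 * k) (2 * k) (\<lambda>(i, j). ?A $$ (?f i, ?f j)))" by (intro real_congruent_perm)
  also have "mat (2 * k) (2 * k) (\<lambda>(i, j). ?A $$ (?f i, ?f j)) = C_mat a b \<otimes>\<^sub>K Gamma_mat k"
  proof (rule eq_matI)
    fix i j assume "i < dim_row (C_mat a b \<otimes>\<^sub>K Gamma_mat k)" "j < dim_col (C_mat a b \<otimes>\<^sub>K Gamma_mat k)"
    hence ij: "i < 2 * k" "j < 2 * k" by (simp_all add: kron_dim C_mat_index Gamma_dim)
    have "i mod k < k" "j mod k < k" using False by simp_all
    hence "?A $$ (i mod k * 2 + i div k, j mod k * 2 + j div k) = Gamma_mat k $$ (i mod k, j mod k) * C_mat a b $$ (i div k, j div k)"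
      "(C_mat a b \<otimes>\<^sub>K Gamma_mat k) $$ (i div k * k + i mod k, j div k * k + j mod k) = C_mat a b $$ (i div k, j div k) * Gamma_mat k $$ (i mod k, j mod k)"
      using kron_index[of "i mod k" "Gamma_mat k" "j mod k" "i div k" "C_mat a b" "j div k"]
        kron_index[of "i div k" "C_mat a b" "j div k" "i mod k" "Gamma_mat k" "j mod k"] dk[OF ij(1)] dk[OF ij(2)]
      unfolding C_mat_index(5,6) Gamma_dim by blast+
    moreover have "i mod k * 2 + i div k = ?f i" "j mod k * 2 + j div k = ?f j" by simp_all
    ultimately have "?A $$ (?f i, ?f j) = Gamma_mat k $$ (i mod k, j mod k) * C_mat a b $$ (i div k, j div k)"
      and "(C_mat a b \<otimes>\<^sub>K Gamma_mat k) $$ (i, j) = C_mat a b $$ (i div k, j div k) * Gamma_mat k $$ (i mod k, j mod k)"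
      unfolding div_mult_mod_eq by metis+
    thus "mat (2 * k) (2 * k) (\<lambda>(i, j). ?A $$ (?f i, ?f j)) $$ (i, j) = (C_mat a b \<otimes>\<^sub>K Gamma_mat k) $$ (i, j)"
      using ij by simp
  qed (auto simp: kron_dim C_mat_index Gamma_dim)
  finally show ?thesis .
qed

text \<open>For 1 x 1 factors N the interchange gives the same matrix, by
  \<open>kron_scalar\<close>, so \<open>base\<close> is kept there.\<close>

fun alt :: "code \<Rightarrow> real mat" where
  "alt (CJ k) = base (CJ k)"
| "alt (CG k w) = (if Im w = 0 then base (CG k w) else C_mat (Re w) (Im w) \<otimes>\<^sub>K Gamma_mat k)"
| "alt (CH k a) = H_mat k (1 / a)"
| "alt (CHH k a b) = H_hat_mat k (a / (a\<^sup>2 + b\<^sup>2)) (b / (a\<^sup>2 + b\<^sup>2))"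

lemma alt_congruent: assumes "valid c" shows "real_congruent (dim_row (base c)) (base c) (alt c)"
proof -
  have r: "real_congruent (dim_row (base c)) (base c) (base c)" using base_dim(2)[of c] by (intro real_congruent_refl) auto
  show ?thesis
  proof (cases c)
    case (CJ k) thus ?thesis using r by simp
  next
    case (CG k w)
    show ?thesis
    proof (cases "Im w = 0")
      case True
      hence "alt c = base c" using CG by simp
      thus ?thesis using r by simp
    next
      case False
      have e: "base c = Gamma_mat k \<otimes>\<^sub>K C_mat (Re w) (Im w)" "alt c = C_mat (Re w) (Im w) \<otimes>\<^sub>K Gamma_mat k" using CG False by simp_all
      show ?thesis unfolding e kron_C_dim by (rule kron_swap)
    qed
  next
    case (CH k a) thus ?thesis using H_inverse[of k a] assms base_dim(1)[of c] by simp
  next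
    case (CHH k a b) thus ?thesis using Hhat_inverse[of k a b] assms base_dim(1)[of c] by simp
  qed
qed

lemma C_N_mats: "cmod w = 1 \<Longrightarrow> 0 < Im w \<Longrightarrow> C_mat (Re w) (Im w) \<in> N_mats"
proof -
  assume "cmod w = 1" "0 < Im w"
  moreover have "(Re w)\<^sup>2 + (Im w)\<^sup>2 = (cmod w)\<^sup>2" by (simp add: cmod_power2)
  ultimately show ?thesis unfolding N_mats_def by auto
qed

lemma inverse_pair: assumes "(b::real) > 0"
  shows "a / (a\<^sup>2 + b\<^sup>2) / ((a / (a\<^sup>2 + b\<^sup>2))\<^sup>2 + (b / (a\<^sup>2 + b\<^sup>2))\<^sup>2) = a"
    "b / (a\<^sup>2 + b\<^sup>2) / ((a / (a\<^sup>2 + b\<^sup>2))\<^sup>2 + (b / (a\<^sup>2 + b\<^sup>2))\<^sup>2) = b"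
    "(a / (a\<^sup>2 + b\<^sup>2))\<^sup>2 + (b / (a\<^sup>2 + b\<^sup>2))\<^sup>2 = 1 / (a\<^sup>2 + b\<^sup>2)" "b / (a\<^sup>2 + b\<^sup>2) > 0" "0 < a\<^sup>2 + b\<^sup>2"
proof -
  show r: "0 < a\<^sup>2 + b\<^sup>2" using assms by (intro add_nonneg_pos) auto
  show s: "(a / (a\<^sup>2 + b\<^sup>2))\<^sup>2 + (b / (a\<^sup>2 + b\<^sup>2))\<^sup>2 = 1 / (a\<^sup>2 + b\<^sup>2)"
  proof -
    have "(a / (a\<^sup>2 + b\<^sup>2))\<^sup>2 + (b / (a\<^sup>2 + b\<^sup>2))\<^sup>2 = (a\<^sup>2 + b\<^sup>2) / (a\<^sup>2 + b\<^sup>2)\<^sup>2" by (simp add: power_divide add_divide_distrib)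
    thus ?thesis using r by (simp add: power2_eq_square)
  qed
  show "a / (a\<^sup>2 + b\<^sup>2) / ((a / (a\<^sup>2 + b\<^sup>2))\<^sup>2 + (b / (a\<^sup>2 + b\<^sup>2))\<^sup>2) = a"
    "b / (a\<^sup>2 + b\<^sup>2) / ((a / (a\<^sup>2 + b\<^sup>2))\<^sup>2 + (b / (a\<^sup>2 + b\<^sup>2))\<^sup>2) = b" unfolding s using r by simp_all
  show "b / (a\<^sup>2 + b\<^sup>2) > 0" using assms r by simp
qed

lemma alt_replacement: assumes "valid c" shows "replacement (base c) (alt c)" "replacement (alt c) (base c)"
proof -
  have "replacement (base c) (alt c) \<and> replacement (alt c) (base c)"
  proof (cases c)
    case (CJ k) thus ?thesis using same by simp
  next
    case (CG k w)
    thus ?thesis using same swap_ii[OF _ C_N_mats, of k w] swap_ii'[OF _ C_N_mats, of k w] assms by auto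
  next
    case (CH k a)
    thus ?thesis using inverse_iii[of k a] inverse_iii[of k "1 / a"] assms by simp
  next
    case (CHH k a b)
    hence b: "b > 0" "k \<ge> 1" using assms by auto
    note i = inverse_pair[OF b(1), of a]
    show ?thesis using inverse_iv[OF b(2,1), of a] inverse_iv[OF b(2) i(4), of "a / (a\<^sup>2 + b\<^sup>2)"] CHH unfolding i(1,2) by simp
  qed
  thus "replacement (base c) (alt c)" "replacement (alt c) (base c)" by blast+
qed

lemma real_congruent_square: "square_mat M \<Longrightarrow> real_congruent (dim_row M) M M"
  by (rule real_congruent_refl) auto

text \<open>\<open>replacement\<close> also admits parameters on the unit circle, which are not
  canonical; there the inversion returns the same parameters, and reflexivity suffices.\<close>

lemma replacement_congruent: assumes "replacement B C" "square_mat B" shows "real_congruent (dim_row B) B C"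
  using assms
proof (induction rule: replacement.induct)
  case (same B) thus ?case by (intro real_congruent_refl) auto
next
  case (swap_ii k N)
  from code_ii[OF swap_ii(1,2)] obtain w where w: "Im w = 0 \<longrightarrow> N = 1\<^sub>m 1 \<or> N = - 1\<^sub>m 1" "Im w \<noteq> 0 \<longrightarrow> N = C_mat (Re w) (Im w)" by blast
  show ?case
  proof (cases "Im w = 0")
    case True
    hence "dim_row N = 1" "dim_col N = 1" using w by auto
    note K = kron_scalar[OF this, of k]
    show ?thesis using real_congruent_square[OF swap_ii(3)] unfolding K .
  next
    case False
    hence N: "N = C_mat (Re w) (Im w)" using w by simp
    show ?thesis unfolding N kron_C_dim by (rule kron_swap)
  qed
next
  case (swap_ii' k N)
  from code_ii[OF swap_ii'(1,2)] obtain w where w: "Im w = 0 \<longrightarrow> N = 1\<^sub>m 1 \<or> N = - 1\<^sub>m 1" "Im w \<noteq> 0 \<longrightarrow> N = C_mat (Re w) (Im w)" by blast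
  show ?case
  proof (cases "Im w = 0")
    case True
    hence "dim_row N = 1" "dim_col N = 1" using w by auto
    note K = kron_scalar[OF this, of k]
    show ?thesis using real_congruent_square[OF swap_ii'(3)] unfolding K .
  next
    case False
    hence N: "N = C_mat (Re w) (Im w)" using w by simp
    have d: "dim_row (N \<otimes>\<^sub>K Gamma_mat k) = 2 * k" unfolding N by (simp add: kron_dim C_mat_index Gamma_dim)
    show ?thesis unfolding d unfolding N by (rule real_congruent_sym[OF kron_swap])
  qed
next
  case (inverse_iii k a)
  have d: "dim_row (H_mat k a) = 2 * k" unfolding H_mat_def by simp
  consider "\<bar>a\<bar> < 1" | "\<bar>a\<bar> > 1" | "a = 1 \<or> a = -1" by linarith
  thus ?case
  proof cases
    case 1 thus ?thesis unfolding d using H_inverse[of k a] inverse_iii by simp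
  next
    case 2
    hence "valid (CH k (1 / a))" using inverse_iii by simp
    from real_congruent_sym[OF H_inverse[OF this]] show ?thesis unfolding d by simp
  next
    case 3
    hence "1 / a = a" by auto
    thus ?thesis using real_congruent_square[OF inverse_iii(3)] by simp
  qed
next
  case (inverse_iv k b a)
  have d: "dim_row (H_hat_mat k a b) = 4 * k" using Hhat_dim by simp
  note i = inverse_pair[OF inverse_iv(2), of a]
  consider "a\<^sup>2 + b\<^sup>2 < 1" | "a\<^sup>2 + b\<^sup>2 > 1" | "a\<^sup>2 + b\<^sup>2 = 1" by linarith
  thus ?case
  proof cases
    case 1 thus ?thesis unfolding d using Hhat_inverse[of k a b] inverse_iv by simp
  next
    case 2
    hence "valid (CHH k (a / (a\<^sup>2 + b\<^sup>2)) (b / (a\<^sup>2 + b\<^sup>2)))" using inverse_iv(1) i(3,4) by simp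
    from real_congruent_sym[OF Hhat_inverse[OF this]] show ?thesis unfolding d i(1,2) .
  next
    case 3 thus ?thesis using real_congruent_square[OF inverse_iv(3)] by simp
  qed
qed

lemma code_iii': assumes "B \<in> type_iii'" shows "\<exists>k a. valid (CH k a) \<and> B = alt (CH k a)"
proof -
  obtain k a where "k \<ge> 1" "B = H_mat k a" "\<bar>a\<bar> > 1" using assms unfolding type_iii'_def by blast
  thus ?thesis by (intro exI[of _ k] exI[of _ "1 / a"]) auto
qed

lemma code_iv': assumes "B \<in> type_iv'" shows "\<exists>k a b. valid (CHH k a b) \<and> B = alt (CHH k a b)"
proof -
  obtain k a b where h: "k \<ge> 1" "B = H_hat_mat k a b" "a\<^sup>2 + b\<^sup>2 > 1" "b > 0" using assms unfolding type_iv'_def by blast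
  note i = inverse_pair[OF h(4), of a]
  show ?thesis
    by (intro exI[of _ k] exI[of _ "a / (a\<^sup>2 + b\<^sup>2)"] exI[of _ "b / (a\<^sup>2 + b\<^sup>2)"]) (use h i in simp)
qed

lemma code_ii': assumes "B \<in> type_ii'" shows "\<exists>k w. valid (CG k w) \<and> B = alt (CG k w)"
proof -
  obtain k N where h: "k \<ge> 1" "N \<in> N_mats" "B = N \<otimes>\<^sub>K Gamma_mat k" using assms unfolding type_ii'_def by blast
  from code_ii[OF h(1,2)] obtain w where w: "valid (CG k w)" "base (CG k w) = Gamma_mat k \<otimes>\<^sub>K N"
    "Im w = 0 \<longrightarrow> N = 1\<^sub>m 1 \<or> N = - 1\<^sub>m 1" "Im w \<noteq> 0 \<longrightarrow> N = C_mat (Re w) (Im w)" by blast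
  have "B = alt (CG k w)"
  proof (cases "Im w = 0")
    case True
    hence "dim_row N = 1" "dim_col N = 1" using w(3) by auto
    from kron_scalar[OF this, of k] show ?thesis using w(2) h(3) True by simp
  qed (use h(3) w(4) in simp)
  thus ?thesis using w(1) by blast
qed

lemma base_type: assumes "valid c"
  shows "case c of CJ k \<Rightarrow> base c \<in> type_i | CG k w \<Rightarrow> base c \<in> type_ii \<and> alt c \<in> type_ii' | CH k a \<Rightarrow> base c \<in> type_iii \<and> alt c \<in> type_iii'
    | CHH k a b \<Rightarrow> base c \<in> type_iv \<and> alt c \<in> type_iv'"
proof (cases c)
  case (CJ k) thus ?thesis using assms unfolding type_i_def by auto
next
  case (CG k w)
  have k: "k \<ge> 1" using assms CG by simp
  show ?thesis
  proof (cases "Im w = 0")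
    case True
    have N: "1\<^sub>m 1 \<in> N_mats" "- 1\<^sub>m 1 \<in> N_mats" unfolding N_mats_def by auto
    have "w = 1 \<or> w = -1" using unit_real True assms CG by simp
    then have "\<exists>M. base c = Gamma_mat k \<otimes>\<^sub>K M \<and> M \<in> N_mats \<and> dim_row M = 1 \<and> dim_col M = 1"
    proof
      assume "w = 1"
      thus ?thesis using Gsgn_pm(1)[of k] N(1) CG by (intro exI[of _ "1\<^sub>m 1"]) simp
    next
      assume "w = -1"
      thus ?thesis using Gsgn_pm(2)[of k] N(2) CG by (intro exI[of _ "- 1\<^sub>m 1"]) simp
    qed
    then obtain M where M: "base c = Gamma_mat k \<otimes>\<^sub>K M" "M \<in> N_mats" "dim_row M = 1" "dim_col M = 1" by (elim exE conjE)
    have "alt c = M \<otimes>\<^sub>K Gamma_mat k" using kron_scalar[OF M(3,4), of k] M(1) CG True by simp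
    thus ?thesis using CG M k unfolding type_ii_def type_ii'_def by auto
  next
    case False
    hence "C_mat (Re w) (Im w) \<in> N_mats" using assms CG by (intro C_N_mats) auto
    thus ?thesis using CG k False unfolding type_ii_def type_ii'_def by auto
  qed
next
  case (CH k a)
  hence h: "\<bar>1 / a\<bar> > 1" "k \<ge> 1" "0 < \<bar>a\<bar>" "\<bar>a\<bar> < 1" using assms by auto
  have "H_mat k a \<in> type_iii" unfolding type_iii_def by (intro CollectI exI[of _ k] exI[of _ a] conjI refl h)
  moreover have "H_mat k (1 / a) \<in> type_iii'" unfolding type_iii'_def by (intro CollectI exI[of _ k] exI[of _ "1 / a"] conjI refl h)
  ultimately show ?thesis using CH by simp
next
  case (CHH k a b)
  hence h: "b > 0" "k \<ge> 1" "a\<^sup>2 + b\<^sup>2 < 1" using assms by auto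
  note i = inverse_pair[OF h(1), of a]
  have g: "(a / (a\<^sup>2 + b\<^sup>2))\<^sup>2 + (b / (a\<^sup>2 + b\<^sup>2))\<^sup>2 > 1" unfolding i(3) using h(3) i(5) by simp
  have "H_hat_mat k a b \<in> type_iv" unfolding type_iv_def by (intro CollectI exI[of _ k] exI[of _ a] exI[of _ b] conjI refl h)
  moreover have "H_hat_mat k (a / (a\<^sup>2 + b\<^sup>2)) (b / (a\<^sup>2 + b\<^sup>2)) \<in> type_iv'" unfolding type_iv'_def
    by (intro CollectI exI[of _ k] exI[of _ "a / (a\<^sup>2 + b\<^sup>2)"] exI[of _ "b / (a\<^sup>2 + b\<^sup>2)"] conjI refl h g i(4))
  ultimately show ?thesis using CHH by simp
qed

text \<open>The Booleans select, type by type, the original or the substituted family, covering all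
  eight choices at once.\<close>

definition rep :: "bool \<Rightarrow> bool \<Rightarrow> bool \<Rightarrow> code \<Rightarrow> real mat" where
  "rep p q r c = (case c of CJ k \<Rightarrow> base c | CG k w \<Rightarrow> (if p then alt c else base c) | CH k a \<Rightarrow> (if q then alt c else base c)
    | CHH k a b \<Rightarrow> (if r then alt c else base c))"

lemma rep_base: "rep p q r c = base c \<or> rep p q r c = alt c" unfolding rep_def by (cases c) auto

lemma base_alt: assumes v: "valid c" and B: "B = base c \<or> B = alt c"
  shows "square_mat B" "real_congruent (dim_row B) B (base c)"
proof -
  define n where "n = dim_row (base c)"
  have r: "real_congruent n (base c) (alt c)" unfolding n_def by (rule alt_congruent[OF v])
  note r' = r[unfolded real_congruent_def]
  note c = conjunct1[OF conjunct2[OF r']] conjunct1[OF r']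
  have s: "real_congruent n B (base c)" using B
  proof
    assume "B = base c" thus ?thesis using real_congruent_refl[OF c(2)] by simp
  next
    assume "B = alt c" thus ?thesis using real_congruent_sym[OF r] by simp
  qed
  have "B \<in> carrier_mat n n" by (rule conjunct1[OF s[unfolded real_congruent_def]])
  hence d: "dim_row B = n" "dim_col B = n" by (rule carrier_matD)+
  thus "square_mat B" by simp
  show "real_congruent (dim_row B) B (base c)" unfolding d by (rule s)
qed

lemma congruent_codes:
  assumes f: "\<And>B. B \<in> set Bs \<Longrightarrow> valid (g B) \<and> (f B = base (g B) \<or> f B = alt (g B))"
  shows "real_congruent n A (diag_block_mat (map f Bs)) \<longleftrightarrow> real_congruent n A (diag_block_mat (map base (map g Bs)))"
proof -
  let ?D = "diag_block_mat (map f Bs)" and ?E = "diag_block_mat (map base (map g Bs))" and ?s = "siz (map f Bs)"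
  have "list_all2 (\<lambda>B C. real_congruent (dim_row B) B C) (map f Bs) (map base (map g Bs))"
    unfolding list_all2_conv_all_nth
  proof (intro conjI allI impI)
    fix i assume "i < length (map f Bs)"
    hence i: "i < length Bs" by simp
    have h: "valid (g (Bs ! i))" "f (Bs ! i) = base (g (Bs ! i)) \<or> f (Bs ! i) = alt (g (Bs ! i))" using f[OF nth_mem[OF i]] by blast+
    show "real_congruent (dim_row (map f Bs ! i)) (map f Bs ! i) (map base (map g Bs) ! i)"
      using base_alt(2)[OF h] i by simp
  qed simp
  hence r: "real_congruent ?s ?D ?E" by (rule diag_list_all2)
  hence d: "dim_row ?D = ?s" "dim_row ?E = ?s" unfolding real_congruent_def by auto
  show ?thesis
  proof
    assume h: "real_congruent n A ?D"
    hence "n = ?s" using d(1) unfolding real_congruent_def by auto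
    thus "real_congruent n A ?E" using real_congruent_trans[OF h] r by simp
  next
    assume h: "real_congruent n A ?E"
    hence "n = ?s" using d(2) unfolding real_congruent_def by auto
    thus "real_congruent n A ?D" using real_congruent_trans[OF h] real_congruent_sym[OF r] by simp
  qed
qed

lemma code_rep:
  assumes "B \<in> type_i \<union> (if p then type_ii' else type_ii) \<union> (if q then type_iii' else type_iii) \<union> (if r then type_iv' else type_iv)"
  shows "\<exists>c. valid c \<and> B = rep p q r c"
proof -
  consider "B \<in> type_i" | "B \<in> (if p then type_ii' else type_ii)" | "B \<in> (if q then type_iii' else type_iii)"
    | "B \<in> (if r then type_iv' else type_iv)" using assms by blast
  thus ?thesis
  proof cases
    case 1
    then obtain k where "k \<ge> 1" "B = jordan_block k 0" unfolding type_i_def by blast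
    thus ?thesis unfolding rep_def by (intro exI[of _ "CJ k"]) simp
  next
    case 2
    have "\<exists>k w. valid (CG k w) \<and> B = (if p then alt (CG k w) else base (CG k w))"
    proof (cases p)
      case True thus ?thesis using code_ii'[of B] 2 by simp
    next
      case False
      then obtain k N where kN: "k \<ge> 1" "N \<in> N_mats" "B = Gamma_mat k \<otimes>\<^sub>K N" using 2 unfolding type_ii_def by auto
      from code_ii[OF kN(1,2)] obtain w where "valid (CG k w)" "base (CG k w) = Gamma_mat k \<otimes>\<^sub>K N" by blast
      thus ?thesis using kN(3) False by (intro exI[of _ k] exI[of _ w]) simp
    qed
    then obtain k w where "valid (CG k w)" "B = (if p then alt (CG k w) else base (CG k w))" by blast
    thus ?thesis unfolding rep_def by (intro exI[of _ "CG k w"]) simp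
  next
    case 3
    have "\<exists>k a. valid (CH k a) \<and> B = (if q then alt (CH k a) else base (CH k a))"
    proof (cases q)
      case True thus ?thesis using code_iii'[of B] 3 by simp
    next
      case False
      then obtain k a where "k \<ge> 1" "B = H_mat k a" "0 < \<bar>a\<bar>" "\<bar>a\<bar> < 1" using 3 unfolding type_iii_def by auto
      thus ?thesis using False by (intro exI[of _ k] exI[of _ a]) simp
    qed
    then obtain k a where "valid (CH k a)" "B = (if q then alt (CH k a) else base (CH k a))" by blast
    thus ?thesis unfolding rep_def by (intro exI[of _ "CH k a"]) simp
  next
    case 4
    have "\<exists>k a b. valid (CHH k a b) \<and> B = (if r then alt (CHH k a b) else base (CHH k a b))"
    proof (cases r)
      case True thus ?thesis using code_iv'[of B] 4 by simp
    next
      case False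
      then obtain k a b where "k \<ge> 1" "B = H_hat_mat k a b" "a\<^sup>2 + b\<^sup>2 < 1" "b > 0" using 4 unfolding type_iv_def by auto
      thus ?thesis using False by (intro exI[of _ k] exI[of _ a] exI[of _ b]) simp
    qed
    then obtain k a b where "valid (CHH k a b)" "B = (if r then alt (CHH k a b) else base (CHH k a b))" by blast
    thus ?thesis unfolding rep_def by (intro exI[of _ "CHH k a b"]) simp
  qed
qed

lemma rep_type: assumes "valid c"
  shows "rep p q r c \<in> type_i \<union> (if p then type_ii' else type_ii) \<union> (if q then type_iii' else type_iii) \<union> (if r then type_iv' else type_iv)"
  using base_type[OF assms] unfolding rep_def by (cases c) auto

lemma code_any:
  assumes "B \<in> type_i \<union> (type_ii \<union> type_ii') \<union> (type_iii \<union> type_iii') \<union> (type_iv \<union> type_iv')"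
  shows "\<exists>c. valid c \<and> (B = base c \<or> B = alt c)"
proof -
  have "\<exists>p q r. B \<in> type_i \<union> (if p then type_ii' else type_ii) \<union> (if q then type_iii' else type_iii) \<union> (if r then type_iv' else type_iv)"
    using assms by (intro exI[of _ "B \<in> type_ii'"] exI[of _ "B \<in> type_iii'"] exI[of _ "B \<in> type_iv'"]) auto
  then obtain p q r where "B \<in> type_i \<union> (if p then type_ii' else type_ii) \<union> (if q then type_iii' else type_iii) \<union> (if r then type_iv' else type_iv)"
    by (elim exE)
  from code_rep[OF this] rep_base show ?thesis by metis
qed

text \<open>Each matrix \<open>B\<close> of the chosen families receives a code \<open>g B\<close>
  from which \<open>rep\<close> recovers it. Uniqueness of the multiset of codes then carries over
  to the multiset of matrices.\<close>

theorem existence_unique_form: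
  assumes A: "A \<in> carrier_mat n n"
    and II: "II = (if p then type_ii' else type_ii)" and III: "III = (if q then type_iii' else type_iii)" and IV: "IV = (if r then type_iv' else type_iv)"
  shows "\<exists>Bs. set Bs \<subseteq> type_i \<union> II \<union> III \<union> IV \<and> real_congruent n A (diag_block_mat Bs) \<and>
            (\<forall>Cs. set Cs \<subseteq> type_i \<union> II \<union> III \<union> IV \<and> real_congruent n A (diag_block_mat Cs) \<longrightarrow> mset Cs = mset Bs)"
proof -
  let ?T = "type_i \<union> II \<union> III \<union> IV" and ?r = "rep p q r"
  obtain Es where Es: "set Es \<subseteq> type_i \<union> type_ii \<union> type_iii \<union> type_iv" "real_congruent n A (diag_block_mat Es)"
    using matrix_canonical[OF A] by blast
  obtain cs where cs: "Es = map base cs" "\<And>c. c \<in> set cs \<Longrightarrow> valid c" using base_codes[OF Es(1)] by blast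
  have rc: "real_congruent n A (diag_block_mat (map base cs))" using Es(2) unfolding cs(1) .
  have "\<exists>g. \<forall>B\<in>?T. valid (g B) \<and> B = ?r (g B)" by (rule bchoice, rule ballI, unfold II III IV, rule code_rep, assumption)
  then obtain g where g: "\<And>B. B \<in> ?T \<Longrightarrow> valid (g B) \<and> B = ?r (g B)" by blast
  show ?thesis
  proof (intro exI[of _ "map ?r cs"] conjI allI impI; (elim conjE)?)
    show "set (map ?r cs) \<subseteq> ?T" using rep_type cs(2) unfolding II III IV by fastforce
    have "real_congruent n A (diag_block_mat (map ?r cs)) \<longleftrightarrow> real_congruent n A (diag_block_mat (map base (map (\<lambda>c. c) cs)))"
      by (rule congruent_codes) (use cs(2) rep_base in blast)
    thus "real_congruent n A (diag_block_mat (map ?r cs))" using rc by simp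
    fix Cs assume Cs: "set Cs \<subseteq> ?T" "real_congruent n A (diag_block_mat Cs)"
    have gC: "valid (g B) \<and> B = ?r (g B)" if "B \<in> set Cs" for B using g[of B] that Cs(1) by blast
    have "real_congruent n A (diag_block_mat (map (\<lambda>B. B) Cs)) \<longleftrightarrow> real_congruent n A (diag_block_mat (map base (map g Cs)))"
    proof (rule congruent_codes)
      fix B assume "B \<in> set Cs"
      hence v: "valid (g B)" and e: "?r (g B) = B" using gC[of B] by (blast, metis)
      show "valid (g B) \<and> (B = base (g B) \<or> B = alt (g B))" using rep_base[of p q r "g B"] v unfolding e by blast
    qed
    hence C: "real_congruent n A (diag_block_mat (map base (map g Cs)))" using Cs(2) by simp
    have vv: "valid c" if c: "c \<in> set (map g Cs) \<union> set cs" for c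
    proof (cases "c \<in> set cs")
      case False
      then obtain B where "B \<in> set Cs" "c = g B" using c by auto
      thus ?thesis using gC[of B] by blast
    qed (rule cs(2))
    have m: "mset (map g Cs) = mset cs" by (rule codes_unique[OF real_congruent_trans[OF real_congruent_sym[OF C] rc] vv])
    have mp: "map ?r (map g Cs) = Cs" unfolding map_map
    proof (rule map_idI)
      fix B assume "B \<in> set Cs"
      from gC[OF this] show "(?r \<circ> g) B = B" unfolding o_apply by metis
    qed
    have "mset (map ?r (map g Cs)) = image_mset ?r (mset (map g Cs))" by (rule mset_map)
    hence "mset Cs = image_mset ?r (mset (map g Cs))" unfolding mp .
    thus "mset Cs = mset (map ?r cs)" unfolding m by simp
  qed
qed

text \<open>Congruent lists have equal code multisets, and two matrices with the same code are each
  its \<open>base\<close> or its \<open>alt\<close>, hence replacements of one another. Conversely,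
  a matching by replacements is a blockwise congruence up to permutation.\<close>

theorem replacement_form:
  assumes U: "set Bs \<union> set Cs \<subseteq> type_i \<union> (type_ii \<union> type_ii') \<union> (type_iii \<union> type_iii') \<union> (type_iv \<union> type_iv')"
    and AB: "real_congruent n A (diag_block_mat Bs)"
  shows "real_congruent n A (diag_block_mat Cs) \<longleftrightarrow> rel_mset replacement (mset Bs) (mset Cs)"
proof -
  let ?U = "set Bs \<union> set Cs"
  have "\<exists>g. \<forall>B\<in>?U. valid (g B) \<and> (B = base (g B) \<or> B = alt (g B))" by (rule bchoice) (use code_any U in blast)
  then obtain g where g: "\<And>B. B \<in> ?U \<Longrightarrow> valid (g B) \<and> (B = base (g B) \<or> B = alt (g B))" by blast
  have e: "real_congruent n A (diag_block_mat Es) \<longleftrightarrow> real_congruent n A (diag_block_mat (map base (map g Es)))" if Es: "set Es \<subseteq> ?U" for Es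
  proof -
    have "real_congruent n A (diag_block_mat (map (\<lambda>B. B) Es)) \<longleftrightarrow> real_congruent n A (diag_block_mat (map base (map g Es)))"
      by (rule congruent_codes) (use g Es in blast)
    thus ?thesis by simp
  qed
  have sq: "sq Es" if "set Es \<subseteq> ?U" for Es
    unfolding sq_def
  proof
    fix B assume "B \<in> set Es"
    hence "valid (g B)" "B = base (g B) \<or> B = alt (g B)" using g[of B] that by blast+
    thus "square_mat B" by (rule base_alt(1))
  qed
  show ?thesis
  proof
    assume AC: "real_congruent n A (diag_block_mat Cs)"
    have b: "real_congruent n A (diag_block_mat (map base (map g Bs)))" using e[of Bs] AB by simp
    have c: "real_congruent n A (diag_block_mat (map base (map g Cs)))" using e[of Cs] AC by simp
    have vv: "valid x" if x: "x \<in> set (map g Bs) \<union> set (map g Cs)" for x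
    proof -
      obtain B where "B \<in> ?U" "x = g B" using x by auto
      thus ?thesis using g[of B] by blast
    qed
    have "mset (map g Bs) = mset (map g Cs)" by (rule codes_unique[OF real_congruent_trans[OF real_congruent_sym[OF b] c] vv])
    hence "rel_mset (=) (image_mset g (mset Bs)) (image_mset g (mset Cs))" by (simp add: multiset.rel_eq)
    hence "rel_mset (\<lambda>x y. g x = g y) (mset Bs) (mset Cs)" by (simp add: multiset.rel_map)
    thus "rel_mset replacement (mset Bs) (mset Cs)"
    proof (rule multiset.rel_mono_strong)
      fix B C assume h: "B \<in># mset Bs" "C \<in># mset Cs" "g B = g C"
      have "B \<in> ?U" "C \<in> ?U" using h(1,2) by simp_all
      hence B: "valid (g B)" "B = base (g B) \<or> B = alt (g B)" and C: "C = base (g B) \<or> C = alt (g B)"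
        using g[of B] g[of C] unfolding h(3) by blast+
      note r = alt_replacement[OF B(1)]
      from B(2) C show "replacement B C"
      proof (elim disjE)
        assume "B = base (g B)" "C = base (g B)" hence "B = C" by metis thus ?thesis using replacement.same by simp
      next
        assume "B = base (g B)" "C = alt (g B)" thus ?thesis using r(1) by metis
      next
        assume "B = alt (g B)" "C = base (g B)" thus ?thesis using r(2) by metis
      next
        assume "B = alt (g B)" "C = alt (g B)" hence "B = C" by metis thus ?thesis using replacement.same by simp
      qed
    qed
  next
    assume "rel_mset replacement (mset Bs) (mset Cs)"
    then obtain xs ys where xy: "mset xs = mset Bs" "mset ys = mset Cs" "list_all2 replacement xs ys" unfolding rel_mset_def by blast
    have sx: "set xs \<subseteq> ?U" "set ys \<subseteq> ?U" using xy(1,2) by (metis Un_upper1 set_mset_mset, metis Un_upper2 set_mset_mset)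
    have "list_all2 (\<lambda>B C. real_congruent (dim_row B) B C) xs ys" unfolding list_all2_conv_all_nth
    proof (intro conjI allI impI)
      show "length xs = length ys" using xy(3) by (rule list_all2_lengthD)
      fix i assume i: "i < length xs"
      have "square_mat (xs ! i)" using sq[OF sx(1)] nth_mem[OF i] unfolding sq_def by blast
      thus "real_congruent (dim_row (xs ! i)) (xs ! i) (ys ! i)"
        by (rule replacement_congruent[OF list_all2_nthD[OF xy(3) i]])
    qed
    note r2 = diag_list_all2[OF this]
    have sqs: "sq Bs" "sq ys" by (rule sq, simp) (rule sq[OF sx(2)])
    note r1 = diag_perm[OF xy(1)[symmetric] sqs(1)] and r3 = diag_perm[OF xy(2) sqs(2)]
    have dims: "dim_row X = m \<and> dim_row Y = m" if "real_congruent m X Y" for m X Y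
      using that unfolding real_congruent_def by auto
    have n1: "siz Bs = n" using dims[OF AB] carrier_matD(1)[OF diag_carrier[OF sqs(1)]] by simp
    have n2: "siz xs = n" using n1 arg_cong[OF xy(1), of "\<lambda>M. sum_mset (image_mset dim_row M)"] unfolding siz_def by (simp add: sum_mset_sum_list flip: mset_map)
    have n3: "siz ys = n" using dims[OF r2] carrier_matD(1)[OF diag_carrier[OF sqs(2)]] n2 by simp
    have "real_congruent n A (diag_block_mat xs)" by (rule real_congruent_trans[OF AB r1[unfolded n1]])
    hence "real_congruent n A (diag_block_mat ys)" by (rule real_congruent_trans[OF _ r2[unfolded n2]])
    thus "real_congruent n A (diag_block_mat Cs)" by (rule real_congruent_trans[OF _ r3[unfolded n3]])
  qed
qed

theorem theorem4p1:
  fixes A :: "real mat" and n :: nat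
  assumes "A \<in> carrier_mat n n"
  shows
    "(\<forall>II \<in> {type_ii, type_ii'}. \<forall>III \<in> {type_iii, type_iii'}. \<forall>IV \<in> {type_iv, type_iv'}.
       \<exists>Bs. set Bs \<subseteq> type_i \<union> II \<union> III \<union> IV \<and> real_congruent n A (diag_block_mat Bs) \<and>
            (\<forall>Cs. set Cs \<subseteq> type_i \<union> II \<union> III \<union> IV \<and> real_congruent n A (diag_block_mat Cs)
                  \<longrightarrow> mset Cs = mset Bs)) \<and>
     (\<forall>Bs Cs. set Bs \<union> set Cs
         \<subseteq> type_i \<union> (type_ii \<union> type_ii') \<union> (type_iii \<union> type_iii') \<union> (type_iv \<union> type_iv') \<and>
       real_congruent n A (diag_block_mat Bs) \<longrightarrow>
         (real_congruent n A (diag_block_mat Cs) \<longleftrightarrow> rel_mset replacement (mset Bs) (mset Cs)))"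
proof (intro conjI ballI)
  fix II III IV assume h: "II \<in> {type_ii, type_ii'}" "III \<in> {type_iii, type_iii'}" "IV \<in> {type_iv, type_iv'}"
  show "\<exists>Bs. set Bs \<subseteq> type_i \<union> II \<union> III \<union> IV \<and> real_congruent n A (diag_block_mat Bs) \<and>
            (\<forall>Cs. set Cs \<subseteq> type_i \<union> II \<union> III \<union> IV \<and> real_congruent n A (diag_block_mat Cs) \<longrightarrow> mset Cs = mset Bs)"
    by (rule existence_unique_form[OF assms, of II "II = type_ii'" III "III = type_iii'" IV "IV = type_iv'"]) (use h in auto)
next
  show "\<forall>Bs Cs. set Bs \<union> set Cs
         \<subseteq> type_i \<union> (type_ii \<union> type_ii') \<union> (type_iii \<union> type_iii') \<union> (type_iv \<union> type_iv') \<and>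
       real_congruent n A (diag_block_mat Bs) \<longrightarrow>
         (real_congruent n A (diag_block_mat Cs) \<longleftrightarrow> rel_mset replacement (mset Bs) (mset Cs))"
    by (intro allI impI; elim conjE) (rule replacement_form)
qed

end
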